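(* There exists a constant $\lambda_0>0$ such that for each $\lambda>\lambda_0$ there are constants $s_0(\lambda)>0$ and $C>0$ such that, with $\varphi(t)=e^{\lambda t}$, $$\begin{aligned} & \int_{Q} \frac{1}{s\varphi}\left(a(x)| (am)_{xx}|^2+a(x)| m_{t}|^2 \right)e^{2s\varphi}\,dx\, dt+\int_{Q} \lambda | (am)_{x}|^2 e^{2s\varphi}\, dx\, dt+\int_{Q} s\lambda^2 \varphi\, a(x)| m|^2 e^{2s\varphi}\, dx\,dt\\ &\leq C \int_{Q}a(x)| G|^2 e^{2s\varphi}\,dx\,dt +C \left(s\lambda\varphi(T)\| m(\cdot,T)\|_{a}^2+\| (am)_{x}(\cdot,T)\|_{L^2(0,1)}^2\right)e^{2s\varphi(T)}\\ &\quad +C\left( s\lambda\| m(\cdot,0)\|_{a}^2 +\| (am)_{x}(\cdot,0)\|_{L^2(0,1)}^2\right)e^{2s} \end{aligned}$$ for all $s\geq s_0(\lambda)$ and all $m\in H^1(0,T;L^2_a(0,1))\cap L^2(0,T;H_{2,a}(0,1))$ satisfying $$m_t(x,t)-(a(x)m(x,t))_{xx}=G(x,t)\ \text{ in }Q,\qquad am=0\ \text{ on }\Sigma,\qquad m(\cdot,0)=m_0\ \text{ in }(0,1).$$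
   Context: Let $T>0$, $Q=(0,1)\times(0,T)$, $\Sigma=\{0,1\}\times(0,T)$. The coefficient $a$ satisfies $a\in C([0,1])\cap C^1(0,1)$, $a(x)>0$ for $x\in(0,1)$ and $a(0)=a(1)=0$. All functions are real-valued. The constants $\lambda_0,s_0(\lambda),C$ do not depend on $m$, $G$ or $m_0$, and $C$ does not depend on $s$. Weighted spaces: $L^2_a(0,1)=\{u \text{ measurable}: \|u\|_a<\infty\}$ with $\|u\|_a^2=\int_0^1 a u^2\,dx$; $H_{1,a}(0,1)=\{u\in L^2_a(0,1): \int_0^1|(au)_x|^2dx<\infty,\ (au)(0)=(au)(1)=0\}$ with $\|u\|_{1,a}^2=\|u\|_a^2+\int_0^1|(au)_x|^2dx$; $H_{2,a}(0,1)=\{u\in H_{1,a}(0,1): (au)_{xx}\in L^2_a(0,1)\}$ with $\|u\|_{2,a}^2=\|u\|_{1,a}^2+\int_0^1 a|(au)_{xx}|^2dx$. *)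

theory Defs
  imports "HOL-Analysis.Analysis"
begin

section \<open>Weak derivatives on the unit interval\<close>

definition test_functions :: "real \<Rightarrow> real \<Rightarrow> (real \<Rightarrow> real) set" where
  "test_functions l r =
     {\<psi>. (\<forall>n x. (deriv ^^ n) \<psi> differentiable (at x)) \<and> closure {x. \<psi> x \<noteq> 0} \<subseteq> {l<..<r}}"

definition locally_integrable :: "(real \<Rightarrow> real) \<Rightarrow> bool" where
  "locally_integrable f \<longleftrightarrow>
     (\<forall>K. compact K \<and> K \<subseteq> {0<..<1} \<longrightarrow> set_integrable lebesgue K f)"

definition has_weak_deriv :: "(real \<Rightarrow> real) \<Rightarrow> (real \<Rightarrow> real) \<Rightarrow> bool" where
  "has_weak_deriv f g \<longleftrightarrow> locally_integrable f \<and> locally_integrable g \<and>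
     (\<forall>\<psi>\<in>test_functions 0 1.
        (LINT x:{0<..<1}|lebesgue. f x * deriv \<psi> x) = - (LINT x:{0<..<1}|lebesgue. g x * \<psi> x))"

text \<open>A weak derivative is determined up to a null set; \<open>wderiv\<close> picks a version.\<close>

definition weakly_differentiable :: "(real \<Rightarrow> real) \<Rightarrow> bool" where
  "weakly_differentiable f \<longleftrightarrow> (\<exists>g. has_weak_deriv f g)"

definition wderiv :: "(real \<Rightarrow> real) \<Rightarrow> real \<Rightarrow> real" where
  "wderiv f = (SOME g. has_weak_deriv f g)"

text \<open>Boundary values of an almost everywhere defined function on \<open>(0,1)\<close> are those of its
  representative that is continuous on \<open>[0,1]\<close>.\<close>

definition vanishes_at_ends :: "(real \<Rightarrow> real) \<Rightarrow> bool" where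
  "vanishes_at_ends f \<longleftrightarrow>
     (\<exists>w. continuous_on {0..1} w \<and> (AE x in lebesgue_on {0<..<1}. f x = w x) \<and> w 0 = 0 \<and> w 1 = 0)"


section \<open>The weighted spaces\<close>

text \<open>Elements are functions rather than classes modulo null sets, so the norms are seminorms.\<close>

definition L2_norm01 :: "(real \<Rightarrow> real) \<Rightarrow> real" where
  "L2_norm01 u = sqrt (LINT x:{0<..<1}|lebesgue. (u x)\<^sup>2)"

definition norm_a :: "(real \<Rightarrow> real) \<Rightarrow> (real \<Rightarrow> real) \<Rightarrow> real" where
  "norm_a a u = sqrt (LINT x:{0<..<1}|lebesgue. a x * (u x)\<^sup>2)"

definition L2a :: "(real \<Rightarrow> real) \<Rightarrow> (real \<Rightarrow> real) set" where
  "L2a a = {u. u \<in> borel_measurable (lebesgue_on {0<..<1}) \<and>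
               set_integrable lebesgue {0<..<1} (\<lambda>x. a x * (u x)\<^sup>2)}"

definition H1a :: "(real \<Rightarrow> real) \<Rightarrow> (real \<Rightarrow> real) set" where
  "H1a a = {u \<in> L2a a. weakly_differentiable (\<lambda>x. a x * u x) \<and>
               set_integrable lebesgue {0<..<1} (\<lambda>x. (wderiv (\<lambda>x. a x * u x) x)\<^sup>2) \<and>
               vanishes_at_ends (\<lambda>x. a x * u x)}"

definition H2a :: "(real \<Rightarrow> real) \<Rightarrow> (real \<Rightarrow> real) set" where
  "H2a a = {u \<in> H1a a. weakly_differentiable (wderiv (\<lambda>x. a x * u x)) \<and>
               wderiv (wderiv (\<lambda>x. a x * u x)) \<in> L2a a}"

definition norm_2a :: "(real \<Rightarrow> real) \<Rightarrow> (real \<Rightarrow> real) \<Rightarrow> real" where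
  "norm_2a a u = sqrt ((norm_a a u)\<^sup>2 + (L2_norm01 (wderiv (\<lambda>x. a x * u x)))\<^sup>2
                       + (norm_a a (wderiv (wderiv (\<lambda>x. a x * u x))))\<^sup>2)"


section \<open>Functions of time with values in a seminormed function space\<close>

text \<open>A time-dependent function is a map \<open>u :: real \<Rightarrow> real \<Rightarrow> real\<close>, where \<open>u t\<close> is the
  function \<open>x \<mapsto> u(x,t)\<close>. The value space is a set \<open>V\<close> of functions with a seminorm \<open>N\<close>;
  it is not a type, so the library's Bochner integral does not apply, and the usual
  construction by simple functions is repeated here.\<close>

definition simple_into ::
  "(real \<Rightarrow> real) set \<Rightarrow> real \<Rightarrow> (real \<Rightarrow> real \<Rightarrow> real) \<Rightarrow> bool" where
  "simple_into V T s \<longleftrightarrow> simple_function (lebesgue_on {0<..<T}) s \<and> s ` {0<..<T} \<subseteq> V"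

definition simple_integral_of :: "real \<Rightarrow> (real \<Rightarrow> real \<Rightarrow> real) \<Rightarrow> real \<Rightarrow> real" where
  "simple_integral_of T s =
     (\<lambda>x. \<Sum>v\<in>s ` {0<..<T}. measure lebesgue (s -` {v} \<inter> {0<..<T}) * v x)"

definition strongly_measurable ::
  "(real \<Rightarrow> real) set \<Rightarrow> ((real \<Rightarrow> real) \<Rightarrow> real) \<Rightarrow> real \<Rightarrow> (real \<Rightarrow> real \<Rightarrow> real) \<Rightarrow> bool" where
  "strongly_measurable V N T u \<longleftrightarrow>
     (AE t in lebesgue_on {0<..<T}. u t \<in> V) \<and>
     (\<exists>s. (\<forall>n. simple_into V T (s n)) \<and>
          (AE t in lebesgue_on {0<..<T}. (\<lambda>n. N (\<lambda>x. u t x - s n t x)) \<longlonglongrightarrow> 0))"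

definition has_bochner_integral_into ::
  "(real \<Rightarrow> real) set \<Rightarrow> ((real \<Rightarrow> real) \<Rightarrow> real) \<Rightarrow> real \<Rightarrow> (real \<Rightarrow> real \<Rightarrow> real)
     \<Rightarrow> (real \<Rightarrow> real) \<Rightarrow> bool" where
  "has_bochner_integral_into V N T u I \<longleftrightarrow> strongly_measurable V N T u \<and> I \<in> V \<and>
     (\<exists>s. (\<forall>n. simple_into V T (s n)) \<and>
          (\<lambda>n. \<integral>\<^sup>+ t. ennreal (N (\<lambda>x. u t x - s n t x)) \<partial>(lebesgue_on {0<..<T})) \<longlonglongrightarrow> 0 \<and>
          (\<lambda>n. N (\<lambda>x. I x - simple_integral_of T (s n) x)) \<longlonglongrightarrow> 0)"

definition L2_time ::
  "(real \<Rightarrow> real) set \<Rightarrow> ((real \<Rightarrow> real) \<Rightarrow> real) \<Rightarrow> real \<Rightarrow> (real \<Rightarrow> real \<Rightarrow> real) set" where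
  "L2_time V N T = {u. strongly_measurable V N T u \<and>
                       set_integrable lebesgue {0<..<T} (\<lambda>t. (N (u t))\<^sup>2)}"

definition has_weak_time_deriv ::
  "(real \<Rightarrow> real) set \<Rightarrow> ((real \<Rightarrow> real) \<Rightarrow> real) \<Rightarrow> real \<Rightarrow> (real \<Rightarrow> real \<Rightarrow> real)
     \<Rightarrow> (real \<Rightarrow> real \<Rightarrow> real) \<Rightarrow> bool" where
  "has_weak_time_deriv V N T u v \<longleftrightarrow>
     (\<forall>\<psi>\<in>test_functions 0 T. \<exists>I.
        has_bochner_integral_into V N T (\<lambda>t x. deriv \<psi> t * u t x) I \<and>
        has_bochner_integral_into V N T (\<lambda>t x. - (\<psi> t * v t x)) I)"

definition H1_time ::
  "(real \<Rightarrow> real) set \<Rightarrow> ((real \<Rightarrow> real) \<Rightarrow> real) \<Rightarrow> real \<Rightarrow> (real \<Rightarrow> real \<Rightarrow> real) set" where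
  "H1_time V N T = {u \<in> L2_time V N T. \<exists>v\<in>L2_time V N T. has_weak_time_deriv V N T u v}"

definition time_deriv ::
  "(real \<Rightarrow> real) set \<Rightarrow> ((real \<Rightarrow> real) \<Rightarrow> real) \<Rightarrow> real \<Rightarrow> (real \<Rightarrow> real \<Rightarrow> real)
     \<Rightarrow> real \<Rightarrow> real \<Rightarrow> real" where
  "time_deriv V N T u = (SOME v. v \<in> L2_time V N T \<and> has_weak_time_deriv V N T u v)"

text \<open>Functions in \<open>H1_time\<close> are determined for almost every time only; their value at a given
  time \<open>\<tau>\<close> in \<open>[0,T]\<close>, in particular at the end points, is that of the representative
  which is continuous from \<open>[0,T]\<close> into \<open>(V, N)\<close>.\<close>

definition continuous_version ::
  "(real \<Rightarrow> real) set \<Rightarrow> ((real \<Rightarrow> real) \<Rightarrow> real) \<Rightarrow> real \<Rightarrow> (real \<Rightarrow> real \<Rightarrow> real)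
     \<Rightarrow> (real \<Rightarrow> real \<Rightarrow> real) \<Rightarrow> bool" where
  "continuous_version V N T u v \<longleftrightarrow>
     (\<forall>t\<in>{0..T}. v t \<in> V \<and> ((\<lambda>\<tau>. N (\<lambda>x. v \<tau> x - v t x)) \<longlongrightarrow> 0) (at t within {0..T})) \<and>
     (AE t in lebesgue_on {0<..<T}. N (\<lambda>x. u t x - v t x) = 0)"

definition time_value ::
  "(real \<Rightarrow> real) set \<Rightarrow> ((real \<Rightarrow> real) \<Rightarrow> real) \<Rightarrow> real \<Rightarrow> (real \<Rightarrow> real \<Rightarrow> real)
     \<Rightarrow> real \<Rightarrow> real \<Rightarrow> real" where
  "time_value V N T u \<tau> = (SOME v. continuous_version V N T u v) \<tau>"

text \<open>Integral over \<open>Q = (0,1) \<times> (0,T)\<close>. The integrands come from elements of Bochner spaces,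
  whose slices at a fixed time are given up to null sets; the iterated integral does not depend
  on the versions chosen, and by Tonelli it equals the Lebesgue integral over \<open>Q\<close> of any
  jointly measurable version of a nonnegative integrand.\<close>

definition int_Q :: "real \<Rightarrow> (real \<Rightarrow> real \<Rightarrow> real) \<Rightarrow> real" where
  "int_Q T f = (LINT t:{0<..<T}|lebesgue. (LINT x:{0<..<1}|lebesgue. f x t))"


section \<open>The equation\<close>

abbreviation am_x :: "(real \<Rightarrow> real) \<Rightarrow> (real \<Rightarrow> real) \<Rightarrow> real \<Rightarrow> real" where
  "am_x a u \<equiv> wderiv (\<lambda>x. a x * u x)"

abbreviation am_xx :: "(real \<Rightarrow> real) \<Rightarrow> (real \<Rightarrow> real) \<Rightarrow> real \<Rightarrow> real" where
  "am_xx a u \<equiv> wderiv (wderiv (\<lambda>x. a x * u x))"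

abbreviation m_t :: "(real \<Rightarrow> real) \<Rightarrow> real \<Rightarrow> (real \<Rightarrow> real \<Rightarrow> real) \<Rightarrow> real \<Rightarrow> real \<Rightarrow> real" where
  "m_t a T m \<equiv> time_deriv (L2a a) (norm_a a) T m"

abbreviation m_at :: "(real \<Rightarrow> real) \<Rightarrow> real \<Rightarrow> (real \<Rightarrow> real \<Rightarrow> real) \<Rightarrow> real \<Rightarrow> real \<Rightarrow> real" where
  "m_at a T m \<equiv> time_value (L2a a) (norm_a a) T m"

definition solves_problem ::
  "(real \<Rightarrow> real) \<Rightarrow> real \<Rightarrow> (real \<Rightarrow> real \<Rightarrow> real) \<Rightarrow> (real \<Rightarrow> real \<Rightarrow> real) \<Rightarrow> (real \<Rightarrow> real) \<Rightarrow> bool"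
  where
  "solves_problem a T m G m0 \<longleftrightarrow>
     (AE t in lebesgue_on {0<..<T}. AE x in lebesgue_on {0<..<1}.
        m_t a T m t x - am_xx a (m t) x = G t x) \<and>
     (AE t in lebesgue_on {0<..<T}. vanishes_at_ends (\<lambda>x. a x * m t x)) \<and>
     (AE x in lebesgue_on {0<..<1}. m_at a T m 0 x = m0 x)"

end

theory Submission
  imports Defs
begin

text \<open>Since the weight depends on time only, the proof takes place in the Hilbert space \<open>L\<^sup>2\<^sub>a\<close>. There
  \<open>B m = - (am)\<^sub>x\<^sub>x\<close> is symmetric and \<open>\<langle>B m, m\<rangle> = D\<close> is the Dirichlet energy \<open>\<integral> |(am)\<^sub>x|\<^sup>2\<close>. With
  \<open>w = exp (2 s \<phi>)\<close> and \<open>\<kappa> = s \<phi>'\<close>, so that \<open>w' = 2 \<kappa> w\<close>, expand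
  \<open>|G|\<^sup>2 = |(B m - \<kappa> m) + (m\<^sub>t + \<kappa> m)|\<^sup>2\<close>, multiply by \<open>w\<close> and integrate. The cross term is made of the two
  time derivatives \<open>(w D)'\<close> and \<open>- (\<kappa> w |m|\<^sup>2)'\<close> and of the positive term \<open>\<kappa>' w |m|\<^sup>2\<close>; the left-hand
  side of the theorem is then recovered pointwise in time, with the constants \<open>\<lambda>\<^sub>0 = s\<^sub>0 = 1\<close> and \<open>C = 7\<close>.

  At this regularity it is not known beforehand that \<open>D\<close> is absolutely continuous. Only the inequality
  for \<open>\<integral> (w D)'\<close> is needed, and it follows from the convexity bound
  \<open>D(t) - D(t - h) \<le> 2 \<langle>B m(t), m(t) - m(t - h)\<rangle>\<close> on dividing by \<open>h\<close>, integrating and letting \<open>h \<rightarrow> 0\<close>.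
  The same bound shows that \<open>D\<close> is bounded along a sequence of times tending to \<open>0\<close>, which gives it for
  the initial value as well.\<close>

section \<open>Test functions\<close>

text \<open>The difficulty is regularity, not algebra. The values of \<open>m\<close> lie in a set
  of functions with a seminorm, so statements about time are tested against a fixed element
  \<open>y\<close>: \<open>ip (m t) y\<close> is a scalar function, and the one-dimensional theory
  of weak derivatives, developed for a general interval, makes it absolutely continuous. The
  exceptional null sets depend on \<open>y\<close> and are united over countably many test elements.

  The difference quotients of the continuous representative \<open>z\<close> converge to the time
  derivative only weakly. This suffices because the one-sided bounds are linear in the increment of
  \<open>z\<close>, up to a quadratic term that disappears with the step size.

  The initial value is delicate: \<open>z 0\<close> is only known as a limit in
  \<open>L2a a\<close>, while \<open>wderiv\<close> of a function without weak derivative is an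
  arbitrary choice. Bounded energies at times near 0 are what produces a weak derivative of
  \<open>a * z 0\<close>.

  The energy at time \<open>T\<close> and the squared norm at time 0 enter with favourable signs and
  are dropped. The resulting estimate has two of the four end point terms; the other two are added
  at the end.\<close>

definition ndiff :: "nat \<Rightarrow> (real \<Rightarrow> real) \<Rightarrow> bool" where
  "ndiff n f \<longleftrightarrow> (\<forall>k\<le>n. \<forall>x. (deriv ^^ k) f differentiable (at x))"

definition smooth :: "(real \<Rightarrow> real) \<Rightarrow> bool" where
  "smooth f \<longleftrightarrow> (\<forall>n x. (deriv ^^ n) f differentiable (at x))"

lemma smooth_iff_ndiff: "smooth f \<longleftrightarrow> (\<forall>n. ndiff n f)"
  by (auto simp: smooth_def ndiff_def)

lemma ndiff_0: "ndiff 0 f \<longleftrightarrow> (\<forall>x. f differentiable (at x))"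
  by (auto simp: ndiff_def)

text \<open>Smoothness is handled through finite orders because closure under sums, products and
  affine substitutions goes by induction: each derivative is built from functions one order less
  regular, and this recursion feeds the induction hypothesis.\<close>

lemma ndiff_Suc: "ndiff (Suc n) f \<longleftrightarrow> (\<forall>x. f differentiable (at x)) \<and> ndiff n (deriv f)"
proof -
  have "(\<forall>k\<le>Suc n. P k) \<longleftrightarrow> P 0 \<and> (\<forall>k\<le>n. P (Suc k))" for P
    using All_less_Suc2[of "Suc n" P] by (simp add: less_Suc_eq_le)
  then show ?thesis
    unfolding ndiff_def by (simp add: funpow_Suc_right del: funpow.simps(2))
qed

lemma ndiff_imp_differentiable: "ndiff n f \<Longrightarrow> f differentiable (at x)"
  by (cases n) (auto simp: ndiff_0 ndiff_Suc)

lemma ndiff_SucI: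
  assumes "\<And>x. (f has_real_derivative f' x) (at x)" "ndiff n f'"
  shows "ndiff (Suc n) f"
proof -
  have "deriv f = f'"
    using assms(1) by (auto intro!: DERIV_imp_deriv)
  then show ?thesis
    using assms by (auto simp: ndiff_Suc real_differentiable_def)
qed

lemma ndiff_Suc_imp: "ndiff (Suc n) f \<Longrightarrow> ndiff n f"
  by (auto simp: ndiff_def)

lemma has_deriv_of_differentiable: "f differentiable (at x) \<Longrightarrow> (f has_real_derivative deriv f x) (at x)"
  using DERIV_deriv_iff_real_differentiable by blast

lemma ndiff_const: "ndiff n (\<lambda>x. c)"
proof (induction n arbitrary: c)
  case (Suc n)
  then show ?case by (intro ndiff_SucI[where f' = "\<lambda>x. 0"]) auto
qed (simp add: ndiff_0)

lemma ndiff_add: "ndiff n f \<Longrightarrow> ndiff n g \<Longrightarrow> ndiff n (\<lambda>x. f x + g x)"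
proof (induction n arbitrary: f g)
  case (Suc n)
  show ?case
    by (rule ndiff_SucI[where f' = "\<lambda>x. deriv f x + deriv g x"])
       (use Suc in \<open>auto simp: ndiff_Suc intro!: derivative_intros has_deriv_of_differentiable\<close>)
qed (simp add: ndiff_0)

lemma ndiff_mult: "ndiff n f \<Longrightarrow> ndiff n g \<Longrightarrow> ndiff n (\<lambda>x. f x * g x)"
proof (induction n arbitrary: f g)
  case (Suc n)
  have "ndiff n (\<lambda>x. deriv f x * g x + deriv g x * f x)"
    using Suc.IH[of "deriv f" g] Suc.IH[of "deriv g" f] Suc.prems ndiff_Suc_imp
    by (intro ndiff_add) (auto simp: ndiff_Suc)
  then show ?case
    by (rule ndiff_SucI[rotated])
       (use Suc in \<open>auto simp: ndiff_Suc intro!: DERIV_mult has_deriv_of_differentiable\<close>)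
qed (simp add: ndiff_0)

lemma has_derivative_affine:
  assumes "\<And>x. f differentiable (at x)"
  shows "((\<lambda>x. f (c * x + d)) has_real_derivative c * deriv f (c * x + d)) (at x)"
proof -
  have "((\<lambda>x. c * x + d) has_real_derivative c) (at x)"
    by (auto intro!: derivative_eq_intros)
  from DERIV_chain2[OF has_deriv_of_differentiable[OF assms] this] show ?thesis
    by (simp add: mult.commute)
qed

lemma ndiff_affine: "ndiff n f \<Longrightarrow> ndiff n (\<lambda>x. f (c * x + d))"
proof (induction n arbitrary: f)
  case 0
  then have "f differentiable (at x)" for x by (simp add: ndiff_0)
  then show ?case
    using has_derivative_affine[of f c d] unfolding ndiff_0 real_differentiable_def by blast
next
  case (Suc n)
  then have "f differentiable (at x)" for x by (simp add: ndiff_Suc)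
  then show ?case
    by (rule ndiff_SucI[OF has_derivative_affine])
       (use Suc in \<open>simp add: ndiff_Suc ndiff_mult ndiff_const\<close>)
qed

section \<open>Flat functions and bumps\<close>

definition flat :: "real poly \<Rightarrow> real \<Rightarrow> real" where
  "flat p x = (if x > 0 then poly p (1 / x) * exp (- (1 / x)) else 0)"

lemma poly_exp_tendsto_0: "((\<lambda>y. poly p y * exp (- y)) \<longlongrightarrow> 0) at_top" for p :: "real poly"
proof -
  have "((\<lambda>y. \<Sum>i\<le>degree p. coeff p i * (y ^ i / exp y)) \<longlongrightarrow> (\<Sum>i\<le>degree p. coeff p i * 0)) at_top"
    by (intro tendsto_intros tendsto_power_div_exp_0)
  then show ?thesis
    by (simp add: poly_altdef exp_minus sum_distrib_right divide_inverse mult.assoc)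
qed

text \<open>With y = 1/x the operator d/dx is - y^2 d/dy, so p(y) e^(-y) goes to y^2 (p - p')(y)
  e^(-y); the factor \<open>[:0, 0, 1:]\<close> is y^2. The family of all \<open>flat p\<close> is
  closed under differentiation, and this one formula yields every order of smoothness.\<close>

lemma has_derivative_flat:
  "(flat p has_real_derivative flat ([:0, 0, 1:] * (p - pderiv p)) x) (at x)"
proof -
  consider "x > 0" | "x < 0" | "x = 0" by linarith
  then show ?thesis
  proof cases
    case 1
    have inv: "((\<lambda>x. 1 / x) has_real_derivative - (1 / x\<^sup>2)) (at x)"
      using 1 by (auto intro!: derivative_eq_intros simp: power2_eq_square)
    have "((\<lambda>x. poly p (1 / x) * exp (- (1 / x))) has_real_derivative
        poly (pderiv p) (1 / x) * (- (1 / x\<^sup>2)) * exp (- (1 / x))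
        + exp (- (1 / x)) * (- (- (1 / x\<^sup>2))) * poly p (1 / x)) (at x)"
      by (intro DERIV_mult DERIV_chain2[OF poly_DERIV inv] DERIV_chain2[OF DERIV_exp] DERIV_minus inv)
    then have "((\<lambda>x. poly p (1 / x) * exp (- (1 / x))) has_real_derivative
        flat ([:0, 0, 1:] * (p - pderiv p)) x) (at x)"
      using 1 by (simp add: flat_def algebra_simps power2_eq_square)
    moreover have "\<forall>\<^sub>F y in nhds x. flat p y = poly p (1 / y) * exp (- (1 / y))"
      using eventually_nhds_in_open[of "{0<..}" x] 1
      by (auto elim!: eventually_mono simp: flat_def)
    ultimately show ?thesis
      using DERIV_cong_ev[of x x "flat p"] by simp
  next
    case 2
    have "\<forall>\<^sub>F y in nhds x. flat p y = 0"
      using eventually_nhds_in_open[of "{..<0}" x] 2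
      by (auto elim!: eventually_mono simp: flat_def)
    then show ?thesis
      using DERIV_cong_ev[of x x "flat p" "\<lambda>_. 0" 0 0] 2 by (simp add: flat_def)
  next
    case 3
    \<comment> \<open>At 0 the quotient \<open>flat p h / h\<close> is y p(y) e^(-y) with y = 1/h,
      and y tends to infinity as h decreases to 0; from the left the quotient is 0.\<close>
    have "((\<lambda>y. poly ([:0, 1:] * p) y * exp (- y)) \<longlongrightarrow> 0) at_top"
      by (rule poly_exp_tendsto_0)
    then have "((\<lambda>h. poly ([:0, 1:] * p) (inverse h) * exp (- inverse h)) \<longlongrightarrow> 0) (at_right 0)"
      by (rule filterlim_compose) (rule filterlim_inverse_at_top_right)
    then have "((\<lambda>h. flat p h / h) \<longlongrightarrow> 0) (at_right 0)"
      by (rule Lim_transform_eventually)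
         (auto simp: flat_def field_simps intro!: eventually_at_rightI[of 0 1])
    moreover have "((\<lambda>h. flat p h / h) \<longlongrightarrow> 0) (at_left 0)"
      by (rule tendsto_eventually) (auto simp: flat_def intro!: eventually_at_leftI[of "-1" 0])
    ultimately have "((\<lambda>h. flat p h / h) \<longlongrightarrow> 0) (at 0)"
      by (simp add: filterlim_at_split)
    then show ?thesis
      using 3 by (simp add: DERIV_def flat_def)
  qed
qed

lemma ndiff_flat: "ndiff n (flat p)"
proof (induction n arbitrary: p)
  case 0
  then show ?case
    using has_derivative_flat by (auto simp: ndiff_0 real_differentiable_def)
next
  case (Suc n)
  then show ?case using has_derivative_flat by (intro ndiff_SucI)
qed

text \<open>For positive x, \<open>flat 1 x\<close> is exp(-1/x). The factor \<open>Suc n\<close>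
  stretches the argument, so the values inside the interval rise to 1 while the support stays in
  \<open>{c..d}\<close>: the bumps approximate the indicator from below.\<close>

definition bump :: "real \<Rightarrow> real \<Rightarrow> nat \<Rightarrow> real \<Rightarrow> real" where
  "bump c d n x = flat 1 (real (Suc n) * (x - c)) * flat 1 (real (Suc n) * (d - x))"

lemma flat_1_bounds: "0 \<le> flat 1 x" "flat 1 x \<le> 1"
  by (auto simp: flat_def)

lemma bump_bounds: "0 \<le> bump c d n x" "bump c d n x \<le> 1"
  by (auto simp: bump_def flat_1_bounds intro!: mult_le_one)

lemma bump_eq_0: "x \<notin> {c<..<d} \<Longrightarrow> bump c d n x = 0"
  by (auto simp: bump_def flat_def zero_less_mult_iff)

lemma bump_pos: "x \<in> {c<..<d} \<Longrightarrow> bump c d n x > 0"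
  by (auto simp: bump_def flat_def)

lemma bump_tendsto: "(\<lambda>n. bump c d n x) \<longlonglongrightarrow> indicat_real {c<..<d} x"
proof (cases "x \<in> {c<..<d}")
  case True
  have "(\<lambda>n. exp (- (inverse (real (Suc n)) * (1/(x-c)))) * exp (- (inverse (real (Suc n)) * (1/(d-x)))))
       \<longlonglongrightarrow> exp (-(0 * (1/(x-c)))) * exp (-(0 * (1/(d-x))))"
    by (intro tendsto_intros LIMSEQ_inverse_real_of_nat)
  moreover have "bump c d n x = exp (- (inverse (real (Suc n)) * (1/(x-c)))) * exp (- (inverse (real (Suc n)) * (1/(d-x))))" for n
  proof -
    have "0 < real (Suc n) * (x - c)" "0 < real (Suc n) * (d - x)"
      using True by (auto intro!: mult_pos_pos)
    then show ?thesis
      by (simp only: bump_def flat_def) (simp add: divide_inverse mult.commute)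
  qed
  ultimately show ?thesis using True by simp
next
  case False
  then show ?thesis by (simp add: bump_eq_0)
qed

lemma smooth_bump: "smooth (bump c d n)"
proof -
  have "bump c d n = (\<lambda>x. flat 1 (real (Suc n) * x + - real (Suc n) * c) * flat 1 (- real (Suc n) * x + real (Suc n) * d))"
    by (auto simp: bump_def algebra_simps)
  then show ?thesis
    unfolding smooth_iff_ndiff by (auto intro!: ndiff_mult ndiff_affine ndiff_flat)
qed

section \<open>Supports of test functions\<close>

lemma test_functions_iff:
  "\<psi> \<in> test_functions l r \<longleftrightarrow> smooth \<psi> \<and> closure {x. \<psi> x \<noteq> 0} \<subseteq> {l<..<r}"
  by (simp add: test_functions_def smooth_def)

lemma closure_support_subset:
  assumes "\<And>x. x \<notin> {c..d} \<Longrightarrow> f x = 0"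
  shows "closure {x::real. f x \<noteq> 0} \<subseteq> {c..d}"
proof (rule closure_minimal)
  show "{x. f x \<noteq> 0} \<subseteq> {c..d}" using assms by blast
qed auto

lemma bump_test_function:
  assumes "l < c" "d < r"
  shows "bump c d n \<in> test_functions l r"
proof -
  have "closure {x. bump c d n x \<noteq> 0} \<subseteq> {c..d}"
    by (rule closure_support_subset) (auto intro!: bump_eq_0)
  then show ?thesis
    unfolding test_functions_iff using assms smooth_bump by auto
qed

lemma test_function_support:
  assumes "\<psi> \<in> test_functions l r" "l < r"
  obtains c d where "l < c" "c < d" "d < r" "\<And>x. x \<notin> {c<..<d} \<Longrightarrow> \<psi> x = 0"
proof -
  let ?S = "closure {x. \<psi> x \<noteq> 0}"
  have S: "?S \<subseteq> {l<..<r}" using assms by (auto simp: test_functions_def)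
  have "bounded {x. \<psi> x \<noteq> 0}"
    by (rule bounded_subset[of "{l<..<r}"]) (use S closure_subset[of "{x. \<psi> x \<noteq> 0}"] in auto)
  then have comp: "compact ?S" by (simp add: compact_closure)
  show thesis
  proof (cases "?S = {}")
    case True
    then have "\<psi> x = 0" for x
      using closure_subset[of "{x. \<psi> x \<noteq> 0}"] by blast
    then show thesis using assms(2) that[of "(2*l+r)/3" "(l+2*r)/3"] by simp
  next
    case False
    obtain m where m: "m \<in> ?S" "\<And>x. x \<in> ?S \<Longrightarrow> m \<le> x"
      using compact_attains_inf[OF comp False] by blast
    obtain M where M: "M \<in> ?S" "\<And>x. x \<in> ?S \<Longrightarrow> x \<le> M"
      using compact_attains_sup[OF comp False] by blast
    have lm: "l < m" "m < r" "l < M" "M < r" "m \<le> M"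
      using subsetD[OF S m(1)] subsetD[OF S M(1)] m(2)[OF M(1)] by simp_all
    \<comment> \<open>\<open>m\<close> and \<open>M\<close> are the ends of the support. Moving
      halfway towards \<open>l\<close> and \<open>r\<close> makes \<open>\<psi>\<close> vanish at
      the new end points themselves, which removes the boundary terms in later integrations by
      parts.\<close>
    show thesis
    proof (rule that[of "(l+m)/2" "(M+r)/2"])
      fix x assume x: "x \<notin> {(l+m)/2<..<(M+r)/2}"
      show "\<psi> x = 0"
      proof (rule ccontr)
        assume "\<psi> x \<noteq> 0"
        then have "x \<in> ?S" using closure_subset[of "{x. \<psi> x \<noteq> 0}"] by (rule_tac subsetD) auto
        then have "m \<le> x" "x \<le> M" using m(2) M(2) by simp_all
        then show False using x lm by simp
      qed
    qed (use lm in simp_all)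
  qed
qed

lemma test_function_ndiff: "\<psi> \<in> test_functions l r \<Longrightarrow> ndiff n \<psi>"
  by (simp add: test_functions_iff smooth_iff_ndiff)

lemma test_function_DERIV:
  assumes "\<psi> \<in> test_functions l r"
  shows "(\<psi> has_real_derivative deriv \<psi> x) (at x)"
  by (rule has_deriv_of_differentiable) (rule ndiff_imp_differentiable[OF test_function_ndiff[OF assms, of 0]])

lemma test_function_continuous:
  assumes "\<psi> \<in> test_functions l r"
  shows "continuous_on S \<psi>" "continuous_on S (deriv \<psi>)"
proof -
  show "continuous_on S \<psi>"
    by (rule continuous_at_imp_continuous_on) (rule ballI, rule DERIV_isCont[OF test_function_DERIV[OF assms]])
  have "ndiff 0 (deriv \<psi>)"
    using test_function_ndiff[OF assms, of 1] by (simp add: ndiff_Suc)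
  then show "continuous_on S (deriv \<psi>)"
    by (intro continuous_at_imp_continuous_on ballI DERIV_isCont)
       (rule has_deriv_of_differentiable, simp add: ndiff_0)
qed

lemma deriv_eq_0_outside:
  assumes "\<And>x. x \<notin> {c<..<d} \<Longrightarrow> f x = 0" "x \<notin> {c..d}"
  shows "deriv f x = (0::real)"
proof -
  have "\<forall>\<^sub>F y in nhds x. f y = 0"
  proof (rule eventually_mono)
    show "\<forall>\<^sub>F y in nhds x. y \<in> - {c..d}"
      using assms(2) by (intro eventually_nhds_in_open) auto
    show "f y = 0" if "y \<in> - {c..d}" for y
      using assms(1)[of y] that by auto
  qed
  then have "(f has_real_derivative 0) (at x)"
    using DERIV_cong_ev[of x x f "\<lambda>_. 0" 0 0] by simp
  then show ?thesis by (rule DERIV_imp_deriv)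
qed

section \<open>An induction principle for Lebesgue measurable sets\<close>

lemma sigma_finite_lebesgue: "sigma_finite_measure (lebesgue :: real measure)"
proof
  show "\<exists>A::real set set. countable A \<and> A \<subseteq> sets lebesgue \<and> \<Union>A = space lebesgue \<and> (\<forall>a\<in>A. emeasure lebesgue a \<noteq> \<infinity>)"
  proof (intro exI conjI)
    show "countable (range (\<lambda>n::nat. {- real n..real n}))" by simp
    show "\<Union> (range (\<lambda>n::nat. {- real n..real n})) = space lebesgue"
    proof -
      have "\<exists>n::nat. x \<in> {- real n..real n}" for x :: real
      proof -
        obtain n :: nat where "\<bar>x\<bar> \<le> real n" using real_arch_simple by blast
        then show ?thesis by (intro exI[of _ n]) auto
      qed
      then show ?thesis by auto
    qed
  qed auto
qed

text \<open>The pi-lambda theorem: left rays are stable under intersection and generate the Borel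
  sets, and a Lebesgue set differs from a Borel set by a null set, which the case
  \<open>null\<close> bridges. It extends statements about integrals from rays to all measurable
  sets.\<close>

lemma lebesgue_sets_induct_disjoint [consumes 1, case_names basic empty compl union null]:
  fixes A :: "real set"
  assumes A: "A \<in> sets lebesgue"
    and basic: "\<And>c. P {..<c}" and empty: "P {}"
    and compl: "\<And>A. A \<in> sets lebesgue \<Longrightarrow> P A \<Longrightarrow> P (- A)"
    and union: "\<And>A. disjoint_family A \<Longrightarrow> (\<And>i::nat. A i \<in> sets lebesgue) \<Longrightarrow> (\<And>i. P (A i)) \<Longrightarrow> P (\<Union>i. A i)"
    and null: "\<And>A B. A \<in> sets lebesgue \<Longrightarrow> B \<in> sets lebesgue \<Longrightarrow> AE x in lebesgue. x \<in> A \<longleftrightarrow> x \<in> B \<Longrightarrow> P A \<Longrightarrow> P B"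
  shows "P A"
proof -
  have borel: "P B" if "B \<in> sets borel" for B
  proof -
    have *: "sets borel = sigma_sets UNIV (range lessThan :: real set set)"
      by (simp add: borel_Iio)
    then have leb: "C \<in> sigma_sets UNIV (range lessThan) \<Longrightarrow> C \<in> sets lebesgue" for C :: "real set"
      using sets_completionI_sets[of C lborel] by simp
    have "Int_stable (range lessThan :: real set set)"
      by (auto simp: Int_stable_def lessThan_def Collect_conj_eq[symmetric] simp flip: min_less_iff_conj)
    moreover have "range lessThan \<subseteq> Pow (UNIV :: real set)" by simp
    ultimately show ?thesis
      using that unfolding *
    proof (induction rule: sigma_sets_induct_disjoint)
      case (basic A)
      then show ?case using \<open>\<And>c. P {..<c}\<close> by blast
    next
      case empty
      show ?case by fact
    next
      case (compl A)
      from assms(4)[OF leb[OF compl(1)] compl(2)] show ?case by (simp add: Compl_eq_Diff_UNIV)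
    next
      case (union A)
      show ?case
        by (rule assms(5)) (use union leb in blast)+
    qed
  qed
  from A obtain S N N' where S: "A = S \<union> N" "N \<subseteq> N'" "N' \<in> null_sets lborel" "S \<in> sets lborel"
    by (rule sets_completionE)
  have "AE x in lebesgue. x \<notin> N'"
    using S(3) by (intro AE_not_in null_sets_completionI)
  then have "AE x in lebesgue. x \<in> S \<longleftrightarrow> x \<in> A"
    by eventually_elim (use S in auto)
  then show ?thesis
    using S A borel[of S] by (intro null[of S A]) (auto intro: sets_completionI_sets)
qed

lemma AE_zero_if_integral_lessThan_zero:
  fixes f :: "real \<Rightarrow> real"
  assumes f: "integrable lebesgue f" and zero: "\<And>c. (LINT x:{..<c}|lebesgue. f x) = 0"
  shows "AE x in lebesgue. f x = 0"
proof (rule sigma_finite_measure.density_zero[OF sigma_finite_lebesgue f])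
  have sf: "set_integrable lebesgue A f" if "A \<in> sets lebesgue" for A
    using f that unfolding set_integrable_def by (intro integrable_mult_indicator)
  \<comment> \<open>Exhaustion by rays gives the integral over the whole line, from which the
    complement case subtracts.\<close>
  have "(\<Union>n::nat. {..<real n}) = UNIV"
    using reals_Archimedean2 by blast
  moreover have "(\<lambda>n. LINT x:{..<real n}|lebesgue. f x) \<longlonglongrightarrow> (LINT x:(\<Union>n::nat. {..<real n})|lebesgue. f x)"
    by (rule set_integral_cont_up) (auto simp: incseq_def intro!: sf)
  ultimately have tot: "(LINT x:UNIV|lebesgue. f x) = 0"
    using zero by (simp add: LIMSEQ_const_iff)
  show "(LINT x:A|lebesgue. f x) = 0" if "A \<in> sets lebesgue" for A
    using that
  proof (induction rule: lebesgue_sets_induct_disjoint)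
    case (basic c) show ?case by (rule zero)
  next
    case (compl A)
    then have "(LINT x:A \<union> - A|lebesgue. f x) = (LINT x:A|lebesgue. f x) + (LINT x:- A|lebesgue. f x)"
      by (intro set_integral_Un sf) (auto simp: Compl_eq_Diff_UNIV)
    then show ?case using tot compl by simp
  next
    case (union A)
    then have "(LINT x:(\<Union>i. A i)|lebesgue. f x) = (\<Sum>i. (LINT x:(A i)|lebesgue. f x))"
      by (intro lebesgue_integral_countable_add sf) (auto simp: disjoint_family_on_def)
    then show ?case using union by simp
  next
    case (null A B)
    then have "(LINT x:B|lebesgue. f x) = (LINT x:A|lebesgue. f x)"
      using sf[of A] sf[of B] unfolding set_integrable_def
      by (intro set_integral_cong_set) (auto simp: set_borel_measurable_def)
    then show ?case using null by simp
  qed (simp add: set_lebesgue_integral_def)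
qed

section \<open>Local integrability and the fundamental lemma of the calculus of variations\<close>

definition loc_int :: "real \<Rightarrow> real \<Rightarrow> (real \<Rightarrow> real) \<Rightarrow> bool" where
  "loc_int l r f \<longleftrightarrow> (\<forall>c d. l < c \<longrightarrow> d < r \<longrightarrow> set_integrable lebesgue {c..d} f)"

lemma loc_intD: "loc_int l r f \<Longrightarrow> l < c \<Longrightarrow> d < r \<Longrightarrow> set_integrable lebesgue {c..d} f"
  by (auto simp: loc_int_def)

text \<open>A nonempty compact subset of (0,1) has a least and a greatest element and so lies in a
  closed subinterval. The interval form has arbitrary end points so that one theory of weak
  derivatives covers the space interval and the time interval.\<close>

lemma locally_integrable_iff_loc_int: "locally_integrable f \<longleftrightarrow> loc_int 0 1 f"
proof
  assume "locally_integrable f"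
  then show "loc_int 0 1 f"
    unfolding loc_int_def
  proof (intro allI impI)
    fix c d :: real assume "0 < c" "d < 1"
    then have "compact {c..d} \<and> {c..d} \<subseteq> {0<..<1}" by auto
    with \<open>locally_integrable f\<close> show "set_integrable lebesgue {c..d} f"
      unfolding locally_integrable_def by blast
  qed
next
  assume f: "loc_int 0 1 f"
  show "locally_integrable f"
    unfolding locally_integrable_def
  proof safe
    fix K :: "real set" assume K: "compact K" "K \<subseteq> {0<..<1}"
    show "set_integrable lebesgue K f"
    proof (cases "K = {}")
      case False
      obtain m where m: "m \<in> K" "\<And>x. x \<in> K \<Longrightarrow> m \<le> x"
        using compact_attains_inf[OF K(1) False] by blast
      obtain M where M: "M \<in> K" "\<And>x. x \<in> K \<Longrightarrow> x \<le> M"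
        using compact_attains_sup[OF K(1) False] by blast
      have "set_integrable lebesgue {m..M} f"
        using K m(1) M(1) by (intro loc_intD[OF f]) auto
      moreover have "K \<in> sets lebesgue"
        using borel_compact[OF K(1)] sets_completionI_sets[of K lborel] by simp
      moreover have "K \<subseteq> {m..M}" using m(2) M(2) by (simp add: subset_iff)
      ultimately show ?thesis by (rule set_integrable_subset)
    qed simp
  qed
qed

lemma loc_int_measurable:
  assumes "loc_int l r f"
  shows "f \<in> borel_measurable (lebesgue_on {l<..<r})"
proof (cases "l < r")
  case True
  define c where "c n = l + (r-l) / (real n + 3)" for n :: nat
  define d where "d n = r - (r-l) / (real n + 3)" for n :: nat
  have cd: "l < c n" "d n < r" for n using True by (auto simp: c_def d_def)
  have lim: "(\<lambda>n. c n) \<longlonglongrightarrow> l" "(\<lambda>n. d n) \<longlonglongrightarrow> r"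
    unfolding c_def d_def by real_asymp+
  have "(\<lambda>x. indicator {l<..<r} x *\<^sub>R f x) \<in> borel_measurable lebesgue"
  proof (rule borel_measurable_LIMSEQ_real)
    show "(\<lambda>x. indicator {c n..d n} x *\<^sub>R f x) \<in> borel_measurable lebesgue" for n
      using loc_intD[OF assms cd(1)[of n] cd(2)[of n]] by (auto simp: set_integrable_def)
    show "(\<lambda>n. indicator {c n..d n} x *\<^sub>R f x) \<longlonglongrightarrow> indicator {l<..<r} x *\<^sub>R f x" for x
    proof (cases "x \<in> {l<..<r}")
      case True
      then have "\<forall>\<^sub>F n in sequentially. c n < x" "\<forall>\<^sub>F n in sequentially. x < d n"
        using lim by (auto intro: order_tendstoD)
      then have "\<forall>\<^sub>F n in sequentially. indicator {c n..d n} x *\<^sub>R f x = indicator {l<..<r} x *\<^sub>R f x"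
        by eventually_elim (use True in auto)
      then show ?thesis by (rule tendsto_eventually)
    next
      case False
      then have "x \<notin> {c n..d n}" for n using cd[of n] by auto
      then show ?thesis using False by simp
    qed
  qed
  then show ?thesis by (simp add: borel_measurable_restrict_space_iff)
qed (simp add: space_empty_iff measurable_def)

text \<open>Bumps converge boundedly to the indicator of an interval, so the integral of
  \<open>h\<close> over every interval compactly contained in (l,r) vanishes, and with it the
  integral over every ray of \<open>h\<close> cut off to such an interval.\<close>

lemma fundamental_lemma_variations:
  assumes h: "loc_int l r h"
    and zero: "\<And>\<psi>. \<psi> \<in> test_functions l r \<Longrightarrow> (LINT x:{l<..<r}|lebesgue. h x * \<psi> x) = 0"
  shows "AE x in lebesgue. x \<in> {l<..<r} \<longrightarrow> h x = 0"
proof -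
  have int0: "(LINT x:{c<..<d}|lebesgue. h x) = 0" if cd: "l < c" "d < r" for c d
  proof -
    have hcd: "set_integrable lebesgue {c..d} h" using loc_intD[OF h cd] .
    then have meas1: "(\<lambda>x. indicat_real {c..d} x *\<^sub>R h x) \<in> borel_measurable lebesgue"
      unfolding set_integrable_def by (rule borel_measurable_integrable)
    have meas2: "bump c d n \<in> borel_measurable lebesgue" for n
      using borel_measurable_continuous_onI[OF test_function_continuous(1)[OF bump_test_function[of "c-1" c d "d+1" n]]]
      by (intro measurable_completion) simp
    note meas = meas1 meas2
    have eq: "indicator {l<..<r} x *\<^sub>R (h x * bump c d n x) = indicator {c..d} x *\<^sub>R h x * bump c d n x" for x n
      using cd by (auto simp: indicator_def bump_eq_0)
    have "(\<lambda>n. \<integral>x. indicator {c..d} x *\<^sub>R h x * bump c d n x \<partial>lebesgue)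
       \<longlonglongrightarrow> (\<integral>x. indicator {c..d} x *\<^sub>R h x * indicator {c<..<d} x \<partial>lebesgue)"
    proof (rule integral_dominated_convergence[where w = "\<lambda>x. norm (indicator {c..d} x *\<^sub>R h x)"])
      show "integrable lebesgue (\<lambda>x. norm (indicat_real {c..d} x *\<^sub>R h x))"
        using hcd by (auto simp: set_integrable_def intro: integrable_norm)
      show "AE x in lebesgue. (\<lambda>n. indicat_real {c..d} x *\<^sub>R h x * bump c d n x)
           \<longlonglongrightarrow> indicat_real {c..d} x *\<^sub>R h x * indicat_real {c<..<d} x"
        by (intro AE_I2 tendsto_intros bump_tendsto)
      show "AE x in lebesgue. norm (indicat_real {c..d} x *\<^sub>R h x * bump c d n x)
         \<le> norm (indicat_real {c..d} x *\<^sub>R h x)" for n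
        using bump_bounds[of c d n] by (intro AE_I2) (auto simp: abs_mult mult_left_le)
      show "(\<lambda>x. indicat_real {c..d} x *\<^sub>R h x * bump c d n x) \<in> borel_measurable lebesgue" for n
        by (rule borel_measurable_times) (rule meas)+
      show "(\<lambda>x. indicat_real {c..d} x *\<^sub>R h x * indicat_real {c<..<d} x) \<in> borel_measurable lebesgue"
        by (rule borel_measurable_times[OF meas(1) borel_measurable_indicator]) simp
    qed
    moreover have "(\<integral>x. indicator {c..d} x *\<^sub>R h x * bump c d n x \<partial>lebesgue) = 0" for n
      using zero[OF bump_test_function[OF cd, of n]] unfolding set_lebesgue_integral_def eq .
    moreover have "(\<lambda>x. indicator {c..d} x *\<^sub>R h x * indicator {c<..<d} x) = (\<lambda>x. indicator {c<..<d} x *\<^sub>R h x)"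
      by (auto simp: indicator_def)
    ultimately show ?thesis
      unfolding set_lebesgue_integral_def by (simp add: LIMSEQ_const_iff)
  qed
  have loc: "AE x in lebesgue. x \<in> {c<..<d} \<longrightarrow> h x = 0" if cd: "l < c" "d < r" for c d
  proof -
    have hi: "integrable lebesgue (\<lambda>x. indicator {c<..<d} x *\<^sub>R h x)"
      using set_integrable_subset[OF loc_intD[OF h cd], of "{c<..<d}"] greaterThanLessThan_subseteq_atLeastAtMost_iff[of c d c d]
      by (simp add: set_integrable_def)
    have "AE x in lebesgue. indicator {c<..<d} x *\<^sub>R h x = 0"
    proof (rule AE_zero_if_integral_lessThan_zero[OF hi])
      fix e
      have "(LINT x:{..<e}|lebesgue. indicat_real {c<..<d} x *\<^sub>R h x) = (LINT x:{c<..<min d e}|lebesgue. h x)"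
        unfolding set_lebesgue_integral_def by (rule Bochner_Integration.integral_cong) (auto simp: indicator_def)
      also have "\<dots> = 0" using cd by (intro int0) auto
      finally show "(LINT x:{..<e}|lebesgue. indicat_real {c<..<d} x *\<^sub>R h x) = 0" .
    qed
    then show ?thesis by eventually_elim auto
  qed
  \<comment> \<open>Countably many compactly contained intervals exhaust (l,r), so their exceptional
    null sets can be united.\<close>
  have "AE x in lebesgue. \<forall>n::nat. x \<in> {l + 1/real (Suc n)<..<r - 1/real (Suc n)} \<longrightarrow> h x = 0"
    unfolding AE_all_countable by (intro allI loc) auto
  then show ?thesis
  proof eventually_elim
    case (elim x)
    show ?case
    proof
      assume x: "x \<in> {l<..<r}"
      have "(\<lambda>n. l + 1/real (Suc n)) \<longlonglongrightarrow> l" "(\<lambda>n. r - 1/real (Suc n)) \<longlonglongrightarrow> r" by real_asymp+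
      then have "\<forall>\<^sub>F n in sequentially. l + 1/real (Suc n) < x" "\<forall>\<^sub>F n in sequentially. x < r - 1/real (Suc n)"
        using x by (auto intro: order_tendstoD)
      then have "\<forall>\<^sub>F n in sequentially. x \<in> {l + 1/real (Suc n)<..<r - 1/real (Suc n)}"
        by eventually_elim simp
      then show "h x = 0" using elim eventually_happens'[OF sequentially_bot] by blast
    qed
  qed
qed

text \<open>Integration by parts for absolutely continuous functions amounts to this exchange of the
  order of integration over the triangle y \<le> x. The integrand is dominated by the product of
  \<open>q x\<close> and \<open>r y\<close>, which is integrable because both factors are.\<close>

lemma Fubini_triangle:
  fixes q r :: "real \<Rightarrow> real"
  assumes q: "integrable lebesgue q" and r: "integrable lebesgue r"
  shows "(\<integral>x. q x * (LINT y:{..x}|lebesgue. r y) \<partial>lebesgue) = (\<integral>y. r y * (LINT x:{y..}|lebesgue. q x) \<partial>lebesgue)"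
proof -
  interpret sigma_finite_measure "lebesgue :: real measure" by (rule sigma_finite_lebesgue)
  interpret pair_sigma_finite "lebesgue :: real measure" "lebesgue :: real measure" ..
  let ?F = "\<lambda>x y. q x * (indicator {..x} y * r y)"
  note [measurable] = borel_measurable_integrable[OF q] borel_measurable_integrable[OF r]
  have id: "(\<lambda>x::real. x) \<in> borel_measurable lebesgue" by (rule measurable_completion) simp
  have [measurable]: "fst \<in> borel_measurable ((lebesgue :: real measure) \<Otimes>\<^sub>M (lebesgue :: real measure))"
    using measurable_compose[OF measurable_fst id] .
  have [measurable]: "snd \<in> borel_measurable ((lebesgue :: real measure) \<Otimes>\<^sub>M (lebesgue :: real measure))"
    using measurable_compose[OF measurable_snd id] .
  have ind: "indicator {..x} y = indicat_real {p. snd p \<le> fst p} (x, y)" for x y :: real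
    by (auto simp: indicator_def)
  have "{p \<in> space (lebesgue \<Otimes>\<^sub>M lebesgue). snd p \<le> (fst p :: real)} \<in> sets (lebesgue \<Otimes>\<^sub>M (lebesgue :: real measure))"
    by (rule borel_measurable_le) measurable
  then have [measurable]: "{p. snd p \<le> fst p} \<in> sets (lebesgue \<Otimes>\<^sub>M (lebesgue :: real measure))"
    by (simp add: space_pair_measure)
  have int1: "integrable lebesgue (\<lambda>x. \<integral> y. norm (q x * r y) \<partial>lebesgue)"
    using q r by (simp add: abs_mult)
  have "integrable (lebesgue \<Otimes>\<^sub>M lebesgue) (\<lambda>p. q (fst p) * r (snd p))"
    by (rule Fubini_integrable) (use int1 r in simp_all)
  then have "integrable (lebesgue \<Otimes>\<^sub>M lebesgue) (case_prod ?F)"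
  proof (rule Bochner_Integration.integrable_bound)
    show "case_prod ?F \<in> borel_measurable (lebesgue \<Otimes>\<^sub>M lebesgue)"
      unfolding ind by measurable
  qed (auto simp: indicator_def)
  from Fubini_integral[OF this]
  have "(\<integral>x. (\<integral>y. ?F x y \<partial>lebesgue) \<partial>lebesgue) = (\<integral>y. (\<integral>x. ?F x y \<partial>lebesgue) \<partial>lebesgue)" by simp
  also have "(\<lambda>y. \<integral>x. ?F x y \<partial>lebesgue) = (\<lambda>y. r y * (LINT x:{y..}|lebesgue. q x))"
  proof
    fix y
    have "(\<integral>x. ?F x y \<partial>lebesgue) = (\<integral>x. r y * (indicator {y..} x * q x) \<partial>lebesgue)"
      by (rule Bochner_Integration.integral_cong) (auto simp: indicator_def)
    then show "(\<integral>x. ?F x y \<partial>lebesgue) = r y * (LINT x:{y..}|lebesgue. q x)"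
      by (simp add: set_lebesgue_integral_def)
  qed
  finally show ?thesis by (simp add: set_lebesgue_integral_def)
qed

section \<open>Primitives of integrable functions\<close>

text \<open>Absolute continuity of \<open>P\<close> on \<open>{c..d}\<close> with derivative
  \<open>q\<close>, in integrated form, so that no almost everywhere differentiability theorem
  enters.\<close>

definition prim :: "real \<Rightarrow> real \<Rightarrow> (real \<Rightarrow> real) \<Rightarrow> (real \<Rightarrow> real) \<Rightarrow> bool" where
  "prim c d q P \<longleftrightarrow> set_integrable lebesgue {c..d} q \<and>
     (\<forall>x\<in>{c..d}. P x = P c + (LINT y:{c..x}|lebesgue. q y))"

lemma LINT_combine:
  assumes "set_integrable lebesgue {a..c} f" "a \<le> b" "b \<le> (c::real)"
  shows "(LINT x:{a..c}|lebesgue. f x) = (LINT x:{a..b}|lebesgue. f x) + (LINT x:{b..c}|lebesgue. f x :: real)"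
proof -
  have i: "set_integrable lebesgue {a..b} f" "set_integrable lebesgue {b..c} f"
    using assms by (auto intro: set_integrable_subset)
  have "(LINT x:{a..b} \<union> {b..c}|lebesgue. f x) = (LINT x:{a..b}|lebesgue. f x) + (LINT x:{b..c}|lebesgue. f x)"
  proof (rule set_integral_Un_AE)
    have "AE x in lebesgue. x \<noteq> b"
      by (rule AE_completion) (rule AE_lborel_singleton)
    then show "AE x in lebesgue. \<not> (x \<in> {a..b} \<and> x \<in> {b..c})"
      by eventually_elim auto
  qed (use i in auto)
  moreover have "{a..b} \<union> {b..c} = {a..c}" using assms by auto
  ultimately show ?thesis by simp
qed

lemma LINT_point [simp]:
  fixes a :: real
  shows "(LINT x:{a..a}|lebesgue. f x) = (0::real)"
proof -
  have "AE x in lebesgue. x \<noteq> a"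
    by (rule AE_completion) (rule AE_lborel_singleton)
  then have "AE x in lebesgue. indicator {a..a} x *\<^sub>R f x = 0"
    by eventually_elim (auto simp: indicator_eq_0_iff)
  then show ?thesis
    unfolding set_lebesgue_integral_def by (rule integral_eq_zero_AE)
qed

lemma primD: "prim c d q P \<Longrightarrow> c \<le> x \<Longrightarrow> x \<le> d \<Longrightarrow> P x = P c + (LINT y:{c..x}|lebesgue. q y)"
  unfolding prim_def by (elim conjE) (erule bspec, simp)

lemma primI:
  assumes "set_integrable lebesgue {c..d} q"
    "\<And>x. c \<le> x \<Longrightarrow> x \<le> d \<Longrightarrow> P x = P c + (LINT y:{c..x}|lebesgue. q y)"
  shows "prim c d q P"
  unfolding prim_def
proof (intro conjI ballI)
  fix x assume "x \<in> {c..d}"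
  then show "P x = P c + (LINT y:{c..x}|lebesgue. q y)" by (intro assms(2)) simp_all
qed fact

lemma prim_integrable: "prim c d q P \<Longrightarrow> set_integrable lebesgue {c..d} q"
  by (simp add: prim_def)

lemma prim_diff:
  assumes "prim c d q P" "c \<le> x" "x \<le> y" "y \<le> d"
  shows "P y - P x = (LINT z:{x..y}|lebesgue. q z)"
proof -
  have "set_integrable lebesgue {c..y} q"
    using assms by (intro set_integrable_subset[OF prim_integrable[OF assms(1)]]) auto
  then show ?thesis
    using assms LINT_combine[of c y q x] primD[OF assms(1), of x] primD[OF assms(1), of y] by linarith
qed

lemma prim_subset:
  assumes "prim c d q P" "c \<le> c'" "d' \<le> d"
  shows "prim c' d' q P"
proof -
  have "set_integrable lebesgue {c'..d'} q"
    using assms by (intro set_integrable_subset[OF prim_integrable[OF assms(1)]]) auto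
  then show ?thesis
  proof (rule primI)
    fix x assume "c' \<le> x" "x \<le> d'"
    then show "P x = P c' + (LINT y:{c'..x}|lebesgue. q y)"
      using prim_diff[OF assms(1), of c' x] assms(2,3) by linarith
  qed
qed

lemma prim_continuous_on:
  assumes "prim c d q P"
  shows "continuous_on {c..d} P"
proof -
  have q: "set_integrable lebesgue {c..d} q" using prim_integrable[OF assms] .
  have "continuous_on {c..d} (\<lambda>x. P c + integral {c..x} q)"
    using set_lebesgue_integral_eq_integral(1)[OF q]
    by (intro continuous_intros indefinite_integral_continuous_1)
  moreover have "P c + integral {c..x} q = P x" if "x \<in> {c..d}" for x
  proof -
    have "set_integrable lebesgue {c..x} q"
      using that by (intro set_integrable_subset[OF q]) auto
    then show ?thesis
      using primD[OF assms, of x] that set_lebesgue_integral_eq_integral(2)[of "{c..x}" q] by simp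
  qed
  ultimately show ?thesis by (rule continuous_on_eq)
qed

lemma set_integrable_mult_continuous:
  fixes q P :: "real \<Rightarrow> real"
  assumes "set_integrable lebesgue {c..d} q" "continuous_on {c..d} P"
  shows "set_integrable lebesgue {c..d} (\<lambda>x. q x * P x)"
proof -
  have "(\<lambda>x. P x * q x) absolutely_integrable_on {c..d}"
  proof (rule absolutely_integrable_bounded_measurable_product_real)
    show "P \<in> borel_measurable (lebesgue_on {c..d})"
      using assms(2) by (rule continuous_imp_measurable_on_sets_lebesgue) simp
    show "bounded (P ` {c..d})"
      using assms(2) by (intro compact_imp_bounded compact_continuous_image) auto
  qed (use assms in auto)
  then show ?thesis by (simp add: mult.commute)
qed

text \<open>Fubini on the triangle, where the inner integrals are the increments R x - R c and P d -
  P y.\<close>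

lemma prim_by_parts:
  assumes P: "prim c d q P" and R: "prim c d r R" and cd: "c \<le> d"
  shows "(LINT x:{c..d}|lebesgue. q x * R x) = P d * R d - P c * R c - (LINT x:{c..d}|lebesgue. r x * P x)"
proof -
  let ?q = "\<lambda>x. indicat_real {c..d} x *\<^sub>R q x" and ?r = "\<lambda>x. indicat_real {c..d} x *\<^sub>R r x"
  note qi = prim_integrable[OF P] and ri = prim_integrable[OF R]
  note qR = set_integrable_mult_continuous[OF qi prim_continuous_on[OF R]]
  note rP = set_integrable_mult_continuous[OF ri prim_continuous_on[OF P]]
  have "(\<integral>x. ?q x * (LINT y:{..x}|lebesgue. ?r y) \<partial>lebesgue) = (\<integral>y. ?r y * (LINT x:{y..}|lebesgue. ?q x) \<partial>lebesgue)"
    by (rule Fubini_triangle) (use qi ri in \<open>auto simp: set_integrable_def\<close>)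
  also have "(\<lambda>x. ?q x * (LINT y:{..x}|lebesgue. ?r y)) = (\<lambda>x. indicat_real {c..d} x *\<^sub>R (q x * R x - R c * q x))"
  proof
    fix x
    have "(LINT y:{..x}|lebesgue. ?r y) = (LINT y:{c..x}|lebesgue. r y)" if "x \<in> {c..d}"
      unfolding set_lebesgue_integral_def by (rule Bochner_Integration.integral_cong) (use that in \<open>auto simp: indicator_def\<close>)
    then show "?q x * (LINT y:{..x}|lebesgue. ?r y) = indicat_real {c..d} x *\<^sub>R (q x * R x - R c * q x)"
      using prim_diff[OF R, of c x] by (auto simp: indicator_def algebra_simps)
  qed
  also have "(\<lambda>y. ?r y * (LINT x:{y..}|lebesgue. ?q x)) = (\<lambda>y. indicat_real {c..d} y *\<^sub>R (P d * r y - r y * P y))"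
  proof
    fix x
    have "(LINT y:{x..}|lebesgue. ?q y) = (LINT y:{x..d}|lebesgue. q y)" if "x \<in> {c..d}"
      unfolding set_lebesgue_integral_def by (rule Bochner_Integration.integral_cong) (use that in \<open>auto simp: indicator_def\<close>)
    then show "?r x * (LINT y:{x..}|lebesgue. ?q y) = indicat_real {c..d} x *\<^sub>R (P d * r x - r x * P x)"
      using prim_diff[OF P, of x d] by (auto simp: indicator_def algebra_simps)
  qed
  finally have "(LINT x:{c..d}|lebesgue. q x * R x - R c * q x) = (LINT x:{c..d}|lebesgue. P d * r x - r x * P x)"
    by (simp add: set_lebesgue_integral_def)
  then have "(LINT x:{c..d}|lebesgue. q x * R x) - R c * (LINT x:{c..d}|lebesgue. q x)
     = P d * (LINT x:{c..d}|lebesgue. r x) - (LINT x:{c..d}|lebesgue. r x * P x)"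
    using qR rP qi ri by (simp add: set_integral_diff(2))
  then show ?thesis
    using prim_diff[OF P, of c d] prim_diff[OF R, of c d] cd by (simp add: algebra_simps)
qed

lemma prim_smooth:
  assumes "\<And>x. (f has_real_derivative f' x) (at x)" "continuous_on UNIV f'"
  shows "prim c d f' f"
proof -
  have i: "set_integrable lebesgue {a..b} f'" for a b
    by (rule absolutely_integrable_continuous_real) (rule continuous_on_subset[OF assms(2)], simp)
  moreover have "f x = f c + (LINT y:{c..x}|lebesgue. f' y)" if "c \<le> x" "x \<le> d" for x
  proof -
    have "(f' has_integral f x - f c) {c..x}"
    proof (rule fundamental_theorem_of_calculus)
      show "(f has_vector_derivative f' y) (at y within {c..x})" for y
        using DERIV_subset[OF assms(1)] by (simp add: has_real_derivative_iff_has_vector_derivative[symmetric])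
    qed fact
    then show ?thesis
      using set_lebesgue_integral_eq_integral(2)[OF i] by (simp add: integral_unique)
  qed
  ultimately show ?thesis by (rule primI)
qed

lemma prim_test_function: "\<psi> \<in> test_functions l r \<Longrightarrow> prim c d (deriv \<psi>) \<psi>"
  by (intro prim_smooth test_function_DERIV test_function_continuous)

text \<open>\<open>g\<close> may fail to be integrable up to the ends of (l,r), so the primitive is
  anchored at the midpoint and carries a sign to its left.\<close>

lemma ex_prim:
  assumes g: "loc_int l r g" and lr: "l < r"
  obtains P where "\<And>c d. l < c \<Longrightarrow> d < r \<Longrightarrow> prim c d g P"
proof -
  define m where "m = (l + r) / 2"
  define P where "P x = (if m \<le> x then (LINT y:{m..x}|lebesgue. g y) else - (LINT y:{x..m}|lebesgue. g y))" for x
  have m: "l < m" "m < r" using lr by (auto simp: m_def)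
  have "P x = P c + (LINT y:{c..x}|lebesgue. g y)" if "l < c" "c \<le> x" "x < r" for c x
  proof -
    note i = loc_intD[OF g]
    consider "m \<le> c" | "c < m" "m \<le> x" | "x < m" using that by linarith
    then show ?thesis
    proof cases
      case 1
      then show ?thesis using LINT_combine[OF i, of m x c] that m by (simp add: P_def)
    next
      case 2
      then show ?thesis using LINT_combine[OF i, of c x m] that m by (simp add: P_def)
    next
      case 3
      then show ?thesis using LINT_combine[OF i, of c m x] that m by (simp add: P_def)
    qed
  qed
  note step = this
  show thesis
  proof (rule that, rule primI)
    fix c d assume "l < c" "d < r"
    then show "set_integrable lebesgue {c..d} g" by (rule loc_intD[OF g])
    show "P x = P c + (LINT y:{c..x}|lebesgue. g y)" if "c \<le> x" "x \<le> d" for x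
      by (rule step) (use that \<open>l < c\<close> \<open>d < r\<close> in linarith)+
  qed
qed

section \<open>Weak derivatives\<close>

lemma LINT_compact_support:
  fixes l r c d :: real
  assumes "l < c" "d < r" "\<And>x. x \<notin> {c..d} \<Longrightarrow> f x = 0"
  shows "(LINT x:{l<..<r}|lebesgue. f x) = (LINT x:{c..d}|lebesgue. f x :: real)"
    and "set_integrable lebesgue {l<..<r} f \<longleftrightarrow> set_integrable lebesgue {c..d} f"
proof -
  have "(\<lambda>x. indicat_real {l<..<r} x *\<^sub>R f x) = (\<lambda>x. indicator {c..d} x *\<^sub>R f x)"
  proof
    fix x
    show "indicat_real {l<..<r} x *\<^sub>R f x = indicator {c..d} x *\<^sub>R f x"
    proof (cases "x \<in> {c..d}")
      case True
      then have "x \<in> {l<..<r}" using assms(1,2) by auto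
      with True show ?thesis by (simp only: indicator_simps)
    qed (use assms(3) in simp)
  qed
  then show "(LINT x:{l<..<r}|lebesgue. f x) = (LINT x:{c..d}|lebesgue. f x)"
    "set_integrable lebesgue {l<..<r} f \<longleftrightarrow> set_integrable lebesgue {c..d} f"
    by (simp_all add: set_lebesgue_integral_def set_integrable_def)
qed

lemma test_function_deriv_support:
  assumes "\<psi> \<in> test_functions l r" "l < r"
  obtains c d where "l < c" "c < d" "d < r" "\<And>x. x \<notin> {c<..<d} \<Longrightarrow> \<psi> x = 0" "\<And>x. x \<notin> {c..d} \<Longrightarrow> deriv \<psi> x = 0"
proof -
  obtain c d where cd: "l < c" "c < d" "d < r" and 0: "\<And>x. x \<notin> {c<..<d} \<Longrightarrow> \<psi> x = 0"
    using test_function_support[OF assms] by blast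
  show thesis by (rule that[OF cd 0 deriv_eq_0_outside[OF 0]])
qed

lemma loc_int_mult_test:
  assumes "loc_int l r f" "\<psi> \<in> test_functions l r" "l < r"
  shows "set_integrable lebesgue {l<..<r} (\<lambda>x. f x * \<psi> x)"
    and "set_integrable lebesgue {l<..<r} (\<lambda>x. f x * deriv \<psi> x)"
proof -
  obtain c d where cd: "l < c" "c < d" "d < r" and 0: "\<And>x. x \<notin> {c<..<d} \<Longrightarrow> \<psi> x = 0" "\<And>x. x \<notin> {c..d} \<Longrightarrow> deriv \<psi> x = 0"
    using test_function_deriv_support[OF assms(2,3)] by blast
  have i: "set_integrable lebesgue {c..d} f" using loc_intD[OF assms(1)] cd by simp
  have "set_integrable lebesgue {c..d} (\<lambda>x. f x * \<psi> x)" "set_integrable lebesgue {c..d} (\<lambda>x. f x * deriv \<psi> x)"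
    by (intro set_integrable_mult_continuous i test_function_continuous[OF assms(2)])+
  moreover have "f x * \<psi> x = 0" "f x * deriv \<psi> x = 0" if "x \<notin> {c..d}" for x
    using 0(1)[of x] 0(2)[OF that] that by auto
  ultimately show "set_integrable lebesgue {l<..<r} (\<lambda>x. f x * \<psi> x)" "set_integrable lebesgue {l<..<r} (\<lambda>x. f x * deriv \<psi> x)"
    using LINT_compact_support(2)[OF cd(1,3)] by auto
qed

text \<open>Integration by parts on an interval that contains the support, where the test function
  vanishes at both ends.\<close>

lemma prim_weak_deriv:
  assumes "\<And>c d. l < c \<Longrightarrow> d < r \<Longrightarrow> prim c d g P" "\<psi> \<in> test_functions l r" "l < r"
  shows "(LINT x:{l<..<r}|lebesgue. P x * deriv \<psi> x) = - (LINT x:{l<..<r}|lebesgue. g x * \<psi> x)"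
proof -
  obtain c d where cd: "l < c" "c < d" "d < r" and 0: "\<And>x. x \<notin> {c<..<d} \<Longrightarrow> \<psi> x = 0" "\<And>x. x \<notin> {c..d} \<Longrightarrow> deriv \<psi> x = 0"
    using test_function_deriv_support[OF assms(2,3)] by blast
  have z: "P x * deriv \<psi> x = 0" "g x * \<psi> x = 0" if "x \<notin> {c..d}" for x
    using 0(1)[of x] 0(2)[OF that] that by auto
  have "(LINT x:{c..d}|lebesgue. g x * \<psi> x) = P d * \<psi> d - P c * \<psi> c - (LINT x:{c..d}|lebesgue. deriv \<psi> x * P x)"
    using cd by (intro prim_by_parts prim_test_function[OF assms(2)] assms(1)) auto
  then show ?thesis
    using 0(1)[of c] 0(1)[of d] LINT_compact_support(1)[OF cd(1,3), of "\<lambda>x. P x * deriv \<psi> x", OF z(1)]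
      LINT_compact_support(1)[OF cd(1,3), of "\<lambda>x. g x * \<psi> x", OF z(2)]
    by (simp add: mult.commute)
qed

section \<open>Functions with vanishing weak derivative\<close>

lemma test_function_add:
  "\<psi> \<in> test_functions l r \<Longrightarrow> \<eta> \<in> test_functions l r \<Longrightarrow> (\<lambda>x. \<psi> x + k * \<eta> x) \<in> test_functions l r"
proof -
  assume *: "\<psi> \<in> test_functions l r" "\<eta> \<in> test_functions l r"
  have "closure {x. \<psi> x + k * \<eta> x \<noteq> 0} \<subseteq> closure ({x. \<psi> x \<noteq> 0} \<union> {x. \<eta> x \<noteq> 0})"
    by (rule closure_mono) auto
  then show ?thesis
    using * by (auto simp: test_functions_iff smooth_iff_ndiff closure_Un intro!: ndiff_add ndiff_mult ndiff_const)
qed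

text \<open>The antiderivative taken from the left vanishes to the left of the support of \<eta>,
  and to its right because the total integral is 0; this keeps its support compact inside
  (l,r).\<close>

lemma test_function_antiderivative:
  assumes \<eta>: "\<eta> \<in> test_functions l r" and lr: "l < r" and zero: "(LINT x:{l<..<r}|lebesgue. \<eta> x) = 0"
  obtains \<Psi> where "\<Psi> \<in> test_functions l r" "\<And>x. deriv \<Psi> x = \<eta> x"
proof -
  obtain c d where cd: "l < c" "c < d" "d < r" and 0: "\<And>x. x \<notin> {c<..<d} \<Longrightarrow> \<eta> x = 0"
    using test_function_support[OF \<eta> lr] by blast
  note cont = test_function_continuous(1)[OF \<eta>]
  \<comment> \<open>Integration starts strictly to the left of the support, so every point from
    \<open>c\<close> on is interior to the interval of integration and has a two-sided derivative
    there.\<close>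
  define c' where "c' = (l + c) / 2"
  have c': "l < c'" "c' < c" using cd by (auto simp: c'_def)
  define \<Psi> where "\<Psi> x = integral {c'..x} \<eta>" for x
  have \<Psi>0: "\<Psi> x = 0" if "x \<le> c" for x
    unfolding \<Psi>_def by (rule integral_eq_0_iff[THEN iffD2] integral_unique has_integral_is_0)+ (use that 0 in auto)
  have \<Psi>d: "\<Psi> x = 0" if "x \<ge> d" for x
  proof -
    have i: "set_integrable lebesgue {c'..x} \<eta>"
      by (intro absolutely_integrable_continuous_real cont)
    have "\<Psi> x = (LINT x:{c'..x}|lebesgue. \<eta> x)"
      unfolding \<Psi>_def by (rule set_lebesgue_integral_eq_integral(2)[OF i, symmetric])
    also have "\<dots> = (LINT x:{l<..<r}|lebesgue. \<eta> x)"
      unfolding set_lebesgue_integral_def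
    proof (rule Bochner_Integration.integral_cong)
      fix y
      show "indicat_real {c'..x} y *\<^sub>R \<eta> y = indicator {l<..<r} y *\<^sub>R \<eta> y"
        using 0[of y] that cd c' by (cases "y \<in> {c<..<d}") simp_all
    qed simp
    finally show ?thesis using zero by simp
  qed
  have der: "(\<Psi> has_real_derivative \<eta> x) (at x)" for x
  proof (cases "x < c")
    case True
    have "\<forall>\<^sub>F y in nhds x. \<Psi> y = 0"
      by (rule eventually_mono[OF eventually_nhds_in_open[of "{..<c}" x]]) (use True \<Psi>0 in auto)
    moreover have "\<eta> x = 0" using 0 True by simp
    ultimately show ?thesis
      using DERIV_cong_ev[of x x \<Psi> "\<lambda>_. 0" 0 0] by simp
  next
    case False
    then have "(\<Psi> has_real_derivative \<eta> x) (at x within {c'..x+1})"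
      unfolding \<Psi>_def using c' by (intro integral_has_real_derivative cont) auto
    moreover have "at x within {c'..x+1} = at x"
      using False c' by (intro at_within_interior) auto
    ultimately show ?thesis by simp
  qed
  have "smooth \<Psi>"
    unfolding smooth_iff_ndiff by (intro allI ndiff_Suc_imp[OF ndiff_SucI[OF der test_function_ndiff[OF \<eta>]]])
  moreover have "closure {x. \<Psi> x \<noteq> 0} \<subseteq> {c..d}"
  proof (rule closure_support_subset)
    show "\<Psi> x = 0" if "x \<notin> {c..d}" for x
      using \<Psi>0[of x] \<Psi>d[of x] that by (cases "x \<le> c") simp_all
  qed
  ultimately have "\<Psi> \<in> test_functions l r" using cd by (auto simp: test_functions_iff)
  then show thesis by (rule that) (rule DERIV_imp_deriv[OF der])
qed

lemma bump_integral_pos: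
  assumes "l < c" "c < d" "d < r"
  shows "(LINT x:{l<..<r}|lebesgue. bump c d n x) > 0"
proof -
  have t: "bump c d n \<in> test_functions l r" using assms by (intro bump_test_function)
  have i: "set_integrable lebesgue {c..d} (bump c d n)"
    by (intro absolutely_integrable_continuous_real test_function_continuous[OF t])
  have i': "set_integrable lebesgue {l<..<r} (bump c d n)"
    using LINT_compact_support(2)[OF assms(1,3), of "bump c d n"] bump_eq_0[of _ c d n] i by force
  have "(LINT x:{l<..<r}|lebesgue. bump c d n x) \<noteq> 0"
  proof
    assume "(LINT x:{l<..<r}|lebesgue. bump c d n x) = 0"
    then have "{c<..<d} \<in> null_sets lebesgue"
    proof (intro null_if_pos_func_has_zero_int)
      show "integrable lebesgue (\<lambda>x. indicat_real {l<..<r} x *\<^sub>R bump c d n x)"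
        using i' by (simp only: set_integrable_def)
      show "AE x\<in>{c<..<d} in lebesgue. 0 < indicat_real {l<..<r} x *\<^sub>R bump c d n x"
        using assms bump_pos[of _ c d n] by (intro AE_I2) auto
      have "indicat_real {c<..<d} x *\<^sub>R indicat_real {l<..<r} x *\<^sub>R bump c d n x = indicat_real {l<..<r} x *\<^sub>R bump c d n x" for x
        using bump_eq_0[of x c d n] by (cases "x \<in> {c<..<d}") auto
      then show "(LINT x:{c<..<d}|lebesgue. indicat_real {l<..<r} x *\<^sub>R bump c d n x) = 0"
        using \<open>(LINT x:{l<..<r}|lebesgue. bump c d n x) = 0\<close>
        by (simp only: set_lebesgue_integral_def)
    qed simp
    then show False using assms by (simp add: null_sets_def)
  qed
  moreover have "(LINT x:{l<..<r}|lebesgue. bump c d n x) \<ge> 0"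
    unfolding set_lebesgue_integral_def by (rule integral_nonneg_AE) (auto simp: bump_bounds)
  ultimately show ?thesis by simp
qed

text \<open>A test function with integral 0 is the derivative of a test function. Subtracting from
  \<psi> the multiple of a fixed bump \<rho> with the same integral reduces to this case;
  \<open>C\<close> is the \<rho>-weighted mean of \<open>h\<close>, and \<open>h - C\<close> turns
  out orthogonal to all test functions.\<close>

lemma du_Bois_Reymond:
  assumes h: "loc_int l r h" and lr: "l < r"
    and zero: "\<And>\<psi>. \<psi> \<in> test_functions l r \<Longrightarrow> (LINT x:{l<..<r}|lebesgue. h x * deriv \<psi> x) = 0"
  obtains C where "AE x in lebesgue. x \<in> {l<..<r} \<longrightarrow> h x = C"
proof -
  define \<rho> where "\<rho> = bump ((2*l+r)/3) ((l+2*r)/3) 0"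
  have \<rho>: "\<rho> \<in> test_functions l r" unfolding \<rho>_def using lr by (intro bump_test_function) auto
  define A where "A = (LINT x:{l<..<r}|lebesgue. \<rho> x)"
  have A: "A > 0" unfolding A_def \<rho>_def using lr by (intro bump_integral_pos) auto
  define C where "C = (LINT x:{l<..<r}|lebesgue. h x * \<rho> x) / A"
  have one: "loc_int l r (\<lambda>x. K)" for K :: real
    unfolding loc_int_def by (auto intro!: absolutely_integrable_continuous_real)
  have hC: "loc_int l r (\<lambda>x. h x - C)"
    using h one unfolding loc_int_def by (auto intro: set_integral_diff(1))
  have "AE x in lebesgue. x \<in> {l<..<r} \<longrightarrow> h x - C = 0"
  proof (rule fundamental_lemma_variations[OF hC])
    fix \<psi> assume \<psi>: "\<psi> \<in> test_functions l r"
    define B where "B = (LINT x:{l<..<r}|lebesgue. \<psi> x)"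
    let ?\<eta> = "\<lambda>x. \<psi> x + (- B / A) * \<rho> x"
    have i: "set_integrable lebesgue {l<..<r} \<psi>" "set_integrable lebesgue {l<..<r} \<rho>"
      using loc_int_mult_test(1)[OF one[of 1] \<psi> lr] loc_int_mult_test(1)[OF one[of 1] \<rho> lr] by simp_all
    note ih = loc_int_mult_test(1)[OF h \<psi> lr] loc_int_mult_test(1)[OF h \<rho> lr]
    have "(LINT x:{l<..<r}|lebesgue. ?\<eta> x) = B + (- B / A) * A"
      unfolding A_def B_def
      by (subst set_integral_add(2)[OF i(1) set_integrable_mult_right[OF i(2)]]) (simp only: set_integral_mult_right)
    then have "(LINT x:{l<..<r}|lebesgue. ?\<eta> x) = 0" using A by simp
    then obtain \<Psi> where \<Psi>: "\<Psi> \<in> test_functions l r" "\<And>x. deriv \<Psi> x = ?\<eta> x"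
      using test_function_antiderivative[OF test_function_add[OF \<psi> \<rho>] lr] by blast
    have "0 = (LINT x:{l<..<r}|lebesgue. h x * ?\<eta> x)"
      using zero[OF \<Psi>(1)] \<Psi>(2) by simp
    also have "(\<lambda>x. h x * ?\<eta> x) = (\<lambda>x. h x * \<psi> x + (- B / A) * (h x * \<rho> x))"
      by (auto simp: algebra_simps)
    also have "(LINT x:{l<..<r}|lebesgue. h x * \<psi> x + (- B / A) * (h x * \<rho> x))
        = (LINT x:{l<..<r}|lebesgue. h x * \<psi> x) + (- B / A) * (LINT x:{l<..<r}|lebesgue. h x * \<rho> x)"
      by (subst set_integral_add(2)[OF ih(1) set_integrable_mult_right[OF ih(2)]]) (simp only: set_integral_mult_right)
    finally have "(LINT x:{l<..<r}|lebesgue. h x * \<psi> x) = C * B" by (simp add: C_def)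
    moreover have "(LINT x:{l<..<r}|lebesgue. (h x - C) * \<psi> x) = (LINT x:{l<..<r}|lebesgue. h x * \<psi> x) - C * B"
      unfolding B_def left_diff_distrib
      by (subst set_integral_diff(2)[OF ih(1) set_integrable_mult_right[OF i(1)]]) (simp only: set_integral_mult_right)
    ultimately show "(LINT x:{l<..<r}|lebesgue. (h x - C) * \<psi> x) = 0" by simp
  qed
  then show thesis by (intro that[of C]) simp
qed

text \<open>Any primitive of \<open>g\<close> also has the weak derivative \<open>g\<close>, so it
  differs from \<open>f\<close> by a function with weak derivative 0, that is by a constant, which
  is absorbed into the primitive.\<close>

lemma weak_deriv_prim:
  assumes f: "loc_int l r f" and g: "loc_int l r g" and lr: "l < r"
    and weak: "\<And>\<psi>. \<psi> \<in> test_functions l r \<Longrightarrow>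
       (LINT x:{l<..<r}|lebesgue. f x * deriv \<psi> x) = - (LINT x:{l<..<r}|lebesgue. g x * \<psi> x)"
  obtains P where "\<And>c d. l < c \<Longrightarrow> d < r \<Longrightarrow> prim c d g P" "AE x in lebesgue. x \<in> {l<..<r} \<longrightarrow> f x = P x"
proof -
  obtain W where W: "\<And>c d. l < c \<Longrightarrow> d < r \<Longrightarrow> prim c d g W" using ex_prim[OF g lr] by blast
  have Wi: "loc_int l r W"
    unfolding loc_int_def using prim_continuous_on[OF W] by (auto intro!: absolutely_integrable_continuous_real)
  then have "loc_int l r (\<lambda>x. f x - W x)"
    using f unfolding loc_int_def by (auto intro: set_integral_diff(1))
  moreover have "(LINT x:{l<..<r}|lebesgue. (f x - W x) * deriv \<psi> x) = 0" if \<psi>: "\<psi> \<in> test_functions l r" for \<psi>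
    using weak[OF \<psi>] prim_weak_deriv[OF W \<psi> lr]
      loc_int_mult_test(2)[OF f \<psi> lr] loc_int_mult_test(2)[OF Wi \<psi> lr]
    unfolding left_diff_distrib by (simp add: set_integral_diff(2))
  ultimately obtain C where C: "AE x in lebesgue. x \<in> {l<..<r} \<longrightarrow> f x - W x = C"
    using du_Bois_Reymond[OF _ lr] by blast
  show thesis
  proof (rule that)
    show "prim c d g (\<lambda>x. W x + C)" if "l < c" "d < r" for c d
    proof (rule primI[OF prim_integrable[OF W[OF that]]])
      fix x assume "c \<le> x" "x \<le> d"
      from primD[OF W[OF that] this] show "W x + C = W c + C + (LINT y:{c..x}|lebesgue. g y)" by linarith
    qed
    show "AE x in lebesgue. x \<in> {l<..<r} \<longrightarrow> f x = W x + C"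
      using C by eventually_elim auto
  qed
qed

section \<open>Seminormed function spaces\<close>

lemma quadratic_nonneg_imp_discriminant:
  fixes A B C :: real
  assumes "\<And>t. A - 2 * t * B + t\<^sup>2 * C \<ge> 0" "C \<ge> 0"
  shows "B\<^sup>2 \<le> A * C"
proof (cases "C = 0")
  case True
  have "B = 0"
  proof (rule ccontr)
    assume "B \<noteq> 0"
    \<comment> \<open>This choice of \<open>t\<close> makes the expression equal to -1.\<close>
    then show False using assms(1)[of "(A + 1) / (2 * B)"] True by (simp add: field_simps)
  qed
  then show ?thesis using True by simp
next
  case False
  then have "A - 2 * (B / C) * B + (B / C)\<^sup>2 * C = A - B\<^sup>2 / C"
    by (simp add: power2_eq_square field_simps)
  with assms(1)[of "B / C"] have "B\<^sup>2 / C \<le> A" by simp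
  then show ?thesis using False assms(2) by (simp add: field_simps)
qed

text \<open>The form is only semidefinite, as the elements are functions rather than classes.
  Linearity is restricted to \<open>V\<close>, since integrals of sums split only for integrable
  functions; symmetry and nonnegativity are available for all functions.\<close>

locale semi_inner =
  fixes V :: "(real \<Rightarrow> real) set" and ip :: "(real \<Rightarrow> real) \<Rightarrow> (real \<Rightarrow> real) \<Rightarrow> real"
  assumes zero_in: "(\<lambda>x. 0) \<in> V"
    and add_in: "u \<in> V \<Longrightarrow> v \<in> V \<Longrightarrow> (\<lambda>x. u x + v x) \<in> V"
    and scale_in: "u \<in> V \<Longrightarrow> (\<lambda>x. c * u x) \<in> V"
    and ip_add: "u \<in> V \<Longrightarrow> v \<in> V \<Longrightarrow> w \<in> V \<Longrightarrow> ip (\<lambda>x. u x + v x) w = ip u w + ip v w"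
    and ip_scale: "u \<in> V \<Longrightarrow> w \<in> V \<Longrightarrow> ip (\<lambda>x. c * u x) w = c * ip u w"
    and ip_sym: "ip u v = ip v u"
    and ip_nonneg: "ip u u \<ge> 0"
begin

definition nrm :: "(real \<Rightarrow> real) \<Rightarrow> real" where
  "nrm u = sqrt (ip u u)"

lemma nrm_nonneg [simp]: "nrm u \<ge> 0"
  by (simp add: nrm_def ip_nonneg)

lemma nrm_square: "(nrm u)\<^sup>2 = ip u u"
  by (simp add: nrm_def ip_nonneg)

lemma minus_in: "u \<in> V \<Longrightarrow> (\<lambda>x. - u x) \<in> V"
  using scale_in[of u "-1"] by simp

lemma diff_in: "u \<in> V \<Longrightarrow> v \<in> V \<Longrightarrow> (\<lambda>x. u x - v x) \<in> V"
  using add_in[of u "\<lambda>x. - v x"] minus_in[of v] by simp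

lemma ip_zero: "w \<in> V \<Longrightarrow> ip (\<lambda>x. 0) w = 0"
  using ip_scale[OF zero_in, of w 0] by simp

lemma ip_minus: "u \<in> V \<Longrightarrow> w \<in> V \<Longrightarrow> ip (\<lambda>x. - u x) w = - ip u w"
  using ip_scale[of u w "-1"] by simp

lemma ip_diff: "u \<in> V \<Longrightarrow> v \<in> V \<Longrightarrow> w \<in> V \<Longrightarrow> ip (\<lambda>x. u x - v x) w = ip u w - ip v w"
  using ip_add[of u "\<lambda>x. - v x" w] ip_minus[of v w] minus_in[of v] by simp

lemma ip_diff_right: "u \<in> V \<Longrightarrow> v \<in> V \<Longrightarrow> w \<in> V \<Longrightarrow> ip w (\<lambda>x. u x - v x) = ip w u - ip w v"
  by (subst (1 2 3) ip_sym) (rule ip_diff)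

lemma ip_scale_right: "u \<in> V \<Longrightarrow> w \<in> V \<Longrightarrow> ip w (\<lambda>x. c * u x) = c * ip w u"
  by (subst (1 2) ip_sym) (rule ip_scale)

lemma sum_in: "finite I \<Longrightarrow> (\<And>i. i \<in> I \<Longrightarrow> f i \<in> V) \<Longrightarrow> (\<lambda>x. \<Sum>i\<in>I. c i * f i x) \<in> V"
  by (induction I rule: finite_induct) (auto intro!: add_in zero_in scale_in)

lemma ip_sum:
  assumes "finite I" "\<And>i. i \<in> I \<Longrightarrow> f i \<in> V" "w \<in> V"
  shows "ip (\<lambda>x. \<Sum>i\<in>I. c i * f i x) w = (\<Sum>i\<in>I. c i * ip (f i) w)"
  using assms
proof (induction I rule: finite_induct)
  case (insert i I)
  then show ?case
    using ip_add[of "\<lambda>x. c i * f i x" "\<lambda>x. \<Sum>i\<in>I. c i * f i x" w] ip_scale[of "f i" w "c i"]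
      sum_in[of I f c] scale_in[of "f i" "c i"] by simp
qed (simp add: ip_zero)

lemma ip_expand:
  assumes u: "u \<in> V" and v: "v \<in> V"
  shows "ip (\<lambda>x. u x - t * v x) (\<lambda>x. u x - t * v x) = ip u u - 2 * t * ip u v + t\<^sup>2 * ip v v"
proof -
  note tv = scale_in[OF v, of t]
  show ?thesis
    using ip_sym[of v u]
    by (simp add: ip_diff ip_diff_right ip_scale ip_scale_right diff_in[OF u tv] u v tv
        power2_eq_square algebra_simps)
qed

lemma Cauchy_Schwarz_square: "u \<in> V \<Longrightarrow> v \<in> V \<Longrightarrow> (ip u v)\<^sup>2 \<le> ip u u * ip v v"
  using ip_nonneg[of "\<lambda>x. u x - _ * v x"] ip_nonneg[of v]
  by (intro quadratic_nonneg_imp_discriminant) (simp_all add: ip_expand[symmetric] ip_nonneg)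

lemma Cauchy_Schwarz: "u \<in> V \<Longrightarrow> v \<in> V \<Longrightarrow> \<bar>ip u v\<bar> \<le> nrm u * nrm v"
  using real_sqrt_le_mono[OF Cauchy_Schwarz_square, of u v]
  by (simp add: nrm_def real_sqrt_mult)

lemma nrm_scale: "u \<in> V \<Longrightarrow> nrm (\<lambda>x. c * u x) = \<bar>c\<bar> * nrm u"
  by (simp add: nrm_def ip_scale ip_scale_right scale_in real_sqrt_mult mult.assoc[symmetric])

lemma nrm_triangle:
  assumes u: "u \<in> V" and v: "v \<in> V"
  shows "nrm (\<lambda>x. u x + v x) \<le> nrm u + nrm v"
proof (rule power2_le_imp_le)
  have "(nrm (\<lambda>x. u x + v x))\<^sup>2 = ip u u + 2 * ip u v + ip v v"
    using ip_expand[OF u v, of "-1"] by (simp add: nrm_square)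
  also have "\<dots> \<le> (nrm u)\<^sup>2 + 2 * (nrm u * nrm v) + (nrm v)\<^sup>2"
    using Cauchy_Schwarz[OF u v] by (simp add: nrm_square)
  finally show "(nrm (\<lambda>x. u x + v x))\<^sup>2 \<le> (nrm u + nrm v)\<^sup>2"
    by (simp add: power2_sum)
qed simp

lemma nrm_minus_commute:
  assumes u: "u \<in> V" and v: "v \<in> V"
  shows "nrm (\<lambda>x. u x - v x) = nrm (\<lambda>x. v x - u x)"
  using nrm_scale[OF diff_in[OF u v], of "-1"] by (simp add: algebra_simps)

lemma nrm_diff_triangle:
  assumes u: "u \<in> V" and v: "v \<in> V" and w: "w \<in> V"
  shows "nrm (\<lambda>x. u x - w x) \<le> nrm (\<lambda>x. u x - v x) + nrm (\<lambda>x. v x - w x)"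
  using nrm_triangle[OF diff_in[OF u v] diff_in[OF v w]] by simp

lemma nrm_le_diff:
  assumes u: "u \<in> V" and v: "v \<in> V"
  shows "nrm u \<le> nrm v + nrm (\<lambda>x. u x - v x)"
  using nrm_triangle[OF v diff_in[OF u v]] by simp

text \<open>This replaces the passage to classes: elements at distance 0 cannot be told apart by the
  form, so \<open>m t\<close> may be exchanged for the value of its continuous representative inside
  inner products.\<close>

lemma ip_cong_nrm:
  assumes u: "u \<in> V" and v: "v \<in> V" and w: "w \<in> V" and 0: "nrm (\<lambda>x. u x - v x) = 0"
  shows "ip u w = ip v w"
  using Cauchy_Schwarz[OF diff_in[OF u v] w] 0 by (simp add: ip_diff[OF u v w])

lemma ip_tendsto:
  assumes s: "\<And>n. s n \<in> V" and u: "u \<in> V" and y: "y \<in> V"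
    and lim: "((\<lambda>n. nrm (\<lambda>x. u x - s n x)) \<longlongrightarrow> 0) F"
  shows "((\<lambda>n. ip (s n) y) \<longlongrightarrow> ip u y) F"
proof (rule LIM_zero_cancel, rule tendsto_rabs_zero_cancel)
  have *: "\<bar>ip (s n) y - ip u y\<bar> \<le> nrm (\<lambda>x. u x - s n x) * nrm y" for n
    using Cauchy_Schwarz[OF diff_in[OF s u, of n] y] nrm_minus_commute[OF s u] by (simp add: ip_diff s u y)
  show "((\<lambda>n. \<bar>ip (s n) y - ip u y\<bar>) \<longlongrightarrow> 0) F"
    by (rule tendsto_sandwich[OF _ _ tendsto_const tendsto_mult_left_zero[OF lim]])
       (use * in \<open>auto intro: always_eventually\<close>)
qed

lemma ip_tendsto2:
  assumes s: "\<And>n. s n \<in> V" and u: "u \<in> V" and r: "\<And>n. r n \<in> V" and v: "v \<in> V"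
    and lims: "((\<lambda>n. nrm (\<lambda>x. u x - s n x)) \<longlongrightarrow> 0) F"
    and limr: "((\<lambda>n. nrm (\<lambda>x. v x - r n x)) \<longlongrightarrow> 0) F"
  shows "((\<lambda>n. ip (s n) (r n)) \<longlongrightarrow> ip u v) F"
proof (rule LIM_zero_cancel, rule tendsto_rabs_zero_cancel)
  let ?s = "\<lambda>n. nrm (\<lambda>x. u x - s n x)" and ?r = "\<lambda>n. nrm (\<lambda>x. v x - r n x)"
  have *: "\<bar>ip (s n) (r n) - ip u v\<bar> \<le> ?s n * (nrm v + ?r n) + nrm u * ?r n" for n
  proof -
    have "\<bar>ip (s n) (r n) - ip u v\<bar> = \<bar>ip (\<lambda>x. s n x - u x) (r n) + ip u (\<lambda>x. r n x - v x)\<bar>"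
      by (simp add: ip_diff ip_diff_right s u r v)
    also have "\<dots> \<le> ?s n * nrm (r n) + nrm u * ?r n"
      using Cauchy_Schwarz[OF diff_in[OF s u, of n] r, of n] Cauchy_Schwarz[OF u diff_in[OF r v, of n]]
        abs_triangle_ineq[of "ip (\<lambda>x. s n x - u x) (r n)" "ip u (\<lambda>x. r n x - v x)"]
      unfolding nrm_minus_commute[OF s[of n] u] nrm_minus_commute[OF r[of n] v] by linarith
    also have "\<dots> \<le> ?s n * (nrm v + ?r n) + nrm u * ?r n"
    proof -
      have "nrm (r n) \<le> nrm v + ?r n"
        using nrm_le_diff[OF r[of n] v] nrm_minus_commute[OF r[of n] v] by linarith
      then show ?thesis by (rule add_right_mono[OF mult_left_mono[OF _ nrm_nonneg]])
    qed
    finally show ?thesis .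
  qed
  have "((\<lambda>n. ?s n * (nrm v + ?r n) + nrm u * ?r n) \<longlongrightarrow> 0 * (nrm v + 0) + nrm u * 0) F"
    by (intro tendsto_intros lims limr)
  then have lim: "((\<lambda>n. ?s n * (nrm v + ?r n) + nrm u * ?r n) \<longlongrightarrow> 0) F" by simp
  show "((\<lambda>n. \<bar>ip (s n) (r n) - ip u v\<bar>) \<longlongrightarrow> 0) F"
    by (rule tendsto_sandwich[OF _ _ tendsto_const lim]) (use * in \<open>auto intro: always_eventually\<close>)
qed

end

locale semi_hilbert = semi_inner +
  assumes complete: "(\<And>n. f n \<in> V) \<Longrightarrow>
      (\<And>e. e > 0 \<Longrightarrow> \<exists>k. \<forall>i\<ge>k. \<forall>j\<ge>k. sqrt (ip (\<lambda>x. f i x - f j x) (\<lambda>x. f i x - f j x)) < e) \<Longrightarrow>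
      \<exists>L\<in>V. (\<lambda>n. sqrt (ip (\<lambda>x. f (n::nat) x - L x) (\<lambda>x. f n x - L x))) \<longlonglongrightarrow> 0"
begin

lemma complete_nrm:
  assumes "\<And>n. f n \<in> V" "\<And>e. e > 0 \<Longrightarrow> \<exists>k. \<forall>i\<ge>k. \<forall>j\<ge>k. nrm (\<lambda>x. f i x - f j x) < e"
  obtains L where "L \<in> V" "(\<lambda>n. nrm (\<lambda>x. f n x - L x)) \<longlonglongrightarrow> 0"
  using complete[of f] assms unfolding nrm_def by blast

end

section \<open>Weighted square integrable functions\<close>

text \<open>The weight \<open>a\<close> on (0,1) gives \<open>L2a a\<close> and the weight 1 gives
  L^2(0,1), so linearity, Cauchy-Schwarz and completeness are proved once for both.\<close>

definition wL2 :: "real measure \<Rightarrow> (real \<Rightarrow> real) \<Rightarrow> (real \<Rightarrow> real) set" where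
  "wL2 M w = {u \<in> borel_measurable M. integrable M (\<lambda>x. w x * (u x)\<^sup>2)}"

definition wip :: "real measure \<Rightarrow> (real \<Rightarrow> real) \<Rightarrow> (real \<Rightarrow> real) \<Rightarrow> (real \<Rightarrow> real) \<Rightarrow> real" where
  "wip M w u v = (\<integral>x. w x * (u x * v x) \<partial>M)"

lemma wL2_integrable_mult:
  assumes u: "u \<in> wL2 M w" and v: "v \<in> wL2 M w"
    and w: "w \<in> borel_measurable M" "\<And>x. x \<in> space M \<Longrightarrow> w x > 0"
  shows "integrable M (\<lambda>x. w x * (u x * v x))"
proof (rule Bochner_Integration.integrable_bound)
  have [measurable]: "u \<in> borel_measurable M" "v \<in> borel_measurable M" using u v by (auto simp: wL2_def)
  note [measurable] = w(1)
  show "integrable M (\<lambda>x. w x * (u x)\<^sup>2 + w x * (v x)\<^sup>2)" using u v by (auto simp: wL2_def)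
  show "(\<lambda>x. w x * (u x * v x)) \<in> borel_measurable M" by measurable
  show "AE x in M. norm (w x * (u x * v x)) \<le> norm (w x * (u x)\<^sup>2 + w x * (v x)\<^sup>2)"
  proof (rule AE_I2)
    fix x assume "x \<in> space M"
    then have w0: "w x > 0" by (rule w(2))
    have "2 * \<bar>u x * v x\<bar> \<le> (u x)\<^sup>2 + (v x)\<^sup>2"
      using sum_squares_bound[of "\<bar>u x\<bar>" "\<bar>v x\<bar>"] by (simp add: abs_mult)
    then have "\<bar>u x * v x\<bar> \<le> (u x)\<^sup>2 + (v x)\<^sup>2" by (smt (verit) abs_ge_zero)
    then have "w x * \<bar>u x * v x\<bar> \<le> w x * ((u x)\<^sup>2 + (v x)\<^sup>2)"
      using w0 by (intro mult_left_mono) auto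
    then show "norm (w x * (u x * v x)) \<le> norm (w x * (u x)\<^sup>2 + w x * (v x)\<^sup>2)"
      using w0 by (simp add: abs_mult distrib_left)
  qed
qed

lemma semi_inner_wL2:
  assumes w: "w \<in> borel_measurable M" "\<And>x. x \<in> space M \<Longrightarrow> w x > 0"
  shows "semi_inner (wL2 M w) (wip M w)"
proof
  note [measurable] = w(1)
  note mult = wL2_integrable_mult[OF _ _ w]
  show "(\<lambda>x. 0) \<in> wL2 M w" by (simp add: wL2_def)
  show "(\<lambda>x. u x + v x) \<in> wL2 M w" if u: "u \<in> wL2 M w" and v: "v \<in> wL2 M w" for u v
  proof -
    have [measurable]: "u \<in> borel_measurable M" "v \<in> borel_measurable M" using u v by (auto simp: wL2_def)
    have "integrable M (\<lambda>x. w x * (u x * u x) + 2 * (w x * (u x * v x)) + w x * (v x * v x))"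
      using mult[OF u u] mult[OF u v] mult[OF v v] by simp
    then show ?thesis
      by (simp add: wL2_def power2_eq_square algebra_simps)
  qed
  show "(\<lambda>x. c * u x) \<in> wL2 M w" if u: "u \<in> wL2 M w" for u c
  proof -
    have [measurable]: "u \<in> borel_measurable M" using u by (auto simp: wL2_def)
    have "integrable M (\<lambda>x. c\<^sup>2 * (w x * (u x * u x)))"
      using mult[OF u u] by simp
    then show ?thesis
      by (simp add: wL2_def power2_eq_square algebra_simps)
  qed
  show "wip M w (\<lambda>x. u x + v x) z = wip M w u z + wip M w v z"
    if "u \<in> wL2 M w" "v \<in> wL2 M w" "z \<in> wL2 M w" for u v z
    using mult[OF that(1,3)] mult[OF that(2,3)]
    by (simp add: wip_def distrib_right distrib_left)
  show "wip M w (\<lambda>x. c * u x) z = c * wip M w u z" for u z c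
    unfolding wip_def by (simp add: mult.assoc mult.left_commute flip: Bochner_Integration.integral_mult_right_zero)
  show "wip M w u v = wip M w v u" for u v by (simp add: wip_def mult.commute)
  show "wip M w u u \<ge> 0" for u
    unfolding wip_def by (rule integral_nonneg_AE) (use less_imp_le[OF w(2)] in \<open>auto intro!: AE_I2 mult_nonneg_nonneg\<close>)
qed

text \<open>Riesz-Fischer. As the weight is integrable, the constant 1 belongs to the space, and
  Cauchy-Schwarz against it makes \<open>w * f n\<close> Cauchy in L^1. A subsequence converges
  almost everywhere, division by the positive weight gives the limit, and Fatou shows convergence of
  the whole sequence in norm.\<close>

lemma semi_hilbert_wL2:
  assumes w: "w \<in> borel_measurable M" "\<And>x. x \<in> space M \<Longrightarrow> w x > 0" and wi: "integrable M w"
  shows "semi_hilbert (wL2 M w) (wip M w)"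
proof -
  interpret semi_inner "wL2 M w" "wip M w" by (rule semi_inner_wL2[OF w])
  note [measurable] = w(1)
  note mult = wL2_integrable_mult[OF _ _ w]
  have one: "(\<lambda>x. 1) \<in> wL2 M w" using wi by (simp add: wL2_def)
  show ?thesis
  proof
    fix f :: "nat \<Rightarrow> real \<Rightarrow> real"
    assume f: "\<And>n. f n \<in> wL2 M w"
      and "\<And>e. e > 0 \<Longrightarrow> \<exists>k. \<forall>i\<ge>k. \<forall>j\<ge>k. sqrt (wip M w (\<lambda>x. f i x - f j x) (\<lambda>x. f i x - f j x)) < e"
    then have Cau: "\<exists>k. \<forall>i\<ge>k. \<forall>j\<ge>k. nrm (\<lambda>x. f i x - f j x) < e" if "e > 0" for e
      using that by (simp add: nrm_def)
    have [measurable]: "f n \<in> borel_measurable M" for n using f by (auto simp: wL2_def)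
    have L1: "(\<integral>x. norm (w x * f i x - w x * f j x) \<partial>M) \<le> nrm (\<lambda>x. f i x - f j x) * nrm (\<lambda>x. 1)" for i j
    proof -
      let ?d = "\<lambda>x. \<bar>f i x - f j x\<bar>"
      have d: "?d \<in> wL2 M w" using diff_in[OF f[of i] f[of j]] by (auto simp: wL2_def)
      have "(\<integral>x. norm (w x * f i x - w x * f j x) \<partial>M) = wip M w ?d (\<lambda>x. 1)"
        unfolding wip_def
        by (rule Bochner_Integration.integral_cong) (use less_imp_le[OF w(2)] in \<open>auto simp: abs_mult right_diff_distrib[symmetric]\<close>)
      also have "\<dots> \<le> nrm ?d * nrm (\<lambda>x. 1)" using Cauchy_Schwarz[OF d one] by simp
      also have "nrm ?d = nrm (\<lambda>x. f i x - f j x)" by (simp add: nrm_def wip_def)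
      finally show ?thesis .
    qed
    obtain r where r: "strict_mono r" "AE x in M. Cauchy (\<lambda>i. w x * f (r i) x)"
    proof (rule cauchy_L1_AE_cauchy_subseq[of M "\<lambda>n x. w x * f n x"])
      show "integrable M (\<lambda>x. w x * f n x)" for n
        using mult[OF f one] by simp
      fix e :: real assume e: "e > 0"
      have "e / (nrm (\<lambda>x. 1) + 1) > 0" using e by (intro divide_pos_pos) (auto simp: add_nonneg_pos)
      then obtain k where k: "\<And>i j. i \<ge> k \<Longrightarrow> j \<ge> k \<Longrightarrow> nrm (\<lambda>x. f i x - f j x) < e / (nrm (\<lambda>x. 1) + 1)"
        using Cau by blast
      show "\<exists>N. \<forall>i\<ge>N. \<forall>j\<ge>N. (\<integral>x. norm (w x * f i x - w x * f j x) \<partial>M) < e"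
      proof (intro exI allI impI)
        fix i j assume "i \<ge> k" "j \<ge> k"
        have p: "nrm (\<lambda>x. 1) + 1 > 0" by (simp add: add_nonneg_pos)
        have "nrm (\<lambda>x. f i x - f j x) * nrm (\<lambda>x. 1) \<le> nrm (\<lambda>x. f i x - f j x) * (nrm (\<lambda>x. 1) + 1)"
          by (intro mult_left_mono) auto
        also have "\<dots> < e"
          using k[OF \<open>i \<ge> k\<close> \<open>j \<ge> k\<close>] p by (simp add: pos_less_divide_eq)
        finally show "(\<integral>x. norm (w x * f i x - w x * f j x) \<partial>M) < e"
          using L1[of i j] by simp
      qed
    qed
    define L where "L x = lim (\<lambda>i. f (r i) x)" for x
    have [measurable]: "L \<in> borel_measurable M" unfolding L_def by measurable
    have lim: "AE x in M. (\<lambda>i. f (r i) x) \<longlonglongrightarrow> L x"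
      using r(2) AE_space
    proof eventually_elim
      case (elim x)
      then have "convergent (\<lambda>i. w x * f (r i) x)" by (simp add: Cauchy_convergent_iff)
      then obtain l where "(\<lambda>i. w x * f (r i) x) \<longlonglongrightarrow> l" by (auto simp: convergent_def)
      then have "(\<lambda>i. w x * f (r i) x / w x) \<longlonglongrightarrow> l / w x"
        using w(2)[OF elim(2)] by (intro tendsto_intros) auto
      then have "(\<lambda>i. f (r i) x) \<longlonglongrightarrow> l / w x" using w(2)[OF elim(2)] by simp
      then show ?case unfolding L_def by (simp add: limI)
    qed
    \<comment> \<open>Only the subsequence \<open>r\<close> converges pointwise. Since
      \<open>r i \<ge> i\<close>, its members are late enough for the Cauchy bound, and Fatou
      carries the bound on \<open>f n - f (r i)\<close> over to \<open>f n - L\<close>.\<close>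
    have fatou: "(\<integral>\<^sup>+x. ennreal (w x * (f n x - L x)\<^sup>2) \<partial>M) \<le> ennreal (e\<^sup>2)"
      if n: "\<And>j. j \<ge> n \<Longrightarrow> nrm (\<lambda>x. f n x - f j x) < e" for n e
    proof -
      have "(\<integral>\<^sup>+x. ennreal (w x * (f n x - L x)\<^sup>2) \<partial>M)
         = (\<integral>\<^sup>+x. liminf (\<lambda>i. ennreal (w x * (f n x - f (r i) x)\<^sup>2)) \<partial>M)"
      proof (rule nn_integral_cong_AE)
        show "AE x in M. ennreal (w x * (f n x - L x)\<^sup>2) = liminf (\<lambda>i. ennreal (w x * (f n x - f (r i) x)\<^sup>2))"
          using lim
        proof eventually_elim
          case (elim x)
          then have "(\<lambda>i. ennreal (w x * (f n x - f (r i) x)\<^sup>2)) \<longlonglongrightarrow> ennreal (w x * (f n x - L x)\<^sup>2)"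
            by (intro tendsto_intros tendsto_ennrealI)
          then show ?case by (intro lim_imp_Liminf[symmetric]) auto
        qed
      qed
      also have "\<dots> \<le> liminf (\<lambda>i. \<integral>\<^sup>+x. ennreal (w x * (f n x - f (r i) x)\<^sup>2) \<partial>M)"
        by (rule nn_integral_liminf) measurable
      also have "\<dots> \<le> liminf (\<lambda>i::nat. ennreal (e\<^sup>2))"
      proof (rule Liminf_mono)
        show "\<forall>\<^sub>F i in sequentially. (\<integral>\<^sup>+x. ennreal (w x * (f n x - f (r i) x)\<^sup>2) \<partial>M) \<le> ennreal (e\<^sup>2)"
          using eventually_ge_at_top[of n]
        proof eventually_elim
          case (elim i)
          have ri: "r i \<ge> n" using elim strict_mono_imp_increasing[OF r(1), of i] by linarith
          have "(\<integral>\<^sup>+x. ennreal (w x * (f n x - f (r i) x)\<^sup>2) \<partial>M) = ennreal (\<integral>x. w x * (f n x - f (r i) x)\<^sup>2 \<partial>M)"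
            by (rule nn_integral_eq_integral)
               (use diff_in[OF f[of n] f[of "r i"]] less_imp_le[OF w(2)] in \<open>auto simp: wL2_def intro!: AE_I2 mult_nonneg_nonneg\<close>)
          also have "(\<integral>x. w x * (f n x - f (r i) x)\<^sup>2 \<partial>M) = (nrm (\<lambda>x. f n x - f (r i) x))\<^sup>2"
            unfolding nrm_square wip_def by (simp add: power2_eq_square)
          also have "\<dots> \<le> e\<^sup>2" using n[OF ri] by (intro power_mono) auto
          finally show ?case by (simp add: ennreal_leI)
        qed
      qed
      also have "\<dots> = ennreal (e\<^sup>2)" by (simp add: Liminf_const)
      finally show ?thesis .
    qed
    have conv: "(\<lambda>x. f n x - L x) \<in> wL2 M w \<and> nrm (\<lambda>x. f n x - L x) \<le> e"
      if n: "\<And>j. j \<ge> n \<Longrightarrow> nrm (\<lambda>x. f n x - f j x) < e" and e: "e > 0" for n e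
    proof -
      have pos: "AE x in M. 0 \<le> w x * (f n x - L x)\<^sup>2"
        using less_imp_le[OF w(2)] by (auto intro!: AE_I2 mult_nonneg_nonneg)
      have fin: "(\<integral>\<^sup>+x. ennreal (w x * (f n x - L x)\<^sup>2) \<partial>M) < \<infinity>"
        using le_less_trans[OF fatou[OF n] ennreal_less_top] by simp
      have i: "integrable M (\<lambda>x. w x * (f n x - L x)\<^sup>2)"
        by (rule integrableI_nonneg[OF _ pos fin]) measurable
      have "ennreal (\<integral>x. w x * (f n x - L x)\<^sup>2 \<partial>M) \<le> ennreal (e\<^sup>2)"
        using fatou[OF n] nn_integral_eq_integral[OF i pos] by simp
      then have "(\<integral>x. w x * (f n x - L x)\<^sup>2 \<partial>M) \<le> e\<^sup>2" by (simp add: ennreal_le_iff)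
      then have "(nrm (\<lambda>x. f n x - L x))\<^sup>2 \<le> e\<^sup>2"
        unfolding nrm_square wip_def by (simp only: power2_eq_square)
      then have "nrm (\<lambda>x. f n x - L x) \<le> e" using e by (rule power2_le_imp_le[OF _ less_imp_le])
      then show ?thesis using i by (auto simp: wL2_def)
    qed
    have LV: "L \<in> wL2 M w"
    proof -
      obtain k where "\<forall>i\<ge>k. \<forall>j\<ge>k. nrm (\<lambda>x. f i x - f j x) < 1" using Cau[of 1] by auto
      then have "(\<lambda>x. f k x - L x) \<in> wL2 M w" using conv[of k 1] by simp
      from diff_in[OF f[of k] this] show ?thesis by simp
    qed
    have "(\<lambda>n. nrm (\<lambda>x. f n x - L x)) \<longlonglongrightarrow> 0"
    proof (rule LIMSEQ_I)
      fix e :: real assume e: "e > 0"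
      then obtain k where k: "\<And>i j. i \<ge> k \<Longrightarrow> j \<ge> k \<Longrightarrow> nrm (\<lambda>x. f i x - f j x) < e/2" using Cau[of "e/2"] by auto
      show "\<exists>no. \<forall>n\<ge>no. norm (nrm (\<lambda>x. f n x - L x) - 0) < e"
      proof (intro exI allI impI)
        fix n assume n: "n \<ge> k"
        have "nrm (\<lambda>x. f n x - L x) \<le> e / 2"
          using conv[of n "e/2"] k[OF n] n e by simp
        then show "norm (nrm (\<lambda>x. f n x - L x) - 0) < e" using e by simp
      qed
    qed
    with LV show "\<exists>L\<in>wL2 M w. (\<lambda>n. sqrt (wip M w (\<lambda>x. f n x - L x) (\<lambda>x. f n x - L x))) \<longlonglongrightarrow> 0"
      by (auto simp: nrm_def)
  qed
qed

section \<open>Functions of time with values in a seminormed space\<close>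

lemma borel_measurable_AE_on:
  fixes f g :: "real \<Rightarrow> real"
  assumes f: "f \<in> borel_measurable (lebesgue_on S)" and S: "S \<in> sets lebesgue"
    and ae: "AE x in lebesgue_on S. f x = g x"
  shows "g \<in> borel_measurable (lebesgue_on S)"
proof -
  have "(\<lambda>x. indicator S x *\<^sub>R f x) \<in> borel_measurable lebesgue"
    using f S by (simp add: borel_measurable_restrict_space_iff)
  moreover have "AE x in lebesgue. indicator S x *\<^sub>R f x = indicator S x *\<^sub>R g x"
    using ae S by (simp add: AE_restrict_space_iff) (auto elim!: eventually_mono simp: indicator_def)
  ultimately have "(\<lambda>x. indicator S x *\<^sub>R g x) \<in> borel_measurable lebesgue"
    by (rule borel_measurable_AE)
  then show ?thesis using S by (simp add: borel_measurable_restrict_space_iff)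
qed

lemma borel_measurable_AE_limit:
  fixes f :: "nat \<Rightarrow> real \<Rightarrow> real"
  assumes [measurable]: "\<And>n. f n \<in> borel_measurable (lebesgue_on S)" and S: "S \<in> sets lebesgue"
    and ae: "AE x in lebesgue_on S. (\<lambda>n. f n x) \<longlonglongrightarrow> g x"
  shows "g \<in> borel_measurable (lebesgue_on S)"
proof (rule borel_measurable_AE_on[OF _ S])
  show "(\<lambda>x. lim (\<lambda>n. f n x)) \<in> borel_measurable (lebesgue_on S)" by measurable
  show "AE x in lebesgue_on S. lim (\<lambda>n. f n x) = g x"
    using ae by eventually_elim (rule limI)
qed

text \<open>The measure of the time interval and, with \<open>T = 1\<close>, also that of the space
  interval.\<close>

abbreviation MT :: "real \<Rightarrow> real measure" where "MT T \<equiv> lebesgue_on {0<..<T}"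

lemma finite_measure_MT: "finite_measure (MT T)"
  by (rule finite_measure_lebesgue_on) simp

lemma integrable_MT_iff: "integrable (MT T) f \<longleftrightarrow> set_integrable lebesgue {0<..<T} (f :: real \<Rightarrow> real)"
  by (simp add: set_integrable_eq)

lemma integral_MT: "(LINT x:{0<..<T}|lebesgue. f x) = (\<integral>x. f x \<partial>MT T :: real)"
  unfolding set_lebesgue_integral_def by (rule integral_restrict_space[symmetric]) simp

lemma integrable_MT_const: "integrable (MT T) (\<lambda>x. c :: real)"
  using finite_measure_MT by (rule finite_measure.integrable_const)

lemma integrable_MT_Icc: "integrable (MT T) f \<Longrightarrow> 0 \<le> s \<Longrightarrow> t \<le> T \<Longrightarrow> set_integrable lebesgue {s..t} (f :: real \<Rightarrow> real)"
proof -
  assume "integrable (MT T) f" "0 \<le> s" "t \<le> T"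
  then have "set_integrable lebesgue {0..T} f"
    by (simp add: integrable_MT_iff absolutely_integrable_on_Icc_iff_Ioo)
  then show ?thesis by (rule set_integrable_subset) (use \<open>0 \<le> s\<close> \<open>t \<le> T\<close> in auto)
qed

lemma integral_MT_Icc: "(\<integral>x. f x \<partial>MT T) = (LINT x:{0..T}|lebesgue. f x :: real)"
proof -
  have ae: "AE x in lebesgue. x \<noteq> 0 \<and> x \<noteq> T"
    by (intro AE_conjI AE_completion AE_lborel_singleton)
  then have ae: "AE x in lebesgue. indicat_real {0<..<T} x *\<^sub>R f x = indicator {0..T} x *\<^sub>R f x"
  proof eventually_elim
    case (elim x)
    then have "x \<in> {0<..<T} \<longleftrightarrow> x \<in> {0..T}" by auto
    then show ?case by (simp add: indicator_def)
  qed
  then have ae': "AE x in lebesgue. indicat_real {0..T} x *\<^sub>R f x = indicator {0<..<T} x *\<^sub>R f x"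
    by eventually_elim (rule sym)
  have "(LINT x:{0<..<T}|lebesgue. f x) = (LINT x:{0..T}|lebesgue. f x)"
  proof (cases "(\<lambda>x. indicator {0<..<T} x *\<^sub>R f x) \<in> borel_measurable lebesgue")
    case True
    from True borel_measurable_AE[OF True ae] ae show ?thesis
      unfolding set_lebesgue_integral_def by (intro integral_cong_AE)
  next
    \<comment> \<open>Integrability is not assumed: by completeness of the measure both integrands
      fail to be measurable together, and both integrals then have the default value 0.\<close>
    case False
    then have "(\<lambda>x. indicator {0..T} x *\<^sub>R f x) \<notin> borel_measurable lebesgue"
      using borel_measurable_AE[OF _ ae'] by blast
    then show ?thesis
      using False unfolding set_lebesgue_integral_def
      by (metis borel_measurable_integrable not_integrable_integral_eq)
  qed
  then show ?thesis by (simp add: integral_MT)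
qed

lemma AE_MT_iff: "(AE t in MT T. P t) \<longleftrightarrow> (AE t in lebesgue. t \<in> {0<..<T} \<longrightarrow> P t)"
  by (subst AE_restrict_space_iff) auto

text \<open>A set of full measure meets every interval of positive length, also next to the ends of
  [0,T]; combined with continuity this carries properties of almost every time to every
  time.\<close>

lemma AE_MT_dense:
  assumes ae: "AE t in MT T. P t" and t: "0 \<le> t" "t \<le> T" and T: "T > 0" and e: "e > 0"
  obtains s where "0 < s" "s < T" "\<bar>s - t\<bar> < e" "P s"
proof -
  let ?I = "{max 0 (t - e)<..<min T (t + e)}"
  have "\<exists>s\<in>?I. P s"
  proof (rule ccontr)
    assume "\<not> (\<exists>s\<in>?I. P s)"
    then have "AE s in lebesgue. s \<notin> ?I"
      using ae unfolding AE_MT_iff by (auto elim!: eventually_mono)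
    then have "?I \<in> null_sets lebesgue" by (subst AE_iff_null_sets) auto
    then have "emeasure lebesgue ?I = 0" by (rule null_setsD1)
    then show False using t T e by (auto simp: max_def min_def split: if_splits)
  qed
  then show thesis using that by (auto simp: abs_less_iff)
qed

text \<open>The integral of (k - z)^2 is a nonnegative quadratic polynomial in \<open>z\<close>, and
  the claim is the sign of its discriminant.\<close>

lemma LINT_Icc_square_le:
  fixes k :: "real \<Rightarrow> real"
  assumes k: "set_integrable lebesgue {s..t} k" and k2: "set_integrable lebesgue {s..t} (\<lambda>x. (k x)\<^sup>2)" and st: "s \<le> t"
  shows "(LINT x:{s..t}|lebesgue. k x)\<^sup>2 \<le> (t - s) * (LINT x:{s..t}|lebesgue. (k x)\<^sup>2)"
proof -
  have one: "set_integrable lebesgue {s..t} (\<lambda>x. 1::real)"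
    by (intro absolutely_integrable_continuous_real continuous_intros)
  have l1: "(LINT x:{s..t}|lebesgue. 1) = t - s"
    using st by (simp add: set_lebesgue_integral_def)
  have "(LINT x:{s..t}|lebesgue. k x)\<^sup>2 \<le> (LINT x:{s..t}|lebesgue. (k x)\<^sup>2) * (t - s)"
  proof (rule quadratic_nonneg_imp_discriminant)
    fix z :: real
    have i: "set_integrable lebesgue {s..t} (\<lambda>x. 2 * z * k x)" "set_integrable lebesgue {s..t} (\<lambda>x. z\<^sup>2 * 1)"
      using k one by (intro set_integrable_mult_right; simp)+
    have "0 \<le> (LINT x:{s..t}|lebesgue. ((k x)\<^sup>2 - 2 * z * k x) + z\<^sup>2 * 1)"
      unfolding set_lebesgue_integral_def
    proof (rule integral_nonneg_AE, rule AE_I2)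
      fix x
      have "((k x)\<^sup>2 - 2 * z * k x) + z\<^sup>2 * 1 = (k x - z)\<^sup>2" by (simp add: power2_diff)
      then show "0 \<le> indicat_real {s..t} x *\<^sub>R ((k x)\<^sup>2 - 2 * z * k x + z\<^sup>2 * 1)"
        by simp
    qed
    also have "\<dots> = (LINT x:{s..t}|lebesgue. (k x)\<^sup>2) - 2 * z * (LINT x:{s..t}|lebesgue. k x) + z\<^sup>2 * (t - s)"
      using set_integral_add(2)[OF set_integral_diff(1)[OF k2 i(1)] i(2)] set_integral_diff(2)[OF k2 i(1)] l1
      by (simp only: set_integral_mult_right)
    finally show "0 \<le> (LINT x:{s..t}|lebesgue. (k x)\<^sup>2) - 2 * z * (LINT x:{s..t}|lebesgue. k x) + z\<^sup>2 * (t - s)" .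
  qed (use st in simp)
  then show ?thesis by (simp add: mult.commute)
qed

section \<open>Strong measurability and square integrability in time\<close>

context semi_inner
begin

text \<open>Inner products of simple approximants are simple scalar functions, and they converge
  almost everywhere by joint continuity of the form.\<close>

lemma strongly_measurable_ip:
  assumes u: "strongly_measurable V nrm T u" and v: "strongly_measurable V nrm T v"
  shows "(\<lambda>t. ip (u t) (v t)) \<in> borel_measurable (MT T)"
proof -
  obtain s where s: "\<And>n. simple_into V T (s n)" "AE t in MT T. (\<lambda>n. nrm (\<lambda>x. u t x - s n t x)) \<longlonglongrightarrow> 0"
    using u unfolding strongly_measurable_def by blast
  obtain r where r: "\<And>n. simple_into V T (r n)" "AE t in MT T. (\<lambda>n. nrm (\<lambda>x. v t x - r n t x)) \<longlonglongrightarrow> 0"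
    using v unfolding strongly_measurable_def by blast
  have uv: "AE t in MT T. u t \<in> V" "AE t in MT T. v t \<in> V"
    using u v unfolding strongly_measurable_def by blast+
  show ?thesis
  proof (rule borel_measurable_AE_limit)
    show "(\<lambda>t. ip (s n t) (r n t)) \<in> borel_measurable (MT T)" for n
    proof (rule borel_measurable_simple_function)
      have sf: "simple_function (MT T) (s n)" "simple_function (MT T) (r n)"
        using s(1)[of n] r(1)[of n] by (simp_all add: simple_into_def)
      show "simple_function (MT T) (\<lambda>t. ip (s n t) (r n t))"
        by (rule simple_function_compose2[OF sf])
    qed
    show "AE t in MT T. (\<lambda>n. ip (s n t) (r n t)) \<longlonglongrightarrow> ip (u t) (v t)"
      using s(2) r(2) uv AE_space
    proof eventually_elim
      case (elim t)
      then have "s n t \<in> V" "r n t \<in> V" for n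
        using s(1)[of n] r(1)[of n] by (auto simp: simple_into_def)
      with elim show ?case by (intro ip_tendsto2)
    qed
  qed simp
qed

lemma strongly_measurable_nrm:
  "strongly_measurable V nrm T u \<Longrightarrow> (\<lambda>t. nrm (u t)) \<in> borel_measurable (MT T)"
  using measurable_compose[OF strongly_measurable_ip[of T u u] borel_measurable_sqrt] by (simp add: nrm_def[abs_def])

lemma strongly_measurable_scale:
  assumes w: "w \<in> borel_measurable (MT T)" and u: "strongly_measurable V nrm T u"
  shows "strongly_measurable V nrm T (\<lambda>t x. w t * u t x)"
proof -
  obtain s where s: "\<And>n. simple_into V T (s n)" "AE t in MT T. (\<lambda>n. nrm (\<lambda>x. u t x - s n t x)) \<longlonglongrightarrow> 0"
    using u unfolding strongly_measurable_def by blast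
  have uV: "AE t in MT T. u t \<in> V" using u unfolding strongly_measurable_def by blast
  obtain r where r: "\<And>n. simple_function (MT T) (r n)" "\<And>t. t \<in> space (MT T) \<Longrightarrow> (\<lambda>n. r n t) \<longlonglongrightarrow> w t"
    using borel_measurable_implies_sequence_metric[OF w, of 0] by blast
  show ?thesis
    unfolding strongly_measurable_def
  proof (intro conjI exI allI)
    show "AE t in MT T. (\<lambda>x. w t * u t x) \<in> V"
      using uV by eventually_elim (rule scale_in)
    show "simple_into V T (\<lambda>t x. r n t * s n t x)" for n
    proof -
      have sf: "simple_function (MT T) (s n)" using s(1)[of n] by (simp add: simple_into_def)
      have "simple_function (MT T) (\<lambda>t. (\<lambda>a f x. a * f x) (r n t) (s n t))"
        by (rule simple_function_compose2[OF r(1) sf])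
      then show ?thesis
        using s(1)[of n] by (auto simp: simple_into_def intro!: scale_in)
    qed
    show "AE t in MT T. (\<lambda>n. nrm (\<lambda>x. w t * u t x - r n t * s n t x)) \<longlonglongrightarrow> 0"
      using s(2) uV AE_space
    proof eventually_elim
      case (elim t)
      then have sV: "s n t \<in> V" for n using s(1)[of n] by (auto simp: simple_into_def)
      note rl = r(2)[OF elim(3)]
      have *: "nrm (\<lambda>x. w t * u t x - r n t * s n t x) \<le> \<bar>w t - r n t\<bar> * nrm (u t) + \<bar>r n t\<bar> * nrm (\<lambda>x. u t x - s n t x)" for n
      proof -
        have "nrm (\<lambda>x. (w t - r n t) * u t x + r n t * (u t x - s n t x))
           \<le> nrm (\<lambda>x. (w t - r n t) * u t x) + nrm (\<lambda>x. r n t * (u t x - s n t x))"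
          by (intro nrm_triangle scale_in diff_in elim sV)
        also have "\<dots> = \<bar>w t - r n t\<bar> * nrm (u t) + \<bar>r n t\<bar> * nrm (\<lambda>x. u t x - s n t x)"
          by (simp only: nrm_scale[OF elim(2)] nrm_scale[OF diff_in[OF elim(2) sV]])
        also have "(\<lambda>x. (w t - r n t) * u t x + r n t * (u t x - s n t x)) = (\<lambda>x. w t * u t x - r n t * s n t x)"
          by (simp add: algebra_simps)
        finally show ?thesis .
      qed
      have "(\<lambda>n. \<bar>w t - r n t\<bar> * nrm (u t) + \<bar>r n t\<bar> * nrm (\<lambda>x. u t x - s n t x))
          \<longlonglongrightarrow> \<bar>w t - w t\<bar> * nrm (u t) + \<bar>w t\<bar> * 0"
        by (intro tendsto_intros rl elim(1))
      then have lim: "(\<lambda>n. \<bar>w t - r n t\<bar> * nrm (u t) + \<bar>r n t\<bar> * nrm (\<lambda>x. u t x - s n t x)) \<longlonglongrightarrow> 0"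
        by simp
      show ?case
        by (rule tendsto_sandwich[OF _ _ tendsto_const lim]) (use * in \<open>auto intro: always_eventually\<close>)
    qed
  qed
qed

lemma simple_into_strongly_measurable: "simple_into V T s \<Longrightarrow> strongly_measurable V nrm T s"
  unfolding strongly_measurable_def
proof (intro conjI exI[of _ "\<lambda>n. s"] allI)
  assume s: "simple_into V T s"
  then show "AE t in MT T. s t \<in> V" by (intro AE_I2) (auto simp: simple_into_def)
  show "AE t in MT T. (\<lambda>n. nrm (\<lambda>x. s t x - s t x)) \<longlonglongrightarrow> 0"
    using ip_zero[OF zero_in] by (simp add: nrm_def)
qed

lemma strongly_measurable_diff:
  assumes u: "strongly_measurable V nrm T u" and v: "strongly_measurable V nrm T v"
  shows "strongly_measurable V nrm T (\<lambda>t x. u t x - v t x)"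
proof -
  from u obtain r where r: "\<And>k. simple_into V T (r k)" "AE t in MT T. (\<lambda>k. nrm (\<lambda>x. u t x - r k t x)) \<longlonglongrightarrow> 0"
    unfolding strongly_measurable_def by blast
  from v obtain s where s: "\<And>k. simple_into V T (s k)" "AE t in MT T. (\<lambda>k. nrm (\<lambda>x. v t x - s k t x)) \<longlonglongrightarrow> 0"
    unfolding strongly_measurable_def by blast
  have uv: "AE t in MT T. u t \<in> V" "AE t in MT T. v t \<in> V"
    using u v unfolding strongly_measurable_def by blast+
  show ?thesis
    unfolding strongly_measurable_def
  proof (intro conjI exI[of _ "\<lambda>k t x. r k t x - s k t x"] allI)
    show "AE t in MT T. (\<lambda>x. u t x - v t x) \<in> V"
      using uv by eventually_elim (rule diff_in)
    show "simple_into V T (\<lambda>t x. r k t x - s k t x)" for k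
    proof -
      have sf: "simple_function (MT T) (r k)" "simple_function (MT T) (s k)"
        using s(1)[of k] r(1)[of k] by (simp_all add: simple_into_def)
      have "simple_function (MT T) (\<lambda>t. (\<lambda>f g x. f x - g x) (r k t) (s k t))"
        by (rule simple_function_compose2[OF sf])
      then show ?thesis
        using s(1)[of k] r(1)[of k] by (auto simp: simple_into_def intro!: diff_in)
    qed
    show "AE t in MT T. (\<lambda>k. nrm (\<lambda>x. u t x - v t x - (r k t x - s k t x))) \<longlonglongrightarrow> 0"
      using r(2) s(2) uv AE_space
    proof eventually_elim
      case (elim t)
      have rs: "r k t \<in> V" "s k t \<in> V" for k
        using r(1)[of k] s(1)[of k] elim(5) by (auto simp: simple_into_def)
      have le: "nrm (\<lambda>x. u t x - v t x - (r k t x - s k t x)) \<le> nrm (\<lambda>x. u t x - r k t x) + nrm (\<lambda>x. v t x - s k t x)" for k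
      proof -
        have "nrm (\<lambda>x. (u t x - r k t x) + (s k t x - v t x)) \<le> nrm (\<lambda>x. u t x - r k t x) + nrm (\<lambda>x. s k t x - v t x)"
          by (intro nrm_triangle diff_in elim rs)
        also have "(\<lambda>x. (u t x - r k t x) + (s k t x - v t x)) = (\<lambda>x. u t x - v t x - (r k t x - s k t x))"
          by (auto simp: algebra_simps)
        finally show ?thesis using nrm_minus_commute[OF rs(2)[of k] elim(4)] by simp
      qed
      have l0: "(\<lambda>k. nrm (\<lambda>x. u t x - r k t x) + nrm (\<lambda>x. v t x - s k t x)) \<longlonglongrightarrow> 0"
        using tendsto_add[OF elim(1,2)] by simp
      show ?case
        by (rule tendsto_sandwich[OF _ always_eventually[OF allI[OF le]] tendsto_const l0]) simp
    qed
  qed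
qed

lemma L2_timeD:
  assumes "u \<in> L2_time V nrm T"
  shows "strongly_measurable V nrm T u" "AE t in MT T. u t \<in> V" "integrable (MT T) (\<lambda>t. ip (u t) (u t))"
  using assms by (auto simp: L2_time_def strongly_measurable_def nrm_square integrable_MT_iff)

lemma L2_timeI:
  assumes "strongly_measurable V nrm T u" "integrable (MT T) (\<lambda>t. ip (u t) (u t))"
  shows "u \<in> L2_time V nrm T"
  using assms by (auto simp: L2_time_def nrm_square integrable_MT_iff)

lemma L2_time_const: "y \<in> V \<Longrightarrow> (\<lambda>t. y) \<in> L2_time V nrm T"
proof (rule L2_timeI)
  assume y: "y \<in> V"
  show "strongly_measurable V nrm T (\<lambda>t. y)"
    by (rule simple_into_strongly_measurable) (use y in \<open>auto simp: simple_into_def\<close>)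
qed (rule integrable_MT_const)

lemma L2_time_ip:
  assumes u: "u \<in> L2_time V nrm T" and v: "v \<in> L2_time V nrm T"
  shows "integrable (MT T) (\<lambda>t. ip (u t) (v t))"
proof (rule Bochner_Integration.integrable_bound)
  note u' = L2_timeD[OF u] and v' = L2_timeD[OF v]
  show "integrable (MT T) (\<lambda>t. ip (u t) (u t) + ip (v t) (v t))" using u' v' by simp
  show "(\<lambda>t. ip (u t) (v t)) \<in> borel_measurable (MT T)"
    using u' v' by (intro strongly_measurable_ip)
  show "AE t in MT T. norm (ip (u t) (v t)) \<le> norm (ip (u t) (u t) + ip (v t) (v t))"
    using u'(2) v'(2)
  proof eventually_elim
    case (elim t)
    have "\<bar>ip (u t) (v t)\<bar> \<le> nrm (u t) * nrm (v t)" by (rule Cauchy_Schwarz[OF elim])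
    also have "\<dots> \<le> (nrm (u t))\<^sup>2 + (nrm (v t))\<^sup>2"
    proof -
      have "2 * (nrm (u t) * nrm (v t)) \<le> (nrm (u t))\<^sup>2 + (nrm (v t))\<^sup>2"
        using sum_squares_bound[of "nrm (u t)" "nrm (v t)"] by simp
      moreover have "0 \<le> nrm (u t) * nrm (v t)" by simp
      ultimately show ?thesis by linarith
    qed
    finally show ?case by (simp add: nrm_square ip_nonneg)
  qed
qed

lemma L2_time_nrm:
  assumes u: "u \<in> L2_time V nrm T"
  shows "integrable (MT T) (\<lambda>t. (nrm (u t))\<^sup>2)" "integrable (MT T) (\<lambda>t. nrm (u t))"
proof -
  note u' = L2_timeD[OF u]
  show 2: "integrable (MT T) (\<lambda>t. (nrm (u t))\<^sup>2)" using u' by (simp add: nrm_square)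
  show "integrable (MT T) (\<lambda>t. nrm (u t))"
  proof (rule Bochner_Integration.integrable_bound)
    show "integrable (MT T) (\<lambda>t. 1 + (nrm (u t))\<^sup>2)" using 2 integrable_MT_const by simp
    show "(\<lambda>t. nrm (u t)) \<in> borel_measurable (MT T)" using u' by (intro strongly_measurable_nrm)
    have "z \<le> 1 + z\<^sup>2" for z :: real
      using sum_squares_bound[of z 1] zero_le_power2[of z] by (simp only: mult_1_right one_power2)
    then show "AE t in MT T. norm (nrm (u t)) \<le> norm (1 + (nrm (u t))\<^sup>2)" by simp
  qed
qed

lemma L2_time_scale:
  assumes w: "w \<in> borel_measurable (MT T)" "\<And>t. t \<in> {0<..<T} \<Longrightarrow> \<bar>w t\<bar> \<le> B" and u: "u \<in> L2_time V nrm T"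
  shows "(\<lambda>t x. w t * u t x) \<in> L2_time V nrm T"
proof (rule L2_timeI)
  note u' = L2_timeD[OF u]
  show sm: "strongly_measurable V nrm T (\<lambda>t x. w t * u t x)"
    by (rule strongly_measurable_scale[OF w(1) u'(1)])
  show "integrable (MT T) (\<lambda>t. ip (\<lambda>x. w t * u t x) (\<lambda>x. w t * u t x))"
  proof (rule Bochner_Integration.integrable_bound)
    show "integrable (MT T) (\<lambda>t. B\<^sup>2 * ip (u t) (u t))" using u' by simp
    show "(\<lambda>t. ip (\<lambda>x. w t * u t x) (\<lambda>x. w t * u t x)) \<in> borel_measurable (MT T)"
      by (rule strongly_measurable_ip[OF sm sm])
    show "AE t in MT T. norm (ip (\<lambda>x. w t * u t x) (\<lambda>x. w t * u t x)) \<le> norm (B\<^sup>2 * ip (u t) (u t))"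
      using u'(2) AE_space
    proof eventually_elim
      case (elim t)
      have "(w t)\<^sup>2 \<le> B\<^sup>2" using w(2)[of t] elim(2) by (simp add: abs_le_square_iff[symmetric])
      then have "(w t)\<^sup>2 * ip (u t) (u t) \<le> B\<^sup>2 * ip (u t) (u t)"
        by (rule mult_right_mono) (rule ip_nonneg)
      then show ?case
        by (simp add: ip_scale ip_scale_right elim scale_in ip_nonneg power2_eq_square mult.assoc abs_mult)
    qed
  qed
qed

section \<open>Bochner integrals tested against a fixed element\<close>

lemma simple_into_ip:
  assumes s: "simple_into V T s" and y: "y \<in> V"
  shows "simple_integral_of T s \<in> V" "integrable (MT T) (\<lambda>t. ip (s t) y)"
    "ip (simple_integral_of T s) y = (\<integral>t. ip (s t) y \<partial>MT T)"
proof -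
  have sf: "simple_function (MT T) s" and sV: "s ` {0<..<T} \<subseteq> V" using s by (auto simp: simple_into_def)
  have fin: "finite (s ` {0<..<T})" using simple_functionD(1)[OF sf] by simp
  have vV: "v \<in> V" if "v \<in> s ` {0<..<T}" for v using that sV by blast
  show "simple_integral_of T s \<in> V"
    unfolding simple_integral_of_def by (rule sum_in[OF fin vV])
  have meas: "s -` {v} \<inter> {0<..<T} \<in> sets (MT T)" for v
    using simple_functionD(2)[OF sf, of "{v}"] by simp
  have ii: "integrable (MT T) (indicat_real (s -` {v} \<inter> {0<..<T}))" for v
    using finite_measure.emeasure_finite[OF finite_measure_MT] meas
    by (intro integrable_real_indicator) (auto simp: less_top[symmetric])
  have eq: "ip (s t) y = (\<Sum>v\<in>s ` {0<..<T}. indicator (s -` {v} \<inter> {0<..<T}) t * ip v y)" if "t \<in> {0<..<T}" for t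
  proof -
    have "(\<Sum>v\<in>s ` {0<..<T}. indicator (s -` {v} \<inter> {0<..<T}) t * ip v y) = (\<Sum>v\<in>s ` {0<..<T}. if v = s t then ip v y else 0)"
      using that by (intro sum.cong) (auto simp: indicator_def)
    then show ?thesis using fin that by simp
  qed
  have int: "integrable (MT T) (\<lambda>t. \<Sum>v\<in>s ` {0<..<T}. indicator (s -` {v} \<inter> {0<..<T}) t * ip v y)"
    using ii by (intro Bochner_Integration.integrable_sum) simp
  then show "integrable (MT T) (\<lambda>t. ip (s t) y)"
    by (rule Bochner_Integration.integrable_cong[THEN iffD1, rotated 2]) (simp_all add: eq)
  have "(\<integral>t. ip (s t) y \<partial>MT T) = (\<integral>t. (\<Sum>v\<in>s ` {0<..<T}. indicator (s -` {v} \<inter> {0<..<T}) t * ip v y) \<partial>MT T)"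
    by (rule Bochner_Integration.integral_cong) (simp_all add: eq)
  also have "\<dots> = (\<Sum>v\<in>s ` {0<..<T}. measure (MT T) (s -` {v} \<inter> {0<..<T}) * ip v y)"
    using ii meas by (subst Bochner_Integration.integral_sum) (auto intro!: sum.cong)
  also have "\<dots> = (\<Sum>v\<in>s ` {0<..<T}. measure lebesgue (s -` {v} \<inter> {0<..<T}) * ip v y)"
    by (intro sum.cong refl arg_cong2[where f = "(*)"] measure_restrict_space) auto
  also have "\<dots> = ip (simple_integral_of T s) y"
    unfolding simple_integral_of_def by (rule ip_sum[OF fin vV y, symmetric])
  finally show "ip (simple_integral_of T s) y = (\<integral>t. ip (s t) y \<partial>MT T)" ..
qed

text \<open>Cauchy-Schwarz bounds the scalar L^1 error of a simple approximation by
  \<open>nrm y\<close> times the vector-valued error, so pairing with \<open>y\<close> commutes with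
  the integral. This is how the vector-valued weak derivative in time becomes a scalar one.\<close>

lemma bochner_integral_ip:
  assumes I: "has_bochner_integral_into V nrm T u I" and y: "y \<in> V"
  shows "integrable (MT T) (\<lambda>t. ip (u t) y)" "(\<integral>t. ip (u t) y \<partial>MT T) = ip I y"
proof -
  from I obtain s where sm: "strongly_measurable V nrm T u" and IV: "I \<in> V"
    and s: "\<And>n. simple_into V T (s n)"
    and l1: "(\<lambda>n. \<integral>\<^sup>+ t. ennreal (nrm (\<lambda>x. u t x - s n t x)) \<partial>(MT T)) \<longlonglongrightarrow> 0"
    and l2: "(\<lambda>n. nrm (\<lambda>x. I x - simple_integral_of T (s n) x)) \<longlonglongrightarrow> 0"
    unfolding has_bochner_integral_into_def by blast
  have uV: "AE t in MT T. u t \<in> V" using sm by (simp add: strongly_measurable_def)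
  note si = simple_into_ip[OF s y]
  have [measurable]: "(\<lambda>t. ip (u t) y) \<in> borel_measurable (MT T)"
    using sm L2_timeD(1)[OF L2_time_const[OF y]] by (rule strongly_measurable_ip)
  note [measurable] = borel_measurable_integrable[OF si(2)]
  let ?e = "\<lambda>n. \<integral>\<^sup>+ t. ennreal (nrm (\<lambda>x. u t x - s n t x)) \<partial>(MT T)"
  have bd: "(\<integral>\<^sup>+ t. ennreal (norm (ip (u t) y - ip (s n t) y)) \<partial>(MT T)) \<le> ennreal (nrm y) * ?e n" for n
  proof -
    have sV: "s n t \<in> V" if "t \<in> {0<..<T}" for t using s[of n] that by (auto simp: simple_into_def)
    have "(\<integral>\<^sup>+ t. ennreal (norm (ip (u t) y - ip (s n t) y)) \<partial>(MT T))
       \<le> (\<integral>\<^sup>+ t. ennreal (nrm y) * ennreal (nrm (\<lambda>x. u t x - s n t x)) \<partial>(MT T))"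
    proof (rule nn_integral_mono_AE)
      show "AE t in MT T. ennreal (norm (ip (u t) y - ip (s n t) y)) \<le> ennreal (nrm y) * ennreal (nrm (\<lambda>x. u t x - s n t x))"
        using uV AE_space
      proof eventually_elim
        case (elim t)
        then have t: "s n t \<in> V" using sV by simp
        show ?case
          using Cauchy_Schwarz[OF diff_in[OF elim(1) t] y]
          by (simp add: ip_diff elim t y ennreal_mult[symmetric] ennreal_leI mult.commute)
      qed
    qed
    also have "\<dots> = ennreal (nrm y) * ?e n"
    proof (rule nn_integral_cmult)
      show "(\<lambda>t. ennreal (nrm (\<lambda>x. u t x - s n t x))) \<in> borel_measurable (MT T)"
        using strongly_measurable_nrm[OF strongly_measurable_diff[OF sm simple_into_strongly_measurable[OF s]]] by simp
    qed
    finally show ?thesis .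
  qed
  have lim0: "(\<lambda>n. ennreal (nrm y) * ?e n) \<longlonglongrightarrow> 0"
    using tendsto_mult_ennreal[OF tendsto_const[of "ennreal (nrm y)"] l1] by simp
  have lim: "(\<lambda>n. \<integral>\<^sup>+ t. ennreal (norm (ip (u t) y - ip (s n t) y)) \<partial>(MT T)) \<longlonglongrightarrow> 0"
    by (rule tendsto_sandwich[OF _ _ tendsto_const lim0]) (use bd in \<open>auto intro: always_eventually\<close>)
  have "\<forall>\<^sub>F n in sequentially. (\<integral>\<^sup>+ t. ennreal (norm (ip (u t) y - ip (s n t) y)) \<partial>(MT T)) < 1"
    using lim by (rule order_tendstoD(2)) simp
  \<comment> \<open>A single simple approximant at finite L^1 distance already makes the scalar
    function integrable.\<close>
  then obtain n where n: "(\<integral>\<^sup>+ t. ennreal (norm (ip (u t) y - ip (s n t) y)) \<partial>(MT T)) < 1"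
    using eventually_happens'[OF sequentially_bot] by blast
  have "integrable (MT T) (\<lambda>t. ip (u t) y - ip (s n t) y)"
    by (rule integrableI_bounded) (use less_trans[OF n ennreal_one_less_top] in simp_all)
  from Bochner_Integration.integrable_add[OF this si(2)[of n]]
  show int: "integrable (MT T) (\<lambda>t. ip (u t) y)" by simp
  have "(\<lambda>n. \<integral>t. ip (s n t) y \<partial>MT T) \<longlonglongrightarrow> (\<integral>t. ip (u t) y \<partial>MT T)"
  proof (rule tendsto_L1_int[OF si(2) int])
    show "(\<lambda>n. \<integral>\<^sup>+ t. ennreal (norm (ip (s n t) y - ip (u t) y)) \<partial>(MT T)) \<longlonglongrightarrow> 0"
      using lim by (simp add: norm_minus_commute[of "ip (s _ _) y"] abs_minus_commute[of "ip (s _ _) y"])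
  qed
  moreover have "(\<lambda>n. ip (simple_integral_of T (s n)) y) \<longlonglongrightarrow> ip I y"
    by (rule ip_tendsto[OF si(1) IV y l2])
  ultimately show "(\<integral>t. ip (u t) y \<partial>MT T) = ip I y"
    unfolding si(3) by (rule LIMSEQ_unique)
qed

end

lemma LINT_mono_Icc:
  fixes f :: "real \<Rightarrow> real"
  assumes f: "set_integrable lebesgue {a..b} f" and sub: "a \<le> s" "t \<le> b" and nn: "\<And>x. 0 \<le> f x"
  shows "(LINT x:{s..t}|lebesgue. f x) \<le> (LINT x:{a..b}|lebesgue. f x)"
proof -
  have "set_integrable lebesgue {s..t} f"
    by (rule set_integrable_subset[OF f]) (use sub in auto)
  then show ?thesis
    using f sub nn unfolding set_lebesgue_integral_def set_integrable_def
    by (intro integral_mono) (auto simp: indicator_def)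
qed

context semi_inner
begin

text \<open>The scalar function \<open>ip (u t) y\<close> has the weak derivative
  \<open>ip (v t) y\<close> and is therefore a primitive of it almost everywhere. The constant
  \<open>c\<close> and the exceptional set depend on \<open>y\<close>.\<close>

lemma weak_time_deriv_ip:
  assumes u: "u \<in> L2_time V nrm T" and v: "v \<in> L2_time V nrm T" and w: "has_weak_time_deriv V nrm T u v"
    and y: "y \<in> V" and T: "T > 0"
  obtains c where "AE t in MT T. ip (u t) y = c + (LINT \<tau>:{0..t}|lebesgue. ip (v \<tau>) y)"
proof -
  define f where "f t = ip (u t) y" for t
  define g where "g t = ip (v t) y" for t
  have fi: "integrable (MT T) f" and gi: "integrable (MT T) g"
    unfolding f_def g_def by (intro L2_time_ip u v L2_time_const y)+
  have loc: "loc_int 0 T f" "loc_int 0 T g"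
    unfolding loc_int_def using fi gi by (auto intro!: integrable_MT_Icc)
  have weak: "(LINT t:{0<..<T}|lebesgue. f t * deriv \<psi> t) = - (LINT t:{0<..<T}|lebesgue. g t * \<psi> t)"
    if \<psi>: "\<psi> \<in> test_functions 0 T" for \<psi>
  proof -
    obtain I where I: "has_bochner_integral_into V nrm T (\<lambda>t x. deriv \<psi> t * u t x) I"
      "has_bochner_integral_into V nrm T (\<lambda>t x. - (\<psi> t * v t x)) I"
      using w \<psi> unfolding has_weak_time_deriv_def by blast
    have "(\<integral>t. ip (\<lambda>x. deriv \<psi> t * u t x) y \<partial>MT T) = (\<integral>t. ip (\<lambda>x. - (\<psi> t * v t x)) y \<partial>MT T)"
      using bochner_integral_ip(2)[OF I(1) y] bochner_integral_ip(2)[OF I(2) y] by simp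
    also have "(\<integral>t. ip (\<lambda>x. deriv \<psi> t * u t x) y \<partial>MT T) = (\<integral>t. f t * deriv \<psi> t \<partial>MT T)"
    proof (rule integral_cong_AE)
      show "(\<lambda>t. ip (\<lambda>x. deriv \<psi> t * u t x) y) \<in> borel_measurable (MT T)"
        using bochner_integral_ip(1)[OF I(1) y] by (rule borel_measurable_integrable)
      show "(\<lambda>t. f t * deriv \<psi> t) \<in> borel_measurable (MT T)"
        using loc_int_mult_test(2)[OF loc(1) \<psi> T]
        by (intro borel_measurable_integrable) (simp add: integrable_MT_iff)
      show "AE t in MT T. ip (\<lambda>x. deriv \<psi> t * u t x) y = f t * deriv \<psi> t"
        using L2_timeD(2)[OF u] by eventually_elim (simp add: ip_scale y f_def)
    qed
    also have "(\<integral>t. ip (\<lambda>x. - (\<psi> t * v t x)) y \<partial>MT T) = (\<integral>t. - (g t * \<psi> t) \<partial>MT T)"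
    proof (rule integral_cong_AE)
      show "(\<lambda>t. ip (\<lambda>x. - (\<psi> t * v t x)) y) \<in> borel_measurable (MT T)"
        using bochner_integral_ip(1)[OF I(2) y] by (rule borel_measurable_integrable)
      show "(\<lambda>t. - (g t * \<psi> t)) \<in> borel_measurable (MT T)"
        using loc_int_mult_test(1)[OF loc(2) \<psi> T]
        by (intro borel_measurable_uminus borel_measurable_integrable) (simp add: integrable_MT_iff)
      show "AE t in MT T. ip (\<lambda>x. - (\<psi> t * v t x)) y = - (g t * \<psi> t)"
        using L2_timeD(2)[OF v] by eventually_elim (simp add: ip_minus scale_in ip_scale y g_def)
    qed
    finally show ?thesis by (simp add: integral_MT)
  qed
  obtain P where P: "\<And>c d. 0 < c \<Longrightarrow> d < T \<Longrightarrow> prim c d g P"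
    and ae: "AE t in lebesgue. t \<in> {0<..<T} \<longrightarrow> f t = P t"
    using weak_deriv_prim[OF loc T weak] by blast
  \<comment> \<open>The primitive \<open>P\<close> is controlled on compact subintervals only; as
    \<open>g\<close> is integrable on all of (0,T), its integral can be taken from 0 once the
    constant is matched at an interior time.\<close>
  define m where "m = T / 2"
  define c where "c = P m - (LINT \<tau>:{0..m}|lebesgue. g \<tau>)"
  have m: "0 < m" "m < T" using T by (auto simp: m_def)
  have eq: "P t = c + (LINT \<tau>:{0..t}|lebesgue. g \<tau>)" if t: "t \<in> {0<..<T}" for t
  proof (cases "m \<le> t")
    case True
    have "P t - P m = (LINT \<tau>:{m..t}|lebesgue. g \<tau>)"
      by (rule prim_diff[OF P[of m t]]) (use m t True in auto)
    moreover have "(LINT \<tau>:{0..t}|lebesgue. g \<tau>) = (LINT \<tau>:{0..m}|lebesgue. g \<tau>) + (LINT \<tau>:{m..t}|lebesgue. g \<tau>)"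
      by (rule LINT_combine[OF integrable_MT_Icc[OF gi]]) (use m t True in auto)
    ultimately show ?thesis by (simp add: c_def)
  next
    case False
    have "P m - P t = (LINT \<tau>:{t..m}|lebesgue. g \<tau>)"
      by (rule prim_diff[OF P[of t m]]) (use m t False in auto)
    moreover have "(LINT \<tau>:{0..m}|lebesgue. g \<tau>) = (LINT \<tau>:{0..t}|lebesgue. g \<tau>) + (LINT \<tau>:{t..m}|lebesgue. g \<tau>)"
      by (rule LINT_combine[OF integrable_MT_Icc[OF gi]]) (use m t False in auto)
    ultimately show ?thesis by (simp add: c_def)
  qed
  show thesis
  proof (rule that)
    show "AE t in MT T. ip (u t) y = c + (LINT \<tau>:{0..t}|lebesgue. ip (v \<tau>) y)"
      unfolding AE_MT_iff using ae
    proof eventually_elim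
      case (elim t)
      then show ?case using eq[of t] by (auto simp: f_def g_def)
    qed
  qed
qed

section \<open>The continuous representative in time\<close>

lemma LINT_ip_le:
  assumes v: "v \<in> L2_time V nrm T" and y: "y \<in> V" and st: "0 \<le> s" "s \<le> t" "t \<le> T"
  shows "\<bar>LINT \<tau>:{s..t}|lebesgue. ip (v \<tau>) y\<bar> \<le> nrm y * sqrt ((t - s) * (LINT \<tau>:{s..t}|lebesgue. (nrm (v \<tau>))\<^sup>2))"
proof -
  have i1: "set_integrable lebesgue {s..t} (\<lambda>\<tau>. ip (v \<tau>) y)"
    by (rule integrable_MT_Icc[OF L2_time_ip[OF v L2_time_const[OF y]] st(1,3)])
  have i2: "set_integrable lebesgue {s..t} (\<lambda>\<tau>. nrm (v \<tau>))"
    by (rule integrable_MT_Icc[OF L2_time_nrm(2)[OF v] st(1,3)])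
  have i3: "set_integrable lebesgue {s..t} (\<lambda>\<tau>. (nrm (v \<tau>))\<^sup>2)"
    by (rule integrable_MT_Icc[OF L2_time_nrm(1)[OF v] st(1,3)])
  have "AE \<tau> in lebesgue. \<tau> \<noteq> 0 \<and> \<tau> \<noteq> T"
    by (intro AE_conjI AE_completion AE_lborel_singleton)
  then have ae: "AE \<tau>\<in>{s..t} in lebesgue. \<bar>ip (v \<tau>) y\<bar> \<le> nrm y * nrm (v \<tau>)"
    using L2_timeD(2)[OF v] unfolding AE_MT_iff
  proof eventually_elim
    case (elim \<tau>)
    show ?case
    proof
      assume "\<tau> \<in> {s..t}"
      then have "v \<tau> \<in> V" using elim st by auto
      from Cauchy_Schwarz[OF this y] show "\<bar>ip (v \<tau>) y\<bar> \<le> nrm y * nrm (v \<tau>)" by (simp add: mult.commute)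
    qed
  qed
  have "\<bar>LINT \<tau>:{s..t}|lebesgue. ip (v \<tau>) y\<bar> \<le> (LINT \<tau>:{s..t}|lebesgue. \<bar>ip (v \<tau>) y\<bar>)"
    using set_integral_norm_bound[OF i1] by simp
  also have "\<dots> \<le> (LINT \<tau>:{s..t}|lebesgue. nrm y * nrm (v \<tau>))"
    by (rule set_integral_mono_AE[OF set_integrable_abs[OF i1] set_integrable_mult_right[OF i2] ae])
  also have "\<dots> = nrm y * (LINT \<tau>:{s..t}|lebesgue. nrm (v \<tau>))" by (rule set_integral_mult_right)
  also have "\<dots> \<le> nrm y * sqrt ((t - s) * (LINT \<tau>:{s..t}|lebesgue. (nrm (v \<tau>))\<^sup>2))"
    by (intro mult_left_mono real_le_rsqrt LINT_Icc_square_le i2 i3 st nrm_nonneg)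
  finally show ?thesis .
qed

text \<open>Testing the increment against itself gives the bound by Cauchy-Schwarz, but the null set
  of times must not depend on the tested element. Increments are limits of differences of values of
  simple approximants; these form the countable set \<open>D\<close>, whose exceptional sets can be
  united.\<close>

lemma L2_time_increment:
  assumes u: "u \<in> L2_time V nrm T" and v: "v \<in> L2_time V nrm T" and w: "has_weak_time_deriv V nrm T u v"
    and T: "T > 0"
  obtains E where "AE t in MT T. t \<in> E" "\<And>t. t \<in> E \<Longrightarrow> 0 < t \<and> t < T \<and> u t \<in> V"
    "\<And>s t. s \<in> E \<Longrightarrow> t \<in> E \<Longrightarrow> nrm (\<lambda>x. u t x - u s x) \<le> sqrt \<bar>t - s\<bar> * sqrt (LINT \<tau>:{0..T}|lebesgue. (nrm (v \<tau>))\<^sup>2)"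
proof -
  define K where "K = sqrt (LINT \<tau>:{0..T}|lebesgue. (nrm (v \<tau>))\<^sup>2)"
  obtain r where r: "\<And>n. simple_into V T (r n)" "AE t in MT T. (\<lambda>n. nrm (\<lambda>x. u t x - r n t x)) \<longlonglongrightarrow> 0"
    using L2_timeD(1)[OF u] unfolding strongly_measurable_def by blast
  define S where "S = (\<Union>n. r n ` {0<..<T})"
  define D where "D = (\<lambda>(p, q) x. p x - q x :: real) ` (S \<times> S)"
  have fin: "finite (r n ` {0<..<T})" for n
    using r(1)[of n] simple_functionD(1)[of "MT T" "r n"] by (simp add: simple_into_def)
  have cS: "countable S"
    unfolding S_def by (rule countable_UN) (auto intro: countable_finite fin)
  have SV: "S \<subseteq> V" unfolding S_def using r(1) by (auto simp: simple_into_def)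
  have cD: "countable D" unfolding D_def using cS by (intro countable_image countable_SIGMA)
  have DV: "y \<in> V" if "y \<in> D" for y using that SV unfolding D_def by (auto intro!: diff_in)
  have "\<exists>c. \<forall>y\<in>D. AE t in MT T. ip (u t) y = c y + (LINT \<tau>:{0..t}|lebesgue. ip (v \<tau>) y)"
    by (rule bchoice) (use weak_time_deriv_ip[OF u v w DV T] in blast)
  then obtain c where c: "\<And>y. y \<in> D \<Longrightarrow> AE t in MT T. ip (u t) y = c y + (LINT \<tau>:{0..t}|lebesgue. ip (v \<tau>) y)"
    by blast
  define E where "E = {t \<in> {0<..<T}. u t \<in> V \<and> (\<lambda>n. nrm (\<lambda>x. u t x - r n t x)) \<longlonglongrightarrow> 0 \<and>
     (\<forall>y\<in>D. ip (u t) y = c y + (LINT \<tau>:{0..t}|lebesgue. ip (v \<tau>) y))}"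
  have ae: "AE t in MT T. \<forall>y\<in>D. ip (u t) y = c y + (LINT \<tau>:{0..t}|lebesgue. ip (v \<tau>) y)"
    using cD c by (subst AE_ball_countable) auto
  have aeE: "AE t in MT T. t \<in> E"
    using L2_timeD(2)[OF u] r(2) ae AE_space by eventually_elim (simp add: E_def)
  have i3: "set_integrable lebesgue {0..T} (\<lambda>\<tau>. (nrm (v \<tau>))\<^sup>2)"
    by (rule integrable_MT_Icc[OF L2_time_nrm(1)[OF v]]) auto
  have le: "nrm (\<lambda>x. u t x - u s x) \<le> sqrt (t - s) * K" if s: "s \<in> E" and t: "t \<in> E" and st: "s \<le> t" for s t
  proof -
    have sV: "u s \<in> V" "u t \<in> V" "0 < s" "t < T" "s < T" "0 < t" using s t by (auto simp: E_def)
    let ?d = "\<lambda>x. u t x - u s x"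
    note dV = diff_in[OF sV(2,1)]
    have rV: "r n s \<in> V" "r n t \<in> V" for n using r(1)[of n] sV by (auto simp: simple_into_def)
    let ?y = "\<lambda>n x. r n t x - r n s x"
    have yV: "?y n \<in> V" for n by (intro diff_in rV)
    have yD: "?y n \<in> D" for n
    proof -
      have "r n t \<in> S" "r n s \<in> S"
        using sV unfolding S_def by (intro UN_I[of n] imageI; simp)+
      then show ?thesis unfolding D_def by (intro image_eqI[of _ _ "(r n t, r n s)"]) auto
    qed
    have bd: "ip ?d (?y n) \<le> nrm (?y n) * (sqrt (t - s) * K)" for n
    proof -
      have gi: "set_integrable lebesgue {0..t} (\<lambda>\<tau>. ip (v \<tau>) (?y n))"
        by (rule integrable_MT_Icc[OF L2_time_ip[OF v L2_time_const[OF yV]]]) (use sV in auto)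
      have "ip (u t) (?y n) = c (?y n) + (LINT \<tau>:{0..t}|lebesgue. ip (v \<tau>) (?y n))"
        using t yD[of n] by (simp add: E_def)
      moreover have "ip (u s) (?y n) = c (?y n) + (LINT \<tau>:{0..s}|lebesgue. ip (v \<tau>) (?y n))"
        using s yD[of n] by (simp add: E_def)
      moreover have "(LINT \<tau>:{0..t}|lebesgue. ip (v \<tau>) (?y n)) = (LINT \<tau>:{0..s}|lebesgue. ip (v \<tau>) (?y n)) + (LINT \<tau>:{s..t}|lebesgue. ip (v \<tau>) (?y n))"
        by (rule LINT_combine[OF gi]) (use sV st in auto)
      ultimately have "ip ?d (?y n) = (LINT \<tau>:{s..t}|lebesgue. ip (v \<tau>) (?y n))"
        using ip_diff[OF sV(2,1) yV[of n]] by linarith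
      also have "\<dots> \<le> nrm (?y n) * sqrt ((t - s) * (LINT \<tau>:{s..t}|lebesgue. (nrm (v \<tau>))\<^sup>2))"
        by (rule order_trans[OF abs_ge_self LINT_ip_le[OF v yV]]) (use sV st in auto)
      also have "\<dots> \<le> nrm (?y n) * (sqrt (t - s) * K)"
      proof -
        have "(LINT \<tau>:{s..t}|lebesgue. (nrm (v \<tau>))\<^sup>2) \<le> (LINT \<tau>:{0..T}|lebesgue. (nrm (v \<tau>))\<^sup>2)"
          by (rule LINT_mono_Icc[OF i3]) (use sV in auto)
        then have "sqrt ((t - s) * (LINT \<tau>:{s..t}|lebesgue. (nrm (v \<tau>))\<^sup>2)) \<le> sqrt (t - s) * K"
          unfolding K_def real_sqrt_mult[symmetric] using st by (intro real_sqrt_le_mono mult_left_mono) auto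
        then show ?thesis by (rule mult_left_mono) simp
      qed
      finally show ?thesis .
    qed
    have rt: "(\<lambda>n. nrm (\<lambda>x. u t x - r n t x)) \<longlonglongrightarrow> 0" "(\<lambda>n. nrm (\<lambda>x. u s x - r n s x)) \<longlonglongrightarrow> 0"
      using s t by (auto simp: E_def)
    have ylim: "(\<lambda>n. nrm (\<lambda>x. ?d x - ?y n x)) \<longlonglongrightarrow> 0"
    proof (rule tendsto_sandwich[OF _ _ tendsto_const])
      show "(\<lambda>n. nrm (\<lambda>x. u t x - r n t x) + nrm (\<lambda>x. u s x - r n s x)) \<longlonglongrightarrow> 0"
        using tendsto_add[OF rt] by simp
      have "nrm (\<lambda>x. ?d x - ?y n x) \<le> nrm (\<lambda>x. u t x - r n t x) + nrm (\<lambda>x. u s x - r n s x)" for n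
      proof -
        have "nrm (\<lambda>x. (u t x - r n t x) + (r n s x - u s x)) \<le> nrm (\<lambda>x. u t x - r n t x) + nrm (\<lambda>x. r n s x - u s x)"
          by (intro nrm_triangle diff_in sV rV)
        also have "(\<lambda>x. (u t x - r n t x) + (r n s x - u s x)) = (\<lambda>x. ?d x - ?y n x)" by (auto simp: algebra_simps)
        finally show ?thesis using nrm_minus_commute[OF rV(1)[of n] sV(1)] by simp
      qed
      then show "\<forall>\<^sub>F n in sequentially. nrm (\<lambda>x. ?d x - ?y n x) \<le> nrm (\<lambda>x. u t x - r n t x) + nrm (\<lambda>x. u s x - r n s x)"
        by (intro always_eventually) blast
    qed (simp add: always_eventually)
    have "(\<lambda>n. ip ?d (?y n)) \<longlonglongrightarrow> ip ?d ?d"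
      using ip_tendsto[OF yV dV dV ylim] by (subst ip_sym)
    moreover have "(\<lambda>n. nrm (?y n)) \<longlonglongrightarrow> nrm ?d"
      unfolding nrm_def by (intro tendsto_real_sqrt ip_tendsto2[OF yV dV yV dV ylim ylim])
    \<comment> \<open>In the limit the increment is tested against itself; one factor
      \<open>nrm ?d\<close> is cancelled afterwards.\<close>
    ultimately have "ip ?d ?d \<le> nrm ?d * (sqrt (t - s) * K)"
      using bd by (intro LIMSEQ_le[OF _ tendsto_mult_right]) auto
    then have "nrm ?d * nrm ?d \<le> nrm ?d * (sqrt (t - s) * K)"
      by (simp add: nrm_square[symmetric] power2_eq_square)
    moreover have "0 \<le> sqrt (t - s) * K"
      unfolding K_def set_lebesgue_integral_def using st
      by (intro mult_nonneg_nonneg) (auto intro!: integral_nonneg_AE)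
    ultimately show ?thesis
      using nrm_nonneg[of ?d] by (cases "nrm ?d = 0") auto
  qed
  show thesis
  proof (rule that[OF aeE])
    show "0 < t \<and> t < T \<and> u t \<in> V" if "t \<in> E" for t using that by (auto simp: E_def)
    show "nrm (\<lambda>x. u t x - u s x) \<le> sqrt \<bar>t - s\<bar> * sqrt (LINT \<tau>:{0..T}|lebesgue. (nrm (v \<tau>))\<^sup>2)"
      if "s \<in> E" "t \<in> E" for s t
    proof (cases "s \<le> t")
      case True
      then show ?thesis using le[OF that True] by (simp add: K_def)
    next
      case False
      have "u s \<in> V" "u t \<in> V" using that by (auto simp: E_def)
      then show ?thesis using le[OF that(2,1)] False nrm_minus_commute[of "u t" "u s"] by (simp add: K_def abs_minus_commute)
    qed
  qed
qed

end

context semi_hilbert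
begin

text \<open>\<open>time_value\<close> selects a continuous version, so one has to exist. On the set
  \<open>E\<close> of full measure the function is Hoelder continuous with exponent 1/2, and
  completeness extends it to the closed interval.\<close>

lemma ex_continuous_version:
  assumes u: "u \<in> L2_time V nrm T" and v: "v \<in> L2_time V nrm T" and w: "has_weak_time_deriv V nrm T u v"
    and T: "T > 0"
  shows "\<exists>z. continuous_version V nrm T u z"
proof -
  define K where "K = sqrt (LINT \<tau>:{0..T}|lebesgue. (nrm (v \<tau>))\<^sup>2)"
  have K0: "K \<ge> 0"
    unfolding K_def set_lebesgue_integral_def by (auto intro!: integral_nonneg_AE)
  obtain E where E: "AE t in MT T. t \<in> E" "\<And>t. t \<in> E \<Longrightarrow> 0 < t \<and> t < T \<and> u t \<in> V"
    and inc: "\<And>s t. s \<in> E \<Longrightarrow> t \<in> E \<Longrightarrow> nrm (\<lambda>x. u t x - u s x) \<le> sqrt \<bar>t - s\<bar> * K"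
    using L2_time_increment[OF u v w T] unfolding K_def by blast
  have dense: "\<exists>s\<in>E. \<bar>s - t\<bar> < e" if "t \<in> {0..T}" "e > 0" for t e
    using AE_MT_dense[OF E(1) _ _ T, of t e] that by auto
  have lim: "\<exists>L\<in>V. \<forall>s\<in>E. nrm (\<lambda>x. u s x - L x) \<le> sqrt \<bar>s - t\<bar> * K" if t: "t \<in> {0..T}" for t
  proof -
    have "\<exists>s. \<forall>n. s n \<in> E \<and> \<bar>s n - t\<bar> < inverse (real (Suc n))"
      by (intro choice allI) (use dense[OF t] in \<open>auto simp: Bex_def\<close>)
    then obtain s where sE: "\<And>n. s n \<in> E" and sd: "\<And>n. \<bar>s n - t\<bar> < inverse (real (Suc n))" by blast
    have sV: "u (s n) \<in> V" for n using E(2)[OF sE] by simp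
    have slim: "s \<longlonglongrightarrow> t"
    proof (rule LIM_zero_cancel, rule tendsto_rabs_zero_cancel)
      show "(\<lambda>n. \<bar>s n - t\<bar>) \<longlonglongrightarrow> 0"
        by (rule tendsto_sandwich[OF _ always_eventually[OF allI[OF less_imp_le[OF sd]]]
              tendsto_const LIMSEQ_inverse_real_of_nat]) simp
    qed
    obtain L where L: "L \<in> V" "(\<lambda>n. nrm (\<lambda>x. u (s n) x - L x)) \<longlonglongrightarrow> 0"
    proof (rule complete_nrm[of "\<lambda>n. u (s n)", OF sV])
      fix e :: real assume e: "e > 0"
      have "Cauchy s" using slim by (rule LIMSEQ_imp_Cauchy)
      \<comment> \<open>\<open>K\<close> may be 0, hence \<open>K + 1\<close>; the square undoes the
        Hoelder exponent 1/2.\<close>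
      moreover have "(e / (K + 1))\<^sup>2 > 0" using e K0 by (intro zero_less_power divide_pos_pos) auto
      ultimately obtain k where k: "\<And>i j. i \<ge> k \<Longrightarrow> j \<ge> k \<Longrightarrow> dist (s i) (s j) < (e / (K + 1))\<^sup>2"
        unfolding Cauchy_def by blast
      show "\<exists>k. \<forall>i\<ge>k. \<forall>j\<ge>k. nrm (\<lambda>x. u (s i) x - u (s j) x) < e"
      proof (intro exI allI impI)
        fix i j assume "i \<ge> k" "j \<ge> k"
        from k[OF this] have "sqrt \<bar>s i - s j\<bar> < sqrt ((e / (K + 1))\<^sup>2)"
          by (intro real_sqrt_less_mono) (simp add: dist_real_def)
        also have "\<dots> = e / (K + 1)" using e K0 by simp
        finally have "sqrt \<bar>s i - s j\<bar> * (K + 1) < e" using K0 by (simp add: field_simps)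
        moreover have "nrm (\<lambda>x. u (s i) x - u (s j) x) \<le> sqrt \<bar>s i - s j\<bar> * (K + 1)"
          by (rule order_trans[OF inc[OF sE sE]]) (simp add: mult_left_mono)
        ultimately show "nrm (\<lambda>x. u (s i) x - u (s j) x) < e" by linarith
      qed
    qed blast
    show ?thesis
    proof (intro bexI[OF _ L(1)] ballI)
      fix \<tau> assume \<tau>: "\<tau> \<in> E"
      have \<tau>V: "u \<tau> \<in> V" using E(2)[OF \<tau>] by simp
      have le: "nrm (\<lambda>x. u \<tau> x - L x) \<le> sqrt \<bar>\<tau> - s n\<bar> * K + nrm (\<lambda>x. u (s n) x - L x)" for n
        using nrm_diff_triangle[OF \<tau>V sV L(1), of n] inc[OF sE \<tau>, of n] by linarith
      have "(\<lambda>n. sqrt \<bar>\<tau> - s n\<bar> * K + nrm (\<lambda>x. u (s n) x - L x)) \<longlonglongrightarrow> sqrt \<bar>\<tau> - t\<bar> * K + 0"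
        by (intro tendsto_intros slim L(2))
      then have "nrm (\<lambda>x. u \<tau> x - L x) \<le> sqrt \<bar>\<tau> - t\<bar> * K + 0"
        using le by (intro LIMSEQ_le_const) auto
      then show "nrm (\<lambda>x. u \<tau> x - L x) \<le> sqrt \<bar>\<tau> - t\<bar> * K" by simp
    qed
  qed
  have "\<exists>z. \<forall>t\<in>{0..T}. z t \<in> V \<and> (\<forall>s\<in>E. nrm (\<lambda>x. u s x - z t x) \<le> sqrt \<bar>s - t\<bar> * K)"
    by (rule bchoice) (use lim in blast)
  then obtain z where zV: "\<And>t. t \<in> {0..T} \<Longrightarrow> z t \<in> V"
    and z: "\<And>s t. t \<in> {0..T} \<Longrightarrow> s \<in> E \<Longrightarrow> nrm (\<lambda>x. u s x - z t x) \<le> sqrt \<bar>s - t\<bar> * K"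
    by blast
  have zz: "nrm (\<lambda>x. z \<tau> x - z t x) \<le> (sqrt (2 * \<bar>\<tau> - t\<bar>) + sqrt \<bar>\<tau> - t\<bar>) * K"
    if t: "t \<in> {0..T}" and \<tau>: "\<tau> \<in> {0..T}" "\<tau> \<noteq> t" for t \<tau>
  proof -
    \<comment> \<open>An intermediate time in \<open>E\<close> that is nearer to \<open>t\<close>
      than \<tau> is; its distance to \<tau> is then at most twice the distance of \<tau> and
      \<open>t\<close>.\<close>
    obtain s where s: "s \<in> E" "\<bar>s - t\<bar> < \<bar>\<tau> - t\<bar>" using dense[OF t, of "\<bar>\<tau> - t\<bar>"] \<tau> by auto
    have sV: "u s \<in> V" using E(2)[OF s(1)] by simp
    have "nrm (\<lambda>x. z \<tau> x - z t x) \<le> nrm (\<lambda>x. z \<tau> x - u s x) + nrm (\<lambda>x. u s x - z t x)"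
      by (rule nrm_diff_triangle[OF zV[OF \<tau>(1)] sV zV[OF t]])
    also have "\<dots> \<le> sqrt \<bar>s - \<tau>\<bar> * K + sqrt \<bar>s - t\<bar> * K"
      using z[OF t s(1)] z[OF \<tau>(1) s(1)] nrm_minus_commute[OF zV[OF \<tau>(1)] sV] by linarith
    also have "\<dots> \<le> sqrt (2 * \<bar>\<tau> - t\<bar>) * K + sqrt \<bar>\<tau> - t\<bar> * K"
    proof -
      have "\<bar>s - \<tau>\<bar> \<le> 2 * \<bar>\<tau> - t\<bar>" using s(2) abs_triangle_ineq4[of "s - t" "\<tau> - t"] by simp
      then show ?thesis using s(2) K0 by (intro add_mono mult_right_mono real_sqrt_le_mono) auto
    qed
    finally show ?thesis by (simp add: distrib_right)
  qed
  show ?thesis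
    unfolding continuous_version_def
  proof (intro exI[of _ z] conjI ballI)
    fix t assume t: "t \<in> {0..T}"
    show "z t \<in> V" by (rule zV[OF t])
    have "((\<lambda>\<tau>. (sqrt (2 * \<bar>\<tau> - t\<bar>) + sqrt \<bar>\<tau> - t\<bar>) * K) \<longlongrightarrow> (sqrt (2 * \<bar>t - t\<bar>) + sqrt \<bar>t - t\<bar>) * K) (at t within {0..T})"
      by (intro tendsto_intros)
    then have l0: "((\<lambda>\<tau>. (sqrt (2 * \<bar>\<tau> - t\<bar>) + sqrt \<bar>\<tau> - t\<bar>) * K) \<longlongrightarrow> 0) (at t within {0..T})" by simp
    show "((\<lambda>\<tau>. nrm (\<lambda>x. z \<tau> x - z t x)) \<longlongrightarrow> 0) (at t within {0..T})"
    proof (rule tendsto_sandwich[OF _ _ tendsto_const l0])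
      show "\<forall>\<^sub>F \<tau> in at t within {0..T}. nrm (\<lambda>x. z \<tau> x - z t x) \<le> (sqrt (2 * \<bar>\<tau> - t\<bar>) + sqrt \<bar>\<tau> - t\<bar>) * K"
        using zz[OF t] by (auto simp: eventually_at_filter)
    qed (simp add: always_eventually)
  next
    show "AE t in MT T. nrm (\<lambda>x. u t x - z t x) = 0"
      using E(1)
    proof eventually_elim
      case (elim t)
      have "t \<in> {0..T}" using E(2)[OF elim] by simp
      from z[OF this elim] show ?case using nrm_nonneg[of "\<lambda>x. u t x - z t x"] by simp
    qed
  qed
qed

end

lemma continuous_AE_zero:
  fixes F :: "real \<Rightarrow> real"
  assumes F: "continuous_on {0..T} F" and ae: "AE t in MT T. F t = 0" and T: "T > 0" and t: "t \<in> {0..T}"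
  shows "F t = 0"
proof (rule ccontr)
  assume "F t \<noteq> 0"
  then have "\<bar>F t\<bar> > 0" by simp
  then obtain d where d: "d > 0" "\<And>s. s \<in> {0..T} \<Longrightarrow> dist s t < d \<Longrightarrow> dist (F s) (F t) < \<bar>F t\<bar>"
    using F t unfolding continuous_on_iff by blast
  obtain s where s: "0 < s" "s < T" "\<bar>s - t\<bar> < d" "F s = 0"
    using AE_MT_dense[OF ae _ _ T d(1), of t] t by auto
  then show False using d(2)[of s] by (simp add: dist_real_def)
qed

context semi_inner
begin

lemma continuous_versionD:
  assumes "continuous_version V nrm T u z"
  shows "\<And>t. 0 \<le> t \<Longrightarrow> t \<le> T \<Longrightarrow> z t \<in> V" "AE t in MT T. nrm (\<lambda>x. u t x - z t x) = 0"
    "\<And>t. 0 \<le> t \<Longrightarrow> t \<le> T \<Longrightarrow> ((\<lambda>\<tau>. nrm (\<lambda>x. z \<tau> x - z t x)) \<longlongrightarrow> 0) (at t within {0..T})"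
  using assms by (auto simp: continuous_version_def)

lemma continuous_version_ip:
  assumes z: "continuous_version V nrm T u z" and y: "y \<in> V"
  shows "continuous_on {0..T} (\<lambda>t. ip (z t) y)"
  unfolding continuous_on_def
proof
  fix t assume t: "t \<in> {0..T}"
  note zD = continuous_versionD[OF z]
  let ?b = "\<lambda>\<tau>. nrm (\<lambda>x. z \<tau> x - z t x) * nrm y"
  have l: "(?b \<longlongrightarrow> 0) (at t within {0..T})"
    by (rule tendsto_mult_left_zero) (use zD(3) t in auto)
  have b: "\<forall>\<^sub>F \<tau> in at t within {0..T}. \<bar>ip (z \<tau>) y - ip (z t) y\<bar> \<le> ?b \<tau>"
    unfolding eventually_at_filter
  proof (rule always_eventually, intro allI impI)
    fix \<tau> assume "\<tau> \<noteq> t" "\<tau> \<in> {0..T}"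
    then have "z \<tau> \<in> V" "z t \<in> V" using zD(1) t by auto
    then show "\<bar>ip (z \<tau>) y - ip (z t) y\<bar> \<le> ?b \<tau>"
      using Cauchy_Schwarz[OF diff_in y, of "z \<tau>" "z t"] y by (simp add: ip_diff)
  qed
  show "((\<lambda>\<tau>. ip (z \<tau>) y) \<longlongrightarrow> ip (z t) y) (at t within {0..T})"
    by (rule LIM_zero_cancel, rule tendsto_rabs_zero_cancel, rule tendsto_sandwich[OF _ b tendsto_const l]) simp
qed

lemma continuous_version_AE_ip:
  assumes u: "u \<in> L2_time V nrm T" and z: "continuous_version V nrm T u z"
  shows "AE t in MT T. u t \<in> V \<and> z t \<in> V \<and> (\<forall>y\<in>V. ip (u t) y = ip (z t) y)"
  using L2_timeD(2)[OF u] continuous_versionD(2)[OF z] AE_space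
proof eventually_elim
  case (elim t)
  then have "z t \<in> V" using continuous_versionD(1)[OF z, of t] by simp
  then show ?case using elim by (auto intro!: ip_cong_nrm)
qed

text \<open>Both sides are continuous in time and agree up to a constant for almost every time,
  hence for all times; the constant cancels in the increment. The identity thus holds for every pair
  of times, without an exceptional set depending on \<open>y\<close>.\<close>

lemma continuous_version_increment:
  assumes u: "u \<in> L2_time V nrm T" and v: "v \<in> L2_time V nrm T" and w: "has_weak_time_deriv V nrm T u v"
    and T: "T > 0" and z: "continuous_version V nrm T u z"
    and st: "0 \<le> s" "s \<le> t" "t \<le> T" and y: "y \<in> V"
  shows "ip (\<lambda>x. z t x - z s x) y = (LINT \<tau>:{s..t}|lebesgue. ip (v \<tau>) y)"
proof -
  let ?g = "\<lambda>\<tau>. ip (v \<tau>) y" and ?G = "\<lambda>t. LINT \<tau>:{0..t}|lebesgue. ip (v \<tau>) y"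
  obtain c where c: "AE t in MT T. ip (u t) y = c + ?G t" by (rule weak_time_deriv_ip[OF u v w y T])
  have gi: "set_integrable lebesgue {0..T} ?g"
    by (rule integrable_MT_Icc[OF L2_time_ip[OF v L2_time_const[OF y]]]) auto
  have "prim 0 T ?g ?G"
    by (rule primI[OF gi]) (simp only: LINT_point add_0)
  then have "continuous_on {0..T} ?G" by (rule prim_continuous_on)
  then have cont: "continuous_on {0..T} (\<lambda>t. ip (z t) y - c - ?G t)"
    by (intro continuous_intros continuous_version_ip[OF z y])
  have "AE t in MT T. ip (z t) y - c - ?G t = 0"
    using continuous_version_AE_ip[OF u z] c by eventually_elim (use y in simp)
  then have eq: "ip (z t) y = c + ?G t" if "t \<in> {0..T}" for t
    using continuous_AE_zero[OF cont _ T that] by simp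
  have "?G t = ?G s + (LINT \<tau>:{s..t}|lebesgue. ip (v \<tau>) y)"
    by (rule LINT_combine) (use st in \<open>auto intro: set_integrable_subset[OF gi]\<close>)
  then show ?thesis
    using eq[of t] eq[of s] st continuous_versionD(1)[OF z] y by (simp add: ip_diff)
qed

lemma continuous_version_nrm_increment:
  assumes u: "u \<in> L2_time V nrm T" and v: "v \<in> L2_time V nrm T" and w: "has_weak_time_deriv V nrm T u v"
    and T: "T > 0" and z: "continuous_version V nrm T u z"
    and st: "0 \<le> s" "s \<le> t" "t \<le> T"
  shows "(nrm (\<lambda>x. z t x - z s x))\<^sup>2 \<le> (t - s) * (LINT \<tau>:{s..t}|lebesgue. (nrm (v \<tau>))\<^sup>2)"
proof -
  let ?d = "\<lambda>x. z t x - z s x" and ?R = "(t - s) * (LINT \<tau>:{s..t}|lebesgue. (nrm (v \<tau>))\<^sup>2)"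
  have R0: "0 \<le> ?R"
    using st unfolding set_lebesgue_integral_def by (intro mult_nonneg_nonneg integral_nonneg_AE) auto
  have dV: "?d \<in> V" by (intro diff_in continuous_versionD(1)[OF z]) (use st in auto)
  have "(nrm ?d)\<^sup>2 = (LINT \<tau>:{s..t}|lebesgue. ip (v \<tau>) ?d)"
    unfolding nrm_square by (rule continuous_version_increment[OF u v w T z st dV])
  also have "\<dots> \<le> nrm ?d * sqrt ?R"
    by (rule order_trans[OF abs_ge_self LINT_ip_le[OF v dV st]])
  finally have "nrm ?d * nrm ?d \<le> nrm ?d * sqrt ?R" by (simp only: power2_eq_square)
  then have "nrm ?d \<le> sqrt ?R"
    using nrm_nonneg[of ?d] R0 by (cases "nrm ?d = 0") auto
  then show ?thesis using R0 nrm_nonneg[of ?d] by (metis real_sqrt_le_iff real_sqrt_unique real_sqrt_pow2 power_mono)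
qed

end

section \<open>Difference quotients in time\<close>

text \<open>Translation telescopes: of the integrated difference only the windows of length
  \<open>h\<close> at the two ends survive. Divided by \<open>h\<close> they become averages, so
  this is a discrete fundamental theorem of calculus.\<close>

lemma LINT_shift:
  fixes F :: "real \<Rightarrow> real"
  assumes F: "set_integrable lebesgue {-h..T} F" and h: "0 \<le> h" "h \<le> T"
  shows "set_integrable lebesgue {0..T} (\<lambda>t. F (t - h))"
    and "(LINT t:{0..T}|lebesgue. F t - F (t - h)) = (LINT t:{T-h..T}|lebesgue. F t) - (LINT t:{-h..0}|lebesgue. F t)"
proof -
  have i1: "set_integrable lebesgue {-h..T-h} F"
    by (rule set_integrable_subset[OF F]) (use h in auto)
  have i2: "set_integrable lebesgue {0..T} F"
    by (rule set_integrable_subset[OF F]) (use h in auto)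
  have eq: "indicat_real {-h..T-h} (- h + 1 * t) *\<^sub>R F (- h + 1 * t) = indicator {0..T} t *\<^sub>R F (t - h)" for t
    by (auto simp: indicator_def)
  show i: "set_integrable lebesgue {0..T} (\<lambda>t. F (t - h))"
    using lebesgue_integrable_real_affine[of "\<lambda>x. indicat_real {-h..T-h} x *\<^sub>R F x" 1 "-h"] i1
    unfolding set_integrable_def eq by simp
  have s: "(LINT t:{-h..T-h}|lebesgue. F t) = (LINT t:{0..T}|lebesgue. F (t - h))"
    using lebesgue_integral_real_affine[of 1 "\<lambda>x. indicat_real {-h..T-h} x *\<^sub>R F x" "-h"]
    unfolding set_lebesgue_integral_def eq by simp
  have "(LINT t:{0..T}|lebesgue. F t - F (t - h)) = (LINT t:{0..T}|lebesgue. F t) - (LINT t:{-h..T-h}|lebesgue. F t)"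
    unfolding s by (rule set_integral_diff(2)[OF i2 i])
  also have "\<dots> = (LINT t:{T-h..T}|lebesgue. F t) - (LINT t:{-h..0}|lebesgue. F t)"
    using LINT_combine[OF F, of 0] LINT_combine[OF F, of "T - h"] h by simp
  finally show "(LINT t:{0..T}|lebesgue. F t - F (t - h)) = (LINT t:{T-h..T}|lebesgue. F t) - (LINT t:{-h..0}|lebesgue. F t)" .
qed

lemma AE_shift:
  assumes "AE t in lebesgue. P (t :: real)"
  shows "AE t in lebesgue. P (t - h)"
proof -
  have N: "negligible {t. \<not> P t}"
    using assms by (simp add: eventually_ae_filter negligible_iff_null_sets)
      (metis completion.complete2 mem_Collect_eq subsetI)
  have "(+) h ` {t. \<not> P t} = {t. \<not> P (t - h)}"
    by (auto simp: image_iff) (metis add.commute diff_add_cancel)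
  then have "{t. \<not> P (t - h)} \<in> null_sets lebesgue"
    using negligible_translation[OF N, of h] by (simp add: negligible_iff_null_sets)
  then show ?thesis by (rule AE_I') auto
qed

lemma avg_tendsto:
  fixes F :: "real \<Rightarrow> real"
  assumes F: "continuous_on {a..b} F" and ab: "a < b" and h: "\<And>n. h n > 0" "h \<longlonglongrightarrow> 0"
  shows "(\<lambda>n. (LINT t:{b - h n..b}|lebesgue. F t) / h n) \<longlonglongrightarrow> F b"
proof (rule LIMSEQ_I)
  fix e :: real assume e: "e > 0"
  obtain d where d: "d > 0" "\<And>t. t \<in> {a..b} \<Longrightarrow> dist t b < d \<Longrightarrow> dist (F t) (F b) < e / 2"
    using F ab e unfolding continuous_on_iff by (metis atLeastAtMost_iff half_gt_zero less_imp_le order_refl)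
  have "\<forall>\<^sub>F n in sequentially. h n < min d (b - a)"
    using h(2) by (rule order_tendstoD) (use d ab in simp)
  then obtain N where N: "\<And>n. n \<ge> N \<Longrightarrow> h n < min d (b - a)"
    by (auto simp: eventually_sequentially)
  show "\<exists>no. \<forall>n\<ge>no. norm ((LINT t:{b - h n..b}|lebesgue. F t) / h n - F b) < e"
  proof (intro exI allI impI)
    fix n assume "n \<ge> N"
    from N[OF this] have hn: "h n < d" "h n < b - a" by auto
    let ?I = "{b - h n..b}"
    have c: "continuous_on ?I F" by (rule continuous_on_subset[OF F]) (use hn in auto)
    have i: "set_integrable lebesgue ?I F" "set_integrable lebesgue ?I (\<lambda>t. K)" for K :: real
      by (intro absolutely_integrable_continuous_real c continuous_intros)+
    have k: "(LINT t:?I|lebesgue. K) = h n * K" for K :: real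
      using h(1)[of n] by (simp add: set_lebesgue_integral_def)
    have "(LINT t:?I|lebesgue. F t) / h n - F b = (LINT t:?I|lebesgue. F t - F b) / h n"
      using set_integral_diff(2)[OF i(1) i(2)[of "F b"]] k[of "F b"] h(1)[of n] by (simp add: field_simps)
    moreover have "\<bar>LINT t:?I|lebesgue. F t - F b\<bar> \<le> (LINT t:?I|lebesgue. \<bar>F t - F b\<bar>)"
      using set_integral_norm_bound[OF set_integral_diff(1)[OF i(1) i(2)[of "F b"]]] by simp
    moreover have "(LINT t:?I|lebesgue. \<bar>F t - F b\<bar>) \<le> (LINT t:?I|lebesgue. e / 2)"
    proof (rule set_integral_mono[OF set_integrable_abs[OF set_integral_diff(1)[OF i(1) i(2)]] i(2)])
      fix t assume "t \<in> ?I"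
      then show "\<bar>F t - F b\<bar> \<le> e / 2" using d(2)[of t] hn h(1)[of n] by (simp add: dist_real_def)
    qed
    ultimately have "\<bar>(LINT t:?I|lebesgue. F t) / h n - F b\<bar> \<le> e / 2"
      using h(1)[of n] k[of "e/2"] by (simp add: abs_divide divide_le_eq mult.commute)
    then show "norm ((LINT t:?I|lebesgue. F t) / h n - F b) < e" using e by simp
  qed
qed

lemma am_gm: "x * y \<le> (p * x\<^sup>2 + y\<^sup>2 / p) / 2" if "p > 0" for x y p :: real
proof -
  have "0 \<le> (p * x - y)\<^sup>2" by simp
  then have "2 * (p * x * y) \<le> p\<^sup>2 * x\<^sup>2 + y\<^sup>2" by (simp add: power2_eq_square algebra_simps)
  then have "2 * (p * x * y) / p \<le> (p\<^sup>2 * x\<^sup>2 + y\<^sup>2) / p" using that by (intro divide_right_mono) auto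
  then show ?thesis using that by (simp add: power2_eq_square field_simps)
qed

text \<open>\<open>u\<close> is the given function, \<open>v\<close> its weak time derivative and
  \<open>z\<close> its continuous representative. Differences are taken of \<open>z\<close>, since
  it has a determined value at every time, the end points included.\<close>

locale time_regular = semi_inner +
  fixes T :: real and u v z :: "real \<Rightarrow> real \<Rightarrow> real"
  assumes T: "T > 0" and u: "u \<in> L2_time V nrm T" and v: "v \<in> L2_time V nrm T"
    and w: "has_weak_time_deriv V nrm T u v" and z: "continuous_version V nrm T u z"
begin

text \<open>The extension by zero to negative times lets the windows \<open>{t - h..t}\<close> cross \<open>0\<close>.\<close>

definition q0 :: "real \<Rightarrow> real" where "q0 \<tau> = indicator {0..T} \<tau> * (nrm (v \<tau>))\<^sup>2"
definition Kf :: "real \<Rightarrow> real" where "Kf t = (LINT \<tau>:{-T..t}|lebesgue. q0 \<tau>)"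
text \<open>Below time 0 the representative is frozen at \<open>z 0\<close>, consistently with a
  derivative that is zero there; for \<open>t < h\<close> the increment is the one over
  [0,t].\<close>

definition dz :: "real \<Rightarrow> real \<Rightarrow> real \<Rightarrow> real" where "dz h t = (\<lambda>x. z t x - z (max 0 (t - h)) x)"

section \<open>Increments of the representative and their energy\<close>

lemma zV: "0 \<le> t \<Longrightarrow> t \<le> T \<Longrightarrow> z t \<in> V"
  by (rule continuous_versionD(1)[OF z])

lemma dzV: "0 \<le> t \<Longrightarrow> t \<le> T \<Longrightarrow> h \<ge> 0 \<Longrightarrow> dz h t \<in> V"
  unfolding dz_def by (intro diff_in zV) auto

lemma prim_Kf: "prim (-T) T q0 Kf"
proof (rule primI)
  have "set_integrable lebesgue {0..T} (\<lambda>\<tau>. (nrm (v \<tau>))\<^sup>2)"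
    by (rule integrable_MT_Icc[OF L2_time_nrm(1)[OF v]]) auto
  moreover have "indicat_real {-T..T} \<tau> *\<^sub>R q0 \<tau> = indicator {0..T} \<tau> *\<^sub>R (nrm (v \<tau>))\<^sup>2" for \<tau>
    using T by (auto simp: q0_def indicator_def)
  ultimately show "set_integrable lebesgue {-T..T} q0" by (simp add: set_integrable_def)
qed (simp only: Kf_def LINT_point add_0)

lemma Kf_mono: "-T \<le> s \<Longrightarrow> s \<le> t \<Longrightarrow> t \<le> T \<Longrightarrow> Kf s \<le> Kf t"
proof -
  assume st: "-T \<le> s" "s \<le> t" "t \<le> T"
  have "Kf t - Kf s = (LINT \<tau>:{s..t}|lebesgue. q0 \<tau>)" by (rule prim_diff[OF prim_Kf st])
  also have "\<dots> \<ge> 0" unfolding set_lebesgue_integral_def q0_def by (rule integral_nonneg_AE) simp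
  finally show ?thesis by simp
qed

lemma Kf_nonneg: "-T \<le> t \<Longrightarrow> t \<le> T \<Longrightarrow> 0 \<le> Kf t"
  using Kf_mono[of "-T" t] unfolding Kf_def[of "-T"] by (simp only: LINT_point)

lemma dz_bound:
  assumes h: "0 \<le> h" "h \<le> T" and t: "0 \<le> t" "t \<le> T"
  shows "(nrm (dz h t))\<^sup>2 \<le> h * (Kf t - Kf (t - h))"
proof -
  let ?s = "max 0 (t - h)"
  have s: "0 \<le> ?s" "?s \<le> t" using h t by auto
  have "(nrm (dz h t))\<^sup>2 \<le> (t - ?s) * (LINT \<tau>:{?s..t}|lebesgue. (nrm (v \<tau>))\<^sup>2)"
    unfolding dz_def by (rule continuous_version_nrm_increment[OF u v w T z s t(2)])
  also have "(LINT \<tau>:{?s..t}|lebesgue. (nrm (v \<tau>))\<^sup>2) = (LINT \<tau>:{?s..t}|lebesgue. q0 \<tau>)"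
    by (rule set_lebesgue_integral_cong) (use s t in \<open>auto simp: q0_def\<close>)
  also have "\<dots> = Kf t - Kf ?s"
    by (rule prim_diff[OF prim_Kf, symmetric]) (use s t T in auto)
  also have "(t - ?s) * (Kf t - Kf ?s) \<le> h * (Kf t - Kf (t - h))"
    using h t T Kf_mono[of "t - h" ?s] Kf_mono[of ?s t] s by (intro mult_mono) auto
  finally show ?thesis .
qed

text \<open>Together with \<open>dz_bound\<close> this bounds the integral of |dz/h|^2 by
  \<open>Kf T\<close> for all step sizes at once. Translation leaves only the window of length
  \<open>h\<close> next to \<open>T\<close>, since the window before 0 contributes with a favourable
  sign.\<close>

lemma Kf_shift:
  assumes h: "0 < h" "h \<le> T"
  shows "integrable (MT T) (\<lambda>t. Kf t - Kf (t - h))" "(\<integral>t. Kf t - Kf (t - h) \<partial>MT T) \<le> h * Kf T"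
    "t \<in> {0..T} \<Longrightarrow> 0 \<le> Kf t - Kf (t - h)"
proof -
  have c: "continuous_on {-T..T} Kf" by (rule prim_continuous_on[OF prim_Kf])
  have i: "set_integrable lebesgue {s..t} Kf" if "-T \<le> s" "t \<le> T" for s t
    using that by (intro absolutely_integrable_continuous_real continuous_on_subset[OF c]) auto
  note sh = LINT_shift[OF i[of "-h" T] less_imp_le[OF h(1)] h(2)]
  show "integrable (MT T) (\<lambda>t. Kf t - Kf (t - h))"
    unfolding integrable_MT_iff
    by (rule set_integrable_subset[of _ "{0..T}"], rule set_integral_diff(1)[OF i sh(1)]) (use h T in auto)
  have "(\<integral>t. Kf t - Kf (t - h) \<partial>MT T) = (LINT t:{T-h..T}|lebesgue. Kf t) - (LINT t:{-h..0}|lebesgue. Kf t)"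
    unfolding integral_MT_Icc using sh(2) h by simp
  also have "(LINT t:{-h..0}|lebesgue. Kf t) \<ge> 0"
    unfolding set_lebesgue_integral_def
    by (rule integral_nonneg_AE) (use h T in \<open>auto simp: indicator_def intro!: Kf_nonneg\<close>)
  then have "(LINT t:{T-h..T}|lebesgue. Kf t) - (LINT t:{-h..0}|lebesgue. Kf t) \<le> (LINT t:{T-h..T}|lebesgue. Kf t)" by simp
  also have "\<dots> \<le> (LINT t:{T-h..T}|lebesgue. Kf T)"
  proof (rule set_integral_mono)
    show "set_integrable lebesgue {T-h..T} Kf" by (rule i) (use h T in auto)
    show "set_integrable lebesgue {T-h..T} (\<lambda>t. Kf T)"
      by (intro absolutely_integrable_continuous_real continuous_intros)
  qed (use h T in \<open>auto intro!: Kf_mono\<close>)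
  also have "\<dots> = h * Kf T" using h by (simp add: set_lebesgue_integral_def)
  finally show "(\<integral>t. Kf t - Kf (t - h) \<partial>MT T) \<le> h * Kf T" .
  show "t \<in> {0..T} \<Longrightarrow> 0 \<le> Kf t - Kf (t - h)" using Kf_mono[of "t - h" t] h T by simp
qed

lemma continuous_z_max: "y \<in> V \<Longrightarrow> continuous_on {-T..T} (\<lambda>t. ip (z (max 0 t)) y)"
  using T by (intro continuous_on_compose2[OF continuous_version_ip[OF z], of y "{-T..T}" "\<lambda>t. max 0 t"] continuous_intros) auto

lemma ip_dz:
  assumes y: "y \<in> V" and h: "0 \<le> h" and t: "0 \<le> t" "t \<le> T"
  shows "ip (dz h t) y = ip (z (max 0 t)) y - ip (z (max 0 (t - h))) y"
  unfolding dz_def using t h by (subst ip_diff) (auto intro!: zV y simp: max_def)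

lemma integrable_ip_dz:
  assumes y: "y \<in> V" and h: "0 \<le> h" "h \<le> T"
  shows "integrable (MT T) (\<lambda>t. ip (dz h t) y)"
proof -
  note c = continuous_z_max[OF y]
  have i: "set_integrable lebesgue {s..t} (\<lambda>t. ip (z (max 0 t)) y)" if "-T \<le> s" "t \<le> T" for s t
    using that by (intro absolutely_integrable_continuous_real continuous_on_subset[OF c]) auto
  note sh = LINT_shift[OF i[of "-h" T] h]
  have "set_integrable lebesgue {0..T} (\<lambda>t. ip (z (max 0 t)) y - ip (z (max 0 (t - h))) y)"
    by (rule set_integral_diff(1)[OF i sh(1)]) (use h T in auto)
  then have "integrable (MT T) (\<lambda>t. ip (z (max 0 t)) y - ip (z (max 0 (t - h))) y)"
    unfolding integrable_MT_iff by (rule set_integrable_subset) auto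
  then show ?thesis
    by (rule Bochner_Integration.integrable_cong[THEN iffD1, rotated 2]) (use ip_dz[OF y h(1)] in auto)
qed

text \<open>Young's inequality with a free parameter \<open>p\<close>, so that either factor can be
  made small. The increment enters the right-hand side only through \<open>Kf\<close>, whose
  difference quotient has an integral bounded uniformly in \<open>h\<close>.\<close>

lemma ip_dz_le:
  assumes g: "g \<in> V" and h: "0 < h" "h \<le> T" and t: "0 \<le> t" "t \<le> T" and p: "p > 0"
  shows "\<bar>ip g (dz h t)\<bar> / h \<le> (p * (nrm g)\<^sup>2 + (Kf t - Kf (t - h)) / h / p) / 2"
proof -
  have "\<bar>ip g (dz h t)\<bar> / h \<le> nrm g * (nrm (dz h t) / h)"
    using Cauchy_Schwarz[OF g dzV[OF t less_imp_le[OF h(1)]]] h by (simp add: divide_right_mono)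
  also have "\<dots> \<le> (p * (nrm g)\<^sup>2 + (nrm (dz h t) / h)\<^sup>2 / p) / 2" by (rule am_gm[OF p])
  also have "(nrm (dz h t) / h)\<^sup>2 \<le> (Kf t - Kf (t - h)) / h"
    using dz_bound[OF less_imp_le[OF h(1)] h(2) t] h by (simp add: power_divide power2_eq_square divide_le_eq mult.commute)
  then have "(p * (nrm g)\<^sup>2 + (nrm (dz h t) / h)\<^sup>2 / p) / 2 \<le> (p * (nrm g)\<^sup>2 + (Kf t - Kf (t - h)) / h / p) / 2"
    using p by (intro divide_right_mono add_left_mono) auto
  finally show ?thesis .
qed

text \<open>On a ray the integrated quotients telescope into averages of \<open>ip (z t) y\<close>,
  which converge by continuity. All measurable sets follow by the induction principle; in a disjoint
  union the tail has to be small uniformly in the step size, which the energy bound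
  provides.\<close>

lemma difference_quotient_indicator:
  assumes h: "\<And>n. 0 < h n" "\<And>n. h n \<le> T" "h \<longlonglongrightarrow> 0" and y: "y \<in> V" and E: "E \<in> sets lebesgue"
  shows "(\<lambda>n. \<integral>t. indicator E t * (ip (dz (h n) t) y / h n) \<partial>MT T) \<longlonglongrightarrow> (\<integral>t. indicator E t * ip (v t) y \<partial>MT T)"
proof -
  define g where "g n t = ip (dz (h n) t) y / h n" for n t
  define f where "f t = ip (v t) y" for t
  have gi: "integrable (MT T) (g n)" for n
    unfolding g_def using integrable_ip_dz[OF y less_imp_le[OF h(1)] h(2)] by simp
  have fi: "integrable (MT T) f" unfolding f_def by (intro L2_time_ip v L2_time_const y)
  have indm: "indicat_real A \<in> borel_measurable (MT T)" if "A \<in> sets lebesgue" for A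
    by (rule measurable_restrict_space1[OF borel_measurable_indicator[OF that]])
  have ind: "integrable (MT T) (\<lambda>t. indicat_real A t * k t)" if "A \<in> sets lebesgue" "integrable (MT T) k" for A and k :: "real \<Rightarrow> real"
    by (rule Bochner_Integration.integrable_bound[OF that(2)])
       (use borel_measurable_times[OF indm[OF that(1)] borel_measurable_integrable[OF that(2)]] in \<open>auto simp: indicator_def\<close>)
  have Iio: "(\<lambda>n. \<integral>t. indicat_real {..<c} t * g n t \<partial>MT T) \<longlonglongrightarrow> (\<integral>t. indicator {..<c} t * f t \<partial>MT T)" for c
  proof (cases "c \<le> 0")
    case True
    have "(\<integral>t. indicat_real {..<c} t * k t \<partial>MT T) = 0" for k :: "real \<Rightarrow> real"
      by (rule integral_eq_zero_AE, rule AE_I2) (use True in auto)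
    then show ?thesis by simp
  next
    case False
    define d where "d = min c T"
    have d: "0 < d" "d \<le> T" using False T by (auto simp: d_def)
    have red: "(\<integral>t. indicat_real {..<c} t * k t \<partial>MT T) = (LINT t:{0..d}|lebesgue. k t)" for k :: "real \<Rightarrow> real"
    proof -
      have "(\<integral>t. indicat_real {..<c} t * k t \<partial>MT T) = (\<integral>t. indicator {0<..<T} t *\<^sub>R (indicat_real {..<c} t * k t) \<partial>lebesgue)"
        by (simp add: integral_MT[symmetric] set_lebesgue_integral_def)
      also have "\<dots> = (\<integral>t. indicator {0<..<d} t *\<^sub>R k t \<partial>lebesgue)"
        by (rule Bochner_Integration.integral_cong) (auto simp: indicator_def d_def)
      also have "\<dots> = (LINT t:{0..d}|lebesgue. k t)"
        using integral_MT_Icc[of d k] by (simp add: integral_MT[symmetric] set_lebesgue_integral_def)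
      finally show ?thesis .
    qed
    let ?F = "\<lambda>t. ip (z (max 0 t)) y"
    note c = continuous_z_max[OF y]
    have i: "set_integrable lebesgue {s..t} ?F" if "-T \<le> s" "t \<le> T" for s t
      using that by (intro absolutely_integrable_continuous_real continuous_on_subset[OF c]) auto
    have lim: "(\<lambda>n. (LINT t:{d - h n..d}|lebesgue. ?F t) / h n - (LINT t:{0 - h n..0}|lebesgue. ?F t) / h n) \<longlonglongrightarrow> ?F d - ?F 0"
      by (intro tendsto_diff avg_tendsto[of "-T"] h continuous_on_subset[OF c]) (use d T in auto)
    have ev: "\<forall>\<^sub>F n in sequentially. h n < d"
      using h(3) by (rule order_tendstoD) (rule d)
    have "\<forall>\<^sub>F n in sequentially. (LINT t:{d - h n..d}|lebesgue. ?F t) / h n - (LINT t:{0 - h n..0}|lebesgue. ?F t) / h n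
       = (\<integral>t. indicat_real {..<c} t * g n t \<partial>MT T)"
      using ev
    proof eventually_elim
      case (elim n)
      have "(\<integral>t. indicat_real {..<c} t * g n t \<partial>MT T) = (LINT t:{0..d}|lebesgue. (?F t - ?F (t - h n)) / h n)"
        unfolding red
        by (rule set_lebesgue_integral_cong) (use ip_dz[OF y less_imp_le[OF h(1)]] d in \<open>auto simp: g_def\<close>)
      also have "\<dots> = (LINT t:{0..d}|lebesgue. ?F t - ?F (t - h n)) / h n"
        by (rule set_integral_divide_zero)
      also have "\<dots> = ((LINT t:{d-h n..d}|lebesgue. ?F t) - (LINT t:{-h n..0}|lebesgue. ?F t)) / h n"
        using h(1)[of n] h(2)[of n] elim d by (subst LINT_shift(2)[OF i]) auto
      finally show ?case by (simp add: diff_divide_distrib)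
    qed
    with lim have "(\<lambda>n. \<integral>t. indicat_real {..<c} t * g n t \<partial>MT T) \<longlonglongrightarrow> ?F d - ?F 0"
      by (rule Lim_transform_eventually)
    moreover have "?F d - ?F 0 = (LINT \<tau>:{0..d}|lebesgue. f \<tau>)"
      using continuous_version_increment[OF u v w T z, of 0 d y] d y zV T by (simp add: f_def ip_diff)
    ultimately show ?thesis unfolding red by simp
  qed
  show ?thesis
    unfolding g_def[symmetric] f_def[symmetric] using E
  proof (induction rule: lebesgue_sets_induct_disjoint)
    case (basic c) show ?case by (rule Iio)
  next
    case empty show ?case by simp
  next
    case (compl A)
    \<comment> \<open>The ray \<open>{..<T}\<close> contains the time interval and so plays the full
      set in the complement case.\<close>
    have eq: "(\<integral>t. indicat_real (- A) t * k t \<partial>MT T) = (\<integral>t. indicat_real {..<T} t * k t \<partial>MT T) - (\<integral>t. indicat_real A t * k t \<partial>MT T)"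
      if k: "integrable (MT T) k" for k
    proof -
      have "(\<integral>t. indicat_real (- A) t * k t \<partial>MT T) = (\<integral>t. indicat_real {..<T} t * k t - indicat_real A t * k t \<partial>MT T)"
        by (rule Bochner_Integration.integral_cong) (auto simp: indicator_def)
      also have "\<dots> = (\<integral>t. indicat_real {..<T} t * k t \<partial>MT T) - (\<integral>t. indicat_real A t * k t \<partial>MT T)"
        by (rule Bochner_Integration.integral_diff) (use ind k compl in auto)
      finally show ?thesis .
    qed
    show ?case unfolding eq[OF gi] eq[OF fi] by (intro tendsto_diff Iio compl)
  next
    case (null A B)
    have "(\<integral>t. indicat_real A t * k t \<partial>MT T) = (\<integral>t. indicat_real B t * k t \<partial>MT T)" if k: "integrable (MT T) k" for k
    proof (rule integral_cong_AE)
      show "AE t in MT T. indicat_real A t * k t = indicat_real B t * k t"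
        unfolding AE_MT_iff using null(3) by eventually_elim (auto simp: indicator_def)
    qed (use ind[OF null(1) k] ind[OF null(2) k] in auto)
    then show ?case using null(4) gi fi by simp
  next
    case (union A)
    define R where "R k = (\<Union>i. A i) - (\<Union>i<k. A i)" for k :: nat
    have Am: "(\<Union>i. A i) \<in> sets lebesgue" "(\<Union>i<k. A i) \<in> sets lebesgue" "R k \<in> sets lebesgue" for k
      unfolding R_def using union(2) by (auto intro!: sets.countable_UN)
    have split: "(\<integral>t. indicat_real (\<Union>i. A i) t * k t \<partial>MT T) = (\<Sum>i<N. \<integral>t. indicat_real (A i) t * k t \<partial>MT T) + (\<integral>t. indicat_real (R N) t * k t \<partial>MT T)"
      if k: "integrable (MT T) k" for k N
    proof -
      have "(\<Sum>i<N. indicat_real (A i) t) = indicat_real (\<Union>i<N. A i) t" for t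
        using union(1) by (intro indicator_UN_disjoint[symmetric]) (auto intro: disjoint_family_on_mono)
      moreover have "indicat_real (\<Union>i. A i) t = indicat_real (\<Union>i<N. A i) t + indicat_real (R N) t" for t
        by (auto simp: R_def indicator_def)
      ultimately have "(\<integral>t. indicat_real (\<Union>i. A i) t * k t \<partial>MT T) = (\<integral>t. (\<Sum>i<N. indicat_real (A i) t * k t) + indicat_real (R N) t * k t \<partial>MT T)"
        by (simp add: distrib_right flip: sum_distrib_right)
      also have "\<dots> = (\<integral>t. (\<Sum>i<N. indicat_real (A i) t * k t) \<partial>MT T) + (\<integral>t. indicat_real (R N) t * k t \<partial>MT T)"
        by (intro Bochner_Integration.integral_add Bochner_Integration.integrable_sum ind k union(2) Am)
      also have "(\<integral>t. (\<Sum>i<N. indicat_real (A i) t * k t) \<partial>MT T) = (\<Sum>i<N. \<integral>t. indicat_real (A i) t * k t \<partial>MT T)"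
        by (intro Bochner_Integration.integral_sum ind k union(2))
      finally show ?thesis .
    qed
    have Rlim: "(\<lambda>N. \<integral>t. indicat_real (R N) t * k t \<partial>MT T) \<longlonglongrightarrow> 0" if k: "integrable (MT T) k" for k
    proof -
      have "(\<lambda>N. \<integral>t. indicat_real (R N) t * k t \<partial>MT T) \<longlonglongrightarrow> (\<integral>t. 0 \<partial>MT T)"
      proof (rule integral_dominated_convergence[where w = "\<lambda>t. norm (k t)"])
        show "AE t in MT T. (\<lambda>N. indicat_real (R N) t * k t) \<longlonglongrightarrow> 0"
        proof (rule AE_I2)
          fix t
          have "\<forall>\<^sub>F N in sequentially. t \<notin> R N"
          proof (cases "t \<in> (\<Union>i. A i)")
            case True
            then obtain i where "t \<in> A i" by blast
            show ?thesis
              using eventually_gt_at_top[of i] by eventually_elim (use \<open>t \<in> A i\<close> in \<open>auto simp: R_def\<close>)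
          qed (simp add: R_def)
          then show "(\<lambda>N. indicat_real (R N) t * k t) \<longlonglongrightarrow> 0"
            by (intro tendsto_eventually) (auto elim!: eventually_mono)
        qed
      qed (use ind[OF Am(3) k] k in \<open>auto simp: indicator_def intro: integrable_norm\<close>)
      then show ?thesis by simp
    qed
    show ?case
    proof (rule LIMSEQ_I)
      fix e :: real assume e: "e > 0"
      define KT where "KT = Kf T + 1"
      have KT: "KT > 0" using Kf_nonneg[of T] T by (simp add: KT_def)
      \<comment> \<open>With this \<open>p\<close> the part \<open>p * Kf T / 2\<close> of the tail
        is at most e/8, uniformly in the step; the part with \<open>c\<close> is small when
        \<open>R N\<close> has small measure. The tail, the tail of the limit and the finite sum
        then each contribute less than e/4.\<close>
      define p where "p = e / (4 * KT)"
      have p: "p > 0" using e KT by (simp add: p_def)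
      define c where "c = (nrm y)\<^sup>2 / p"
      have c0: "c \<ge> 0" using p by (simp add: c_def)
      have tail: "\<bar>\<integral>t. indicat_real (R N) t * g n t \<partial>MT T\<bar> \<le> c * (\<integral>t. indicat_real (R N) t * 1 \<partial>MT T) + e / 8" for n N
      proof -
        have bi: "integrable (MT T) (\<lambda>t. (c * (indicat_real (R N) t * 1) + p * ((Kf t - Kf (t - h n)) / h n)) / 2)"
          using ind[OF Am(3) integrable_MT_const, of N 1] Kf_shift(1)[OF h(1,2), of n] by simp
        have "\<bar>\<integral>t. indicat_real (R N) t * g n t \<partial>MT T\<bar> \<le> (\<integral>t. \<bar>indicat_real (R N) t * g n t\<bar> \<partial>MT T)"
          by (rule integral_abs_bound)
        also have "\<dots> \<le> (\<integral>t. (c * (indicat_real (R N) t * 1) + p * ((Kf t - Kf (t - h n)) / h n)) / 2 \<partial>MT T)"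
        proof (rule integral_mono[OF _ bi])
          show "integrable (MT T) (\<lambda>t. \<bar>indicat_real (R N) t * g n t\<bar>)"
            using ind[OF Am(3) gi] by (rule integrable_abs)
          fix t assume "t \<in> space (MT T)"
          then have t: "0 \<le> t" "t \<le> T" by auto
          have "\<bar>ip y (dz (h n) t)\<bar> / h n \<le> ((1/p) * (nrm y)\<^sup>2 + (Kf t - Kf (t - h n)) / h n / (1/p)) / 2"
            by (rule ip_dz_le[OF y h(1,2) t]) (use p in simp)
          moreover have "\<bar>g n t\<bar> = \<bar>ip y (dz (h n) t)\<bar> / h n"
            using h(1)[of n] by (simp add: g_def abs_divide ip_sym[of y])
          ultimately have "\<bar>g n t\<bar> \<le> (c + p * ((Kf t - Kf (t - h n)) / h n)) / 2"
            by (simp add: c_def mult.commute)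
          moreover have "0 \<le> p * ((Kf t - Kf (t - h n)) / h n)"
            using Kf_shift(3)[OF h(1,2), of t] t p h(1)[of n] by simp
          ultimately show "\<bar>indicat_real (R N) t * g n t\<bar> \<le> (c * (indicat_real (R N) t * 1) + p * ((Kf t - Kf (t - h n)) / h n)) / 2"
            by (auto simp: indicator_def)
        qed
        also have "\<dots> = (c * (\<integral>t. indicat_real (R N) t * 1 \<partial>MT T) + p * ((\<integral>t. Kf t - Kf (t - h n) \<partial>MT T) / h n)) / 2"
          using ind[OF Am(3) integrable_MT_const, of N 1] Kf_shift(1)[OF h(1,2), of n] by simp
        also have "\<dots> \<le> (c * (\<integral>t. indicat_real (R N) t * 1 \<partial>MT T) + p * Kf T) / 2"
          using Kf_shift(2)[OF h(1,2), of n] p h(1)[of n]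
          by (intro divide_right_mono add_left_mono mult_left_mono) (auto simp: divide_le_eq mult.commute)
        also have "\<dots> \<le> c * (\<integral>t. indicat_real (R N) t * 1 \<partial>MT T) + e / 8"
        proof -
          have "p * Kf T \<le> p * KT" using p by (simp add: KT_def)
          also have "\<dots> = e / 4" using KT by (simp add: p_def)
          finally have "p * Kf T \<le> e / 4" .
          moreover have "0 \<le> c * (\<integral>t. indicat_real (R N) t * 1 \<partial>MT T)"
            using c0 by (intro mult_nonneg_nonneg integral_nonneg_AE) auto
          moreover have "(X + Y) / 2 \<le> X + e / 8" if "Y \<le> e / 4" "0 \<le> X" for X Y
            using that by simp
          ultimately show ?thesis by blast
        qed
        finally show ?thesis .
      qed
      have "(\<lambda>N. c * (\<integral>t. indicat_real (R N) t * 1 \<partial>MT T)) \<longlonglongrightarrow> c * 0"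
        by (intro tendsto_mult tendsto_const Rlim integrable_MT_const)
      then have "\<forall>\<^sub>F N in sequentially. c * (\<integral>t. indicat_real (R N) t * 1 \<partial>MT T) < e / 8"
        by (rule order_tendstoD) (use e in simp)
      moreover have "\<forall>\<^sub>F N in sequentially. \<bar>\<integral>t. indicat_real (R N) t * f t \<partial>MT T\<bar> < e / 4"
        using tendsto_rabs[OF Rlim[OF fi]] by (rule order_tendstoD) (use e in simp)
      ultimately have "\<forall>\<^sub>F N in sequentially. c * (\<integral>t. indicat_real (R N) t * 1 \<partial>MT T) < e / 8
          \<and> \<bar>\<integral>t. indicat_real (R N) t * f t \<partial>MT T\<bar> < e / 4" by eventually_elim simp
      then obtain N where N: "c * (\<integral>t. indicat_real (R N) t * 1 \<partial>MT T) < e / 8"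
          "\<bar>\<integral>t. indicat_real (R N) t * f t \<partial>MT T\<bar> < e / 4"
        using eventually_happens'[OF sequentially_bot] by blast
      have "(\<lambda>n. \<Sum>i<N. \<integral>t. indicat_real (A i) t * g n t \<partial>MT T) \<longlonglongrightarrow> (\<Sum>i<N. \<integral>t. indicat_real (A i) t * f t \<partial>MT T)"
        by (intro tendsto_sum union(3))
      from LIMSEQ_D[OF this, of "e/4"] e obtain M where M: "\<And>n. n \<ge> M \<Longrightarrow>
         \<bar>(\<Sum>i<N. \<integral>t. indicat_real (A i) t * g n t \<partial>MT T) - (\<Sum>i<N. \<integral>t. indicat_real (A i) t * f t \<partial>MT T)\<bar> < e / 4" by auto
      show "\<exists>no. \<forall>n\<ge>no. norm ((\<integral>t. indicat_real (\<Union>i. A i) t * g n t \<partial>MT T) - (\<integral>t. indicat_real (\<Union>i. A i) t * f t \<partial>MT T)) < e"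
      proof (intro exI allI impI)
        fix n assume "n \<ge> M"
        from M[OF this] tail[of N n] N
        show "norm ((\<integral>t. indicat_real (\<Union>i. A i) t * g n t \<partial>MT T) - (\<integral>t. indicat_real (\<Union>i. A i) t * f t \<partial>MT T)) < e"
          unfolding split[OF gi, where N = N] split[OF fi, where N = N] real_norm_def by linarith
      qed
    qed
  qed
qed

end

section \<open>Weak convergence of the difference quotients\<close>

context semi_inner
begin

text \<open>The approximants of \<open>g\<close> converge almost everywhere but may lack a
  dominating function. They are cut to 0 where their norm exceeds twice that of \<open>g\<close>.
  Where \<open>g\<close> has positive norm the cut is eventually inactive, and where it has norm 0
  so has the cut function; dominated convergence applies.\<close>

lemma L2_time_simple_dense:
  assumes g: "g \<in> L2_time V nrm T" and e: "e > 0"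
  obtains s where "simple_into V T s" "integrable (MT T) (\<lambda>t. (nrm (\<lambda>x. g t x - s t x))\<^sup>2)"
    "(\<integral>t. (nrm (\<lambda>x. g t x - s t x))\<^sup>2 \<partial>MT T) < e"
proof -
  note g' = L2_timeD[OF g]
  obtain r where r: "\<And>n. simple_into V T (r n)" "AE t in MT T. (\<lambda>n. nrm (\<lambda>x. g t x - r n t x)) \<longlonglongrightarrow> 0"
    using g'(1) unfolding strongly_measurable_def by blast
  define B where "B n = {t \<in> space (MT T). nrm (r n t) \<le> 2 * nrm (g t)}" for n
  define s where "s n t = (if t \<in> B n then r n t else (\<lambda>x. 0))" for n t
  note [measurable] = strongly_measurable_nrm[OF g'(1)] strongly_measurable_nrm[OF simple_into_strongly_measurable[OF r(1)]]
  have Bm: "B n \<in> sets (MT T)" for n unfolding B_def by measurable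
  have s: "simple_into V T (s n)" for n
  proof -
    have "simple_function (MT T) (r n)" "r n ` {0<..<T} \<subseteq> V" using r(1)[of n] by (auto simp: simple_into_def)
    moreover have "{t \<in> space (MT T). t \<in> B n} = B n" by (auto simp: B_def)
    ultimately have "simple_function (MT T) (s n)"
      unfolding s_def[abs_def] using Bm[of n] by (intro simple_function_If) auto
    then show ?thesis
      using \<open>r n ` {0<..<T} \<subseteq> V\<close> zero_in by (auto simp: simple_into_def s_def)
  qed
  let ?d = "\<lambda>n t. nrm (\<lambda>x. g t x - s n t x)"
  have dm: "?d n \<in> borel_measurable (MT T)" for n
    by (rule strongly_measurable_nrm[OF strongly_measurable_diff[OF g'(1) simple_into_strongly_measurable[OF s]]])
  \<comment> \<open>The norm of the error is at most (1 + 2) times that of \<open>g\<close>, hence 9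
    after squaring.\<close>
  have bd: "AE t in MT T. norm ((?d n t)\<^sup>2) \<le> 9 * (nrm (g t))\<^sup>2" for n
    using g'(2) AE_space
  proof eventually_elim
    case (elim t)
    have sV: "s n t \<in> V" using s[of n] elim(2) by (auto simp: simple_into_def)
    have "nrm (s n t) \<le> 2 * nrm (g t)"
      using ip_zero[OF zero_in] by (auto simp: s_def B_def nrm_def[of "\<lambda>x. 0"])
    moreover have "?d n t \<le> nrm (g t) + nrm (s n t)"
      using nrm_triangle[OF elim(1) minus_in[OF sV]] nrm_scale[OF sV, of "-1"] by simp
    ultimately have "?d n t \<le> 3 * nrm (g t)" by simp
    then have "(?d n t)\<^sup>2 \<le> (3 * nrm (g t))\<^sup>2" by (rule power_mono) simp
    then show ?case by (simp add: power_mult_distrib)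
  qed
  have lim: "AE t in MT T. (\<lambda>n. (?d n t)\<^sup>2) \<longlonglongrightarrow> 0"
    using g'(2) r(2) AE_space
  proof eventually_elim
    case (elim t)
    have rV: "r n t \<in> V" for n using r(1)[of n] elim(3) by (auto simp: simple_into_def)
    have "(\<lambda>n. ?d n t) \<longlonglongrightarrow> 0"
    proof (cases "nrm (g t) = 0")
      case True
      have "?d n t = 0" for n
      proof -
        have sV: "s n t \<in> V" using s[of n] elim(3) by (auto simp: simple_into_def)
        have "nrm (s n t) = 0"
          using ip_zero[OF zero_in] True nrm_nonneg[of "r n t"] by (auto simp: s_def B_def nrm_def[of "\<lambda>x. 0"] simp del: nrm_nonneg)
        then show ?thesis
          using nrm_triangle[OF elim(1) minus_in[OF sV]] nrm_scale[OF sV, of "-1"] True by (intro antisym nrm_nonneg) simp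
      qed
      then show ?thesis by simp
    next
      case False
      then have pos: "nrm (g t) > 0" using nrm_nonneg[of "g t"] by linarith
      have "\<forall>\<^sub>F n in sequentially. nrm (\<lambda>x. g t x - r n t x) < nrm (g t)"
        using elim(2) pos by (rule order_tendstoD)
      then have "\<forall>\<^sub>F n in sequentially. nrm (\<lambda>x. g t x - r n t x) = ?d n t"
      proof eventually_elim
        case (elim n)
        have "nrm (r n t) \<le> nrm (g t) + nrm (\<lambda>x. r n t x - g t x)"
          using nrm_le_diff[OF rV \<open>g t \<in> V\<close>] .
        then have "nrm (r n t) \<le> 2 * nrm (g t)"
          using elim nrm_minus_commute[OF rV[of n] \<open>g t \<in> V\<close>] by linarith
        then show ?case using \<open>t \<in> space (MT T)\<close> by (simp add: s_def B_def)
      qed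
      then show ?thesis using elim(2) by (rule Lim_transform_eventually[rotated])
    qed
    then show ?case using tendsto_power[of _ 0 sequentially 2] by force
  qed
  have wi: "integrable (MT T) (\<lambda>t. 9 * (nrm (g t))\<^sup>2)" using L2_time_nrm(1)[OF g] by simp
  have "(\<lambda>n. \<integral>t. (?d n t)\<^sup>2 \<partial>MT T) \<longlonglongrightarrow> (\<integral>t. 0 \<partial>MT T)"
    by (rule integral_dominated_convergence[OF _ _ wi lim bd]) (use dm in simp_all)
  then have "\<forall>\<^sub>F n in sequentially. (\<integral>t. (?d n t)\<^sup>2 \<partial>MT T) < e"
    by (rule order_tendstoD) (use e in simp)
  then obtain n where n: "(\<integral>t. (?d n t)\<^sup>2 \<partial>MT T) < e"
    using eventually_happens'[OF sequentially_bot] by blast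
  have "integrable (MT T) (\<lambda>t. (?d n t)\<^sup>2)"
    by (rule Bochner_Integration.integrable_bound[OF wi]) (use dm bd[of n] in \<open>auto elim!: eventually_mono\<close>)
  with s n show thesis using that by blast
qed

end

context time_regular
begin

lemma simple_ip_sum:
  assumes s: "simple_into V T s" and t: "t \<in> {0<..<T}"
  shows "ip (s t) x = (\<Sum>y\<in>s ` {0<..<T}. indicator (s -` {y} \<inter> {0<..<T}) t * ip x y)"
proof -
  have fin: "finite (s ` {0<..<T})" using s simple_functionD(1)[of "MT T" s] by (simp add: simple_into_def)
  have "(\<Sum>y\<in>s ` {0<..<T}. indicator (s -` {y} \<inter> {0<..<T}) t * ip x y) = (\<Sum>y\<in>s ` {0<..<T}. if y = s t then ip x y else 0)"
    using t by (intro sum.cong) (auto simp: indicator_def)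
  then show ?thesis using fin t by (simp add: ip_sym)
qed

lemma difference_quotient_simple:
  assumes h: "\<And>n. 0 < h n" "\<And>n. h n \<le> T" "h \<longlonglongrightarrow> 0" and s: "simple_into V T s"
  shows "integrable (MT T) (\<lambda>t. ip (s t) (dz (h n) t))"
    and "(\<lambda>n. \<integral>t. ip (s t) (dz (h n) t) / h n \<partial>MT T) \<longlonglongrightarrow> (\<integral>t. ip (s t) (v t) \<partial>MT T)"
proof -
  let ?S = "s ` {0<..<T}" and ?E = "\<lambda>y. s -` {y} \<inter> {0<..<T}"
  have sf: "simple_function (MT T) s" and SV: "y \<in> ?S \<Longrightarrow> y \<in> V" for y using s by (auto simp: simple_into_def)
  have E: "?E y \<in> sets (MT T)" for y using simple_functionD(2)[OF sf, of "{y}"] by simp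
  then have E': "?E y \<in> sets lebesgue" for y
    by (rule sets_restrict_space_iff[THEN iffD1, THEN conjunct2, rotated]) simp
  have ind: "integrable (MT T) (\<lambda>t. indicat_real (?E y) t * k t)" if k: "integrable (MT T) k" for k y
    using integrable_mult_indicator[OF E k] by simp
  have i: "integrable (MT T) (\<lambda>t. indicat_real (?E y) t * (ip (dz (h n) t) y / c))" if "y \<in> ?S" for y n c
    by (rule ind) (use integrable_ip_dz[OF SV[OF that] less_imp_le[OF h(1)] h(2), of n] in simp)
  have i1: "integrable (MT T) (\<lambda>t. indicat_real (?E y) t * ip (dz (h n) t) y)" if "y \<in> ?S" for y n
    by (rule ind) (rule integrable_ip_dz[OF SV[OF that] less_imp_le[OF h(1)] h(2)])
  have iv: "integrable (MT T) (\<lambda>t. indicat_real (?E y) t * ip (v t) y)" if "y \<in> ?S" for y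
    by (intro ind L2_time_ip v L2_time_const SV that)
  have "integrable (MT T) (\<lambda>t. \<Sum>y\<in>?S. indicat_real (?E y) t * ip (dz (h n) t) y)"
    by (intro Bochner_Integration.integrable_sum i1)
  then show "integrable (MT T) (\<lambda>t. ip (s t) (dz (h n) t))"
    by (rule Bochner_Integration.integrable_cong[THEN iffD1, rotated 2]) (simp_all add: simple_ip_sum[OF s])
  have "(\<lambda>n. \<Sum>y\<in>?S. \<integral>t. indicat_real (?E y) t * (ip (dz (h n) t) y / h n) \<partial>MT T)
       \<longlonglongrightarrow> (\<Sum>y\<in>?S. \<integral>t. indicat_real (?E y) t * ip (v t) y \<partial>MT T)"
    by (intro tendsto_sum difference_quotient_indicator h SV E')
  also have "(\<Sum>y\<in>?S. \<integral>t. indicat_real (?E y) t * ip (v t) y \<partial>MT T) = (\<integral>t. (\<Sum>y\<in>?S. indicat_real (?E y) t * ip (v t) y) \<partial>MT T)"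
    by (rule Bochner_Integration.integral_sum[symmetric]) (rule iv)
  also have "\<dots> = (\<integral>t. ip (s t) (v t) \<partial>MT T)"
    by (rule Bochner_Integration.integral_cong) (simp_all add: simple_ip_sum[OF s])
  also have "(\<lambda>n. \<Sum>y\<in>?S. \<integral>t. indicat_real (?E y) t * (ip (dz (h n) t) y / h n) \<partial>MT T)
      = (\<lambda>n. \<integral>t. ip (s t) (dz (h n) t) / h n \<partial>MT T)"
  proof
    fix n
    have "(\<Sum>y\<in>?S. \<integral>t. indicat_real (?E y) t * (ip (dz (h n) t) y / h n) \<partial>MT T)
       = (\<integral>t. (\<Sum>y\<in>?S. indicat_real (?E y) t * (ip (dz (h n) t) y / h n)) \<partial>MT T)"
      by (rule Bochner_Integration.integral_sum[symmetric]) (rule i)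
    also have "\<dots> = (\<integral>t. ip (s t) (dz (h n) t) / h n \<partial>MT T)"
      by (rule Bochner_Integration.integral_cong) (simp_all add: simple_ip_sum[OF s] sum_divide_distrib)
    finally show "(\<Sum>y\<in>?S. \<integral>t. indicat_real (?E y) t * (ip (dz (h n) t) y / h n) \<partial>MT T)
       = (\<integral>t. ip (s t) (dz (h n) t) / h n \<partial>MT T)" .
  qed
  finally show "(\<lambda>n. \<integral>t. ip (s t) (dz (h n) t) / h n \<partial>MT T) \<longlonglongrightarrow> (\<integral>t. ip (s t) (v t) \<partial>MT T)" .
qed

lemma integrable_ip_dz_L2:
  assumes g: "g \<in> L2_time V nrm T" and h: "0 < h" "h \<le> T"
  shows "integrable (MT T) (\<lambda>t. ip (g t) (dz h t))"
proof (rule Bochner_Integration.integrable_bound)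
  note g' = L2_timeD[OF g]
  obtain r where r: "\<And>n. simple_into V T (r n)" "AE t in MT T. (\<lambda>n. nrm (\<lambda>x. g t x - r n t x)) \<longlonglongrightarrow> 0"
    using g'(1) unfolding strongly_measurable_def by blast
  \<comment> \<open>\<open>difference_quotient_simple\<close> speaks of a null sequence of steps;
    the given \<open>h\<close> is the member with index 0 of the sequence h / (n + 1).\<close>
  have hh: "0 < h / real (Suc n)" "h / real (Suc n) \<le> T" for n
  proof -
    have "h / real (Suc n) \<le> h / 1" using h by (intro divide_left_mono) auto
    then show "0 < h / real (Suc n)" "h / real (Suc n) \<le> T" using h by simp_all
  qed
  have hl: "(\<lambda>n. h / real (Suc n)) \<longlonglongrightarrow> 0" by real_asymp
  show "(\<lambda>t. ip (g t) (dz h t)) \<in> borel_measurable (MT T)"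
  proof (rule borel_measurable_AE_limit)
    show "(\<lambda>t. ip (r n t) (dz h t)) \<in> borel_measurable (MT T)" for n
      using difference_quotient_simple(1)[of "\<lambda>n. h / real (Suc n)" "r n" 0, OF hh hl r(1)] by (simp add: borel_measurable_integrable)
    show "AE t in MT T. (\<lambda>n. ip (r n t) (dz h t)) \<longlonglongrightarrow> ip (g t) (dz h t)"
      using r(2) g'(2) AE_space
    proof eventually_elim
      case (elim t)
      then have "r n t \<in> V" for n using r(1)[of n] by (auto simp: simple_into_def)
      with elim show ?case using h by (intro ip_tendsto dzV) auto
    qed
  qed simp
  let ?b = "\<lambda>t. h * ((1 * (nrm (g t))\<^sup>2 + (Kf t - Kf (t - h)) / h / 1) / 2)"
  show "integrable (MT T) ?b"
    using L2_time_nrm(1)[OF g] Kf_shift(1)[OF h] by simp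
  show "AE t in MT T. norm (ip (g t) (dz h t)) \<le> norm (?b t)"
    using g'(2) AE_space
  proof eventually_elim
    case (elim t)
    have "\<bar>ip (g t) (dz h t)\<bar> / h \<le> (1 * (nrm (g t))\<^sup>2 + (Kf t - Kf (t - h)) / h / 1) / 2"
      by (rule ip_dz_le) (use elim h in auto)
    then have "\<bar>ip (g t) (dz h t)\<bar> \<le> ?b t" using h by (simp only: divide_le_eq mult.commute if_True)
    then show ?case by simp
  qed
qed

lemma difference_quotient_bound:
  assumes d: "integrable (MT T) (\<lambda>t. (nrm (d t))\<^sup>2)" "AE t in MT T. d t \<in> V" and h: "0 < h" "h \<le> T" and p: "p > 0"
    and i: "integrable (MT T) (\<lambda>t. ip (d t) (dz h t))"
  shows "\<bar>\<integral>t. ip (d t) (dz h t) / h \<partial>MT T\<bar> \<le> (p * (\<integral>t. (nrm (d t))\<^sup>2 \<partial>MT T) + Kf T / p) / 2"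
proof -
  let ?b = "\<lambda>t. (p * (nrm (d t))\<^sup>2 + (Kf t - Kf (t - h)) / h / p) / 2"
  have bi: "integrable (MT T) ?b" using d Kf_shift(1)[OF h] by simp
  have "\<bar>\<integral>t. ip (d t) (dz h t) / h \<partial>MT T\<bar> \<le> (\<integral>t. \<bar>ip (d t) (dz h t) / h\<bar> \<partial>MT T)" by (rule integral_abs_bound)
  also have "\<dots> \<le> (\<integral>t. ?b t \<partial>MT T)"
  proof (rule integral_mono_AE[OF _ bi])
    show "AE t in MT T. \<bar>ip (d t) (dz h t) / h\<bar> \<le> ?b t"
      using d(2) AE_space
    proof eventually_elim
      case (elim t)
      have "\<bar>ip (d t) (dz h t)\<bar> / h \<le> ?b t" by (rule ip_dz_le) (use elim h p in auto)
      then show ?case using h by (simp add: abs_divide)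
    qed
  qed (use i in simp)
  also have "\<dots> = (p * (\<integral>t. (nrm (d t))\<^sup>2 \<partial>MT T) + (\<integral>t. Kf t - Kf (t - h) \<partial>MT T) / h / p) / 2"
    using d Kf_shift(1)[OF h] by simp
  also have "\<dots> \<le> (p * (\<integral>t. (nrm (d t))\<^sup>2 \<partial>MT T) + Kf T / p) / 2"
    using Kf_shift(2)[OF h] h p by (intro divide_right_mono add_left_mono) (auto simp: divide_le_eq mult.commute)
  finally show ?thesis .
qed

text \<open>The quotients converge when tested against simple functions and are bounded in mean
  square uniformly in the step. Density of the simple functions extends this to weak convergence
  against every square integrable \<open>g\<close>.\<close>

lemma difference_quotient_tendsto:
  assumes h: "\<And>n. 0 < h n" "\<And>n. h n \<le> T" "h \<longlonglongrightarrow> 0" and g: "g \<in> L2_time V nrm T"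
  shows "(\<lambda>n. \<integral>t. ip (g t) (dz (h n) t) / h n \<partial>MT T) \<longlonglongrightarrow> (\<integral>t. ip (g t) (v t) \<partial>MT T)"
proof (rule LIMSEQ_I)
  fix e :: real assume e: "e > 0"
  \<comment> \<open>\<open>W\<close> dominates the energy bound of the quotients and that of
    \<open>v\<close>. The parameter \<open>p\<close> makes \<open>W / p\<close> equal to e/4, and
    \<open>s\<close> is then taken so close to \<open>g\<close> that \<open>p\<close> times the
    squared error is at most e/4 as well; Young's inequality turns both into errors of at most
    e/4.\<close>
  define W where "W = Kf T + (\<integral>t. (nrm (v t))\<^sup>2 \<partial>MT T) + 1"
  have K0: "Kf T \<ge> 0" using Kf_nonneg[of T] T by simp
  have v0: "(\<integral>t. (nrm (v t))\<^sup>2 \<partial>MT T) \<ge> 0" by (rule integral_nonneg_AE) simp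
  have W: "W > 0" "Kf T \<le> W" "(\<integral>t. (nrm (v t))\<^sup>2 \<partial>MT T) \<le> W" using K0 v0 unfolding W_def by linarith+
  define p where "p = 4 * W / e"
  have p: "p > 0" "W / p = e / 4" using W e by (auto simp: p_def)
  have "e / (4 * p) > 0" using e p by simp
  then obtain s where s: "simple_into V T s" "integrable (MT T) (\<lambda>t. (nrm (\<lambda>x. g t x - s t x))\<^sup>2)"
    "(\<integral>t. (nrm (\<lambda>x. g t x - s t x))\<^sup>2 \<partial>MT T) < e / (4 * p)"
    using L2_time_simple_dense[OF g] by blast
  let ?d = "\<lambda>t x. g t x - s t x"
  have pe: "p * (\<integral>t. (nrm (?d t))\<^sup>2 \<partial>MT T) \<le> e / 4"
    using s(3) p by (simp add: field_simps)
  have sV: "s t \<in> V" if "t \<in> space (MT T)" for t using s(1) that by (auto simp: simple_into_def)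
  have dV: "AE t in MT T. ?d t \<in> V"
    using L2_timeD(2)[OF g] AE_space by eventually_elim (intro diff_in sV)
  have svi: "integrable (MT T) (\<lambda>t. ip (s t) (v t))"
  proof -
    have "s \<in> L2_time V nrm T"
    proof (rule L2_timeI[OF simple_into_strongly_measurable[OF s(1)]])
      show "integrable (MT T) (\<lambda>t. ip (s t) (s t))"
      proof (rule Bochner_Integration.integrable_bound)
        show "integrable (MT T) (\<lambda>t. 2 * (nrm (g t))\<^sup>2 + 2 * (nrm (?d t))\<^sup>2)"
          using s(2) L2_time_nrm(1)[OF g] by simp
        show "(\<lambda>t. ip (s t) (s t)) \<in> borel_measurable (MT T)"
          by (intro strongly_measurable_ip simple_into_strongly_measurable s)
        show "AE t in MT T. norm (ip (s t) (s t)) \<le> norm (2 * (nrm (g t))\<^sup>2 + 2 * (nrm (?d t))\<^sup>2)"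
          using L2_timeD(2)[OF g] AE_space
        proof eventually_elim
          case (elim t)
          have "nrm (s t) \<le> nrm (g t) + nrm (?d t)"
            using nrm_le_diff[OF sV[OF elim(2)] elim(1)] nrm_minus_commute[OF sV[OF elim(2)] elim(1)] by simp
          then have "(nrm (s t))\<^sup>2 \<le> (nrm (g t) + nrm (?d t))\<^sup>2" by (rule power_mono) simp
          also have "\<dots> \<le> 2 * (nrm (g t))\<^sup>2 + 2 * (nrm (?d t))\<^sup>2"
            using sum_squares_bound[of "nrm (g t)" "nrm (?d t)"] by (simp add: power2_sum)
          finally show ?case by (simp add: nrm_square ip_nonneg)
        qed
      qed
    qed
    then show ?thesis by (intro L2_time_ip v)
  qed
  have gvi: "integrable (MT T) (\<lambda>t. ip (g t) (v t))" by (intro L2_time_ip g v)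
  have vterm: "\<bar>(\<integral>t. ip (g t) (v t) \<partial>MT T) - (\<integral>t. ip (s t) (v t) \<partial>MT T)\<bar> \<le> e / 4"
  proof -
    let ?b = "\<lambda>t. (p * (nrm (?d t))\<^sup>2 + (nrm (v t))\<^sup>2 / p) / 2"
    have "\<bar>(\<integral>t. ip (g t) (v t) \<partial>MT T) - (\<integral>t. ip (s t) (v t) \<partial>MT T)\<bar> = \<bar>\<integral>t. ip (g t) (v t) - ip (s t) (v t) \<partial>MT T\<bar>"
      using gvi svi by simp
    also have "\<dots> \<le> (\<integral>t. \<bar>ip (g t) (v t) - ip (s t) (v t)\<bar> \<partial>MT T)" by (rule integral_abs_bound)
    also have "\<dots> \<le> (\<integral>t. ?b t \<partial>MT T)"
    proof (rule integral_mono_AE)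
      show "integrable (MT T) ?b" using s(2) L2_time_nrm(1)[OF v] by simp
      show "AE t in MT T. \<bar>ip (g t) (v t) - ip (s t) (v t)\<bar> \<le> ?b t"
        using L2_timeD(2)[OF g] L2_timeD(2)[OF v] AE_space
      proof eventually_elim
        case (elim t)
        have "\<bar>ip (?d t) (v t)\<bar> \<le> nrm (?d t) * nrm (v t)"
          by (intro Cauchy_Schwarz diff_in elim sV)
        also have "\<dots> \<le> ?b t" by (rule am_gm[OF p(1)])
        finally show ?case unfolding ip_diff[OF elim(1) sV[OF elim(3)] elim(2)] .
      qed
    qed (use gvi svi in simp)
    also have "\<dots> = (p * (\<integral>t. (nrm (?d t))\<^sup>2 \<partial>MT T) + (\<integral>t. (nrm (v t))\<^sup>2 \<partial>MT T) / p) / 2"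
      using s(2) L2_time_nrm(1)[OF v] by simp
    also have "\<dots> \<le> (e / 4 + W / p) / 2"
      using pe W p by (intro divide_right_mono add_mono) (auto simp: divide_right_mono)
    also have "\<dots> = e / 4" using p by simp
    finally show ?thesis .
  qed
  have dterm: "\<bar>(\<integral>t. ip (g t) (dz (h n) t) / h n \<partial>MT T) - (\<integral>t. ip (s t) (dz (h n) t) / h n \<partial>MT T)\<bar> \<le> e / 4" for n
  proof -
    note gi = integrable_ip_dz_L2[OF g h(1,2)] and si = difference_quotient_simple(1)[OF h s(1)]
    have eq: "AE t in MT T. ip (?d t) (dz (h n) t) = ip (g t) (dz (h n) t) - ip (s t) (dz (h n) t)"
      using L2_timeD(2)[OF g] AE_space
      by eventually_elim (use h(1)[of n] in \<open>auto intro!: ip_diff sV dzV\<close>)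
    have eq': "AE t in MT T. ip (g t) (dz (h n) t) - ip (s t) (dz (h n) t) = ip (?d t) (dz (h n) t)"
      using eq by eventually_elim (rule sym)
    note diff = Bochner_Integration.integrable_diff[OF gi[of n] si[of n]]
    have dm: "(\<lambda>t. ip (?d t) (dz (h n) t)) \<in> borel_measurable (MT T)"
      by (rule borel_measurable_AE_on[OF borel_measurable_integrable[OF diff] _ eq']) simp
    have di: "integrable (MT T) (\<lambda>t. ip (?d t) (dz (h n) t))"
      by (rule integrable_cong_AE[THEN iffD1, OF borel_measurable_integrable[OF diff] dm eq' diff])
    have "(\<integral>t. ip (g t) (dz (h n) t) / h n \<partial>MT T) - (\<integral>t. ip (s t) (dz (h n) t) / h n \<partial>MT T)
        = (\<integral>t. ip (g t) (dz (h n) t) / h n - ip (s t) (dz (h n) t) / h n \<partial>MT T)"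
      using gi[of n] si[of n] by simp
    also have "\<dots> = (\<integral>t. ip (?d t) (dz (h n) t) / h n \<partial>MT T)"
    proof (rule integral_cong_AE)
      show "AE t in MT T. ip (g t) (dz (h n) t) / h n - ip (s t) (dz (h n) t) / h n = ip (?d t) (dz (h n) t) / h n"
        using eq by eventually_elim (simp add: diff_divide_distrib)
    qed (use gi[of n] si[of n] dm in \<open>simp_all add: borel_measurable_integrable\<close>)
    finally have "\<bar>(\<integral>t. ip (g t) (dz (h n) t) / h n \<partial>MT T) - (\<integral>t. ip (s t) (dz (h n) t) / h n \<partial>MT T)\<bar>
       \<le> (p * (\<integral>t. (nrm (?d t))\<^sup>2 \<partial>MT T) + Kf T / p) / 2"
      using difference_quotient_bound[OF s(2) dV h(1,2) p(1) di] by simp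
    also have "\<dots> \<le> (e / 4 + W / p) / 2"
      using pe W p by (intro divide_right_mono add_mono) (auto simp: divide_right_mono)
    also have "\<dots> = e / 4" using p by simp
    finally show ?thesis .
  qed
  obtain N where N: "\<And>n. n \<ge> N \<Longrightarrow> \<bar>(\<integral>t. ip (s t) (dz (h n) t) / h n \<partial>MT T) - (\<integral>t. ip (s t) (v t) \<partial>MT T)\<bar> < e / 4"
    using LIMSEQ_D[OF difference_quotient_simple(2)[OF h s(1)], of "e / 4"] e by auto
  show "\<exists>no. \<forall>n\<ge>no. norm ((\<integral>t. ip (g t) (dz (h n) t) / h n \<partial>MT T) - (\<integral>t. ip (g t) (v t) \<partial>MT T)) < e"
  proof (intro exI allI impI)
    fix n assume "n \<ge> N"
    from N[OF this] dterm[of n] vterm e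
    show "norm ((\<integral>t. ip (g t) (dz (h n) t) / h n \<partial>MT T) - (\<integral>t. ip (g t) (v t) \<partial>MT T)) < e"
      unfolding real_norm_def by linarith
  qed
qed

text \<open>The hypothesis \<open>step\<close> is a one-sided (convexity) estimate. It survives division by the step
  size and integration, so no regularity in time of \<open>\<Phi>\<close> has to be known beforehand. As \<open>\<Phi>\<close> is
  determined almost everywhere only, \<open>Lo T\<close> and \<open>\<Phi>0\<close> stand for its values at the end points. The
  inequality is applied to \<open>D\<close> with \<open>Lo = 0\<close>, and to \<open>- |z|\<^sup>2\<close>, for which the squared norm in \<open>step\<close>
  is needed.\<close>

lemma energy_inequality:
  assumes g: "g \<in> L2_time V nrm T" and \<Phi>: "integrable (MT T) \<Phi>"
    and Lo: "continuous_on {0..T} Lo" "AE t in MT T. Lo t \<le> \<Phi> t"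
    and \<omega>: "\<And>t. (\<omega> has_real_derivative \<omega>' t) (at t)" "continuous_on UNIV \<omega>'" "\<And>t. \<omega> t \<ge> 0"
    and E: "AE t in MT T. t \<in> E"
    and step: "\<And>s t. s \<in> E \<Longrightarrow> t \<in> E \<Longrightarrow> 0 < s \<Longrightarrow> s < t \<Longrightarrow> t < T \<Longrightarrow>
        \<Phi> t - \<Phi> s \<le> ip (g t) (\<lambda>x. z t x - z s x) + (nrm (\<lambda>x. z t x - z s x))\<^sup>2"
    and step0: "\<And>t. t \<in> E \<Longrightarrow> 0 < t \<Longrightarrow> t < T \<Longrightarrow>
        \<Phi> t - \<Phi>0 \<le> ip (g t) (\<lambda>x. z t x - z 0 x) + (nrm (\<lambda>x. z t x - z 0 x))\<^sup>2"
  shows "\<omega> T * Lo T \<le> \<omega> 0 * \<Phi>0 + (\<integral>t. \<omega> t * ip (g t) (v t) \<partial>MT T) + (\<integral>t. \<omega>' t * \<Phi> t \<partial>MT T)"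
proof -
  define h where "h n = T / real (Suc n)" for n
  have h: "0 < h n" "h n \<le> T" for n
  proof -
    have "h n \<le> T / 1" unfolding h_def using T by (intro divide_left_mono) auto
    then show "0 < h n" "h n \<le> T" using T by (simp_all add: h_def)
  qed
  have hl: "h \<longlonglongrightarrow> 0" unfolding h_def by real_asymp
  \<comment> \<open>Prescribing \<open>\<Phi>0\<close> for all times up to 0 makes the window before
    0 contribute exactly \<open>\<Phi>0\<close> times an average of \<omega>.\<close>
  define \<Phi>e where "\<Phi>e t = (if t \<le> 0 then \<Phi>0 else \<Phi> t)" for t
  define \<Psi> where "\<Psi> t = \<Phi>e t * \<omega> t" for t
  have \<omega>c: "continuous_on S \<omega>" for S
    by (rule continuous_at_imp_continuous_on) (use \<omega>(1) DERIV_isCont in blast)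
  have \<omega>'c: "continuous_on S \<omega>'" for S
    using \<omega>(2) by (rule continuous_on_subset) simp
  have \<Phi>i: "set_integrable lebesgue {0..T} \<Phi>" by (rule integrable_MT_Icc[OF \<Phi>]) auto
  have \<Phi>ei: "set_integrable lebesgue {-T..T} \<Phi>e"
  proof -
    have "set_integrable lebesgue {-T..0} (\<lambda>t. \<Phi>0)"
      by (intro absolutely_integrable_continuous_real continuous_intros)
    then have 1: "set_integrable lebesgue {-T..0} \<Phi>e"
      by (rule set_integrable_cong[THEN iffD1, rotated 3]) (auto simp: \<Phi>e_def)
    have "set_integrable lebesgue {0<..T} \<Phi>"
      by (rule set_integrable_subset[OF \<Phi>i]) auto
    then have 2: "set_integrable lebesgue {0<..T} \<Phi>e"
      by (rule set_integrable_cong[THEN iffD1, rotated 3]) (auto simp: \<Phi>e_def)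
    have "{-T..0} \<union> {0<..T} = {-T..T}" using T by auto
    then show ?thesis using set_integrable_Un[OF 1 2] by simp
  qed
  have \<Psi>i: "set_integrable lebesgue {-T..T} \<Psi>"
    unfolding \<Psi>_def by (rule set_integrable_mult_continuous[OF \<Phi>ei \<omega>c])
  have \<Psi>h: "set_integrable lebesgue {-h n..T} \<Psi>" for n
    by (rule set_integrable_subset[OF \<Psi>i]) (use h[of n] in auto)
  note shift = LINT_shift[OF \<Psi>h less_imp_le[OF h(1)] h(2)]
  have "compact ((\<lambda>t. \<bar>\<omega> t\<bar> + \<bar>\<omega>' t\<bar>) ` {-T..T})"
    by (intro compact_continuous_image continuous_intros \<omega>c \<omega>'c) simp
  then have "bounded ((\<lambda>t. \<bar>\<omega> t\<bar> + \<bar>\<omega>' t\<bar>) ` {-T..T})" by (rule compact_imp_bounded)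
  then obtain B where "\<forall>x\<in>(\<lambda>t. \<bar>\<omega> t\<bar> + \<bar>\<omega>' t\<bar>) ` {-T..T}. \<bar>x\<bar> \<le> B"
    unfolding bounded_real by blast
  then have B: "\<bar>\<omega> t\<bar> + \<bar>\<omega>' t\<bar> \<le> B" if "t \<in> {-T..T}" for t using that by auto
  have Bd: "\<bar>\<omega> t\<bar> \<le> B" "\<bar>\<omega>' t\<bar> \<le> B" if "t \<in> {-T..T}" for t using B[OF that] by auto
  have B0: "0 \<le> B" using Bd(1)[of 0] T by simp
  have lip: "\<bar>\<omega> t - \<omega> s\<bar> \<le> B * (t - s)" if "-T \<le> s" "s \<le> t" "t \<le> T" for s t
  proof (cases "s = t")
    case False
    with that have "s < t" by simp
    then obtain r where r: "s < r" "r < t" "\<omega> t - \<omega> s = (t - s) * \<omega>' r"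
      using MVT2[of s t \<omega> \<omega>'] \<omega>(1) by blast
    have "\<bar>\<omega> t - \<omega> s\<bar> = (t - s) * \<bar>\<omega>' r\<bar>" using r \<open>s < t\<close> by (simp add: abs_mult)
    also have "\<dots> \<le> (t - s) * B" using Bd(2)[of r] r that by (intro mult_left_mono) auto
    finally show ?thesis by (simp add: mult.commute)
  qed simp
  define g' where "g' t = (\<lambda>x. \<omega> t * g t x)" for t
  have \<omega>m: "k \<in> borel_measurable (MT T)" if "continuous_on UNIV k" for k :: "real \<Rightarrow> real"
    using continuous_imp_measurable_on_sets_lebesgue[OF continuous_on_subset[OF that], of "{0<..<T}"] by simp
  have g': "g' \<in> L2_time V nrm T"
    unfolding g'_def by (rule L2_time_scale[OF \<omega>m[OF \<omega>c] _ g, of B]) (use Bd(1) T in auto)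
  have gae: "AE t in MT T. g t \<in> V" by (rule L2_timeD(2)[OF g])
  have lim1: "(\<lambda>n. \<integral>t. ip (g' t) (dz (h n) t) / h n \<partial>MT T) \<longlonglongrightarrow> (\<integral>t. ip (g' t) (v t) \<partial>MT T)"
    by (rule difference_quotient_tendsto[OF h hl g'])
  have eq1: "(\<integral>t. ip (g' t) (v t) \<partial>MT T) = (\<integral>t. \<omega> t * ip (g t) (v t) \<partial>MT T)"
  proof (rule integral_cong_AE)
    show "AE t in MT T. ip (g' t) (v t) = \<omega> t * ip (g t) (v t)"
      using gae L2_timeD(2)[OF v] by eventually_elim (simp add: g'_def ip_scale)
    show "(\<lambda>t. ip (g' t) (v t)) \<in> borel_measurable (MT T)"
      using L2_time_ip[OF g' v] by (rule borel_measurable_integrable)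
    show "(\<lambda>t. \<omega> t * ip (g t) (v t)) \<in> borel_measurable (MT T)"
      by (intro borel_measurable_times \<omega>m \<omega>c borel_measurable_integrable L2_time_ip g v)
  qed
  \<comment> \<open>The difference quotient of the weight multiplies \<Phi> at the unshifted time,
    so the product converges by domination although \<Phi> is merely integrable.\<close>
  define q where "q n t = (\<omega> t - \<omega> (t - h n)) / h n" for n t
  have qb: "\<bar>q n t\<bar> \<le> B" if "t \<in> {0..T}" for n t
    using lip[of "t - h n" t] h[of n] that by (simp add: q_def abs_divide divide_le_eq)
  have qc: "continuous_on UNIV (q n)" for n
    unfolding q_def using h(1)[of n] by (intro continuous_intros \<omega>c continuous_on_compose2[OF \<omega>c[of UNIV]]) auto
  have q\<Phi>: "integrable (MT T) (\<lambda>t. q n t * \<Phi> t)" for n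
  proof (rule Bochner_Integration.integrable_bound)
    show "integrable (MT T) (\<lambda>t. B * \<Phi> t)" using \<Phi> by simp
    show "(\<lambda>t. q n t * \<Phi> t) \<in> borel_measurable (MT T)"
      by (intro borel_measurable_times \<omega>m qc borel_measurable_integrable \<Phi>)
    show "AE t in MT T. norm (q n t * \<Phi> t) \<le> norm (B * \<Phi> t)"
      using qb[of _ n] B0 by (intro AE_I2) (auto simp: abs_mult intro!: mult_right_mono)
  qed
  have lim2: "(\<lambda>n. \<integral>t. q n t * \<Phi> t \<partial>MT T) \<longlonglongrightarrow> (\<integral>t. \<omega>' t * \<Phi> t \<partial>MT T)"
  proof (rule integral_dominated_convergence[where w = "\<lambda>t. B * \<bar>\<Phi> t\<bar>"])
    show "integrable (MT T) (\<lambda>t. B * \<bar>\<Phi> t\<bar>)" using \<Phi> by simp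
    show "AE t in MT T. (\<lambda>n. q n t * \<Phi> t) \<longlonglongrightarrow> \<omega>' t * \<Phi> t"
    proof (rule AE_I2)
      fix t
      have "filterlim (\<lambda>n. - h n) (at 0) sequentially"
        using tendsto_minus[OF hl] h(1) by (auto simp: filterlim_at less_imp_neq[OF h(1), symmetric])
      then have "(\<lambda>n. (\<omega> (t + - h n) - \<omega> t) / (- h n)) \<longlonglongrightarrow> \<omega>' t"
        using \<omega>(1)[of t] unfolding DERIV_def by (rule filterlim_compose[rotated])
      moreover have "(\<omega> (t + - h n) - \<omega> t) / (- h n) = q n t" for n
        by (simp add: q_def divide_simps)
      ultimately show "(\<lambda>n. q n t * \<Phi> t) \<longlonglongrightarrow> \<omega>' t * \<Phi> t" by (intro tendsto_mult) auto
    qed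
    show "AE t in MT T. norm (q n t * \<Phi> t) \<le> B * \<bar>\<Phi> t\<bar>" for n
      using qb[of _ n] by (intro AE_I2) (auto simp: abs_mult intro!: mult_right_mono)
    show "(\<lambda>t. \<omega>' t * \<Phi> t) \<in> borel_measurable (MT T)"
      by (intro borel_measurable_times \<omega>m \<omega>'c borel_measurable_integrable \<Phi>)
  qed (use q\<Phi> in \<open>auto intro: borel_measurable_integrable\<close>)
  let ?G = "\<integral>t. (nrm (g t))\<^sup>2 \<partial>MT T"
  define kd where "kd n t = Kf t - Kf (t - h n)" for n t
  have kdi: "integrable (MT T) (kd n)" and kdle: "(\<integral>t. kd n t \<partial>MT T) \<le> h n * Kf T" for n
    unfolding kd_def by (rule Kf_shift[OF h])+
  \<comment> \<open>Two errors, after division by the step: replacing \<omega> (t - h) by \<omega> t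
    in front of the inner product costs B (h |g|^2 + kd) / 2, and the squared increment costs B kd.
    Both have integrals of order h.\<close>
  define rem where "rem n t = B * (h n * (nrm (g t))\<^sup>2 + 3 * kd n t) / 2" for n t
  have remi: "integrable (MT T) (rem n)" for n
    unfolding rem_def using L2_time_nrm(1)[OF g] kdi by simp
  have remle: "(\<integral>t. rem n t \<partial>MT T) \<le> B * (h n * ?G + 3 * (h n * Kf T)) / 2" for n
    unfolding rem_def using L2_time_nrm(1)[OF g] kdi kdle[of n] B0
    by (simp add: mult_left_mono)
  have pw: "AE t in lebesgue. t \<in> {0<..<T} \<longrightarrow> (\<Psi> t - \<Psi> (t - h n)) / h n \<le> ip (g' t) (dz (h n) t) / h n + rem n t + q n t * \<Phi> t" for n
    using E[unfolded AE_MT_iff] AE_shift[OF E[unfolded AE_MT_iff], of "h n"] gae[unfolded AE_MT_iff]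
  proof eventually_elim
    case (elim t)
    show ?case
    proof
      assume t: "t \<in> {0<..<T}"
      let ?s = "max 0 (t - h n)" and ?d = "dz (h n) t"
      have tE: "t \<in> E" and gV: "g t \<in> V" using elim t by auto
      have dV: "?d \<in> V" using t h(1)[of n] by (intro dzV) auto
      have st: "\<Phi>e t - \<Phi>e (t - h n) \<le> ip (g t) ?d + (nrm ?d)\<^sup>2"
      proof (cases "t - h n \<le> 0")
        case True
        then show ?thesis using step0[OF tE] t by (simp add: \<Phi>e_def dz_def max_def)
      next
        case False
        then have "t - h n \<in> E" using elim t h(1)[of n] by auto
        then show ?thesis using step[OF _ tE, of "t - h n"] False t h(1)[of n] by (simp add: \<Phi>e_def dz_def max_def)
      qed
      let ?k = "Kf t - Kf (t - h n)"
      have b1: "\<bar>ip (g t) ?d\<bar> \<le> (h n * (nrm (g t))\<^sup>2 + ?k) / 2"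
        using ip_dz_le[OF gV h(1)[of n] h(2)[of n] _ _ zero_less_one, of t] t h(1)[of n] by (simp add: field_simps)
      have b2: "(nrm ?d)\<^sup>2 \<le> h n * ?k" using dz_bound[of "h n" t] h[of n] t by simp
      have \<omega>t: "0 \<le> \<omega> (t - h n)" "\<omega> (t - h n) \<le> B" using \<omega>(3) Bd(1)[of "t - h n"] t h[of n] by auto
      have \<omega>d: "\<bar>\<omega> (t - h n) - \<omega> t\<bar> \<le> B * h n" using lip[of "t - h n" t] t h[of n] by (simp add: abs_minus_commute)
      have k0: "0 \<le> ?k" using Kf_shift(3)[OF h, of t n] t by simp
      \<comment> \<open>Discrete product rule. The nonnegative weight in front of the increment of
        \<Phi> is taken at the earlier time, so that the remaining term carries \<Phi> at time
        \<open>t\<close>.\<close>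
      have "\<Psi> t - \<Psi> (t - h n) = \<omega> (t - h n) * (\<Phi>e t - \<Phi>e (t - h n)) + (\<omega> t - \<omega> (t - h n)) * \<Phi> t"
        using t by (simp add: \<Psi>_def \<Phi>e_def algebra_simps)
      also have "\<omega> (t - h n) * (\<Phi>e t - \<Phi>e (t - h n)) \<le> \<omega> (t - h n) * (ip (g t) ?d + (nrm ?d)\<^sup>2)"
        by (rule mult_left_mono[OF st \<omega>t(1)])
      also have "\<dots> = \<omega> t * ip (g t) ?d + (\<omega> (t - h n) - \<omega> t) * ip (g t) ?d + \<omega> (t - h n) * (nrm ?d)\<^sup>2"
        by (simp add: algebra_simps)
      also have "(\<omega> (t - h n) - \<omega> t) * ip (g t) ?d \<le> (B * h n) * ((h n * (nrm (g t))\<^sup>2 + ?k) / 2)"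
        by (rule order_trans[OF abs_ge_self], subst abs_mult, rule mult_mono[OF \<omega>d b1])
           (use B0 h(1)[of n] in auto)
      also have "\<omega> (t - h n) * (nrm ?d)\<^sup>2 \<le> B * (h n * ?k)"
        by (rule mult_mono[OF \<omega>t(2) b2 B0]) simp
      finally have "\<Psi> t - \<Psi> (t - h n) \<le> \<omega> t * ip (g t) ?d + h n * rem n t + (\<omega> t - \<omega> (t - h n)) * \<Phi> t"
        by (simp add: rem_def kd_def field_simps)
      then have "(\<Psi> t - \<Psi> (t - h n)) / h n \<le> (\<omega> t * ip (g t) ?d + h n * rem n t + (\<omega> t - \<omega> (t - h n)) * \<Phi> t) / h n"
        by (rule divide_right_mono) (use h(1)[of n] in simp)
      also have "\<dots> = \<omega> t * ip (g t) ?d / h n + rem n t + q n t * \<Phi> t"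
        using h(1)[of n] by (simp add: q_def add_divide_distrib)
      also have "\<omega> t * ip (g t) ?d = ip (g' t) ?d" unfolding g'_def by (rule ip_scale[OF gV dV, symmetric])
      finally show "(\<Psi> t - \<Psi> (t - h n)) / h n \<le> ip (g' t) ?d / h n + rem n t + q n t * \<Phi> t" .
    qed
  qed
  have dqi: "integrable (MT T) (\<lambda>t. ip (g' t) (dz (h n) t) / h n)" for n
    using integrable_ip_dz_L2[OF g' h] by simp
  have Psi_d: "set_integrable lebesgue {0..T} (\<lambda>t. \<Psi> t - \<Psi> (t - h n))" for n
    by (rule set_integral_diff(1)[OF _ shift(1)]) (rule set_integrable_subset[OF \<Psi>i], use T in auto)
  have up: "(\<integral>t. (\<Psi> t - \<Psi> (t - h n)) / h n \<partial>MT T)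
      \<le> (\<integral>t. ip (g' t) (dz (h n) t) / h n \<partial>MT T) + B * (h n * ?G + 3 * (h n * Kf T)) / 2 + (\<integral>t. q n t * \<Phi> t \<partial>MT T)" for n
  proof -
    have "(\<integral>t. (\<Psi> t - \<Psi> (t - h n)) / h n \<partial>MT T) \<le> (\<integral>t. ip (g' t) (dz (h n) t) / h n + rem n t + q n t * \<Phi> t \<partial>MT T)"
    proof (rule integral_mono_AE)
      have "set_integrable lebesgue {0<..<T} (\<lambda>t. (\<Psi> t - \<Psi> (t - h n)) / h n)"
        by (rule set_integrable_subset[OF set_integrable_divide[OF Psi_d]]) auto
      then show "integrable (MT T) (\<lambda>t. (\<Psi> t - \<Psi> (t - h n)) / h n)" by (simp add: integrable_MT_iff)
    qed (use dqi[of n] remi[of n] q\<Phi>[of n] pw[of n] in \<open>auto simp: AE_MT_iff\<close>)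
    also have "\<dots> = (\<integral>t. ip (g' t) (dz (h n) t) / h n \<partial>MT T) + (\<integral>t. rem n t \<partial>MT T) + (\<integral>t. q n t * \<Phi> t \<partial>MT T)"
      using dqi[of n] remi[of n] q\<Phi>[of n] by simp
    finally show ?thesis using remle[of n] by linarith
  qed
  \<comment> \<open>After telescoping, the window next to \<open>T\<close> is bounded below through
    \<open>Lo\<close>: its averages converge by continuity, while nothing of the kind is known for
    \<Phi>.\<close>
  have lo: "(LINT t:{T - h n..T}|lebesgue. Lo t * \<omega> t) / h n - \<Phi>0 * ((LINT t:{0 - h n..0}|lebesgue. \<omega> t) / h n)
     \<le> (\<integral>t. (\<Psi> t - \<Psi> (t - h n)) / h n \<partial>MT T)" for n
  proof -
    have "(\<integral>t. (\<Psi> t - \<Psi> (t - h n)) / h n \<partial>MT T) = (LINT t:{0..T}|lebesgue. \<Psi> t - \<Psi> (t - h n)) / h n"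
      unfolding integral_MT_Icc by (rule set_integral_divide_zero)
    also have "\<dots> = (LINT t:{T - h n..T}|lebesgue. \<Psi> t) / h n - (LINT t:{-h n..0}|lebesgue. \<Psi> t) / h n"
      by (simp add: shift(2) diff_divide_distrib)
    also have "(LINT t:{-h n..0}|lebesgue. \<Psi> t) = (LINT t:{-h n..0}|lebesgue. \<Phi>0 * \<omega> t)"
      by (rule set_lebesgue_integral_cong) (auto simp: \<Psi>_def \<Phi>e_def)
    also have "\<dots> = \<Phi>0 * (LINT t:{-h n..0}|lebesgue. \<omega> t)" by (rule set_integral_mult_right)
    finally have eq: "(\<integral>t. (\<Psi> t - \<Psi> (t - h n)) / h n \<partial>MT T)
       = (LINT t:{T - h n..T}|lebesgue. \<Psi> t) / h n - \<Phi>0 * ((LINT t:{0 - h n..0}|lebesgue. \<omega> t) / h n)" by simp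
    have "(LINT t:{T - h n..T}|lebesgue. Lo t * \<omega> t) \<le> (LINT t:{T - h n..T}|lebesgue. \<Psi> t)"
    proof (rule set_integral_mono_AE)
      show "set_integrable lebesgue {T - h n..T} (\<lambda>t. Lo t * \<omega> t)"
        using h[of n] by (intro absolutely_integrable_continuous_real continuous_intros \<omega>c continuous_on_subset[OF Lo(1)]) auto
      show "set_integrable lebesgue {T - h n..T} \<Psi>"
        by (rule set_integrable_subset[OF \<Psi>i]) (use h[of n] T in auto)
      have "AE t in lebesgue. t \<noteq> 0 \<and> t \<noteq> T" by (intro AE_conjI AE_completion AE_lborel_singleton)
      then show "AE t\<in>{T - h n..T} in lebesgue. Lo t * \<omega> t \<le> \<Psi> t"
        using Lo(2)[unfolded AE_MT_iff]
        by eventually_elim (use h[of n] \<omega>(3) in \<open>auto simp: \<Psi>_def \<Phi>e_def intro!: mult_right_mono\<close>)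
    qed
    then have "(LINT t:{T - h n..T}|lebesgue. Lo t * \<omega> t) / h n \<le> (LINT t:{T - h n..T}|lebesgue. \<Psi> t) / h n"
      using h(1)[of n] by (intro divide_right_mono) auto
    then show ?thesis unfolding eq by linarith
  qed
  have "Lo T * \<omega> T - \<Phi>0 * \<omega> 0 \<le> (\<integral>t. ip (g' t) (v t) \<partial>MT T) + B * (0 * ?G + 3 * (0 * Kf T)) / 2 + (\<integral>t. \<omega>' t * \<Phi> t \<partial>MT T)"
  proof (rule LIMSEQ_le)
    show "(\<lambda>n. (LINT t:{T - h n..T}|lebesgue. Lo t * \<omega> t) / h n - \<Phi>0 * ((LINT t:{0 - h n..0}|lebesgue. \<omega> t) / h n))
        \<longlonglongrightarrow> Lo T * \<omega> T - \<Phi>0 * \<omega> 0"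
      by (intro tendsto_intros avg_tendsto[of 0 T] avg_tendsto[of "-T" 0] h hl continuous_on_mult \<omega>c Lo(1)) (use T in auto)
    show "(\<lambda>n. (\<integral>t. ip (g' t) (dz (h n) t) / h n \<partial>MT T) + B * (h n * ?G + 3 * (h n * Kf T)) / 2 + (\<integral>t. q n t * \<Phi> t \<partial>MT T))
        \<longlonglongrightarrow> (\<integral>t. ip (g' t) (v t) \<partial>MT T) + B * (0 * ?G + 3 * (0 * Kf T)) / 2 + (\<integral>t. \<omega>' t * \<Phi> t \<partial>MT T)"
      by (intro tendsto_add tendsto_divide tendsto_mult tendsto_const lim1 lim2 hl) simp
  qed (use order_trans[OF lo up] in blast)
  then show ?thesis unfolding eq1 by (simp add: mult.commute)
qed

text \<open>The mean of \<Phi> over (0,h) stays bounded as h tends to 0, so good times with bounded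
  values exist arbitrarily close to 0. For the mean, the difference of (T - t) \<Phi> t over one
  step is integrated: telescoping leaves at most h times the integral of \<Phi>, while on (0,h) the
  function itself remains, with a factor of at least T - h; on the rest \<open>step\<close> limits
  the decrease of \<Phi>.\<close>

lemma bounded_near_zero:
  assumes g: "g \<in> L2_time V nrm T" and \<Phi>: "integrable (MT T) \<Phi>" "AE t in MT T. 0 \<le> \<Phi> t"
    and E: "AE t in MT T. t \<in> E"
    and step: "\<And>s t. s \<in> E \<Longrightarrow> t \<in> E \<Longrightarrow> 0 < s \<Longrightarrow> s < t \<Longrightarrow> t < T \<Longrightarrow>
        \<Phi> s - \<Phi> t \<le> ip (g s) (\<lambda>x. z s x - z t x)"
  obtains K where "\<And>d. d > 0 \<Longrightarrow> \<exists>t\<in>E. 0 < t \<and> t < T \<and> t < d \<and> \<Phi> t \<le> K"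
proof -
  let ?P = "LINT t:{0..T}|lebesgue. \<Phi> t"
  let ?G = "LINT t:{0..T}|lebesgue. (nrm (g t))\<^sup>2"
  \<comment> \<open>\<open>2 * ?P\<close> comes from the window next to \<open>T\<close> and from
    the change of the factor T - t over one step; the other term is Young's inequality applied to
    \<open>step\<close>, with that factor bounded by \<open>T\<close>.\<close>
  define C where "C = 2 * ?P + T / 2 * (?G + Kf T)"
  have \<Phi>i: "set_integrable lebesgue {s..t} \<Phi>" if "0 \<le> s" "t \<le> T" for s t by (rule integrable_MT_Icc[OF \<Phi>(1) that])
  have ends: "AE t in lebesgue. t \<noteq> 0 \<and> t \<noteq> T" by (intro AE_conjI AE_completion AE_lborel_singleton)
  have \<Phi>0: "AE t in lebesgue. t \<in> {0..T} \<longrightarrow> 0 \<le> \<Phi> t"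
    using ends \<Phi>(2)[unfolded AE_MT_iff] by eventually_elim auto
  have main: "(LINT t:{0..h}|lebesgue. \<Phi> t) \<le> h * (2 * C / T)" if h: "0 < h" "h \<le> T / 2" for h
  proof -
    have hT: "h \<le> T" "h < T" using h T by auto
    \<comment> \<open>The factor T - t is at most h in the last window, so the integral of \<Phi>
      suffices there and no bound near \<open>T\<close> is required.\<close>
    define F where "F t = indicator {0<..T} t * ((T - t) * \<Phi> t)" for t
    define q where "q t = indicator {0<..T} t * (nrm (g t))\<^sup>2" for t
    have ext: "set_integrable lebesgue {-h..T} (\<lambda>t. indicator {0<..T} t * k t)" if "set_integrable lebesgue {0..T} k" for k :: "real \<Rightarrow> real"
    proof -
      have "set_integrable lebesgue {0<..T} k" by (rule set_integrable_subset[OF that]) auto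
      moreover have "indicat_real {0<..T} t *\<^sub>R k t = indicat_real {-h..T} t *\<^sub>R (indicator {0<..T} t * k t)" for t
        using h by (auto simp: indicator_def)
      ultimately show ?thesis unfolding set_integrable_def by (simp only:)
    qed
    have Fi0: "set_integrable lebesgue {0..T} (\<lambda>t. (T - t) * \<Phi> t)"
      using set_integrable_mult_continuous[OF \<Phi>i[of 0 T], of "\<lambda>t. T - t"] by (simp add: mult.commute continuous_intros)
    have qi0: "set_integrable lebesgue {0..T} (\<lambda>t. (nrm (g t))\<^sup>2)"
      by (rule integrable_MT_Icc[OF L2_time_nrm(1)[OF g]]) auto
    have Fi: "set_integrable lebesgue {-h..T} F" and qi: "set_integrable lebesgue {-h..T} q"
      unfolding F_def q_def by (rule ext[OF Fi0] ext[OF qi0])+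
    note Fs = LINT_shift[OF Fi less_imp_le[OF h(1)] hT(1)] and qs = LINT_shift[OF qi less_imp_le[OF h(1)] hT(1)]
    have sub: "set_integrable lebesgue {0..T} f" if "set_integrable lebesgue {-h..T} f" for f :: "real \<Rightarrow> real"
      by (rule set_integrable_subset[OF that]) (use h in auto)
    have left0: "(LINT t:{-h..0}|lebesgue. indicator {0<..T} t * k t) = 0" for k :: "real \<Rightarrow> real"
      unfolding set_lebesgue_integral_def by (rule integral_eq_zero_AE) (auto simp: indicator_def)
    have qle: "(LINT t:{0..T}|lebesgue. q (t - h)) \<le> ?G"
    proof -
      have "0 \<le> (LINT t:{T-h..T}|lebesgue. q t)"
        unfolding set_lebesgue_integral_def by (rule integral_nonneg_AE) (auto simp: q_def)
      also have "\<dots> = (LINT t:{0..T}|lebesgue. q t) - (LINT t:{0..T}|lebesgue. q (t - h))"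
        using qs(2) left0 set_integral_diff(2)[OF sub[OF qi] qs(1)] by (simp add: q_def)
      also have "(LINT t:{0..T}|lebesgue. q t) = ?G"
      proof -
        have "AE t in lebesgue. indicat_real {0..T} t *\<^sub>R q t = indicat_real {0..T} t *\<^sub>R (nrm (g t))\<^sup>2"
          using ends by eventually_elim (auto simp: q_def indicator_def)
        then show ?thesis
          unfolding set_lebesgue_integral_def using sub[OF qi] qi0
          by (intro integral_cong_AE) (auto simp: set_integrable_def)
      qed
      finally show ?thesis by simp
    qed
    define kd where "kd t = Kf t - Kf (t - h)" for t
    have kdi: "set_integrable lebesgue {0..T} kd" and kdle: "(LINT t:{0..T}|lebesgue. kd t) \<le> h * Kf T"
      using integrable_MT_Icc[OF Kf_shift(1)[OF h(1) hT(1)], of 0 T] Kf_shift(2)[OF h(1) hT(1)]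
      unfolding kd_def integral_MT_Icc by auto
    \<comment> \<open>One lower bound for both cases: on (0,h) the shifted function vanishes and the
      subtracted terms are nonnegative, while beyond h the first term is zero.\<close>
    let ?low = "\<lambda>t. (T - h) * (indicator {0..h} t * \<Phi> t) - T / 2 * (h * q (t - h) + kd t) - h * \<Phi> t"
    have i0h: "set_integrable lebesgue {0..T} (\<lambda>t. indicator {0..h} t * \<Phi> t)"
    proof -
      have "indicat_real {0..h} t *\<^sub>R \<Phi> t = indicat_real {0..T} t *\<^sub>R (indicator {0..h} t * \<Phi> t)" for t
        using hT by (auto simp: indicator_def)
      moreover have "set_integrable lebesgue {0..h} \<Phi>" using hT by (intro \<Phi>i) auto
      ultimately show ?thesis unfolding set_integrable_def by (simp only:)
    qed
    have l0h: "(LINT t:{0..T}|lebesgue. indicator {0..h} t * \<Phi> t) = (LINT t:{0..h}|lebesgue. \<Phi> t)"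
      unfolding set_lebesgue_integral_def
      by (rule Bochner_Integration.integral_cong) (use hT in \<open>auto simp: indicator_def\<close>)
    have i1: "set_integrable lebesgue {0..T} (\<lambda>t. T / 2 * (h * q (t - h) + kd t))"
      by (intro set_integrable_mult_right set_integral_add(1) qs(1) kdi)
    have lowi: "set_integrable lebesgue {0..T} ?low"
      by (intro set_integral_diff(1) set_integrable_mult_right i0h i1 \<Phi>i) auto
    have lowint: "(LINT t:{0..T}|lebesgue. ?low t) = (T - h) * (LINT t:{0..h}|lebesgue. \<Phi> t)
        - T / 2 * (h * (LINT t:{0..T}|lebesgue. q (t - h)) + (LINT t:{0..T}|lebesgue. kd t)) - h * ?P"
      by (subst set_integral_diff(2)[OF set_integral_diff(1)[OF set_integrable_mult_right[OF i0h] i1] set_integrable_mult_right[OF \<Phi>i]], simp, simp,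
          subst set_integral_diff(2)[OF set_integrable_mult_right[OF i0h] i1],
          simp only: set_integral_mult_right l0h set_integral_add(2)[OF set_integrable_mult_right[OF qs(1)] kdi])
    have pw: "AE t in lebesgue. t \<in> {0..T} \<longrightarrow> ?low t \<le> F t - F (t - h)"
      using ends E[unfolded AE_MT_iff] AE_shift[OF E[unfolded AE_MT_iff], of h] \<Phi>0
        L2_timeD(2)[OF g, unfolded AE_MT_iff] AE_shift[OF L2_timeD(2)[OF g, unfolded AE_MT_iff], of h]
        AE_shift[OF ends, of h]
    proof eventually_elim
      case (elim t)
      show ?case
      proof
        assume "t \<in> {0..T}"
        then have t: "0 < t" "t < T" using elim(1) by auto
        have P0: "0 \<le> \<Phi> t" using elim(4) t by simp
        have k0: "0 \<le> kd t" unfolding kd_def by (rule Kf_shift(3)[OF h(1) hT(1)]) (use t in auto)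
        show "?low t \<le> F t - F (t - h)"
        proof (cases "t < h")
          case True
          have "q (t - h) = 0" "F (t - h) = 0" using True by (auto simp: q_def F_def)
          moreover have "(T - h) * \<Phi> t \<le> (T - t) * \<Phi> t" using True P0 by (intro mult_right_mono) auto
          moreover have "0 \<le> T / 2 * kd t" "0 \<le> h * \<Phi> t" using T k0 P0 h by auto
          ultimately show ?thesis using True t by (simp add: F_def)
        next
          case False
          then have s: "0 < t - h" "t - h < T" using elim(7) t h by auto
          have sE: "t - h \<in> E" "t \<in> E" and gV: "g (t - h) \<in> V" using elim s t by auto
          have dzeq: "dz h t = (\<lambda>x. z t x - z (t - h) x)" using s by (simp add: dz_def max_def)
          have zs: "z (t - h) \<in> V" "z t \<in> V" using s t by (auto intro: zV)
          have "\<Phi> (t - h) - \<Phi> t \<le> ip (g (t - h)) (\<lambda>x. z (t - h) x - z t x)"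
            by (rule step[OF sE s(1)]) (use h t in auto)
          also have "\<dots> \<le> \<bar>ip (g (t - h)) (dz h t)\<bar>"
            unfolding dzeq by (simp add: ip_diff_right[OF zs gV] ip_diff_right[OF zs(2,1) gV])
          also have "\<dots> \<le> (h * (nrm (g (t - h)))\<^sup>2 + kd t) / 2"
            using ip_dz_le[OF gV h(1) hT(1) _ _ zero_less_one, of t] t h by (simp add: kd_def field_simps)
          finally have d: "\<Phi> (t - h) - \<Phi> t \<le> (h * q (t - h) + kd t) / 2"
            using s by (simp add: q_def)
          have nn: "0 \<le> h * q (t - h) + kd t" using k0 h by (auto simp: q_def)
          have "(T - (t - h)) * (\<Phi> (t - h) - \<Phi> t) \<le> (T - (t - h)) * ((h * q (t - h) + kd t) / 2)"
            using d s by (intro mult_left_mono) auto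
          also have "\<dots> \<le> T * ((h * q (t - h) + kd t) / 2)"
            using nn s by (intro mult_right_mono) auto
          finally have "(T - (t - h)) * (\<Phi> (t - h) - \<Phi> t) \<le> T / 2 * (h * q (t - h) + kd t)" by simp
          moreover have "F t - F (t - h) = - ((T - (t - h)) * (\<Phi> (t - h) - \<Phi> t)) - h * \<Phi> t"
            using s t by (simp add: F_def algebra_simps)
          moreover have "(T - h) * (indicator {0..h} t * \<Phi> t) = 0"
            using False elim(7) by (auto simp: indicator_def)
          ultimately show ?thesis by linarith
        qed
      qed
    qed
    have Fhi: "(LINT t:{T-h..T}|lebesgue. F t) \<le> h * ?P"
    proof -
      have "(LINT t:{T-h..T}|lebesgue. F t) \<le> (LINT t:{T-h..T}|lebesgue. h * \<Phi> t)"
      proof (rule set_integral_mono_AE)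
        show "set_integrable lebesgue {T-h..T} F" by (rule set_integrable_subset[OF Fi]) (use hT h in auto)
        show "set_integrable lebesgue {T-h..T} (\<lambda>t. h * \<Phi> t)" by (rule set_integrable_mult_right[OF \<Phi>i]) (use hT in auto)
        show "AE t\<in>{T-h..T} in lebesgue. F t \<le> h * \<Phi> t"
          using \<Phi>0 by eventually_elim (use hT in \<open>auto simp: F_def intro!: mult_right_mono\<close>)
      qed
      also have "\<dots> = h * (LINT t:{T-h..T}|lebesgue. \<Phi> t)" by (rule set_integral_mult_right)
      also have "(LINT t:{T-h..T}|lebesgue. \<Phi> t) \<le> ?P"
      proof -
        have "?P = (LINT t:{0..T-h}|lebesgue. \<Phi> t) + (LINT t:{T-h..T}|lebesgue. \<Phi> t)"
          by (rule LINT_combine[OF \<Phi>i]) (use hT h in auto)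
        moreover have "0 \<le> (LINT t:{0..T-h}|lebesgue. \<Phi> t)"
          unfolding set_lebesgue_integral_def
          by (rule integral_nonneg_AE) (use \<Phi>0 h in \<open>auto elim!: eventually_mono simp: indicator_def\<close>)
        ultimately show ?thesis by simp
      qed
      finally show ?thesis using h by simp
    qed
    have "(LINT t:{0..T}|lebesgue. ?low t) \<le> (LINT t:{0..T}|lebesgue. F t - F (t - h))"
      by (rule set_integral_mono_AE[OF lowi set_integral_diff(1)[OF sub[OF Fi] Fs(1)]]) (use pw in auto)
    also have "\<dots> \<le> h * ?P" using Fs(2) left0 Fhi by (simp add: F_def)
    finally have "(T - h) * (LINT t:{0..h}|lebesgue. \<Phi> t) \<le> T / 2 * (h * (LINT t:{0..T}|lebesgue. q (t - h)) + (LINT t:{0..T}|lebesgue. kd t)) + 2 * h * ?P"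
      unfolding lowint by linarith
    also have "\<dots> \<le> T / 2 * (h * ?G + h * Kf T) + 2 * h * ?P"
      using qle kdle T h by (intro add_right_mono mult_left_mono add_mono) auto
    also have "\<dots> = h * C" by (simp add: C_def algebra_simps)
    finally have A: "(T - h) * (LINT t:{0..h}|lebesgue. \<Phi> t) \<le> h * C" .
    have "0 \<le> (LINT t:{0..h}|lebesgue. \<Phi> t)"
      unfolding set_lebesgue_integral_def
      by (rule integral_nonneg_AE) (use \<Phi>0 hT in \<open>auto elim!: eventually_mono simp: indicator_def\<close>)
    then have "T / 2 * (LINT t:{0..h}|lebesgue. \<Phi> t) \<le> (T - h) * (LINT t:{0..h}|lebesgue. \<Phi> t)"
      using h by (intro mult_right_mono) auto
    with A have "T / 2 * (LINT t:{0..h}|lebesgue. \<Phi> t) \<le> h * C" by linarith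
    then show ?thesis using T by (simp add: field_simps)
  qed
  show thesis
  proof (rule that)
    fix d :: real assume d: "d > 0"
    define h where "h = min d (T / 2)"
    have h: "0 < h" "h \<le> T / 2" "h \<le> d" "h < T" using d T by (auto simp: h_def)
    show "\<exists>t\<in>E. 0 < t \<and> t < T \<and> t < d \<and> \<Phi> t \<le> 2 * C / T + 1"
    proof (rule ccontr)
      assume no: "\<not> ?thesis"
      have ki: "set_integrable lebesgue {0..h} (\<lambda>t. 2 * C / T + 1)"
        by (intro absolutely_integrable_continuous_real continuous_intros)
      have "AE t in lebesgue. t \<noteq> h" by (rule AE_completion) (rule AE_lborel_singleton)
      then have "AE t\<in>{0..h} in lebesgue. 2 * C / T + 1 \<le> \<Phi> t"
        using ends E[unfolded AE_MT_iff] by eventually_elim (use no h in \<open>force simp: not_le\<close>)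
      then have "(LINT t:{0..h}|lebesgue. 2 * C / T + 1) \<le> (LINT t:{0..h}|lebesgue. \<Phi> t)"
        using h by (intro set_integral_mono_AE ki \<Phi>i) auto
      also have "\<dots> \<le> h * (2 * C / T)" by (rule main[OF h(1,2)])
      finally have "h * (2 * C / T + 1) \<le> h * (2 * C / T)" using h by (simp add: set_lebesgue_integral_def)
      then have "2 * C / T + 1 \<le> 2 * C / T" by (simp only: mult_le_cancel_left_pos[OF h(1)])
      then show False by simp
    qed
  qed
qed

end

section \<open>The weighted Sobolev spaces\<close>

lemma has_weak_derivD:
  assumes "has_weak_deriv f g"
  shows "loc_int 0 1 f" "loc_int 0 1 g"
    "\<And>\<psi>. \<psi> \<in> test_functions 0 1 \<Longrightarrow>
        (LINT x:{0<..<1}|lebesgue. f x * deriv \<psi> x) = - (LINT x:{0<..<1}|lebesgue. g x * \<psi> x)"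
  using assms by (auto simp: has_weak_deriv_def locally_integrable_iff_loc_int)

lemma weakly_differentiable_wderiv: "weakly_differentiable f \<Longrightarrow> has_weak_deriv f (wderiv f)"
  using someI_ex[of "has_weak_deriv f"] by (simp add: weakly_differentiable_def wderiv_def)

text \<open>Measurability is not assumed. As the measure is complete, both functions are measurable
  or neither is, and in the second case both integrals are 0 by convention. Versions picked by a
  choice operator thus become interchangeable under integrals.\<close>

lemma integral_MT_cong_AE:
  fixes f g :: "real \<Rightarrow> real"
  assumes ae: "AE x in MT T. f x = g x"
  shows "(\<integral>x. f x \<partial>MT T) = (\<integral>x. g x \<partial>MT T)"
proof -
  have ae': "AE x in MT T. g x = f x" using ae by eventually_elim (rule sym)
  show ?thesis
  proof (cases "f \<in> borel_measurable (MT T)")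
    case True
    then show ?thesis
      by (rule integral_cong_AE[OF _ borel_measurable_AE_on[OF True _ ae] ae]) simp
  next
    case False
    then have "g \<notin> borel_measurable (MT T)" using borel_measurable_AE_on[OF _ _ ae'] by auto
    then show ?thesis using False
      by (metis borel_measurable_integrable not_integrable_integral_eq)
  qed
qed

lemma LINT_01_cong_AE:
  "AE x in MT 1. f x = g x \<Longrightarrow> (LINT x:{0<..<1}|lebesgue. f x) = (LINT x:{0<..<1}|lebesgue. g x :: real)"
  unfolding integral_MT by (rule integral_MT_cong_AE)

text \<open>The fundamental lemma applied to g - g'. Since \<open>wderiv\<close> is a choice,
  identities for it can hold almost everywhere only, and they all rest on this uniqueness.\<close>

lemma has_weak_deriv_unique:
  assumes f: "has_weak_deriv f g" and f': "has_weak_deriv f' g'" and ae: "AE x in MT 1. f x = f' x"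
  shows "AE x in MT 1. g x = g' x"
proof -
  note fD = has_weak_derivD[OF f] and fD' = has_weak_derivD[OF f']
  have l: "loc_int 0 1 (\<lambda>x. g x - g' x)"
    using fD(2) fD'(2) unfolding loc_int_def by (auto intro: set_integral_diff(1))
  have "AE x in lebesgue. x \<in> {0<..<1} \<longrightarrow> g x - g' x = 0"
  proof (rule fundamental_lemma_variations[OF l])
    fix \<psi> assume \<psi>: "\<psi> \<in> test_functions 0 1"
    have "(LINT x:{0<..<1}|lebesgue. f x * deriv \<psi> x) = (LINT x:{0<..<1}|lebesgue. f' x * deriv \<psi> x)"
      by (rule LINT_01_cong_AE) (use ae in \<open>auto elim!: eventually_mono\<close>)
    then have "(LINT x:{0<..<1}|lebesgue. g x * \<psi> x) = (LINT x:{0<..<1}|lebesgue. g' x * \<psi> x)"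
      using fD(3)[OF \<psi>] fD'(3)[OF \<psi>] by simp
    then show "(LINT x:{0<..<1}|lebesgue. (g x - g' x) * \<psi> x) = 0"
      unfolding left_diff_distrib
      by (subst set_integral_diff(2)[OF loc_int_mult_test(1)[OF fD(2) \<psi>] loc_int_mult_test(1)[OF fD'(2) \<psi>]]) simp_all
  qed
  then show ?thesis unfolding AE_MT_iff by simp
qed

lemma has_weak_deriv_linear:
  assumes f: "has_weak_deriv f g" and f': "has_weak_deriv f' g'"
  shows "has_weak_deriv (\<lambda>x. f x + c * f' x) (\<lambda>x. g x + c * g' x)"
proof -
  note fD = has_weak_derivD[OF f] and fD' = has_weak_derivD[OF f']
  have l: "loc_int 0 1 (\<lambda>x. k x + c * k' x)" if "loc_int 0 1 k" "loc_int 0 1 k'" for k k'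
    using that unfolding loc_int_def by (intro allI impI set_integral_add(1) set_integrable_mult_right) auto
  have lin: "(LINT x:{0<..<1}|lebesgue. (k x + c * k' x) * p x)
      = (LINT x:{0<..<1}|lebesgue. k x * p x) + c * (LINT x:{0<..<1}|lebesgue. k' x * p x)"
    if "set_integrable lebesgue {0<..<1} (\<lambda>x. k x * p x)" "set_integrable lebesgue {0<..<1} (\<lambda>x. k' x * p x)" for k k' p :: "real \<Rightarrow> real"
    unfolding distrib_right mult.assoc
    by (subst set_integral_add(2)[OF that(1) set_integrable_mult_right[OF that(2)]]) (simp only: set_integral_mult_right)
  show ?thesis
    unfolding has_weak_deriv_def locally_integrable_iff_loc_int
  proof (intro conjI ballI l fD fD')
    fix \<psi> assume \<psi>: "\<psi> \<in> test_functions 0 1"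
    note t = loc_int_mult_test[OF _ \<psi> zero_less_one]
    show "(LINT x:{0<..<1}|lebesgue. (f x + c * f' x) * deriv \<psi> x) = - (LINT x:{0<..<1}|lebesgue. (g x + c * g' x) * \<psi> x)"
      using fD(3)[OF \<psi>] fD'(3)[OF \<psi>]
      by (simp add: lin[OF t(2)[OF fD(1)] t(2)[OF fD'(1)]] lin[OF t(1)[OF fD(2)] t(1)[OF fD'(2)]])
  qed
qed

lemma loc_int_cong_AE:
  assumes f: "loc_int 0 1 f" and ae: "AE x in MT 1. f x = f' x"
  shows "loc_int 0 1 f'"
  unfolding loc_int_def
proof (intro allI impI)
  fix c d :: real assume cd: "0 < c" "d < 1"
  have i: "integrable lebesgue (\<lambda>x. indicat_real {c..d} x *\<^sub>R f x)"
    using loc_intD[OF f cd] by (simp add: set_integrable_def)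
  have ae': "AE x in lebesgue. indicat_real {c..d} x *\<^sub>R f x = indicat_real {c..d} x *\<^sub>R f' x"
    using ae unfolding AE_MT_iff by eventually_elim (use cd in \<open>auto simp: indicator_def\<close>)
  have m: "(\<lambda>x. indicat_real {c..d} x *\<^sub>R f' x) \<in> borel_measurable lebesgue"
    by (rule borel_measurable_AE[OF borel_measurable_integrable[OF i] ae'])
  show "set_integrable lebesgue {c..d} f'"
    unfolding set_integrable_def
    by (rule integrable_cong_AE[THEN iffD1, OF borel_measurable_integrable[OF i] m ae' i])
qed

lemma has_weak_deriv_cong_AE:
  assumes f: "has_weak_deriv f g" and ae: "AE x in MT 1. f x = f' x"
  shows "has_weak_deriv f' g"
proof -
  note fD = has_weak_derivD[OF f]
  have "(LINT x:{0<..<1}|lebesgue. f' x * deriv \<psi> x) = - (LINT x:{0<..<1}|lebesgue. g x * \<psi> x)"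
    if \<psi>: "\<psi> \<in> test_functions 0 1" for \<psi>
  proof -
    have "(LINT x:{0<..<1}|lebesgue. f x * deriv \<psi> x) = (LINT x:{0<..<1}|lebesgue. f' x * deriv \<psi> x)"
      by (rule LINT_01_cong_AE) (use ae in \<open>auto elim!: eventually_mono\<close>)
    then show ?thesis using fD(3)[OF \<psi>] by simp
  qed
  then show ?thesis
    unfolding has_weak_deriv_def locally_integrable_iff_loc_int using loc_int_cong_AE[OF fD(1) ae] fD(2) by blast
qed

interpretation L: semi_hilbert "wL2 (MT 1) (\<lambda>x. 1)" "wip (MT 1) (\<lambda>x. 1)"
  by (rule semi_hilbert_wL2) (auto intro: integrable_MT_const)

lemma L2_norm01_L: "L2_norm01 f = L.nrm f"
  unfolding L2_norm01_def L.nrm_def wip_def integral_MT by (simp add: power2_eq_square)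

lemma wip1: "wip (MT 1) (\<lambda>x. 1) f g = (\<integral>x. f x * g x \<partial>MT 1)"
  by (simp add: wip_def)

lemma wip_cong_AE:
  assumes "AE x in MT 1. f x = f' x" "AE x in MT 1. g x = g' x"
  shows "wip (MT 1) w f g = wip (MT 1) w f' g'"
  unfolding wip_def integral_MT[symmetric]
  by (rule LINT_01_cong_AE) (use assms in \<open>eventually_elim, simp\<close>)

lemma wL2_cong_AE:
  assumes "f \<in> wL2 (MT 1) w" "AE x in MT 1. f x = f' x" and [measurable]: "w \<in> borel_measurable (MT 1)"
  shows "f' \<in> wL2 (MT 1) w"
proof -
  have [measurable]: "f \<in> borel_measurable (MT 1)" using assms by (simp add: wL2_def)
  have [measurable]: "f' \<in> borel_measurable (MT 1)"
    by (rule borel_measurable_AE_on[OF _ _ assms(2)]) simp_all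
  have "integrable (MT 1) (\<lambda>x. w x * (f' x)\<^sup>2)"
  proof (rule integrable_cong_AE[THEN iffD1, rotated 3])
    show "integrable (MT 1) (\<lambda>x. w x * (f x)\<^sup>2)" using assms by (simp add: wL2_def)
    show "AE x in MT 1. w x * (f x)\<^sup>2 = w x * (f' x)\<^sup>2" using assms(2) by eventually_elim simp
  qed measurable
  then show ?thesis by (simp add: wL2_def)
qed

section \<open>The weight and the spaces it defines\<close>

locale weight =
  fixes a :: "real \<Rightarrow> real"
  assumes a_cont: "continuous_on {0..1} a" and a_pos: "\<And>x. 0 < x \<Longrightarrow> x < 1 \<Longrightarrow> a x > 0"
begin

lemma a_measurable: "a \<in> borel_measurable (MT 1)"
  by (rule continuous_imp_measurable_on_sets_lebesgue) (auto intro: continuous_on_subset[OF a_cont])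

lemma a_bounded: obtains A where "A > 0" "\<And>x. x \<in> {0<..<1} \<Longrightarrow> a x \<le> A"
proof -
  have "bounded (a ` {0..1})"
    by (intro compact_imp_bounded compact_continuous_image a_cont) simp
  then obtain A where "\<forall>x\<in>a ` {0..1}. \<bar>x\<bar> \<le> A" unfolding bounded_real by blast
  then have A: "\<bar>a x\<bar> \<le> A" if "x \<in> {0..1}" for x using that by blast
  show thesis
  proof (rule that)
    show "\<bar>A\<bar> + 1 > 0" by simp
    show "a x \<le> \<bar>A\<bar> + 1" if "x \<in> {0<..<1}" for x using A[of x] that by auto
  qed
qed

lemma a_integrable: "integrable (MT 1) a"
proof -
  obtain A where A: "\<And>x. x \<in> {0<..<1} \<Longrightarrow> a x \<le> A" using a_bounded by blast
  show ?thesis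
    by (rule Bochner_Integration.integrable_bound[OF integrable_MT_const[of 1 A] a_measurable])
       (use A a_pos in \<open>auto simp: abs_of_pos intro!: AE_I2 order_trans[OF A]\<close>)
qed

lemma L2a_eq: "L2a a = wL2 (MT 1) a"
  by (simp add: L2a_def wL2_def integrable_MT_iff)

lemma norm_a_eq: "norm_a a u = sqrt (wip (MT 1) a u u)"
  by (simp add: norm_a_def wip_def integral_MT power2_eq_square)

text \<open>The abstract norm is rewritten to \<open>norm_a a\<close>, so that the general results
  speak of the very norm of the statement.\<close>

sublocale semi_hilbert "L2a a" "wip (MT 1) a"
  rewrites "semi_inner.nrm (wip (MT 1) a) = norm_a a"
proof -
  show s: "semi_hilbert (L2a a) (wip (MT 1) a)"
    unfolding L2a_eq by (rule semi_hilbert_wL2[OF a_measurable _ a_integrable]) (use a_pos in auto)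
  interpret semi_hilbert "L2a a" "wip (MT 1) a" by (rule s)
  show "semi_inner.nrm (wip (MT 1) a) = norm_a a"
    by (rule ext) (simp add: nrm_def norm_a_eq)
qed

lemma a_mult_L2:
  assumes u: "u \<in> L2a a"
  shows "(\<lambda>x. a x * u x) \<in> wL2 (MT 1) (\<lambda>x. 1)"
proof -
  obtain A where A: "\<And>x. x \<in> {0<..<1} \<Longrightarrow> a x \<le> A" using a_bounded by blast
  have um: "u \<in> borel_measurable (MT 1)" and ui: "integrable (MT 1) (\<lambda>x. a x * (u x)\<^sup>2)"
    using u by (auto simp: L2a_eq wL2_def)
  have "integrable (MT 1) (\<lambda>x. (a x * u x)\<^sup>2)"
  proof (rule Bochner_Integration.integrable_bound)
    show "integrable (MT 1) (\<lambda>x. A * (a x * (u x)\<^sup>2))" using ui by simp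
    show "(\<lambda>x. (a x * u x)\<^sup>2) \<in> borel_measurable (MT 1)"
      by (intro borel_measurable_power borel_measurable_times um a_measurable)
    show "AE x in MT 1. norm ((a x * u x)\<^sup>2) \<le> norm (A * (a x * (u x)\<^sup>2))"
    proof (rule AE_I2)
      fix x assume "x \<in> space (MT 1)"
      then have x: "x \<in> {0<..<1}" by simp
      have ax: "0 < a x" using x a_pos by simp
      have "a x * (a x * (u x)\<^sup>2) \<le> A * (a x * (u x)\<^sup>2)"
        using A[OF x] ax by (intro mult_right_mono) auto
      then have "(a x * u x)\<^sup>2 \<le> A * (a x * (u x)\<^sup>2)"
        by (simp add: power2_eq_square mult_ac)
      then have "(a x * u x)\<^sup>2 \<le> \<bar>A * (a x * (u x)\<^sup>2)\<bar>" by (rule order_trans[OF _ abs_ge_self])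
      then show "norm ((a x * u x)\<^sup>2) \<le> norm (A * (a x * (u x)\<^sup>2))" by simp
    qed
  qed
  moreover have "(\<lambda>x. a x * u x) \<in> borel_measurable (MT 1)"
    by (intro borel_measurable_times um a_measurable)
  ultimately show ?thesis by (simp add: wL2_def)
qed

text \<open>Since \<open>a\<close> is bounded, (a u)^2 is at most a constant times a u^2.
  Convergence in the weighted space therefore gives convergence of the products with
  \<open>a\<close> in L^2(0,1), where weak derivatives are tested.\<close>

lemma a_mult_norm:
  obtains A where "A > 0" "\<And>u. u \<in> L2a a \<Longrightarrow> L.nrm (\<lambda>x. a x * u x) \<le> A * norm_a a u"
proof -
  obtain A where A: "A > 0" "\<And>x. x \<in> {0<..<1} \<Longrightarrow> a x \<le> A" using a_bounded by blast
  show thesis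
  proof (rule that)
    show "sqrt A > 0" using A by simp
    fix u assume u: "u \<in> L2a a"
    have ui: "integrable (MT 1) (\<lambda>x. a x * (u x)\<^sup>2)" using u by (auto simp: L2a_eq wL2_def)
    have "(\<integral>x. (a x * u x)\<^sup>2 \<partial>MT 1) \<le> (\<integral>x. A * (a x * (u x)\<^sup>2) \<partial>MT 1)"
    proof (rule integral_mono)
      show "integrable (MT 1) (\<lambda>x. (a x * u x)\<^sup>2)" using a_mult_L2[OF u] by (simp add: wL2_def)
      show "integrable (MT 1) (\<lambda>x. A * (a x * (u x)\<^sup>2))" using ui by simp
      fix x assume "x \<in> space (MT 1)"
      then have x: "x \<in> {0<..<1}" by simp
      have ax: "0 < a x" using x a_pos by simp
      have "a x * (a x * (u x)\<^sup>2) \<le> A * (a x * (u x)\<^sup>2)"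
        using A(2)[OF x] ax by (intro mult_right_mono) auto
      then show "(a x * u x)\<^sup>2 \<le> A * (a x * (u x)\<^sup>2)"
        by (simp add: power2_eq_square mult_ac)
    qed
    also have "\<dots> = A * (norm_a a u)\<^sup>2"
      using nrm_square[of u] by (simp add: wip_def power2_eq_square)
    finally have "(L.nrm (\<lambda>x. a x * u x))\<^sup>2 \<le> A * (norm_a a u)\<^sup>2"
      unfolding L.nrm_square wip1 by (simp add: power2_eq_square)
    then have "sqrt ((L.nrm (\<lambda>x. a x * u x))\<^sup>2) \<le> sqrt (A * (norm_a a u)\<^sup>2)" by (rule real_sqrt_le_mono)
    then show "L.nrm (\<lambda>x. a x * u x) \<le> sqrt A * norm_a a u" by (simp add: real_sqrt_mult)
  qed
qed

lemma H1aD: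
  assumes "u \<in> H1a a"
  shows "u \<in> L2a a" "has_weak_deriv (\<lambda>x. a x * u x) (am_x a u)" "am_x a u \<in> wL2 (MT 1) (\<lambda>x. 1)"
    "vanishes_at_ends (\<lambda>x. a x * u x)"
proof -
  show "u \<in> L2a a" and w: "has_weak_deriv (\<lambda>x. a x * u x) (am_x a u)" and "vanishes_at_ends (\<lambda>x. a x * u x)"
    using assms by (auto simp: H1a_def intro: weakly_differentiable_wderiv)
  have "am_x a u \<in> borel_measurable (MT 1)" by (rule loc_int_measurable[OF has_weak_derivD(2)[OF w]])
  then show "am_x a u \<in> wL2 (MT 1) (\<lambda>x. 1)"
    using assms by (simp add: wL2_def H1a_def integrable_MT_iff)
qed

lemma H2aD:
  assumes "u \<in> H2a a"
  shows "u \<in> H1a a" "has_weak_deriv (am_x a u) (am_xx a u)" "am_xx a u \<in> L2a a"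
  using assms by (auto simp: H2a_def intro: weakly_differentiable_wderiv)

lemma am_x_AE:
  assumes "has_weak_deriv (\<lambda>x. a x * u x) g"
  shows "AE x in MT 1. am_x a u x = g x"
proof -
  have "has_weak_deriv (\<lambda>x. a x * u x) (am_x a u)"
    by (rule weakly_differentiable_wderiv) (use assms in \<open>auto simp: weakly_differentiable_def\<close>)
  from has_weak_deriv_unique[OF this assms] show ?thesis by simp
qed

lemma am_x_linear:
  assumes u: "u \<in> H1a a" and v: "v \<in> H1a a"
  shows "has_weak_deriv (\<lambda>x. a x * (u x + c * v x)) (\<lambda>x. am_x a u x + c * am_x a v x)"
    "AE x in MT 1. am_x a (\<lambda>x. u x + c * v x) x = am_x a u x + c * am_x a v x"
proof -
  show w: "has_weak_deriv (\<lambda>x. a x * (u x + c * v x)) (\<lambda>x. am_x a u x + c * am_x a v x)"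
    using has_weak_deriv_linear[OF H1aD(2)[OF u] H1aD(2)[OF v], of c] by (simp add: algebra_simps)
  show "AE x in MT 1. am_x a (\<lambda>x. u x + c * v x) x = am_x a u x + c * am_x a v x"
    by (rule am_x_AE[OF w])
qed

lemma H1a_linear:
  assumes u: "u \<in> H1a a" and v: "v \<in> H1a a"
  shows "(\<lambda>x. u x + c * v x) \<in> H1a a"
proof -
  note lin = am_x_linear[OF u v, of c]
  have "(\<lambda>x. am_x a u x + c * am_x a v x) \<in> wL2 (MT 1) (\<lambda>x. 1)"
    by (intro L.add_in L.scale_in H1aD(3) u v)
  then have "am_x a (\<lambda>x. u x + c * v x) \<in> wL2 (MT 1) (\<lambda>x. 1)"
    by (rule wL2_cong_AE) (use lin(2) in \<open>auto elim!: eventually_mono\<close>)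
  then have 1: "set_integrable lebesgue {0<..<1} (\<lambda>x. (am_x a (\<lambda>x. u x + c * v x) x)\<^sup>2)"
    by (simp add: wL2_def integrable_MT_iff)
  have 2: "vanishes_at_ends (\<lambda>x. a x * (u x + c * v x))"
  proof -
    obtain w1 where w1: "continuous_on {0..1} w1" "AE x in MT 1. a x * u x = w1 x" "w1 0 = 0" "w1 1 = 0"
      using H1aD(4)[OF u] unfolding vanishes_at_ends_def by blast
    obtain w2 where w2: "continuous_on {0..1} w2" "AE x in MT 1. a x * v x = w2 x" "w2 0 = 0" "w2 1 = 0"
      using H1aD(4)[OF v] unfolding vanishes_at_ends_def by blast
    have "AE x in MT 1. a x * (u x + c * v x) = w1 x + c * w2 x"
      using w1(2) w2(2) by eventually_elim (simp add: algebra_simps)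
    then show ?thesis
      unfolding vanishes_at_ends_def using w1 w2
      by (intro exI[of _ "\<lambda>x. w1 x + c * w2 x"]) (auto intro!: continuous_intros)
  qed
  have "weakly_differentiable (\<lambda>x. a x * (u x + c * v x))"
    using lin(1) by (auto simp: weakly_differentiable_def)
  then show ?thesis
    using 1 2 add_in[OF H1aD(1)[OF u] scale_in[OF H1aD(1)[OF v]], of c] by (simp add: H1a_def)
qed

lemma am_xx_diff_AE:
  assumes u: "u \<in> H2a a" and v: "v \<in> H2a a"
  shows "AE x in MT 1. am_xx a (\<lambda>x. u x - v x) x = am_xx a u x - am_xx a v x"
proof -
  note u' = H2aD[OF u] and v' = H2aD[OF v]
  have ae: "AE x in MT 1. am_x a (\<lambda>x. u x - v x) x = am_x a u x + (-1) * am_x a v x"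
    using am_x_linear(2)[OF u'(1) v'(1), of "-1"] by simp
  then have ae': "AE x in MT 1. am_x a u x + (-1) * am_x a v x = am_x a (\<lambda>x. u x - v x) x"
    by eventually_elim (rule sym)
  have w: "has_weak_deriv (am_x a (\<lambda>x. u x - v x)) (\<lambda>x. am_xx a u x + (-1) * am_xx a v x)"
    by (rule has_weak_deriv_cong_AE[OF has_weak_deriv_linear[OF u'(2) v'(2)] ae'])
  then have "has_weak_deriv (am_x a (\<lambda>x. u x - v x)) (am_xx a (\<lambda>x. u x - v x))"
    by (intro weakly_differentiable_wderiv) (auto simp: weakly_differentiable_def)
  from has_weak_deriv_unique[OF this w] show ?thesis by simp
qed

text \<open>\<open>a * y\<close> agrees almost everywhere with a local primitive of its weak
  derivative and with a continuous function on [0,1] that vanishes at both ends. The weak derivative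
  is square integrable, hence integrable up to the ends, so the continuous function differs from a
  primitive on [0,1] by a constant and is one itself.\<close>

lemma H1a_prim:
  assumes y: "y \<in> H1a a"
  obtains F where "prim 0 1 (am_x a y) F" "F 0 = 0" "F 1 = 0" "AE x in MT 1. a x * y x = F x"
proof -
  note y' = H1aD[OF y]
  let ?r = "am_x a y"
  note wd = has_weak_derivD[OF y'(2)]
  have "(\<lambda>x. 1) \<in> wL2 (MT 1) (\<lambda>x. 1)" by (simp add: wL2_def integrable_MT_const)
  from wL2_integrable_mult[OF y'(3) this]
  have ri: "set_integrable lebesgue {0..1} ?r" by (intro integrable_MT_Icc) auto
  obtain P where P: "\<And>c d. 0 < c \<Longrightarrow> d < 1 \<Longrightarrow> prim c d ?r P"
    and ae: "AE x in lebesgue. x \<in> {0<..<1} \<longrightarrow> a x * y x = P x"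
    using weak_deriv_prim[OF wd(1,2) zero_less_one wd(3)] by blast
  obtain F where F: "continuous_on {0..1} F" "AE x in MT 1. a x * y x = F x" "F 0 = 0" "F 1 = 0"
    using y'(4) unfolding vanishes_at_ends_def by blast
  let ?G = "\<lambda>x. LINT t:{0..x}|lebesgue. ?r t"
  have G: "prim 0 1 ?r ?G" by (rule primI[OF ri]) (simp only: LINT_point add_0)
  define C where "C = P (1/2) - ?G (1/2)"
  have PG: "P x - ?G x = C" if x: "0 < x" "x < 1" for x
  proof (cases "x \<le> 1/2")
    case True
    have "P (1/2) - P x = ?G (1/2) - ?G x"
      using prim_diff[OF P[of x "1/2"], of x "1/2"] prim_diff[OF G, of x "1/2"] x True by simp
    then show ?thesis by (simp add: C_def)
  next
    case False
    have "P x - P (1/2) = ?G x - ?G (1/2)"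
      using prim_diff[OF P[of "1/2" x], of "1/2" x] prim_diff[OF G, of "1/2" x] x False by simp
    then show ?thesis by (simp add: C_def)
  qed
  have "AE x in MT 1. F x - ?G x - C = 0"
    using F(2) ae[unfolded AE_MT_iff[symmetric]] AE_space
  proof eventually_elim
    case (elim x)
    then have "P x - ?G x = C" by (intro PG) auto
    then show ?case using elim by simp
  qed
  then have FG: "F x - ?G x - C = 0" if "x \<in> {0..1}" for x
    using prim_continuous_on[OF G] F(1) by (intro continuous_AE_zero[of 1 "\<lambda>x. F x - ?G x - C", OF _ _ zero_less_one that] continuous_intros) auto
  have "prim 0 1 ?r F"
  proof (rule primI[OF ri])
    fix x :: real assume "0 \<le> x" "x \<le> 1"
    then have "F x - ?G x - C = 0" by (intro FG) simp
    moreover have "F 0 - ?G 0 - C = 0" by (rule FG) simp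
    moreover have "?G 0 = 0" by (rule LINT_point)
    ultimately show "F x = F 0 + ?G x" by linarith
  qed
  then show thesis using F that by blast
qed

end

text \<open>Otherwise \<open>f\<close> would exceed its mean by a fixed amount everywhere. The slack
  \<open>e\<close> spares strict monotonicity of the integral.\<close>

lemma ex_le_average:
  fixes f :: "real \<Rightarrow> real"
  assumes f: "set_integrable lebesgue {c..d} f" and cd: "c < d" and e: "e > 0"
  shows "\<exists>x\<in>{c..d}. (d - c) * f x \<le> (LINT x:{c..d}|lebesgue. f x) + e"
proof (rule ccontr)
  let ?J = "LINT x:{c..d}|lebesgue. f x"
  assume no: "\<not> ?thesis"
  have lt: "(?J + e) / (d - c) \<le> f x" if "x \<in> {c..d}" for x
  proof -
    have "?J + e < (d - c) * f x" using that no by (meson not_le)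
    then show ?thesis using cd by (simp add: pos_divide_le_eq mult.commute)
  qed
  have "(LINT x:{c..d}|lebesgue. (?J + e) / (d - c)) \<le> ?J"
  proof (rule set_integral_mono[OF _ f])
    show "set_integrable lebesgue {c..d} (\<lambda>x. (?J + e) / (d - c))"
      by (rule absolutely_integrable_continuous_real) (rule continuous_on_const)
  qed (rule lt)
  moreover have "(LINT x:{c..d}|lebesgue. (?J + e) / (d - c)) = ?J + e"
    using cd by (simp add: set_lebesgue_integral_def)
  ultimately show False using e by simp
qed

lemma L2_imp_integrable_Icc:
  assumes "f \<in> wL2 (MT 1) (\<lambda>x. 1)" "0 \<le> c" "d \<le> 1"
  shows "set_integrable lebesgue {c..d} f" "set_integrable lebesgue {c..d} (\<lambda>x. (f x)\<^sup>2)"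
proof -
  have "(\<lambda>x. 1) \<in> wL2 (MT 1) (\<lambda>x. 1)" by (simp add: wL2_def integrable_MT_const)
  from wL2_integrable_mult[OF assms(1) this] show "set_integrable lebesgue {c..d} f"
    using assms(2,3) by (intro integrable_MT_Icc) auto
  show "set_integrable lebesgue {c..d} (\<lambda>x. (f x)\<^sup>2)"
    using assms by (intro integrable_MT_Icc) (auto simp: wL2_def)
qed

section \<open>Integration by parts and the Dirichlet energy\<close>

context weight
begin

text \<open>The boundary terms of the integration by parts vanish along suitable sequences:
  \<open>(am)\<^sub>x\<close> is square integrable, while \<open>a y\<close> is \<open>O(sqrt x)\<close> at \<open>0\<close> and \<open>O(sqrt (1 - x))\<close> at \<open>1\<close>.\<close>

lemma am_xx_by_parts:
  assumes u: "u \<in> H2a a" and y: "y \<in> H1a a"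
  shows "wip (MT 1) a (am_xx a u) y = - wip (MT 1) (\<lambda>x. 1) (am_x a u) (am_x a y)"
proof -
  note u1 = H1aD[OF H2aD(1)[OF u]] and u2 = H2aD[OF u] and y1 = H1aD[OF y]
  let ?p = "am_x a u" and ?q = "am_xx a u" and ?r = "am_x a y"
  note wd = has_weak_derivD[OF u2(2)]
  obtain P where P: "\<And>c d. 0 < c \<Longrightarrow> d < 1 \<Longrightarrow> prim c d ?q P"
    and aeP: "AE x in lebesgue. x \<in> {0<..<1} \<longrightarrow> ?p x = P x"
    using weak_deriv_prim[OF wd(1,2) zero_less_one wd(3)] by blast
  have aeP: "AE x in MT 1. ?p x = P x" using aeP by (simp add: AE_MT_iff)
  obtain F where F: "prim 0 1 ?r F" "F 0 = 0" "F 1 = 0" and aeF: "AE x in MT 1. a x * y x = F x"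
    using H1a_prim[OF y] by blast
  have PL: "P \<in> wL2 (MT 1) (\<lambda>x. 1)" by (rule wL2_cong_AE[OF u1(3) aeP]) simp
  define R where "R = (LINT x:{0..1}|lebesgue. (?r x)\<^sup>2)"
  have R0: "0 \<le> R" unfolding R_def set_lebesgue_integral_def by (rule integral_nonneg_AE) simp
  \<comment> \<open>Cauchy-Schwarz for the primitive started at either end, where \<open>F\<close>
    vanishes.\<close>
  have F_le: "(F x)\<^sup>2 \<le> x * R" "(F x)\<^sup>2 \<le> (1 - x) * R" if x: "0 \<le> x" "x \<le> 1" for x
  proof -
    have "F x = (LINT t:{0..x}|lebesgue. ?r t)" using prim_diff[OF F(1), of 0 x] F(2) x by simp
    then have "(F x)\<^sup>2 \<le> (x - 0) * (LINT t:{0..x}|lebesgue. (?r t)\<^sup>2)"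
      using x by (simp only:) (intro LINT_Icc_square_le L2_imp_integrable_Icc[OF y1(3)]; simp)
    also have "\<dots> \<le> x * R"
      unfolding R_def using x by (simp only: diff_0_right) (intro mult_left_mono LINT_mono_Icc L2_imp_integrable_Icc[OF y1(3)]; simp)
    finally show "(F x)\<^sup>2 \<le> x * R" .
    have "F x = - (LINT t:{x..1}|lebesgue. ?r t)" using prim_diff[OF F(1), of x 1] F(3) x by simp
    then have "(F x)\<^sup>2 = (LINT t:{x..1}|lebesgue. ?r t)\<^sup>2" by simp
    also have "\<dots> \<le> (1 - x) * (LINT t:{x..1}|lebesgue. (?r t)\<^sup>2)"
      using x by (intro LINT_Icc_square_le L2_imp_integrable_Icc[OF y1(3)]; simp)
    also have "\<dots> \<le> (1 - x) * R"
      unfolding R_def using x by (intro mult_left_mono LINT_mono_Icc L2_imp_integrable_Icc[OF y1(3)]; simp)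
    finally show "(F x)\<^sup>2 \<le> (1 - x) * R" .
  qed
  define S where "S x = (LINT t:{0..x}|lebesgue. (P t)\<^sup>2)" for x
  have S: "prim 0 1 (\<lambda>t. (P t)\<^sup>2) S"
    unfolding S_def by (rule primI[OF L2_imp_integrable_Icc(2)[OF PL]]) (simp_all only: LINT_point add_0 order_refl)
  have S0: "S 0 = 0" unfolding S_def by (rule LINT_point)
  have S_mono: "S x \<le> S x'" if "0 \<le> x" "x \<le> x'" "x' \<le> 1" for x x'
  proof -
    have "S x' - S x = (LINT t:{x..x'}|lebesgue. (P t)\<^sup>2)" by (rule prim_diff[OF S that])
    also have "\<dots> \<ge> 0" unfolding set_lebesgue_integral_def by (rule integral_nonneg_AE) simp
    finally show ?thesis by simp
  qed
  \<comment> \<open>The shift by 4 gives 2 \<epsilon> \<le> 1/2, so the windows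
    [\<epsilon>, 2 \<epsilon>] and [1 - 2 \<epsilon>, 1 - \<epsilon>] lie in different halves and
    \<open>c n \<le> d n\<close>.\<close>
  define \<epsilon> where "\<epsilon> n = 1 / (real n + 4)" for n
  have \<epsilon>: "0 < \<epsilon> n" "\<epsilon> n \<le> 1/4" for n by (auto simp: \<epsilon>_def field_simps)
  have \<epsilon>l: "\<epsilon> \<longlonglongrightarrow> 0" unfolding \<epsilon>_def by real_asymp
  \<comment> \<open>Some point of the window has P^2 at most its mean plus 1. Multiplied by the
    window length, the mean is an increment of \<open>S\<close>, which tends to 0 as the window
    moves to the boundary.\<close>
  have good: "\<exists>x\<in>{c..d}. (d - c) * (P x)\<^sup>2 \<le> S d - S c + (d - c)" if "0 < c" "c < d" "d < 1" for c d
    using ex_le_average[OF L2_imp_integrable_Icc(2)[OF PL, of c d], of "d - c"] prim_diff[OF S, of c d] that by simp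
  have "\<exists>c. \<forall>n. c n \<in> {\<epsilon> n..2 * \<epsilon> n} \<and> \<epsilon> n * (P (c n))\<^sup>2 \<le> S (2 * \<epsilon> n) - S (\<epsilon> n) + \<epsilon> n"
  proof (rule choice, rule allI)
    fix n show "\<exists>c. c \<in> {\<epsilon> n..2 * \<epsilon> n} \<and> \<epsilon> n * (P c)\<^sup>2 \<le> S (2 * \<epsilon> n) - S (\<epsilon> n) + \<epsilon> n"
      using good[of "\<epsilon> n" "2 * \<epsilon> n"] \<epsilon>[of n] by auto
  qed
  then obtain c where c: "\<And>n. \<epsilon> n \<le> c n" "\<And>n. c n \<le> 2 * \<epsilon> n"
      "\<And>n. \<epsilon> n * (P (c n))\<^sup>2 \<le> S (2 * \<epsilon> n) - S (\<epsilon> n) + \<epsilon> n" by auto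
  have "\<exists>d. \<forall>n. d n \<in> {1 - 2 * \<epsilon> n..1 - \<epsilon> n} \<and> \<epsilon> n * (P (d n))\<^sup>2 \<le> S (1 - \<epsilon> n) - S (1 - 2 * \<epsilon> n) + \<epsilon> n"
  proof (rule choice, rule allI)
    fix n show "\<exists>d. d \<in> {1 - 2 * \<epsilon> n..1 - \<epsilon> n} \<and> \<epsilon> n * (P d)\<^sup>2 \<le> S (1 - \<epsilon> n) - S (1 - 2 * \<epsilon> n) + \<epsilon> n"
      using good[of "1 - 2 * \<epsilon> n" "1 - \<epsilon> n"] \<epsilon>[of n] by auto
  qed
  then obtain d where d: "\<And>n. 1 - 2 * \<epsilon> n \<le> d n" "\<And>n. d n \<le> 1 - \<epsilon> n"
      "\<And>n. \<epsilon> n * (P (d n))\<^sup>2 \<le> S (1 - \<epsilon> n) - S (1 - 2 * \<epsilon> n) + \<epsilon> n" by auto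
  have cd: "0 < c n" "c n \<le> d n" "d n < 1" for n using c[of n] d[of n] \<epsilon>[of n] by linarith+
  have e2: "(\<lambda>n. 2 * \<epsilon> n) \<longlonglongrightarrow> 0" "(\<lambda>n. 1 - 2 * \<epsilon> n) \<longlonglongrightarrow> 1" "(\<lambda>n. 1 - \<epsilon> n) \<longlonglongrightarrow> 1"
    unfolding \<epsilon>_def by real_asymp+
  have lc: "c \<longlonglongrightarrow> 0"
    by (rule tendsto_sandwich[OF always_eventually[OF allI[OF c(1)]] always_eventually[OF allI[OF c(2)]] \<epsilon>l e2(1)])
  have ld: "d \<longlonglongrightarrow> 1"
    by (rule tendsto_sandwich[OF always_eventually[OF allI[OF d(1)]] always_eventually[OF allI[OF d(2)]] e2(2,3)])
  have compose: "(\<lambda>n. k (x n)) \<longlonglongrightarrow> k l" if "continuous_on {0..1} k" "x \<longlonglongrightarrow> l" "l \<in> {0..1}" "\<And>n. x n \<in> {0..1}"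
    for k :: "real \<Rightarrow> real" and x l
    using continuous_on_tendsto_compose[OF that(1,2,3) always_eventually] that(4) by blast
  \<comment> \<open>P^2 is bounded by (J + \<epsilon>) / \<epsilon> and F^2 by a multiple of
    \<epsilon>, so \<epsilon> cancels in the product and what remains tends to 0.\<close>
  have small: "(\<lambda>n. P (x n) * F (x n)) \<longlonglongrightarrow> 0"
    if b: "\<And>n. \<epsilon> n * (P (x n))\<^sup>2 \<le> J n + \<epsilon> n" "\<And>n. (F (x n))\<^sup>2 \<le> 2 * \<epsilon> n * R" "J \<longlonglongrightarrow> 0" for x J
  proof -
    have le: "(P (x n) * F (x n))\<^sup>2 \<le> 2 * R * (J n + \<epsilon> n)" for n
    proof -
      have "(P (x n) * F (x n))\<^sup>2 \<le> (P (x n))\<^sup>2 * (2 * \<epsilon> n * R)"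
        unfolding power_mult_distrib by (rule mult_left_mono[OF b(2)]) simp
      also have "\<dots> = 2 * R * (\<epsilon> n * (P (x n))\<^sup>2)" by simp
      also have "\<dots> \<le> 2 * R * (J n + \<epsilon> n)" by (rule mult_left_mono[OF b(1)]) (use R0 in simp)
      finally show ?thesis .
    qed
    have "(\<lambda>n. sqrt (2 * R * (J n + \<epsilon> n))) \<longlonglongrightarrow> sqrt (2 * R * (0 + 0))"
      by (intro tendsto_intros b(3) \<epsilon>l)
    then have l: "(\<lambda>n. sqrt (2 * R * (J n + \<epsilon> n))) \<longlonglongrightarrow> 0" by simp
    have "\<bar>P (x n) * F (x n)\<bar> \<le> sqrt (2 * R * (J n + \<epsilon> n))" for n
      using real_sqrt_le_mono[OF le[of n]] by simp
    then have "(\<lambda>n. \<bar>P (x n) * F (x n)\<bar>) \<longlonglongrightarrow> 0"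
      by (intro tendsto_sandwich[OF _ always_eventually tendsto_const l]) auto
    then show ?thesis by (rule tendsto_rabs_zero_cancel)
  qed
  have Sc: "continuous_on {0..1} S" by (rule prim_continuous_on[OF S])
  have PFc: "(\<lambda>n. P (c n) * F (c n)) \<longlonglongrightarrow> 0"
  proof (rule small[where J = "\<lambda>n. S (2 * \<epsilon> n) - S (\<epsilon> n)"])
    show "(F (c n))\<^sup>2 \<le> 2 * \<epsilon> n * R" for n
      using F_le(1)[of "c n"] cd[of n] mult_right_mono[OF c(2) R0, of n] by linarith
    have "(\<lambda>n. S (2 * \<epsilon> n) - S (\<epsilon> n)) \<longlonglongrightarrow> S 0 - S 0"
    proof (intro tendsto_diff compose[OF Sc] e2 \<epsilon>l)
      show "2 * \<epsilon> n \<in> {0..1}" "\<epsilon> n \<in> {0..1}" for n using \<epsilon>[of n] by auto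
    qed auto
    then show "(\<lambda>n. S (2 * \<epsilon> n) - S (\<epsilon> n)) \<longlonglongrightarrow> 0" by simp
  qed (rule c)
  have PFd: "(\<lambda>n. P (d n) * F (d n)) \<longlonglongrightarrow> 0"
  proof (rule small[where J = "\<lambda>n. S (1 - \<epsilon> n) - S (1 - 2 * \<epsilon> n)"])
    show "(F (d n))\<^sup>2 \<le> 2 * \<epsilon> n * R" for n
    proof -
      have "1 - d n \<le> 2 * \<epsilon> n" using d(1)[of n] by simp
      from mult_right_mono[OF this R0] show ?thesis using F_le(2)[of "d n"] cd[of n] by linarith
    qed
    have "(\<lambda>n. S (1 - \<epsilon> n) - S (1 - 2 * \<epsilon> n)) \<longlonglongrightarrow> S 1 - S 1"
    proof (intro tendsto_diff compose[OF Sc] e2)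
      show "1 - 2 * \<epsilon> n \<in> {0..1}" "1 - \<epsilon> n \<in> {0..1}" for n using \<epsilon>[of n] by auto
    qed auto
    then show "(\<lambda>n. S (1 - \<epsilon> n) - S (1 - 2 * \<epsilon> n)) \<longlonglongrightarrow> 0" by simp
  qed (rule d)
  have aqy: "integrable (MT 1) (\<lambda>x. a x * (?q x * y x))"
    by (rule wL2_integrable_mult[OF _ _ a_measurable]) (use u2(3) y1(1) a_pos in \<open>auto simp: L2a_eq\<close>)
  have qm: "?q \<in> borel_measurable (MT 1)" using u2(3) by (simp add: L2a_eq wL2_def)
  have Fm: "F \<in> borel_measurable (MT 1)"
    by (rule continuous_imp_measurable_on_sets_lebesgue[OF continuous_on_subset[OF prim_continuous_on[OF F(1)]]]) auto
  have Pm: "P \<in> borel_measurable (MT 1)" using PL by (simp add: wL2_def)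
  have rm: "?r \<in> borel_measurable (MT 1)" using y1(3) by (simp add: wL2_def)
  have ae1: "AE x in MT 1. a x * (?q x * y x) = ?q x * F x" using aeF by eventually_elim (simp add: mult_ac)
  have qF: "integrable (MT 1) (\<lambda>x. ?q x * F x)"
    by (rule integrable_cong_AE[THEN iffD1, OF borel_measurable_integrable[OF aqy] borel_measurable_times[OF qm Fm] ae1 aqy])
  have rP: "integrable (MT 1) (\<lambda>x. ?r x * P x)"
    using wL2_integrable_mult[OF y1(3) PL] by simp
  \<comment> \<open>Both products are integrable on all of (0,1), so the two integrals over
    [c n, d n] are increments of functions continuous on [0,1] and pass to the limit.\<close>
  define Q1 where "Q1 x = (LINT t:{0..x}|lebesgue. ?q t * F t)" for x
  define Q2 where "Q2 x = (LINT t:{0..x}|lebesgue. ?r t * P t)" for x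
  have Q1: "prim 0 1 (\<lambda>t. ?q t * F t) Q1"
    unfolding Q1_def by (rule primI[OF integrable_MT_Icc[OF qF]]) (simp_all only: LINT_point add_0 order_refl)
  have Q2: "prim 0 1 (\<lambda>t. ?r t * P t) Q2"
    unfolding Q2_def by (rule primI[OF integrable_MT_Icc[OF rP]]) (simp_all only: LINT_point add_0 order_refl)
  have parts: "Q1 (d n) - Q1 (c n) = P (d n) * F (d n) - P (c n) * F (c n) - (Q2 (d n) - Q2 (c n))" for n
  proof -
    note n = cd[of n]
    have "(LINT x:{c n..d n}|lebesgue. ?q x * F x) = P (d n) * F (d n) - P (c n) * F (c n) - (LINT x:{c n..d n}|lebesgue. ?r x * P x)"
      by (rule prim_by_parts[OF P[OF n(1,3)] prim_subset[OF F(1)] n(2)]) (use n in auto)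
    then show ?thesis
      using prim_diff[OF Q1, of "c n" "d n"] prim_diff[OF Q2, of "c n" "d n"] n by simp
  qed
  have cd01: "c n \<in> {0..1}" "d n \<in> {0..1}" for n using cd[of n] by auto
  have "(\<lambda>n. Q1 (d n) - Q1 (c n)) \<longlonglongrightarrow> Q1 1 - Q1 0"
    by (intro tendsto_diff compose[OF prim_continuous_on[OF Q1]] lc ld cd01) auto
  moreover have "(\<lambda>n. P (d n) * F (d n) - P (c n) * F (c n) - (Q2 (d n) - Q2 (c n))) \<longlonglongrightarrow> 0 - 0 - (Q2 1 - Q2 0)"
    by (intro tendsto_diff PFc PFd compose[OF prim_continuous_on[OF Q2]] lc ld cd01) auto
  ultimately have "Q1 1 - Q1 0 = 0 - 0 - (Q2 1 - Q2 0)"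
    unfolding parts by (rule LIMSEQ_unique)
  moreover have "Q1 0 = 0" "Q2 0 = 0" unfolding Q1_def Q2_def by (rule LINT_point)+
  ultimately have Q: "Q1 1 = - Q2 1" by simp
  have "wip (MT 1) a ?q y = (\<integral>x. ?q x * F x \<partial>MT 1)"
    unfolding wip_def
    by (rule integral_cong_AE[OF borel_measurable_integrable[OF aqy] borel_measurable_integrable[OF qF] ae1])
  also have "\<dots> = - (\<integral>x. ?r x * P x \<partial>MT 1)" unfolding integral_MT_Icc using Q by (simp add: Q1_def Q2_def)
  also have "(\<integral>x. ?r x * P x \<partial>MT 1) = wip (MT 1) (\<lambda>x. 1) ?r P" by (simp add: wip1)
  also have "\<dots> = wip (MT 1) (\<lambda>x. 1) ?p ?r"
    unfolding L.ip_sym[of ?r] by (rule wip_cong_AE) (use aeP in \<open>auto elim!: eventually_mono\<close>)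
  finally show ?thesis .
qed

text \<open>If \<open>a * u\<close> has no weak derivative, then \<open>am_x a u\<close> is an
  arbitrary choice and this number carries no information; hence the separate treatment of the
  initial value.\<close>

definition Dir :: "(real \<Rightarrow> real) \<Rightarrow> real" where
  "Dir u = wip (MT 1) (\<lambda>x. 1) (am_x a u) (am_x a u)"

lemma Dir_L2_norm01: "(L2_norm01 (am_x a u))\<^sup>2 = Dir u"
  by (simp add: L2_norm01_L Dir_def L.nrm_square)

text \<open>The inequality |p|^2 - |g|^2 \<le> 2 <p, p - g> for p = (au)_x, followed by integration
  by parts. \<open>g\<close> plays the derivative of \<open>a * y\<close>, and the integration by
  parts is a hypothesis, so that the bound also serves for a \<open>y\<close> reached only as a
  limit.\<close>

lemma Dir_convex_aux:
  assumes u: "u \<in> H2a a" and y: "y \<in> L2a a" and g: "g \<in> wL2 (MT 1) (\<lambda>x. 1)"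
    and parts: "wip (MT 1) a (am_xx a u) y = - wip (MT 1) (\<lambda>x. 1) (am_x a u) g"
  shows "Dir u - wip (MT 1) (\<lambda>x. 1) g g \<le> wip (MT 1) a (\<lambda>x. - 2 * am_xx a u x) (\<lambda>x. u x - y x)"
proof -
  note u2 = H2aD[OF u]
  note u1 = H1aD[OF u2(1)]
  have "wip (MT 1) a (\<lambda>x. - 2 * am_xx a u x) (\<lambda>x. u x - y x) = - 2 * (wip (MT 1) a (am_xx a u) u - wip (MT 1) a (am_xx a u) y)"
    using diff_in[OF u1(1) y] by (simp only: ip_scale[OF u2(3)] ip_diff_right[OF u1(1) y u2(3)])
  also have "\<dots> = 2 * Dir u - 2 * wip (MT 1) (\<lambda>x. 1) (am_x a u) g"
    unfolding parts am_xx_by_parts[OF u u2(1)] by (simp add: Dir_def)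
  finally show ?thesis
    using L.ip_expand[OF u1(3) g, of 1] L.ip_nonneg[of "\<lambda>x. am_x a u x - 1 * g x"] by (simp add: Dir_def)
qed

lemma Dir_convex:
  assumes u: "u \<in> H2a a" and y: "y \<in> H1a a"
  shows "Dir u - Dir y \<le> wip (MT 1) a (\<lambda>x. - 2 * am_xx a u x) (\<lambda>x. u x - y x)"
  unfolding Dir_def[of y] by (rule Dir_convex_aux[OF u H1aD(1)[OF y] H1aD(3)[OF y] am_xx_by_parts[OF u y]])

text \<open>Near-minimisers of \<open>Dir\<close> over shrinking balls around \<open>y\<close> form a Cauchy sequence by the
  parallelogram law, which replaces weak compactness in the passage to the limit.\<close>

lemma Dir_Cauchy_sequence:
  assumes y: "y \<in> L2a a" and near: "\<And>e. e > 0 \<Longrightarrow> \<exists>u\<in>H1a a. norm_a a (\<lambda>x. u x - y x) \<le> e \<and> Dir u \<le> K"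
  obtains f where "\<And>n. f n \<in> H1a a" "(\<lambda>n. norm_a a (\<lambda>x. f n x - y x)) \<longlonglongrightarrow> 0"
    "\<And>e. e > 0 \<Longrightarrow> \<exists>k. \<forall>i\<ge>k. \<forall>j\<ge>k. L.nrm (\<lambda>x. am_x a (f i) x - am_x a (f j) x) < e"
proof -
  \<comment> \<open>Nested convex sets; the infima \<open>d n\<close> of the energy over them
    increase and stay below \<open>K\<close>, hence converge.\<close>
  define C where "C n = {u \<in> H1a a. norm_a a (\<lambda>x. u x - y x) \<le> inverse (real (Suc n)) \<and> Dir u \<le> K}" for n
  define d where "d n = Inf (Dir ` C n)" for n
  have Cne: "C n \<noteq> {}" for n using near[of "inverse (real (Suc n))"] by (auto simp: C_def)
  have D0: "0 \<le> Dir u" for u unfolding Dir_def by (rule L.ip_nonneg)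
  have bdd: "bdd_below (Dir ` C n)" for n using D0 by (intro bdd_belowI[of _ 0]) auto
  have Cmono: "C n \<subseteq> C m" if "m \<le> n" for m n
  proof -
    have "inverse (real (Suc n)) \<le> inverse (real (Suc m))" using that by (intro le_imp_inverse_le) auto
    then show ?thesis unfolding C_def by (auto elim: order_trans)
  qed
  have dlow: "d n \<le> Dir u" if "u \<in> C n" for u n
    unfolding d_def using that bdd by (intro cInf_lower) auto
  have dmono: "d m \<le> d n" if "m \<le> n" for m n
    unfolding d_def using Cne bdd Cmono[OF that] by (intro cInf_superset_mono) auto
  have dK: "d n \<le> K" for n using Cne[of n] dlow[of _ n] by (fastforce simp: C_def)
  have "Bseq d"
    using dmono[of 0] dK by (intro BseqI'[of _ "\<bar>d 0\<bar> + \<bar>K\<bar>"]) (smt (verit) real_norm_def le0)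
  then have "convergent d" using dmono by (intro Bseq_mono_convergent) auto
  then have dC: "Cauchy d" by (simp add: Cauchy_convergent_iff)
  have "\<exists>f. \<forall>n. f n \<in> C n \<and> Dir (f n) < d n + inverse (real (Suc n))"
  proof (rule choice, rule allI)
    fix n
    have "d n < d n + inverse (real (Suc n))" by simp
    then show "\<exists>u. u \<in> C n \<and> Dir u < d n + inverse (real (Suc n))"
      unfolding d_def using cInf_lessD[of "Dir ` C n"] Cne by blast
  qed
  then obtain f where fC: "\<And>n. f n \<in> C n" and fd: "\<And>n. Dir (f n) < d n + inverse (real (Suc n))" by blast
  have fH: "f n \<in> H1a a" and fn: "norm_a a (\<lambda>x. f n x - y x) \<le> inverse (real (Suc n))" for n using fC[of n] by (auto simp: C_def)
  let ?g = "\<lambda>n. am_x a (f n)"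
  have gL: "?g n \<in> wL2 (MT 1) (\<lambda>x. 1)" for n by (rule H1aD(3)[OF fH])
  \<comment> \<open>The midpoint of \<open>f i\<close> and \<open>f j\<close> lies in
    \<open>C j\<close> by convexity, so its energy is at least \<open>d j\<close>; the parallelogram
    law turns this into a bound on the distance of the derivatives.\<close>
  have sq: "(L.nrm (\<lambda>x. ?g i x - ?g j x))\<^sup>2 \<le> 2 * (d i - d j) + 4 * inverse (real (Suc j))" if ij: "j \<le> i" for i j
  proof -
    let ?m = "\<lambda>x. (1/2) * f i x + (1/2) * f j x"
    have zeroH: "(\<lambda>x. f i x + (-1) * f i x) \<in> H1a a" by (rule H1a_linear[OF fH fH])
    then have halfH: "(\<lambda>x. (1/2) * f i x) \<in> H1a a"
      using H1a_linear[OF fH[of i] fH[of i], of "-1/2"] by (simp add: algebra_simps)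
    have mH: "?m \<in> H1a a" using H1a_linear[OF halfH fH[of j], of "1/2"] by simp
    have haeq: "AE x in MT 1. am_x a (\<lambda>x. (1/2) * f i x) x = (1/2) * ?g i x"
      using am_x_linear(2)[OF fH[of i] fH[of i], of "-1/2"] by (simp add: algebra_simps)
    have maeq: "AE x in MT 1. am_x a ?m x = (1/2) * (?g i x + ?g j x)"
      using am_x_linear(2)[OF halfH fH[of j], of "1/2"] haeq by eventually_elim (simp add: algebra_simps)
    have Dm: "Dir ?m = wip (MT 1) (\<lambda>x. 1) (\<lambda>x. (1/2) * (?g i x + ?g j x)) (\<lambda>x. (1/2) * (?g i x + ?g j x))"
      unfolding Dir_def by (rule wip_cong_AE[OF maeq maeq])
    have gij: "(\<lambda>x. ?g i x + ?g j x) \<in> wL2 (MT 1) (\<lambda>x. 1)" by (intro L.add_in gL)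
    have Dm': "4 * Dir ?m = Dir (f i) + 2 * wip (MT 1) (\<lambda>x. 1) (?g i) (?g j) + Dir (f j)"
      unfolding Dm L.ip_scale[OF gij L.scale_in[OF gij]] L.ip_scale_right[OF gij gij]
      using L.ip_expand[OF gL[of i] gL[of j], of "-1"] by (simp add: Dir_def)
    have nd: "(L.nrm (\<lambda>x. ?g i x - ?g j x))\<^sup>2 = Dir (f i) - 2 * wip (MT 1) (\<lambda>x. 1) (?g i) (?g j) + Dir (f j)"
      unfolding L.nrm_square using L.ip_expand[OF gL[of i] gL[of j], of 1] by (simp add: Dir_def)
    have fiC: "f i \<in> C j" using fC[of i] Cmono[OF ij] by blast
    have "?m \<in> C j"
    proof -
      have iL: "f i \<in> L2a a" "f j \<in> L2a a" using H1aD(1)[OF fH] by blast+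
      have "norm_a a (\<lambda>x. (1/2) * (f i x - y x) + (1/2) * (f j x - y x)) \<le> (1/2) * norm_a a (\<lambda>x. f i x - y x) + (1/2) * norm_a a (\<lambda>x. f j x - y x)"
        using nrm_triangle[OF scale_in[OF diff_in[OF iL(1) y], of "1/2"] scale_in[OF diff_in[OF iL(2) y], of "1/2"]]
        by (simp only: nrm_scale[OF diff_in[OF iL(1) y]] nrm_scale[OF diff_in[OF iL(2) y]] abs_of_pos[OF half_gt_zero[OF zero_less_one]])
      also have "\<dots> \<le> inverse (real (Suc j))" using fiC fC[of j] by (simp add: C_def)
      also have "(\<lambda>x. (1/2) * (f i x - y x) + (1/2) * (f j x - y x)) = (\<lambda>x. ?m x - y x)" by (auto simp: algebra_simps)
      finally have n: "norm_a a (\<lambda>x. ?m x - y x) \<le> inverse (real (Suc j))" .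
      have "4 * Dir ?m \<le> 2 * Dir (f i) + 2 * Dir (f j)"
        using Dm' nd zero_le_power2[of "L.nrm (\<lambda>x. ?g i x - ?g j x)"] by linarith
      then have "Dir ?m \<le> K" using fC[of i] fC[of j] by (simp add: C_def)
      with n mH show ?thesis by (simp add: C_def)
    qed
    then have "d j \<le> Dir ?m" by (rule dlow)
    moreover have "inverse (real (Suc i)) \<le> inverse (real (Suc j))" using ij by (intro le_imp_inverse_le) auto
    moreover have "n \<le> 2 * (d i - d j) + 4 * rj"
      if "d j \<le> M" "ri \<le> rj" "4 * M = A + 2 * W + B" "n = A - 2 * W + B" "A < d i + ri" "B < d j + rj" for n M A B W ri rj
      using that by (smt (verit))
    ultimately show ?thesis using Dm' nd fd[of i] fd[of j] by blast
  qed
  show thesis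
  proof (rule that[OF fH])
    show "(\<lambda>n. norm_a a (\<lambda>x. f n x - y x)) \<longlonglongrightarrow> 0"
      by (rule tendsto_sandwich[OF _ always_eventually[OF allI[OF fn]] tendsto_const LIMSEQ_inverse_real_of_nat])
         (simp add: nrm_nonneg)
    fix e :: real assume e: "e > 0"
    have "\<forall>\<^sub>F n in sequentially. inverse (real (Suc n)) < e\<^sup>2 / 8"
      using LIMSEQ_inverse_real_of_nat by (rule order_tendstoD) (use e in simp)
    then obtain k1 where k1: "\<And>n. n \<ge> k1 \<Longrightarrow> inverse (real (Suc n)) < e\<^sup>2 / 8" by (auto simp: eventually_sequentially)
    have "e\<^sup>2 / 4 > 0" using e by simp
    then obtain k2 where k2: "\<And>m n. m \<ge> k2 \<Longrightarrow> n \<ge> k2 \<Longrightarrow> dist (d m) (d n) < e\<^sup>2 / 4"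
      using dC unfolding Cauchy_def by blast
    have lt: "L.nrm (\<lambda>x. ?g i x - ?g j x) < e" if "j \<le> i" "max k1 k2 \<le> j" for i j
    proof -
      have "(L.nrm (\<lambda>x. ?g i x - ?g j x))\<^sup>2 < e\<^sup>2"
      proof -
        have "d i - d j < e\<^sup>2 / 4" "inverse (real (Suc j)) < e\<^sup>2 / 8"
          using k1[of j] le_less_trans[OF abs_ge_self k2[of i j, unfolded dist_real_def]] that by auto
        moreover have "n < E" if "n \<le> 2 * q + 4 * r" "q < E / 4" "r < E / 8" for n q r E :: real
          using that by linarith
        ultimately show ?thesis using sq[OF that(1)] by blast
      qed
      then show ?thesis using e by (rule power_less_imp_less_base[OF _ less_imp_le])
    qed
    show "\<exists>k. \<forall>i\<ge>k. \<forall>j\<ge>k. L.nrm (\<lambda>x. ?g i x - ?g j x) < e"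
    proof (intro exI allI impI)
      fix i j assume ij: "max k1 k2 \<le> i" "max k1 k2 \<le> j"
      show "L.nrm (\<lambda>x. ?g i x - ?g j x) < e"
      proof (cases "j \<le> i")
        case False
        then show ?thesis using lt[of i j] ij L.nrm_minus_commute[OF gL gL, of i j] by simp
      qed (use lt ij in simp)
    qed
  qed
qed

text \<open>The derivatives of the approximants converge in L^2 to some \<open>g\<close>. The limit
  in the definition of the weak derivative identifies \<open>g\<close> as that of
  \<open>a * y\<close>, and the limit in the integration by parts supplies the identity required by
  \<open>Dir_convex_aux\<close>; the boundary condition enters through the approximants.\<close>

lemma Dir_convex_limit:
  assumes y: "y \<in> L2a a" and near: "\<And>e. e > 0 \<Longrightarrow> \<exists>u\<in>H1a a. norm_a a (\<lambda>x. u x - y x) \<le> e \<and> Dir u \<le> K"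
    and u: "u \<in> H2a a"
  shows "Dir u - Dir y \<le> wip (MT 1) a (\<lambda>x. - 2 * am_xx a u x) (\<lambda>x. u x - y x)"
proof -
  obtain f where fH: "\<And>n. f n \<in> H1a a" and fy: "(\<lambda>n. norm_a a (\<lambda>x. f n x - y x)) \<longlonglongrightarrow> 0"
    and fC: "\<And>e. e > 0 \<Longrightarrow> \<exists>k. \<forall>i\<ge>k. \<forall>j\<ge>k. L.nrm (\<lambda>x. am_x a (f i) x - am_x a (f j) x) < e"
    using Dir_Cauchy_sequence[OF y near] by blast
  note f1 = H1aD[OF fH]
  obtain g where gL: "g \<in> wL2 (MT 1) (\<lambda>x. 1)" and gl: "(\<lambda>n. L.nrm (\<lambda>x. am_x a (f n) x - g x)) \<longlonglongrightarrow> 0"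
    using L.complete_nrm[of "\<lambda>n. am_x a (f n)", OF f1(3) fC] by blast
  have gl': "(\<lambda>n. L.nrm (\<lambda>x. g x - am_x a (f n) x)) \<longlonglongrightarrow> 0"
    using gl unfolding L.nrm_minus_commute[OF f1(3) gL] .
  have fy': "(\<lambda>n. norm_a a (\<lambda>x. y x - f n x)) \<longlonglongrightarrow> 0"
    using fy unfolding nrm_minus_commute[OF f1(1) y] .
  have parts: "wip (MT 1) a (am_xx a u) y = - wip (MT 1) (\<lambda>x. 1) (am_x a u) g"
  proof (rule LIMSEQ_unique)
    note u2 = H2aD[OF u]
    have "(\<lambda>n. wip (MT 1) a (f n) (am_xx a u)) \<longlonglongrightarrow> wip (MT 1) a y (am_xx a u)"
      by (rule ip_tendsto[OF f1(1) y u2(3) fy'])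
    then show "(\<lambda>n. wip (MT 1) a (am_xx a u) (f n)) \<longlonglongrightarrow> wip (MT 1) a (am_xx a u) y"
      by (simp add: ip_sym)
    have "(\<lambda>n. - wip (MT 1) (\<lambda>x. 1) (am_x a (f n)) (am_x a u)) \<longlonglongrightarrow> - wip (MT 1) (\<lambda>x. 1) g (am_x a u)"
      by (intro tendsto_minus L.ip_tendsto[OF f1(3) gL H1aD(3)[OF u2(1)] gl'])
    then show "(\<lambda>n. wip (MT 1) a (am_xx a u) (f n)) \<longlonglongrightarrow> - wip (MT 1) (\<lambda>x. 1) (am_x a u) g"
      unfolding am_xx_by_parts[OF u fH] by (simp add: L.ip_sym)
  qed
  have "has_weak_deriv (\<lambda>x. a x * y x) g"
    unfolding has_weak_deriv_def locally_integrable_iff_loc_int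
  proof (intro conjI ballI)
    note ayL = a_mult_L2[OF y]
    show l1: "loc_int 0 1 (\<lambda>x. a x * y x)" and l2: "loc_int 0 1 g"
      unfolding loc_int_def using L2_imp_integrable_Icc(1)[OF ayL] L2_imp_integrable_Icc(1)[OF gL] by auto
    fix \<psi> assume \<psi>: "\<psi> \<in> test_functions 0 1"
    have cL: "k \<in> wL2 (MT 1) (\<lambda>x. 1)" if "continuous_on UNIV k" for k
    proof -
      have "k \<in> borel_measurable (MT 1)"
        by (rule continuous_imp_measurable_on_sets_lebesgue[OF continuous_on_subset[OF that]]) auto
      moreover have "set_integrable lebesgue {0<..<1} (\<lambda>x. (k x)\<^sup>2)"
        by (rule set_integrable_subset[of _ "{0..1}"], intro absolutely_integrable_continuous_real continuous_intros continuous_on_subset[OF that]) auto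
      ultimately show ?thesis by (simp add: wL2_def integrable_MT_iff)
    qed
    note \<psi>L = cL[OF test_function_continuous(1)[OF \<psi>]] cL[OF test_function_continuous(2)[OF \<psi>]]
    obtain A where A: "A > 0" "\<And>u. u \<in> L2a a \<Longrightarrow> L.nrm (\<lambda>x. a x * u x) \<le> A * norm_a a u" using a_mult_norm by blast
    have al: "(\<lambda>n. L.nrm (\<lambda>x. a x * y x - a x * f n x)) \<longlonglongrightarrow> 0"
    proof (rule tendsto_sandwich[OF _ _ tendsto_const tendsto_mult_right_zero[OF fy']])
      show "\<forall>\<^sub>F n in sequentially. L.nrm (\<lambda>x. a x * y x - a x * f n x) \<le> A * norm_a a (\<lambda>x. y x - f n x)"
        using A(2)[OF diff_in[OF y f1(1)]] by (intro always_eventually) (simp add: right_diff_distrib)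
    qed simp
    have "wip (MT 1) (\<lambda>x. 1) (\<lambda>x. a x * y x) (deriv \<psi>) = - wip (MT 1) (\<lambda>x. 1) g \<psi>"
    proof (rule LIMSEQ_unique)
      show "(\<lambda>n. wip (MT 1) (\<lambda>x. 1) (\<lambda>x. a x * f n x) (deriv \<psi>)) \<longlonglongrightarrow> wip (MT 1) (\<lambda>x. 1) (\<lambda>x. a x * y x) (deriv \<psi>)"
        by (rule L.ip_tendsto[OF a_mult_L2[OF f1(1)] ayL \<psi>L(2) al])
      have eq: "wip (MT 1) (\<lambda>x. 1) (\<lambda>x. a x * f n x) (deriv \<psi>) = - wip (MT 1) (\<lambda>x. 1) (am_x a (f n)) \<psi>" for n
        using has_weak_derivD(3)[OF f1(2) \<psi>, of n] by (simp add: wip1 integral_MT)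
      show "(\<lambda>n. wip (MT 1) (\<lambda>x. 1) (\<lambda>x. a x * f n x) (deriv \<psi>)) \<longlonglongrightarrow> - wip (MT 1) (\<lambda>x. 1) g \<psi>"
        unfolding eq by (intro tendsto_minus L.ip_tendsto[OF f1(3) gL \<psi>L(1) gl'])
    qed
    then show "(LINT x:{0<..<1}|lebesgue. a x * y x * deriv \<psi> x) = - (LINT x:{0<..<1}|lebesgue. g x * \<psi> x)"
      by (simp add: wip1 integral_MT)
  qed
  then have "AE x in MT 1. am_x a y x = g x" by (rule am_x_AE)
  then have "Dir y = wip (MT 1) (\<lambda>x. 1) g g" unfolding Dir_def by (intro wip_cong_AE)
  then show ?thesis using Dir_convex_aux[OF u y gL parts] by simp
qed

end

section \<open>The Carleman estimate\<close>

lemma integrable_MT_mult_continuous: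
  fixes f w :: "real \<Rightarrow> real"
  assumes f: "integrable (MT T) f" and w: "continuous_on {0..T} w"
  shows "integrable (MT T) (\<lambda>t. w t * f t)"
proof -
  have "set_integrable lebesgue {0..T} (\<lambda>t. f t * w t)"
    by (intro set_integrable_mult_continuous integrable_MT_Icc[OF f] w) auto
  then have "set_integrable lebesgue {0<..<T} (\<lambda>t. f t * w t)"
    by (rule set_integrable_subset) auto
  then show ?thesis by (simp add: integrable_MT_iff mult.commute)
qed

context semi_inner
begin

lemma continuous_version_nrm_square:
  assumes z: "continuous_version V nrm T u z"
  shows "continuous_on {0..T} (\<lambda>t. ip (z t) (z t))"
proof -
  have "continuous_on {0..T} (\<lambda>t. nrm (z t))"
    unfolding continuous_on_def
  proof
    fix t assume t: "t \<in> {0..T}"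
    have l: "((\<lambda>\<tau>. nrm (\<lambda>x. z \<tau> x - z t x)) \<longlongrightarrow> 0) (at t within {0..T})"
      using continuous_versionD(3)[OF z] t by auto
    have b: "\<forall>\<^sub>F \<tau> in at t within {0..T}. \<bar>nrm (z \<tau>) - nrm (z t)\<bar> \<le> nrm (\<lambda>x. z \<tau> x - z t x)"
      unfolding eventually_at_filter
    proof (rule always_eventually, intro allI impI)
      fix \<tau> assume "\<tau> \<noteq> t" "\<tau> \<in> {0..T}"
      then have V: "z \<tau> \<in> V" "z t \<in> V" using continuous_versionD(1)[OF z] t by auto
      show "\<bar>nrm (z \<tau>) - nrm (z t)\<bar> \<le> nrm (\<lambda>x. z \<tau> x - z t x)"
        using nrm_le_diff[OF V] nrm_le_diff[OF V(2,1)] unfolding nrm_minus_commute[OF V(2,1)] by (simp add: abs_le_iff)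
    qed
    show "((\<lambda>\<tau>. nrm (z \<tau>)) \<longlongrightarrow> nrm (z t)) (at t within {0..T})"
      by (rule LIM_zero_cancel, rule tendsto_rabs_zero_cancel, rule tendsto_sandwich[OF _ b tendsto_const l]) simp
  qed
  then have "continuous_on {0..T} (\<lambda>t. (nrm (z t))\<^sup>2)" by (intro continuous_intros)
  then show ?thesis by (simp add: nrm_square)
qed

end

text \<open>The algebra of the conjugated operator in scalar form: with \<open>B = - am_xx\<close> and \<open>k = m\<^sub>t\<close>,
  \<open>A = |Bm|\<^sup>2\<close>, \<open>K = |k|\<^sup>2\<close>, \<open>D = \<langle>Bm, m\<rangle>\<close>, \<open>J = \<langle>m, k\<rangle>\<close>, \<open>N = |m|\<^sup>2\<close>; the hypotheses are the nonnegativity of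
  \<open>|Bm - 2 \<kappa> m|\<^sup>2\<close>, \<open>|k + 2 \<kappa> m|\<^sup>2\<close>, \<open>|Bm - \<kappa> m|\<^sup>2\<close>, \<open>|k + \<kappa> m|\<^sup>2\<close> and \<open>|Bm - (\<kappa> + l/2) m|\<^sup>2\<close>.\<close>

lemma carleman_pointwise:
  fixes A K D J N \<kappa> l \<rho> :: real
  assumes "0 \<le> A - 4 * \<kappa> * D + 4 * \<kappa>\<^sup>2 * N" "0 \<le> K + 4 * \<kappa> * J + 4 * \<kappa>\<^sup>2 * N"
    and P1: "0 \<le> A - 2 * \<kappa> * D + \<kappa>\<^sup>2 * N" and P2: "0 \<le> K + 2 * \<kappa> * J + \<kappa>\<^sup>2 * N"
    and "0 \<le> A - 2 * (\<kappa> + l / 2) * D + (\<kappa> + l / 2)\<^sup>2 * N"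
    and N: "0 \<le> N" and \<rho>: "1 \<le> \<rho>" and l: "0 < l" and \<kappa>: "\<kappa> = \<rho> * l"
  shows "(A + K) / \<rho> + l * D + l * \<kappa> * N \<le> 7 * (A - 2 * \<kappa> * D + K + 2 * \<kappa> * J + 2 * \<kappa>\<^sup>2 * N + l * \<kappa> * N)"
proof -
  let ?P1 = "A - 2 * \<kappa> * D + \<kappa>\<^sup>2 * N" and ?P2 = "K + 2 * \<kappa> * J + \<kappa>\<^sup>2 * N"
  have ll: "l\<^sup>2 * N \<le> l * \<kappa> * N"
    using \<rho> l N unfolding \<kappa> by (intro mult_right_mono) (auto simp: power2_eq_square)
  have lk: "0 \<le> l * \<kappa> * N" using \<rho> l N unfolding \<kappa> by simp
  \<comment> \<open>The two squares with 2 \<kappa> recover A + K from twice the squares with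
    \<kappa>, at the cost of 4 \<kappa>^2 N. Since \<kappa> = \<rho> l, division by \<rho> turns
    \<kappa>^2 into l \<kappa>.\<close>
  have "A + K \<le> 2 * (?P1 + ?P2) + 4 * (\<kappa>\<^sup>2 * N)" using add_nonneg_nonneg[OF assms(1,2)] by (simp add: algebra_simps)
  then have "(A + K) / \<rho> \<le> (2 * (?P1 + ?P2) + 4 * (\<kappa>\<^sup>2 * N)) / \<rho>" using \<rho> by (intro divide_right_mono) auto
  also have "\<dots> = 2 * ((?P1 + ?P2) / \<rho>) + 4 * (l * \<kappa> * N)"
    using \<rho> unfolding \<kappa> by (simp add: field_simps power2_eq_square)
  also have "(?P1 + ?P2) / \<rho> \<le> ?P1 + ?P2"
  proof -
    have "x / \<rho> \<le> x" if "0 \<le> x" for x :: real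
      using that \<rho> mult_left_mono[of 1 \<rho> x] by (simp add: divide_le_eq)
    then show ?thesis using add_nonneg_nonneg[OF P1 P2] by blast
  qed
  finally have 1: "(A + K) / \<rho> \<le> 2 * (?P1 + ?P2) + 4 * (l * \<kappa> * N)" by simp
  \<comment> \<open>Shifting \<kappa> by l/2 changes the cross term by exactly l D, which bounds the
    gradient term of the estimate.\<close>
  have "0 \<le> ?P1 - l * D + l * \<kappa> * N + l\<^sup>2 * N / 4"
    using assms(5) by (simp add: power2_eq_square algebra_simps)
  then have 2: "l * D \<le> ?P1 + l * \<kappa> * N + l\<^sup>2 * N / 4" by simp
  \<comment> \<open>The sum is at most 3 p1 + 2 p2 + (6 + 1/4) Z; this is the origin of the constant
    7.\<close>
  have "X + Y + Z \<le> 7 * (p1 + p2 + Z)"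
    if "X \<le> 2 * (p1 + p2) + 4 * Z" "Y \<le> p1 + Z + W / 4" "W \<le> Z" "0 \<le> p1" "0 \<le> p2" "0 \<le> Z" for X Y Z W p1 p2 :: real
  proof -
    have "Y \<le> p1 + Z + Z / 4" using that(2,3) by simp
    then show ?thesis using that by simp
  qed
  from this[OF 1 2 ll P1 P2 lk] show ?thesis by (simp add: algebra_simps)
qed

section \<open>Weighted energies in time and their assembly\<close>

context weight
begin

lemma nrm_norm_a: "semi_inner.nrm (wip (MT 1) a) = norm_a a"
proof (rule ext)
  have "semi_inner (L2a a) (wip (MT 1) a)"
    unfolding L2a_eq by (rule semi_inner_wL2[OF a_measurable]) (use a_pos in auto)
  then show "semi_inner.nrm (wip (MT 1) a) u = norm_a a u" for u
    unfolding norm_a_eq by (rule semi_inner.nrm_def)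
qed

lemma norm_a_am_xx_le: "norm_a a (am_xx a u) \<le> norm_2a a u"
  unfolding norm_2a_def by (rule real_le_rsqrt) simp

text \<open>\<open>am_xx\<close> sends simple functions to simple functions and is dominated by the
  norm of \<open>H2a a\<close>. As \<open>wderiv\<close> is a choice, it is additive only almost
  everywhere, a defect that the seminorm does not see.\<close>

lemma am_xx_L2_time:
  assumes m: "m \<in> L2_time (H2a a) (norm_2a a) T"
  shows "(\<lambda>t. am_xx a (m t)) \<in> L2_time (L2a a) (norm_a a) T"
proof -
  have sm: "strongly_measurable (H2a a) (norm_2a a) T m" and i: "set_integrable lebesgue {0<..<T} (\<lambda>t. (norm_2a a (m t))\<^sup>2)"
    using m by (auto simp: L2_time_def)
  have mV: "AE t in MT T. m t \<in> H2a a" using sm by (simp add: strongly_measurable_def)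
  obtain s where s: "\<And>n. simple_into (H2a a) T (s n)" "AE t in MT T. (\<lambda>n. norm_2a a (\<lambda>x. m t x - s n t x)) \<longlonglongrightarrow> 0"
    using sm unfolding strongly_measurable_def by blast
  have sm': "strongly_measurable (L2a a) (norm_a a) T (\<lambda>t. am_xx a (m t))"
    unfolding strongly_measurable_def
  proof (intro conjI exI[of _ "\<lambda>n t. am_xx a (s n t)"] allI)
    show "AE t in MT T. am_xx a (m t) \<in> L2a a" using mV by eventually_elim (rule H2aD(3))
    show "simple_into (L2a a) T (\<lambda>t. am_xx a (s n t))" for n
    proof -
      have sf: "simple_function (MT T) (s n)" using s(1)[of n] by (simp add: simple_into_def)
      have "simple_function (MT T) (\<lambda>t. am_xx a (s n t))" by (rule simple_function_compose1[OF sf])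
      then show ?thesis using s(1)[of n] H2aD(3) by (auto simp: simple_into_def)
    qed
    show "AE t in MT T. (\<lambda>n. norm_a a (\<lambda>x. am_xx a (m t) x - am_xx a (s n t) x)) \<longlonglongrightarrow> 0"
      using s(2) mV AE_space
    proof eventually_elim
      case (elim t)
      have le: "norm_a a (\<lambda>x. am_xx a (m t) x - am_xx a (s n t) x) \<le> norm_2a a (\<lambda>x. m t x - s n t x)" for n
      proof -
        have "s n t \<in> H2a a" using s(1)[of n] elim(3) by (auto simp: simple_into_def)
        from am_xx_diff_AE[OF elim(2) this]
        have "norm_a a (\<lambda>x. am_xx a (m t) x - am_xx a (s n t) x) = norm_a a (am_xx a (\<lambda>x. m t x - s n t x))"
          unfolding norm_a_eq by (intro arg_cong[of _ _ sqrt] wip_cong_AE) (auto elim!: eventually_mono)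
        then show ?thesis using norm_a_am_xx_le by simp
      qed
      show ?case
        by (rule tendsto_sandwich[OF _ always_eventually[OF allI[OF le]] tendsto_const elim(1)]) simp
    qed
  qed
  show ?thesis
  proof (rule L2_timeI[OF sm'], rule Bochner_Integration.integrable_bound)
    show "integrable (MT T) (\<lambda>t. (norm_2a a (m t))\<^sup>2)" using i by (simp add: integrable_MT_iff)
    show "(\<lambda>t. wip (MT 1) a (am_xx a (m t)) (am_xx a (m t))) \<in> borel_measurable (MT T)"
      by (rule strongly_measurable_ip[OF sm' sm'])
    show "AE t in MT T. norm (wip (MT 1) a (am_xx a (m t)) (am_xx a (m t))) \<le> norm ((norm_2a a (m t))\<^sup>2)"
    proof (rule AE_I2)
      fix t
      have "(norm_a a (am_xx a (m t)))\<^sup>2 \<le> (norm_2a a (m t))\<^sup>2"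
        by (rule power_mono[OF norm_a_am_xx_le nrm_nonneg])
      then show "norm (wip (MT 1) a (am_xx a (m t)) (am_xx a (m t))) \<le> norm ((norm_2a a (m t))\<^sup>2)"
        by (simp add: nrm_square ip_nonneg)
    qed
  qed
qed

text \<open>This form keeps two of the four end point terms and is stated for an arbitrary weak time
  derivative \<open>k\<close> and continuous version \<open>z\<close>, independently of how these
  are chosen in \<open>time_deriv\<close> and \<open>time_value\<close>.\<close>

lemma carleman:
  assumes T: "T > 0" and m: "m \<in> L2_time (L2a a) (norm_a a) T" "m \<in> L2_time (H2a a) (norm_2a a) T"
    and k: "k \<in> L2_time (L2a a) (norm_a a) T" "has_weak_time_deriv (L2a a) (norm_a a) T m k"
    and z: "continuous_version (L2a a) (norm_a a) T m z"
    and G: "AE t in MT T. AE x in MT 1. k t x - am_xx a (m t) x = G t x"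
    and l: "l > 0" and s: "s \<ge> 1"
  shows "int_Q T (\<lambda>x t. 1 / (s * exp (l * t)) *
          (a x * \<bar>am_xx a (m t) x\<bar>\<^sup>2 + a x * \<bar>k t x\<bar>\<^sup>2) * exp (2 * s * exp (l * t)))
      + int_Q T (\<lambda>x t. l * \<bar>am_x a (m t) x\<bar>\<^sup>2 * exp (2 * s * exp (l * t)))
      + int_Q T (\<lambda>x t. s * l\<^sup>2 * exp (l * t) * a x * \<bar>m t x\<bar>\<^sup>2 * exp (2 * s * exp (l * t)))
      \<le> 7 * (int_Q T (\<lambda>x t. a x * \<bar>G t x\<bar>\<^sup>2 * exp (2 * s * exp (l * t)))
        + s * l * exp (l * T) * (norm_a a (z T))\<^sup>2 * exp (2 * s * exp (l * T))
        + (L2_norm01 (am_x a (z 0)))\<^sup>2 * exp (2 * s))"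
proof -
  interpret R: time_regular "L2a a" "wip (MT 1) a" T m k z
    rewrites "semi_inner.nrm (wip (MT 1) a) = norm_a a"
    by (rule time_regular.intro, rule semi_inner_axioms, rule time_regular_axioms.intro)
       (simp_all only: nrm_norm_a T m k z)
  define q where "q t = am_xx a (m t)" for t
  have q: "q \<in> L2_time (L2a a) (norm_a a) T" unfolding q_def by (rule am_xx_L2_time[OF m(2)])
  let ?ip = "wip (MT 1) a"
  define A where "A t = ?ip (q t) (q t)" for t
  define K where "K t = ?ip (k t) (k t)" for t
  define D where "D t = - ?ip (q t) (m t)" for t
  define I where "I t = ?ip (q t) (k t)" for t
  define J where "J t = ?ip (m t) (k t)" for t
  define N where "N t = ?ip (m t) (m t)" for t
  have Ai: "integrable (MT T) A" and Ki: "integrable (MT T) K" and Di: "integrable (MT T) D"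
    and Ii: "integrable (MT T) I" and Ji: "integrable (MT T) J" and Ni: "integrable (MT T) N"
    unfolding A_def K_def D_def I_def J_def N_def
    by (intro Bochner_Integration.integrable_minus L2_time_ip q k m)+
  \<comment> \<open>Good times: \<open>m t\<close> is regular and at distance 0 from the
    representative. On \<open>E\<close> the two are interchangeable in inner products; at the end
    points only \<open>z\<close> has a meaning.\<close>
  define E where "E = {t \<in> {0<..<T}. m t \<in> H2a a \<and> norm_a a (\<lambda>x. m t x - z t x) = 0}"
  have mH: "AE t in MT T. m t \<in> H2a a" using m(2) by (simp add: L2_time_def strongly_measurable_def)
  have E: "AE t in MT T. t \<in> E"
    using mH continuous_versionD(2)[OF z] AE_space by eventually_elim (simp add: E_def)
  have ED: "0 < t" "t < T" "m t \<in> H2a a" "m t \<in> L2a a" "z t \<in> L2a a" "q t \<in> L2a a"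
    and Ez: "norm_a a (\<lambda>x. m t x - z t x) = 0" and DE: "D t = Dir (m t)" if "t \<in> E" for t
  proof -
    show t: "0 < t" "t < T" and mt: "m t \<in> H2a a" and "norm_a a (\<lambda>x. m t x - z t x) = 0" using that by (auto simp: E_def)
    show "m t \<in> L2a a" "q t \<in> L2a a" unfolding q_def using H1aD(1)[OF H2aD(1)[OF mt]] H2aD(3)[OF mt] by auto
    show "z t \<in> L2a a" using t by (intro R.zV) auto
    show "D t = Dir (m t)" unfolding D_def q_def am_xx_by_parts[OF mt H2aD(1)[OF mt]] by (simp add: Dir_def)
  qed
  have mz: "?ip y (m t) = ?ip y (z t)" if "t \<in> E" "y \<in> L2a a" for t y
    using ip_cong_nrm[OF ED(4,5)[OF that(1)] that(2) Ez[OF that(1)]] by (simp add: ip_sym)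
  \<comment> \<open>Minus twice \<open>am_xx\<close> is the gradient of the energy
    \<open>Dir\<close> in the weighted inner product.\<close>
  define g where "g t = (\<lambda>x. - 2 * q t x)" for t
  have g: "g \<in> L2_time (L2a a) (norm_a a) T"
    unfolding g_def by (rule L2_time_scale[where B = 2, OF _ _ q]) auto
  have gV: "g t \<in> L2a a" if "t \<in> E" for t unfolding g_def by (intro scale_in ED that)
  have gq: "?ip (g t) y = - 2 * ?ip (q t) y" if "t \<in> E" "y \<in> L2a a" for t y
    unfolding g_def by (rule ip_scale[OF ED(6)[OF that(1)] that(2)])
  have step: "D t - D \<tau> \<le> ?ip (g t) (\<lambda>x. z t x - z \<tau> x)" if "\<tau> \<in> E" "t \<in> E" for \<tau> t
  proof -
    have "D t - D \<tau> \<le> ?ip (g t) (\<lambda>x. m t x - m \<tau> x)"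
      unfolding DE[OF that(1)] DE[OF that(2)] g_def q_def
      by (rule Dir_convex[OF ED(3)[OF that(2)] H2aD(1)[OF ED(3)[OF that(1)]]])
    also have "\<dots> = ?ip (g t) (\<lambda>x. z t x - z \<tau> x)"
      unfolding ip_diff_right[OF ED(4)[OF that(2)] ED(4)[OF that(1)] gV[OF that(2)]]
        ip_diff_right[OF ED(5)[OF that(2)] ED(5)[OF that(1)] gV[OF that(2)]]
      by (simp only: mz[OF that(2) gV[OF that(2)]] mz[OF that(1) gV[OF that(2)]])
    finally show ?thesis .
  qed
  have D0: "AE t in MT T. 0 \<le> D t"
    using E by eventually_elim (simp add: DE Dir_def L.ip_nonneg)
  obtain C where C: "\<And>d. d > 0 \<Longrightarrow> \<exists>t\<in>E. 0 < t \<and> t < T \<and> t < d \<and> D t \<le> C"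
    by (rule R.bounded_near_zero[OF g Di D0 E step]) (assumption | blast)+
  have z0: "z 0 \<in> L2a a" using T by (intro R.zV) auto
  \<comment> \<open>Good times close to 0 with bounded energy supply regular functions near
    \<open>z 0\<close>, because \<open>z\<close> is continuous at 0.\<close>
  have near: "\<exists>u\<in>H1a a. norm_a a (\<lambda>x. u x - z 0 x) \<le> e \<and> Dir u \<le> C" if e: "e > 0" for e
  proof -
    have "((\<lambda>\<tau>. norm_a a (\<lambda>x. z \<tau> x - z 0 x)) \<longlongrightarrow> 0) (at 0 within {0..T})"
      using continuous_versionD(3)[OF z, of 0] T by simp
    then have "\<forall>\<^sub>F \<tau> in at 0 within {0..T}. norm_a a (\<lambda>x. z \<tau> x - z 0 x) < e"
      by (rule order_tendstoD) (rule e)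
    then obtain d where d: "d > 0" "\<And>\<tau>. \<tau> \<in> {0..T} \<Longrightarrow> \<tau> \<noteq> 0 \<Longrightarrow> dist \<tau> 0 < d \<Longrightarrow> norm_a a (\<lambda>x. z \<tau> x - z 0 x) < e"
      unfolding eventually_at by blast
    obtain t where t: "t \<in> E" "0 < t" "t < T" "t < d" "D t \<le> C" using C[OF d(1)] by blast
    have "norm_a a (\<lambda>x. m t x - z 0 x) \<le> norm_a a (\<lambda>x. m t x - z t x) + norm_a a (\<lambda>x. z t x - z 0 x)"
      by (rule nrm_diff_triangle[OF ED(4,5)[OF t(1)] z0])
    also have "\<dots> \<le> e" using Ez[OF t(1)] d(2)[of t] t by simp
    finally show ?thesis using t DE[OF t(1)] H2aD(1)[OF ED(3)[OF t(1)]] by auto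
  qed
  have step0: "D t - Dir (z 0) \<le> ?ip (g t) (\<lambda>x. z t x - z 0 x)" if "t \<in> E" for t
  proof -
    have "D t - Dir (z 0) \<le> ?ip (g t) (\<lambda>x. m t x - z 0 x)"
      unfolding DE[OF that] g_def q_def by (rule Dir_convex_limit[OF z0 near ED(3)[OF that]])
    also have "\<dots> = ?ip (g t) (\<lambda>x. z t x - z 0 x)"
      unfolding ip_diff_right[OF ED(4)[OF that] z0 gV[OF that]] ip_diff_right[OF ED(5)[OF that] z0 gV[OF that]]
      by (simp only: mz[OF that gV[OF that]])
    finally show ?thesis .
  qed
  define \<kappa> where "\<kappa> t = s * exp (l * t) * l" for t
  define w where "w t = exp (2 * s * exp (l * t))" for t
  have s0: "s > 0" using s by simp
  have wpos: "w t > 0" and \<kappa>pos: "\<kappa> t > 0" for t using l s0 by (auto simp: w_def \<kappa>_def)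
  have w': "(w has_real_derivative 2 * \<kappa> t * w t) (at t)" for t
    unfolding w_def \<kappa>_def by (auto intro!: derivative_eq_intros)
  have \<kappa>w': "((\<lambda>t. \<kappa> t * w t) has_real_derivative (l * \<kappa> t + 2 * (\<kappa> t)\<^sup>2) * w t) (at t)" for t
  proof -
    have "(\<kappa> has_real_derivative l * \<kappa> t) (at t)"
      unfolding \<kappa>_def by (auto intro!: derivative_eq_intros)
    from DERIV_mult[OF this w'[of t]] show ?thesis by (simp add: power2_eq_square algebra_simps)
  qed
  have wc: "continuous_on X w" and \<kappa>c: "continuous_on X \<kappa>" for X
    unfolding w_def \<kappa>_def by (intro continuous_intros)+
  have mult: "integrable (MT T) (\<lambda>t. c t * f t)" if "integrable (MT T) f" "continuous_on UNIV c" for c f :: "real \<Rightarrow> real"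
    using that by (intro integrable_MT_mult_continuous) (auto intro: continuous_on_subset)
  have kV: "AE t in MT T. k t \<in> L2a a" by (rule L2_timeD(2)[OF k(1)])
  \<comment> \<open>Taking \<open>Lo = 0\<close> expresses nonnegativity of the energy, so that its
    value at \<open>T\<close> does not appear.\<close>
  have E1: "0 \<le> w 0 * Dir (z 0) + (\<integral>t. w t * ?ip (g t) (k t) \<partial>MT T) + (\<integral>t. 2 * \<kappa> t * w t * D t \<partial>MT T)"
  proof -
    have "w T * 0 \<le> w 0 * Dir (z 0) + (\<integral>t. w t * ?ip (g t) (k t) \<partial>MT T) + (\<integral>t. 2 * \<kappa> t * w t * D t \<partial>MT T)"
    proof (rule R.energy_inequality[OF g Di _ _ w' _ _ E, where Lo = "\<lambda>t. 0"])
      show "continuous_on UNIV (\<lambda>t. 2 * \<kappa> t * w t)" by (intro continuous_intros wc \<kappa>c)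
      show "D t - D \<tau> \<le> ?ip (g t) (\<lambda>x. z t x - z \<tau> x) + (norm_a a (\<lambda>x. z t x - z \<tau> x))\<^sup>2" if "\<tau> \<in> E" "t \<in> E" for \<tau> t
        using step[OF that] by (rule order_trans) simp
      show "D t - Dir (z 0) \<le> ?ip (g t) (\<lambda>x. z t x - z 0 x) + (norm_a a (\<lambda>x. z t x - z 0 x))\<^sup>2" if "t \<in> E" for t
        using step0[OF that] by (rule order_trans) simp
    qed (use wpos D0 in \<open>auto intro: less_imp_le\<close>)
    then show ?thesis by simp
  qed
  have E1': "2 * (\<integral>t. w t * I t \<partial>MT T) \<le> w 0 * Dir (z 0) + 2 * (\<integral>t. \<kappa> t * w t * D t \<partial>MT T)"
  proof -
    have "(\<integral>t. w t * ?ip (g t) (k t) \<partial>MT T) = (\<integral>t. - 2 * (w t * I t) \<partial>MT T)"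
    proof (rule integral_MT_cong_AE)
      show "AE t in MT T. w t * ?ip (g t) (k t) = - 2 * (w t * I t)"
        using E kV by eventually_elim (simp add: gq I_def)
    qed
    also have "\<dots> = - 2 * (\<integral>t. w t * I t \<partial>MT T)" by (rule Bochner_Integration.integral_mult_right_zero)
    finally have "(\<integral>t. w t * ?ip (g t) (k t) \<partial>MT T) = - 2 * (\<integral>t. w t * I t \<partial>MT T)" .
    moreover have "(\<integral>t. 2 * \<kappa> t * w t * D t \<partial>MT T) = 2 * (\<integral>t. \<kappa> t * w t * D t \<partial>MT T)"
      unfolding mult.assoc by (rule Bochner_Integration.integral_mult_right_zero)
    ultimately show ?thesis using E1 by linarith
  qed
  define N' where "N' t = - ?ip (z t) (z t)" for t
  have N'c: "continuous_on {0..T} N'"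
    unfolding N'_def by (intro continuous_on_minus continuous_version_nrm_square[OF z])
  have NN': "N' t = - N t" if "t \<in> E" for t
    using mz[OF that ED(4)[OF that]] mz[OF that ED(5)[OF that]] by (simp add: N'_def N_def ip_sym)
  have N'ae: "AE t in MT T. N' t = - N t" using E by eventually_elim (rule NN')
  have N'i: "integrable (MT T) N'"
  proof -
    have "set_integrable lebesgue {0..T} N'" by (rule absolutely_integrable_continuous_real[OF N'c])
    then show ?thesis unfolding integrable_MT_iff by (rule set_integrable_subset) auto
  qed
  define g2 where "g2 t = (\<lambda>x. - 2 * m t x)" for t
  have g2: "g2 \<in> L2_time (L2a a) (norm_a a) T"
    unfolding g2_def by (rule L2_time_scale[where B = 2, OF _ _ m(1)]) auto
  have g2m: "?ip (g2 t) y = - 2 * ?ip (m t) y" if "t \<in> E" "y \<in> L2a a" for t y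
    unfolding g2_def by (rule ip_scale[OF ED(4)[OF that(1)] that(2)])
  \<comment> \<open>For minus the squared norm the one-sided bound is an identity: the squared
    increment is the error of linearisation at the later time.\<close>
  have step2: "N' t - N' \<tau> \<le> ?ip (g2 t) (\<lambda>x. z t x - z \<tau> x) + (norm_a a (\<lambda>x. z t x - z \<tau> x))\<^sup>2"
    if t: "t \<in> E" and \<tau>: "0 \<le> \<tau>" "\<tau> < T" for \<tau> t
  proof -
    have zt: "z t \<in> L2a a" "z \<tau> \<in> L2a a" using ED(5)[OF t] R.zV[of \<tau>] \<tau> by auto
    note d = diff_in[OF zt]
    have "?ip (g2 t) (\<lambda>x. z t x - z \<tau> x) = - 2 * ?ip (z t) (\<lambda>x. z t x - z \<tau> x)"
      unfolding g2m[OF t d] using mz[OF t d] by (simp add: ip_sym)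
    also have "\<dots> = - 2 * (?ip (z t) (z t) - ?ip (z t) (z \<tau>))" by (simp only: ip_diff_right[OF zt zt(1)])
    finally have 1: "?ip (g2 t) (\<lambda>x. z t x - z \<tau> x) = - 2 * (?ip (z t) (z t) - ?ip (z t) (z \<tau>))" .
    have "(norm_a a (\<lambda>x. z t x - z \<tau> x))\<^sup>2 = ?ip (z t) (z t) - 2 * ?ip (z t) (z \<tau>) + ?ip (z \<tau>) (z \<tau>)"
      unfolding nrm_square using ip_expand[OF zt, of 1] by simp
    then show ?thesis unfolding 1 N'_def by simp
  qed
  \<comment> \<open>The derivative of the weight \<kappa> w contributes 2 \<kappa>^2 w, which
    completes the squares, and, through \<kappa>' = l \<kappa>, the term l \<kappa> w |m|^2 of the
    estimate.\<close>
  have E2: "\<kappa> T * w T * N' T \<le> \<kappa> 0 * w 0 * N' 0 + (\<integral>t. \<kappa> t * w t * ?ip (g2 t) (k t) \<partial>MT T)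
      + (\<integral>t. (l * \<kappa> t + 2 * (\<kappa> t)\<^sup>2) * w t * N' t \<partial>MT T)"
  proof (rule R.energy_inequality[OF g2 N'i N'c _ \<kappa>w' _ _ E])
    show "continuous_on UNIV (\<lambda>t. (l * \<kappa> t + 2 * (\<kappa> t)\<^sup>2) * w t)" by (intro continuous_intros wc \<kappa>c)
    show "N' t - N' \<tau> \<le> ?ip (g2 t) (\<lambda>x. z t x - z \<tau> x) + (norm_a a (\<lambda>x. z t x - z \<tau> x))\<^sup>2" if "\<tau> \<in> E" "t \<in> E" for \<tau> t
      by (rule step2[OF that(2)]) (use ED(1,2)[OF that(1)] in auto)
    show "N' t - N' 0 \<le> ?ip (g2 t) (\<lambda>x. z t x - z 0 x) + (norm_a a (\<lambda>x. z t x - z 0 x))\<^sup>2" if "t \<in> E" for t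
      by (rule step2[OF that]) (use T in auto)
  qed (use wpos \<kappa>pos in \<open>auto intro: less_imp_le\<close>)
  have N'0: "N' 0 \<le> 0" unfolding N'_def using ip_nonneg[of "z 0"] by simp
  have E2': "2 * (\<integral>t. \<kappa> t * w t * J t \<partial>MT T) + (\<integral>t. (l * \<kappa> t + 2 * (\<kappa> t)\<^sup>2) * w t * N t \<partial>MT T) \<le> \<kappa> T * w T * (norm_a a (z T))\<^sup>2"
  proof -
    have "(\<integral>t. \<kappa> t * w t * ?ip (g2 t) (k t) \<partial>MT T) = (\<integral>t. - 2 * (\<kappa> t * w t * J t) \<partial>MT T)"
    proof (rule integral_MT_cong_AE)
      show "AE t in MT T. \<kappa> t * w t * ?ip (g2 t) (k t) = - 2 * (\<kappa> t * w t * J t)"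
        using E kV by eventually_elim (simp add: g2m J_def)
    qed
    also have "\<dots> = - 2 * (\<integral>t. \<kappa> t * w t * J t \<partial>MT T)" by (rule Bochner_Integration.integral_mult_right_zero)
    finally have 1: "(\<integral>t. \<kappa> t * w t * ?ip (g2 t) (k t) \<partial>MT T) = - 2 * (\<integral>t. \<kappa> t * w t * J t \<partial>MT T)" .
    have "(\<integral>t. (l * \<kappa> t + 2 * (\<kappa> t)\<^sup>2) * w t * N' t \<partial>MT T) = (\<integral>t. - ((l * \<kappa> t + 2 * (\<kappa> t)\<^sup>2) * w t * N t) \<partial>MT T)"
      by (rule integral_MT_cong_AE) (use N'ae in \<open>eventually_elim, simp\<close>)
    then have 2: "(\<integral>t. (l * \<kappa> t + 2 * (\<kappa> t)\<^sup>2) * w t * N' t \<partial>MT T) = - (\<integral>t. (l * \<kappa> t + 2 * (\<kappa> t)\<^sup>2) * w t * N t \<partial>MT T)" by simp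
    have 3: "\<kappa> 0 * w 0 * N' 0 \<le> 0" using N'0 wpos[of 0] \<kappa>pos[of 0] by (intro mult_nonneg_nonpos) auto
    have 4: "\<kappa> T * w T * N' T = - (\<kappa> T * w T * (norm_a a (z T))\<^sup>2)" by (simp add: N'_def nrm_square)
    show ?thesis using E2 3 unfolding 1 2 4 by linarith
  qed
  define Gn where "Gn t = K t - 2 * I t + A t" for t
  \<comment> \<open>\<open>P\<close> is |Bm - \<kappa> m|^2 + |k + \<kappa> m|^2 + l \<kappa> |m|^2
    with B = - am_xx, the bracket on the right of \<open>carleman_pointwise\<close>.\<close>
  define P where "P t = A t - 2 * \<kappa> t * D t + K t + 2 * \<kappa> t * J t + 2 * (\<kappa> t)\<^sup>2 * N t + l * \<kappa> t * N t" for t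
  have Gni: "integrable (MT T) Gn" unfolding Gn_def using Ki Ii Ai by simp
  have i1: "integrable (MT T) (\<lambda>t. w t * Gn t)" by (rule mult[OF Gni wc])
  have i2: "integrable (MT T) (\<lambda>t. w t * I t)" by (rule mult[OF Ii wc])
  have i3: "integrable (MT T) (\<lambda>t. \<kappa> t * w t * D t)" by (rule mult[OF Di]) (intro continuous_intros wc \<kappa>c)
  have i4: "integrable (MT T) (\<lambda>t. \<kappa> t * w t * J t)" by (rule mult[OF Ji]) (intro continuous_intros wc \<kappa>c)
  have i5: "integrable (MT T) (\<lambda>t. (l * \<kappa> t + 2 * (\<kappa> t)\<^sup>2) * w t * N t)" by (rule mult[OF Ni]) (intro continuous_intros wc \<kappa>c)
  have wP: "w t * P t = w t * Gn t + 2 * (w t * I t) - 2 * (\<kappa> t * w t * D t) + 2 * (\<kappa> t * w t * J t) + (l * \<kappa> t + 2 * (\<kappa> t)\<^sup>2) * w t * N t" for t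
    by (simp add: P_def Gn_def algebra_simps)
  have iP: "integrable (MT T) (\<lambda>t. w t * P t)" unfolding wP using i1 i2 i3 i4 i5 by simp
  have "(\<integral>t. w t * P t \<partial>MT T) = (\<integral>t. w t * Gn t \<partial>MT T) + 2 * (\<integral>t. w t * I t \<partial>MT T) - 2 * (\<integral>t. \<kappa> t * w t * D t \<partial>MT T)
      + 2 * (\<integral>t. \<kappa> t * w t * J t \<partial>MT T) + (\<integral>t. (l * \<kappa> t + 2 * (\<kappa> t)\<^sup>2) * w t * N t \<partial>MT T)"
    unfolding wP using i1 i2 i3 i4 i5 by simp
  \<comment> \<open>The terms with \<open>I\<close> and \<open>D\<close> are exchanged for the
    initial energy by \<open>E1'\<close>, those with \<open>J\<close> and \<open>N\<close> for the
    final norm by \<open>E2'\<close>.\<close>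
  then have main: "(\<integral>t. w t * P t \<partial>MT T) \<le> (\<integral>t. w t * Gn t \<partial>MT T) + w 0 * Dir (z 0) + \<kappa> T * w T * (norm_a a (z T))\<^sup>2"
    using E1' E2' by linarith
  have space: "(LINT x:{0<..<1}|lebesgue. c * (a x * (u x)\<^sup>2)) = c * ?ip u u" for c u
    unfolding integral_MT wip_def by (simp add: power2_eq_square)
  \<comment> \<open>For fixed time the inner integrals become inner products; this and the three
    identities below reduce the claim to scalar functions of time.\<close>
  have Q1: "int_Q T (\<lambda>x t. 1 / (s * exp (l * t)) * (a x * \<bar>am_xx a (m t) x\<bar>\<^sup>2 + a x * \<bar>k t x\<bar>\<^sup>2) * exp (2 * s * exp (l * t)))
      = (\<integral>t. w t / (s * exp (l * t)) * (A t + K t) \<partial>MT T)"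
    unfolding int_Q_def integral_MT[of T]
  proof (rule integral_MT_cong_AE)
    show "AE t in MT T. (LINT x:{0<..<1}|lebesgue. 1 / (s * exp (l * t)) * (a x * \<bar>am_xx a (m t) x\<bar>\<^sup>2 + a x * \<bar>k t x\<bar>\<^sup>2) * exp (2 * s * exp (l * t)))
        = w t / (s * exp (l * t)) * (A t + K t)"
      using E kV
    proof eventually_elim
      case (elim t)
      let ?c = "w t / (s * exp (l * t))"
      have i: "set_integrable lebesgue {0<..<1} (\<lambda>x. ?c * (a x * (u x)\<^sup>2))" if "u \<in> L2a a" for u
        using that by (intro set_integrable_mult_right) (simp add: L2a_def)
      have "(LINT x:{0<..<1}|lebesgue. 1 / (s * exp (l * t)) * (a x * \<bar>am_xx a (m t) x\<bar>\<^sup>2 + a x * \<bar>k t x\<bar>\<^sup>2) * exp (2 * s * exp (l * t)))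
         = (LINT x:{0<..<1}|lebesgue. ?c * (a x * (q t x)\<^sup>2) + ?c * (a x * (k t x)\<^sup>2))"
        by (simp add: w_def q_def algebra_simps add_divide_distrib)
      also have "\<dots> = ?c * A t + ?c * K t"
        by (simp only: set_integral_add(2)[OF i[OF ED(6)[OF elim(1)]] i[OF elim(2)]] space A_def K_def)
      finally show ?case by (simp add: distrib_left)
    qed
  qed
  have Q2: "int_Q T (\<lambda>x t. l * \<bar>am_x a (m t) x\<bar>\<^sup>2 * exp (2 * s * exp (l * t))) = (\<integral>t. w t * (l * D t) \<partial>MT T)"
    unfolding int_Q_def integral_MT[of T]
  proof (rule integral_MT_cong_AE)
    show "AE t in MT T. (LINT x:{0<..<1}|lebesgue. l * \<bar>am_x a (m t) x\<bar>\<^sup>2 * exp (2 * s * exp (l * t))) = w t * (l * D t)"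
      using E
    proof eventually_elim
      case (elim t)
      have "(LINT x:{0<..<1}|lebesgue. l * \<bar>am_x a (m t) x\<bar>\<^sup>2 * exp (2 * s * exp (l * t)))
         = (LINT x:{0<..<1}|lebesgue. (w t * l) * (am_x a (m t) x * am_x a (m t) x))"
        by (simp add: w_def power2_eq_square mult_ac)
      also have "\<dots> = (w t * l) * (LINT x:{0<..<1}|lebesgue. am_x a (m t) x * am_x a (m t) x)" by (rule set_integral_mult_right)
      also have "\<dots> = w t * (l * D t)" unfolding DE[OF elim] Dir_def wip1 integral_MT by simp
      finally show ?case .
    qed
  qed
  have Q3: "int_Q T (\<lambda>x t. s * l\<^sup>2 * exp (l * t) * a x * \<bar>m t x\<bar>\<^sup>2 * exp (2 * s * exp (l * t))) = (\<integral>t. w t * (l * \<kappa> t * N t) \<partial>MT T)"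
    unfolding int_Q_def integral_MT[of T]
  proof (rule Bochner_Integration.integral_cong[OF refl])
    fix t
    have "(LINT x:{0<..<1}|lebesgue. s * l\<^sup>2 * exp (l * t) * a x * \<bar>m t x\<bar>\<^sup>2 * exp (2 * s * exp (l * t)))
       = (LINT x:{0<..<1}|lebesgue. (w t * l * \<kappa> t) * (a x * (m t x)\<^sup>2))"
      by (simp add: w_def \<kappa>_def power2_eq_square mult_ac)
    also have "\<dots> = (w t * l * \<kappa> t) * N t" unfolding N_def by (rule space)
    finally show "(LINT x:{0<..<1}|lebesgue. s * l\<^sup>2 * exp (l * t) * a x * \<bar>m t x\<bar>\<^sup>2 * exp (2 * s * exp (l * t))) = w t * (l * \<kappa> t * N t)"
      by simp
  qed
  have Q4: "int_Q T (\<lambda>x t. a x * \<bar>G t x\<bar>\<^sup>2 * exp (2 * s * exp (l * t))) = (\<integral>t. w t * Gn t \<partial>MT T)"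
    unfolding int_Q_def integral_MT[of T]
  proof (rule integral_MT_cong_AE)
    show "AE t in MT T. (LINT x:{0<..<1}|lebesgue. a x * \<bar>G t x\<bar>\<^sup>2 * exp (2 * s * exp (l * t))) = w t * Gn t"
      using E kV G
    proof eventually_elim
      case (elim t)
      have "(LINT x:{0<..<1}|lebesgue. a x * \<bar>G t x\<bar>\<^sup>2 * exp (2 * s * exp (l * t))) = (LINT x:{0<..<1}|lebesgue. w t * (a x * (k t x - 1 * q t x)\<^sup>2))"
      proof (rule LINT_01_cong_AE)
        show "AE x in MT 1. a x * \<bar>G t x\<bar>\<^sup>2 * exp (2 * s * exp (l * t)) = w t * (a x * (k t x - 1 * q t x)\<^sup>2)"
          using elim(3) by eventually_elim (simp add: w_def q_def mult_ac)
      qed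
      also have "\<dots> = w t * ?ip (\<lambda>x. k t x - 1 * q t x) (\<lambda>x. k t x - 1 * q t x)" by (rule space)
      also have "\<dots> = w t * Gn t"
        unfolding ip_expand[OF elim(2) ED(6)[OF elim(1)], of 1] by (simp add: Gn_def K_def I_def A_def ip_sym)
      finally show ?case .
    qed
  qed
  have j1: "integrable (MT T) (\<lambda>t. w t / (s * exp (l * t)) * (A t + K t))"
  proof (rule mult)
    show "integrable (MT T) (\<lambda>t. A t + K t)" using Ai Ki by simp
    show "continuous_on UNIV (\<lambda>t. w t / (s * exp (l * t)))" using s0 by (intro continuous_intros wc) auto
  qed
  have j2: "integrable (MT T) (\<lambda>t. w t * (l * D t))" by (rule mult[OF _ wc]) (use Di in simp)
  have j3: "integrable (MT T) (\<lambda>t. w t * (l * \<kappa> t * N t))"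
    by (rule mult[OF _ wc], rule mult[OF Ni]) (intro continuous_intros \<kappa>c)
  have "(\<integral>t. w t / (s * exp (l * t)) * (A t + K t) \<partial>MT T) + (\<integral>t. w t * (l * D t) \<partial>MT T) + (\<integral>t. w t * (l * \<kappa> t * N t) \<partial>MT T)
     = (\<integral>t. w t / (s * exp (l * t)) * (A t + K t) + w t * (l * D t) + w t * (l * \<kappa> t * N t) \<partial>MT T)"
    using j1 j2 j3 by simp
  also have "\<dots> \<le> (\<integral>t. 7 * (w t * P t) \<partial>MT T)"
  proof (rule integral_mono_AE)
    show "AE t in MT T. w t / (s * exp (l * t)) * (A t + K t) + w t * (l * D t) + w t * (l * \<kappa> t * N t) \<le> 7 * (w t * P t)"
      using E kV
    proof eventually_elim
      case (elim t)
      note V = ED(6)[OF elim(1)] ED(4)[OF elim(1)] elim(2)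
      have q: "0 \<le> A t - 2 * c * D t + c\<^sup>2 * N t" for c
        using ip_expand[OF V(1,2), of "- c"] ip_nonneg[of "\<lambda>x. q t x - - c * m t x"] by (simp add: A_def D_def N_def)
      have kk: "0 \<le> K t + 2 * c * J t + c\<^sup>2 * N t" for c
        using ip_expand[OF V(3,2), of "- c"] ip_nonneg[of "\<lambda>x. k t x - - c * m t x"] by (simp add: K_def J_def N_def ip_sym)
      have "(A t + K t) / (s * exp (l * t)) + l * D t + l * \<kappa> t * N t \<le> 7 * P t"
        unfolding P_def
      proof (rule carleman_pointwise)
        show "0 \<le> A t - 4 * \<kappa> t * D t + 4 * (\<kappa> t)\<^sup>2 * N t" using q[of "2 * \<kappa> t"] by (simp add: power2_eq_square)
        show "0 \<le> K t + 4 * \<kappa> t * J t + 4 * (\<kappa> t)\<^sup>2 * N t" using kk[of "2 * \<kappa> t"] by (simp add: power2_eq_square)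
        show "0 \<le> N t" unfolding N_def by (rule ip_nonneg)
        have "1 * 1 \<le> s * exp (l * t)" using s l ED(1)[OF elim(1)] by (intro mult_mono) auto
        then show "1 \<le> s * exp (l * t)" by simp
        show "0 \<le> A t - 2 * \<kappa> t * D t + (\<kappa> t)\<^sup>2 * N t" by (rule q)
        show "0 \<le> K t + 2 * \<kappa> t * J t + (\<kappa> t)\<^sup>2 * N t" by (rule kk)
        show "0 \<le> A t - 2 * (\<kappa> t + l / 2) * D t + (\<kappa> t + l / 2)\<^sup>2 * N t" by (rule q)
        show "\<kappa> t = s * exp (l * t) * l" by (simp add: \<kappa>_def)
        show "0 < l" by (rule l)
      qed
      from mult_left_mono[OF this less_imp_le[OF wpos[of t]]] show ?case by (simp add: algebra_simps add_divide_distrib)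
    qed
  qed (use j1 j2 j3 iP in auto)
  also have "\<dots> = 7 * (\<integral>t. w t * P t \<partial>MT T)" by (rule Bochner_Integration.integral_mult_right_zero)
  also have "\<dots> \<le> 7 * ((\<integral>t. w t * Gn t \<partial>MT T) + w 0 * Dir (z 0) + \<kappa> T * w T * (norm_a a (z T))\<^sup>2)"
    using main by simp
  finally show ?thesis
    unfolding Q1 Q2 Q3 Q4 Dir_L2_norm01 by (simp add: w_def \<kappa>_def mult_ac)
qed

end

theorem lemma2p4:
  fixes T :: real and a :: "real \<Rightarrow> real"
  assumes "T > 0"
    and "continuous_on {0..1} a"
    and "a C1_differentiable_on {0<..<1}"
    and "\<forall>x\<in>{0<..<1}. a x > 0"
    and "a 0 = 0" and "a 1 = 0"
  shows "\<exists>l0>0. \<forall>l>l0. \<exists>s0>0. \<exists>C>0. \<forall>s\<ge>s0. \<forall>m G m0.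
    m \<in> H1_time (L2a a) (norm_a a) T \<inter> L2_time (H2a a) (norm_2a a) T \<longrightarrow>
    solves_problem a T m G m0 \<longrightarrow>
    (let \<phi> = (\<lambda>t::real. exp (l * t)) in
      int_Q T (\<lambda>x t. 1 / (s * \<phi> t) *
          (a x * \<bar>am_xx a (m t) x\<bar>\<^sup>2 + a x * \<bar>m_t a T m t x\<bar>\<^sup>2) * exp (2 * s * \<phi> t))
      + int_Q T (\<lambda>x t. l * \<bar>am_x a (m t) x\<bar>\<^sup>2 * exp (2 * s * \<phi> t))
      + int_Q T (\<lambda>x t. s * l\<^sup>2 * \<phi> t * a x * \<bar>m t x\<bar>\<^sup>2 * exp (2 * s * \<phi> t))
      \<le> C * int_Q T (\<lambda>x t. a x * \<bar>G t x\<bar>\<^sup>2 * exp (2 * s * \<phi> t))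
      + C * (s * l * \<phi> T * (norm_a a (m_at a T m T))\<^sup>2
             + (L2_norm01 (am_x a (m_at a T m T)))\<^sup>2) * exp (2 * s * \<phi> T)
      + C * (s * l * (norm_a a (m_at a T m 0))\<^sup>2
             + (L2_norm01 (am_x a (m_at a T m 0)))\<^sup>2) * exp (2 * s))"
proof -
  interpret weight a by unfold_locales (use assms in auto)
  have "let \<phi> = (\<lambda>t::real. exp (l * t)) in
      int_Q T (\<lambda>x t. 1 / (s * \<phi> t) *
          (a x * \<bar>am_xx a (m t) x\<bar>\<^sup>2 + a x * \<bar>m_t a T m t x\<bar>\<^sup>2) * exp (2 * s * \<phi> t))
      + int_Q T (\<lambda>x t. l * \<bar>am_x a (m t) x\<bar>\<^sup>2 * exp (2 * s * \<phi> t))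
      + int_Q T (\<lambda>x t. s * l\<^sup>2 * \<phi> t * a x * \<bar>m t x\<bar>\<^sup>2 * exp (2 * s * \<phi> t))
      \<le> 7 * int_Q T (\<lambda>x t. a x * \<bar>G t x\<bar>\<^sup>2 * exp (2 * s * \<phi> t))
      + 7 * (s * l * \<phi> T * (norm_a a (m_at a T m T))\<^sup>2
             + (L2_norm01 (am_x a (m_at a T m T)))\<^sup>2) * exp (2 * s * \<phi> T)
      + 7 * (s * l * (norm_a a (m_at a T m 0))\<^sup>2
             + (L2_norm01 (am_x a (m_at a T m 0)))\<^sup>2) * exp (2 * s)"
    if l: "l > 1" and s: "s \<ge> 1" and m: "m \<in> H1_time (L2a a) (norm_a a) T \<inter> L2_time (H2a a) (norm_2a a) T"
      and sol: "solves_problem a T m G m0" for l s m G m0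
  proof -
    have m1: "m \<in> L2_time (L2a a) (norm_a a) T" and m2: "m \<in> L2_time (H2a a) (norm_2a a) T"
      and ex: "\<exists>v. v \<in> L2_time (L2a a) (norm_a a) T \<and> has_weak_time_deriv (L2a a) (norm_a a) T m v"
      using m by (auto simp: H1_time_def)
    have k: "m_t a T m \<in> L2_time (L2a a) (norm_a a) T" "has_weak_time_deriv (L2a a) (norm_a a) T m (m_t a T m)"
      using someI_ex[OF ex] unfolding time_deriv_def by blast+
    define z where "z = (SOME v. continuous_version (L2a a) (norm_a a) T m v)"
    have z: "continuous_version (L2a a) (norm_a a) T m z"
      unfolding z_def by (rule someI_ex[OF ex_continuous_version[OF m1 k assms(1)]])
    have at: "m_at a T m \<tau> = z \<tau>" for \<tau> by (rule ext) (simp add: time_value_def z_def)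
    have G: "AE t in MT T. AE x in MT 1. m_t a T m t x - am_xx a (m t) x = G t x"
      using sol by (simp add: solves_problem_def)
    have l0: "l > 0" using l by simp
    have nn: "0 \<le> (L2_norm01 (am_x a (z T)))\<^sup>2 * exp (2 * s * exp (l * T))" "0 \<le> s * l * (norm_a a (z 0))\<^sup>2 * exp (2 * s)"
      using l0 s by auto
    have arith: "X \<le> 7 * g + 7 * (u + v) * e + 7 * (p + d) * f"
      if "X \<le> 7 * (g + u * e + d * f)" "0 \<le> v * e" "0 \<le> p * f" for X g u v p d e f :: real
      using that by (simp add: algebra_simps)
    show ?thesis
      unfolding at Let_def by (rule arith[OF carleman[OF assms(1) m1 m2 k z G l0 s] nn])
  qed
  then show ?thesis
    by (intro exI[of _ "1::real"] conjI allI impI zero_less_one exI[of _ "7::real"]) simp_all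
qed

end
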